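(* Work in a monster model of ACVF. Let $\tau$ be the code of a definable vvs structure on $K^m$. Then $\tau$ is interdefinable with a (finite tuple of) element(s) of the geometric sorts.
   Context: ACVF is the theory of non-trivially valued algebraically closed valued fields; $K$ the valued field with value group $\Gamma$, $\mathcal{O}$ the valuation ring, $\mathfrak{M}$ its maximal ideal, $k$ the residue field. A lattice in $K^n$ is an $\mathcal{O}$-submodule isomorphic to $\mathcal{O}^n$; $\operatorname{res}\Lambda=\Lambda/\mathfrak{M}\Lambda$. $R_{n,\ell}$ is the interpretable set of pairs $(\Lambda,V)$ with $\Lambda$ a lattice in $K^n$ and $V$ an $\ell$-dimensional $k$-subspace of $\operatorname{res}\Lambda$. The geometric sorts are $K$ and the $R_{n,\ell}$. A valued $K$-vector space is a $K$-vector space $V$ together with a totally ordered set $\Gamma(V)$, an action $+:\Gamma\times\Gamma(V)\to\Gamma(V)$ strictly order-preserving in each variable, and a surjective map $\mathrm{val}:V\setminus\{0\}\to\Gamma(V)$ with $\mathrm{val}(w+v)\ge\min(\mathrm{val}(w),\mathrm{val}(v))$ and $\mathrm{val}(\alpha v)=\mathrm{val}(\alpha)+\mathrm{val}(v)$ for $\alpha\in K$ (with $\mathrm{val}(0)=+\infty$). A vvs structure on a $K$-vector space $V$ is a binary relation $R$ on $V$ such that for some valued $K$-vector space structure on $V$, $xRy\iff \mathrm{val}(x)\le\mathrm{val}(y)$. It is definable if $R$ is a definable subset of $V\times V$. *)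

theory Defs
  imports "Jordan_Normal_Form.VS_Connect" "HOL-Algebra.QuotRing"
begin

unbundle cardinal_syntax

section \<open>Valued fields\<close>

text \<open>
  A valuation is given by its values on nonzero elements; the value at 0 is irrelevant and is
  always treated as \<open>+\<infinity>\<close>, see \<open>vdiv\<close>, \<open>val_ring\<close> and \<open>max_ideal\<close>.
  The whole type \<open>'g\<close> is the value group.
\<close>

definition valuation :: "('k::field \<Rightarrow> 'g::linordered_ab_group_add) \<Rightarrow> bool" where
  "valuation v \<longleftrightarrow>
     (\<forall>x y. x \<noteq> 0 \<longrightarrow> y \<noteq> 0 \<longrightarrow> v (x * y) = v x + v y) \<and>
     (\<forall>x y. x \<noteq> 0 \<longrightarrow> y \<noteq> 0 \<longrightarrow> x + y \<noteq> 0 \<longrightarrow> min (v x) (v y) \<le> v (x + y)) \<and>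
     v ` (UNIV - {0}) = UNIV"

definition ACVF :: "('k::alg_closed_field \<Rightarrow> 'g::linordered_ab_group_add) \<Rightarrow> bool" where
  "ACVF v \<longleftrightarrow> valuation v \<and> (\<exists>x. x \<noteq> 0 \<and> v x \<noteq> 0)"

definition vdiv :: "('k::field \<Rightarrow> 'g::linordered_ab_group_add) \<Rightarrow> 'k \<Rightarrow> 'k \<Rightarrow> bool" where
  "vdiv v x y \<longleftrightarrow> y = 0 \<or> (x \<noteq> 0 \<and> v x \<le> v y)"

definition val_ring :: "('k::field \<Rightarrow> 'g::linordered_ab_group_add) \<Rightarrow> 'k ring" where
  "val_ring v = class_ring\<lparr>carrier := {a. a = 0 \<or> 0 \<le> v a}\<rparr>"

definition max_ideal :: "('k::field \<Rightarrow> 'g::linordered_ab_group_add) \<Rightarrow> 'k set" where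
  "max_ideal v = {a. a = 0 \<or> 0 < v a}"

definition res_field :: "('k::field \<Rightarrow> 'g::linordered_ab_group_add) \<Rightarrow> 'k set ring" where
  "res_field v = val_ring v Quot max_ideal v"


section \<open>First-order formulas and definable sets\<close>

text \<open>
  The one-sorted language of rings with a binary predicate for \<open>v x \<le> v y\<close>.
  Variables are de Bruijn indices.
\<close>

datatype tm = Var nat | Zero | One | Plus tm tm | Uminus tm | Times tm tm

datatype fm = Equal tm tm | VLe tm tm | Not fm | And fm fm | Ex fm

primrec tm_val :: "(nat \<Rightarrow> 'k::field) \<Rightarrow> tm \<Rightarrow> 'k" where
  "tm_val e (Var i) = e i"
| "tm_val e Zero = 0"
| "tm_val e One = 1"
| "tm_val e (Plus s t) = tm_val e s + tm_val e t"
| "tm_val e (Uminus t) = - tm_val e t"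
| "tm_val e (Times s t) = tm_val e s * tm_val e t"

primrec sat :: "('k::field \<Rightarrow> 'g::linordered_ab_group_add) \<Rightarrow> (nat \<Rightarrow> 'k) \<Rightarrow> fm \<Rightarrow> bool" where
  "sat v e (Equal s t) \<longleftrightarrow> tm_val e s = tm_val e t"
| "sat v e (VLe s t) \<longleftrightarrow> vdiv v (tm_val e s) (tm_val e t)"
| "sat v e (Not \<phi>) \<longleftrightarrow> \<not> sat v e \<phi>"
| "sat v e (And \<phi> \<psi>) \<longleftrightarrow> sat v e \<phi> \<and> sat v e \<psi>"
| "sat v e (Ex \<phi>) \<longleftrightarrow> (\<exists>a. sat v (case_nat a e) \<phi>)"

text \<open>
  Variables beyond the given tuple are read as 0. As 0 is a constant of the language, this
  allows no further definable sets.
\<close>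

definition env :: "'k::zero list \<Rightarrow> nat \<Rightarrow> 'k" where
  "env xs i = (if i < length xs then xs ! i else 0)"

definition definable :: "('k::field \<Rightarrow> 'g::linordered_ab_group_add) \<Rightarrow> 'k set \<Rightarrow> 'k list set \<Rightarrow> bool" where
  "definable v A X \<longleftrightarrow>
     (\<exists>N \<phi> ps. set ps \<subseteq> A \<and> X = {xs. length xs = N \<and> sat v (env (xs @ ps)) \<phi>})"


section \<open>Monster models\<close>

definition saturated :: "'c rel \<Rightarrow> ('k::field \<Rightarrow> 'g::linordered_ab_group_add) \<Rightarrow> bool" where
  "saturated \<kappa> v \<longleftrightarrow>
     (\<forall>A F. |A| <o \<kappa> \<longrightarrow> F \<subseteq> {(\<phi>, ps). set ps \<subseteq> A} \<longrightarrow>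
        (\<forall>F0. F0 \<subseteq> F \<longrightarrow> finite F0 \<longrightarrow> (\<exists>a. \<forall>(\<phi>, ps)\<in>F0. sat v (env (a # ps)) \<phi>)) \<longrightarrow>
        (\<exists>a. \<forall>(\<phi>, ps)\<in>F. sat v (env (a # ps)) \<phi>))"

definition elementary_on ::
  "('k::field \<Rightarrow> 'g::linordered_ab_group_add) \<Rightarrow> 'k set \<Rightarrow> ('k \<Rightarrow> 'k) \<Rightarrow> bool" where
  "elementary_on v A f \<longleftrightarrow>
     (\<forall>\<phi> ps. set ps \<subseteq> A \<longrightarrow> (sat v (env ps) \<phi> \<longleftrightarrow> sat v (env (map f ps)) \<phi>))"

definition automorphism :: "('k::field \<Rightarrow> 'g::linordered_ab_group_add) \<Rightarrow> ('k \<Rightarrow> 'k) \<Rightarrow> bool" where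
  "automorphism v \<sigma> \<longleftrightarrow> bij \<sigma> \<and>
     (\<forall>x y. \<sigma> (x + y) = \<sigma> x + \<sigma> y) \<and> (\<forall>x y. \<sigma> (x * y) = \<sigma> x * \<sigma> y) \<and>
     (\<forall>x y. vdiv v (\<sigma> x) (\<sigma> y) \<longleftrightarrow> vdiv v x y)"

definition strongly_homogeneous :: "'c rel \<Rightarrow> ('k::field \<Rightarrow> 'g::linordered_ab_group_add) \<Rightarrow> bool" where
  "strongly_homogeneous \<kappa> v \<longleftrightarrow>
     (\<forall>A f. |A| <o \<kappa> \<longrightarrow> elementary_on v A f \<longrightarrow>
        (\<exists>\<sigma>. automorphism v \<sigma> \<and> (\<forall>a\<in>A. \<sigma> a = f a)))"

text \<open>
  Monster models are relative to an uncountable cardinal \<open>\<kappa>\<close>; sets of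
  cardinality less than \<open>\<kappa>\<close> are the small ones.
\<close>

definition monster_model ::
  "'c rel \<Rightarrow> ('k::alg_closed_field \<Rightarrow> 'g::linordered_ab_group_add) \<Rightarrow> bool" where
  "monster_model \<kappa> v \<longleftrightarrow>
     ACVF v \<and> Card_order \<kappa> \<and> natLeq <o \<kappa> \<and> saturated \<kappa> v \<and> strongly_homogeneous \<kappa> v"


section \<open>Imaginaries\<close>

text \<open>
  A sort is the set of classes of a \<open>\<emptyset>\<close>-definable equivalence relation on a
  \<open>\<emptyset>\<close>-definable set of tuples, and an imaginary is a pair of a sort and one of
  its elements.
\<close>

type_synonym 'k eq_elem = "'k list set"
type_synonym 'k eq_sort = "'k eq_elem set"
type_synonym 'k imaginary = "'k eq_sort \<times> 'k eq_elem"

definition is_sort :: "('k::field \<Rightarrow> 'g::linordered_ab_group_add) \<Rightarrow> 'k eq_sort \<Rightarrow> bool" where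
  "is_sort v S \<longleftrightarrow>
     (\<exists>n D E. D \<subseteq> {xs. length xs = n} \<and> equiv D E \<and>
        definable v {} {xs @ ys | xs ys. (xs, ys) \<in> E} \<and> S = D // E)"

definition is_imaginary :: "('k::field \<Rightarrow> 'g::linordered_ab_group_add) \<Rightarrow> 'k imaginary \<Rightarrow> bool" where
  "is_imaginary v e \<longleftrightarrow> is_sort v (fst e) \<and> snd e \<in> fst e"

text \<open>
  A relation between sorts is \<open>\<emptyset>\<close>-definable in the structure with imaginaries
  iff its preimage among tuples of representatives is \<open>\<emptyset>\<close>-definable.
\<close>

definition eq_definable ::
  "('k::field \<Rightarrow> 'g::linordered_ab_group_add) \<Rightarrow> 'k eq_sort list \<Rightarrow> 'k eq_elem list set \<Rightarrow> bool" where
  "eq_definable v Ss D \<longleftrightarrow>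
     D \<subseteq> listset Ss \<and> definable v {} {concat xss | xss. \<exists>Cs\<in>D. list_all2 (\<in>) xss Cs}"

definition in_dcl ::
  "('k::field \<Rightarrow> 'g::linordered_ab_group_add) \<Rightarrow> 'k imaginary \<Rightarrow> 'k imaginary list \<Rightarrow> bool" where
  "in_dcl v e es \<longleftrightarrow>
     is_imaginary v e \<and> list_all (is_imaginary v) es \<and>
     (\<exists>D. eq_definable v (map fst es @ [fst e]) D \<and>
          {c \<in> fst e. map snd es @ [c] \<in> D} = {snd e})"

definition interdefinable ::
  "('k::field \<Rightarrow> 'g::linordered_ab_group_add) \<Rightarrow> 'k imaginary list \<Rightarrow> 'k imaginary list \<Rightarrow> bool" where
  "interdefinable v es fs \<longleftrightarrow>
     (\<forall>e\<in>set es. in_dcl v e fs) \<and> (\<forall>f\<in>set fs. in_dcl v f es)"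

text \<open>
  A code of \<open>X\<close> is a canonical parameter: \<open>X\<close> is the fibre over
  \<open>\<tau>\<close>, and over no other element of the sort, of a \<open>\<emptyset>\<close>-definable family
  indexed by the sort of \<open>\<tau>\<close>.
\<close>

definition is_code ::
  "('k::field \<Rightarrow> 'g::linordered_ab_group_add) \<Rightarrow> 'k imaginary \<Rightarrow> 'k list set \<Rightarrow> bool" where
  "is_code v \<tau> X \<longleftrightarrow>
     is_imaginary v \<tau> \<and>
     (\<exists>r D. D \<subseteq> {xs. length xs = r} \<times> fst \<tau> \<and>
        definable v {} {xs @ ys | xs ys. \<exists>C. (xs, C) \<in> D \<and> ys \<in> C} \<and>
        (\<forall>C\<in>fst \<tau>. {xs. (xs, C) \<in> D} = X \<longleftrightarrow> C = snd \<tau>))"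


section \<open>Lattices and the geometric sorts\<close>

abbreviation Kn :: "'k::field itself \<Rightarrow> nat \<Rightarrow> ('k, 'k vec) module" where
  "Kn \<equiv> module_vec"

definition On :: "('k::field \<Rightarrow> 'g::linordered_ab_group_add) \<Rightarrow> nat \<Rightarrow> ('k, 'k vec) module" where
  "On v n = (Kn TYPE('k) n)
     \<lparr>carrier := {x \<in> carrier_vec n. \<forall>i<n. x $ i \<in> carrier (val_ring v)}\<rparr>"

definition lattice ::
  "('k::field \<Rightarrow> 'g::linordered_ab_group_add) \<Rightarrow> nat \<Rightarrow> 'k vec set \<Rightarrow> bool" where
  "lattice v n \<Lambda> \<longleftrightarrow>
     LinearCombinations.submodule (val_ring v) \<Lambda> (Kn TYPE('k) n) \<and>
     (\<exists>f \<in> LinearCombinations.module_hom (val_ring v) (On v n) ((Kn TYPE('k) n)\<lparr>carrier := \<Lambda>\<rparr>).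
        bij_betw f (carrier (On v n)) \<Lambda>)"

text \<open>The submodule \<open>\<MM>\<Lambda>\<close> generated by the products, and the \<open>k\<close>-vector
  space \<open>\<Lambda>/\<MM>\<Lambda>\<close> of its cosets.\<close>

definition max_ideal_mult ::
  "('k::field \<Rightarrow> 'g::linordered_ab_group_add) \<Rightarrow> nat \<Rightarrow> 'k vec set \<Rightarrow> 'k vec set" where
  "max_ideal_mult v n \<Lambda> =
     \<Inter>{N. LinearCombinations.submodule (val_ring v) N (Kn TYPE('k) n) \<and>
         (\<forall>a\<in>max_ideal v. \<forall>x\<in>\<Lambda>. a \<cdot>\<^sub>v x \<in> N)}"

definition res ::
  "('k::field \<Rightarrow> 'g::linordered_ab_group_add) \<Rightarrow> nat \<Rightarrow> 'k vec set \<Rightarrow> ('k set, 'k vec set) module" where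
  "res v n \<Lambda> =
     \<lparr>carrier = a_rcosets\<^bsub>(Kn TYPE('k) n)\<lparr>carrier := \<Lambda>\<rparr>\<^esub> (max_ideal_mult v n \<Lambda>),
      mult = undefined,
      one = undefined,
      zero = max_ideal_mult v n \<Lambda>,
      add = set_add (Kn TYPE('k) n),
      smult = (\<lambda>A X. \<Union>a\<in>A. \<Union>x\<in>X. max_ideal_mult v n \<Lambda> +>\<^bsub>Kn TYPE('k) n\<^esub> (a \<cdot>\<^sub>v x))\<rparr>"

definition R_sort ::
  "('k::field \<Rightarrow> 'g::linordered_ab_group_add) \<Rightarrow> nat \<Rightarrow> nat \<Rightarrow> ('k vec set \<times> 'k vec set set) set" where
  "R_sort v n l =
     {(\<Lambda>, V). lattice v n \<Lambda> \<and> VectorSpace.subspace (res_field v) V (res v n \<Lambda>) \<and>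
        vectorspace.fin_dim (res_field v) ((res v n \<Lambda>)\<lparr>carrier := V\<rparr>) \<and>
        vectorspace.dim (res_field v) ((res v n \<Lambda>)\<lparr>carrier := V\<rparr>) = l}"

text \<open>
  \<open>R_sort v n l\<close> is interpretable as a quotient of \<open>GL\<^sub>n(K)\<close>: the class of
  \<open>(\<Lambda>, V)\<close> consists of the matrices whose columns form an \<open>\<O>\<close>-basis of
  \<open>\<Lambda>\<close> the first \<open>l\<close> members of which reduce to a basis of \<open>V\<close>. Every
  \<open>(\<Lambda>, V)\<close> has such a basis, and is determined by any one of them.
\<close>

definition frames ::
  "('k::field \<Rightarrow> 'g::linordered_ab_group_add) \<Rightarrow> nat \<Rightarrow> nat \<Rightarrow> 'k vec set \<Rightarrow> 'k vec set set \<Rightarrow> 'k eq_elem" where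
  "frames v n l \<Lambda> V =
     {concat (mat_to_list A) | A. A \<in> carrier_mat n n \<and> invertible_mat A \<and>
        \<Lambda> = (\<lambda>x. A *\<^sub>v x) ` carrier (On v n) \<and>
        V = (\<lambda>x. max_ideal_mult v n \<Lambda> +>\<^bsub>Kn TYPE('k) n\<^esub> (A *\<^sub>v x)) `
              {x \<in> carrier (On v n). \<forall>i\<in>{l..<n}. x $ i = 0}}"

datatype 'k geom = FieldElem 'k | RElem nat nat "'k vec set" "'k vec set set"

primrec is_geometric :: "('k::field \<Rightarrow> 'g::linordered_ab_group_add) \<Rightarrow> 'k geom \<Rightarrow> bool" where
  "is_geometric v (FieldElem a) \<longleftrightarrow> True"
| "is_geometric v (RElem n l \<Lambda> V) \<longleftrightarrow> (\<Lambda>, V) \<in> R_sort v n l"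

primrec geom_imaginary :: "('k::field \<Rightarrow> 'g::linordered_ab_group_add) \<Rightarrow> 'k geom \<Rightarrow> 'k imaginary" where
  "geom_imaginary v (FieldElem a) = (range (\<lambda>x. {[x]}), {[a]})"
| "geom_imaginary v (RElem n l \<Lambda> V) =
     ((\<lambda>(\<Lambda>', V'). frames v n l \<Lambda>' V') ` R_sort v n l, frames v n l \<Lambda> V)"


section \<open>Valued vector spaces\<close>

text \<open>
  Here \<open>G\<close> with the order \<open>leq\<close> is \<open>\<Gamma>(V)\<close>, \<open>act\<close> the action of
  \<open>\<Gamma>\<close> on it, and \<open>val\<close> is again only relevant on nonzero vectors.
\<close>

definition valued_vector_space ::
  "('k::field \<Rightarrow> 'g::linordered_ab_group_add) \<Rightarrow> nat \<Rightarrow> 'h set \<Rightarrow> 'h rel \<Rightarrow> ('g \<Rightarrow> 'h \<Rightarrow> 'h) \<Rightarrow>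
     ('k vec \<Rightarrow> 'h) \<Rightarrow> bool" where
  "valued_vector_space v m G leq act val \<longleftrightarrow>
     linear_order_on G leq \<and>
     (\<forall>a. \<forall>h\<in>G. act a h \<in> G) \<and>
     (\<forall>h\<in>G. act 0 h = h) \<and>
     (\<forall>a b. \<forall>h\<in>G. act (a + b) h = act a (act b h)) \<and>
     (\<forall>a b. \<forall>h\<in>G. a < b \<longrightarrow> (act a h, act b h) \<in> leq - Id) \<and>
     (\<forall>a. \<forall>h\<in>G. \<forall>h'\<in>G. (h, h') \<in> leq - Id \<longrightarrow> (act a h, act a h') \<in> leq - Id) \<and>
     val ` (carrier_vec m - {0\<^sub>v m}) = G \<and>
     (\<forall>x\<in>carrier_vec m - {0\<^sub>v m}. \<forall>y\<in>carrier_vec m - {0\<^sub>v m}. x + y \<noteq> 0\<^sub>v m \<longrightarrow>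
        (val x, val (x + y)) \<in> leq \<or> (val y, val (x + y)) \<in> leq) \<and>
     (\<forall>a. \<forall>x\<in>carrier_vec m - {0\<^sub>v m}. a \<noteq> 0 \<longrightarrow> val (a \<cdot>\<^sub>v x) = act (v a) (val x))"

text \<open>
  As \<open>val\<close> is onto \<open>\<Gamma>(V)\<close>, the elements of \<open>\<Gamma>(V)\<close> may be identified
  with the fibres of \<open>val\<close>, so that \<open>'k vec set\<close> is a large enough type for them.
  The disjunction expresses \<open>val x \<le> val y\<close> with \<open>val 0 = +\<infinity>\<close>.
\<close>

definition vvs_structure ::
  "('k::field \<Rightarrow> 'g::linordered_ab_group_add) \<Rightarrow> nat \<Rightarrow> 'k vec rel \<Rightarrow> bool" where
  "vvs_structure v m R \<longleftrightarrow>
     (\<exists>(G :: 'k vec set set) leq act val. valued_vector_space v m G leq act val \<and>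
        R = {(x, y). x \<in> carrier_vec m \<and> y \<in> carrier_vec m \<and>
              (y = 0\<^sub>v m \<or> (x \<noteq> 0\<^sub>v m \<and> y \<noteq> 0\<^sub>v m \<and> (val x, val y) \<in> leq))})"

definition rel_tuples :: "'k vec rel \<Rightarrow> 'k list set" where
  "rel_tuples R = {list_of_vec x @ list_of_vec y | x y. (x, y) \<in> R}"

end

theory Submission
  imports Defs "HOL-Library.Countable_Set"
begin

text \<open>
  A definable structure \<open>R\<close> on \<open>K\<^sup>m\<close> is recovered from the \<open>\<O>\<close>-module \<open>M\<close> of all matrices
  \<open>f\<close> with \<open>x R f x\<close> for every \<open>x\<close>, because \<open>x R y\<close> holds iff \<open>y = f x\<close> for some \<open>f \<in> M\<close>. This uses
  a splitting basis of \<open>R\<close>, which exists as definable chains of balls have common points in a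
  saturated model. As every definable submodule of \<open>K\<close> is \<open>0\<close>, \<open>K\<close> or a scalar multiple of \<open>\<O>\<close> or
  of \<open>\<MM>\<close>, a linear change of coordinates turns \<open>M\<close> into a product of such modules. Both facts on
  one-dimensional sets follow from quantifier elimination, in the form that isomorphisms between
  countable valued subfields preserve formulas.

  The largest \<open>K\<close>-subspace of \<open>M\<close>, and a complement of it in the \<open>K\<close>-span of \<open>M\<close>, are coded by
  projection matrices along coordinate subspaces. Completing the rest of \<open>M\<close> by \<open>\<MM>\<close> in the other
  coordinate directions gives a module \<open>A (\<O>\<^sup>l \<times> \<MM>\<^bsup>N - l\<^esup>)\<close> with \<open>A\<close> invertible, which is the
  preimage of an \<open>l\<close>-dimensional subspace of \<open>res (A \<O>\<^sup>N)\<close>, and so amounts to an element of the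
  sort \<open>R\<^bsub>N,l\<^esub>\<close>.
\<close>

section \<open>Definability calculus\<close>

text \<open>Interdefinability is witnessed by parameter-free formulas evaluated on representatives,
  not by automorphisms, and this constrains every construction: whatever is attached to
  \<open>R\<close> must be describable from \<open>R\<close>, and only finite external data, such as
  index sets and dimensions, may be written into a formula. Bases serve only to verify such
  descriptions. The relation is a family of modules indexed by \<open>x\<close>; passing to
  endomorphisms leaves a single submodule of K^(m^2). It need not be a lattice: it may contain
  lines, fail to span, and have open besides closed directions. The first two defects call for
  complements, which are not canonical; coordinate complements are, once an index set is fixed. The
  third is the reason for sorts with a subspace of the reduction in place of lattices alone. Both
  one-dimensional facts are proved by exchange: a definable set without endpoint, or a definable
  chain of balls without common point, would separate elements that a partial isomorphism over the
  parameters carries into each other.\<close>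

primrec tm_subst :: "(nat \<Rightarrow> tm) \<Rightarrow> tm \<Rightarrow> tm" where
  "tm_subst r (Var i) = r i"
| "tm_subst r Zero = Zero"
| "tm_subst r One = One"
| "tm_subst r (Plus s t) = Plus (tm_subst r s) (tm_subst r t)"
| "tm_subst r (Uminus t) = Uminus (tm_subst r t)"
| "tm_subst r (Times s t) = Times (tm_subst r s) (tm_subst r t)"

lemma tm_val_subst: "tm_val e (tm_subst r t) = tm_val (\<lambda>i. tm_val e (r i)) t"
  by (induction t) auto

definition lift_subst :: "(nat \<Rightarrow> tm) \<Rightarrow> nat \<Rightarrow> tm" where
  "lift_subst r = case_nat (Var 0) (\<lambda>i. tm_subst (\<lambda>j. Var (Suc j)) (r i))"

primrec fm_subst :: "(nat \<Rightarrow> tm) \<Rightarrow> fm \<Rightarrow> fm" where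
  "fm_subst r (Equal s t) = Equal (tm_subst r s) (tm_subst r t)"
| "fm_subst r (VLe s t) = VLe (tm_subst r s) (tm_subst r t)"
| "fm_subst r (Not \<phi>) = Not (fm_subst r \<phi>)"
| "fm_subst r (And \<phi> \<psi>) = And (fm_subst r \<phi>) (fm_subst r \<psi>)"
| "fm_subst r (Ex \<phi>) = Ex (fm_subst (lift_subst r) \<phi>)"

lemma sat_subst: "sat v e (fm_subst r \<phi>) \<longleftrightarrow> sat v (\<lambda>i. tm_val e (r i)) \<phi>"
proof (induction \<phi> arbitrary: e r)
  case (Ex \<phi>)
  have "(\<lambda>i. tm_val (case_nat a e) (lift_subst r i)) = case_nat a (\<lambda>i. tm_val e (r i))" for a
    by (auto simp: lift_subst_def tm_val_subst fun_eq_iff split: nat.split)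
  then show ?case using Ex by simp
qed (simp_all add: tm_val_subst)

primrec tm_bound :: "tm \<Rightarrow> nat" where
  "tm_bound (Var i) = Suc i"
| "tm_bound Zero = 0"
| "tm_bound One = 0"
| "tm_bound (Plus s t) = max (tm_bound s) (tm_bound t)"
| "tm_bound (Uminus t) = tm_bound t"
| "tm_bound (Times s t) = max (tm_bound s) (tm_bound t)"

text \<open>Only an upper bound for the free variables is needed, so the bound is not lowered under
  \<open>Ex\<close>.\<close>

primrec fm_bound :: "fm \<Rightarrow> nat" where
  "fm_bound (Equal s t) = max (tm_bound s) (tm_bound t)"
| "fm_bound (VLe s t) = max (tm_bound s) (tm_bound t)"
| "fm_bound (Not \<phi>) = fm_bound \<phi>"
| "fm_bound (And \<phi> \<psi>) = max (fm_bound \<phi>) (fm_bound \<psi>)"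
| "fm_bound (Ex \<phi>) = fm_bound \<phi>"

lemma tm_val_cong: "(\<And>i. i < tm_bound t \<Longrightarrow> e i = e' i) \<Longrightarrow> tm_val e t = tm_val e' t"
  by (induction t) auto

lemma sat_cong: "(\<And>i. i < fm_bound \<phi> \<Longrightarrow> e i = e' i) \<Longrightarrow> sat v e \<phi> \<longleftrightarrow> sat v e' \<phi>"
proof (induction \<phi> arbitrary: e e')
  case (Equal s t)
  then show ?case using tm_val_cong[of s e e'] tm_val_cong[of t e e'] by simp
next
  case (VLe s t)
  then show ?case using tm_val_cong[of s e e'] tm_val_cong[of t e e'] by simp
next
  case (Not \<phi>)
  then show ?case by (metis fm_bound.simps(3) sat.simps(3))
next
  case (And \<phi> \<psi>)
  have "sat v e \<phi> = sat v e' \<phi>" "sat v e \<psi> = sat v e' \<psi>"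
    by (rule And.IH; use And.prems in auto)+
  then show ?case by simp
next
  case (Ex \<phi>)
  have "sat v (case_nat a e) \<phi> = sat v (case_nat a e') \<phi>" for a
    by (rule Ex.IH) (use Ex.prems in \<open>auto split: nat.split\<close>)
  then show ?case by simp
qed

text \<open>Definability is handled semantically: properties of environments are built up by the
  rules \<open>fdef_intros\<close>, and no concrete formula is ever written down. Conditions that do
  not depend on the environment enter through \<open>fdef_const\<close>.\<close>

definition tdef :: "((nat \<Rightarrow> 'k::field) \<Rightarrow> 'k) \<Rightarrow> bool" where
  "tdef t \<longleftrightarrow> (\<exists>u. \<forall>e. tm_val e u = t e)"

definition fdef :: "('k::field \<Rightarrow> 'g::linordered_ab_group_add) \<Rightarrow> ((nat \<Rightarrow> 'k) \<Rightarrow> bool) \<Rightarrow> bool" where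
  "fdef v P \<longleftrightarrow> (\<exists>\<phi>. \<forall>e. sat v e \<phi> \<longleftrightarrow> P e)"

named_theorems fdef_intros

lemma tdef_var [fdef_intros]: "tdef (\<lambda>e. e i)"
  unfolding tdef_def by (rule exI[of _ "Var i"]) simp

lemma tdef_0 [fdef_intros]: "tdef (\<lambda>e. 0)"
  unfolding tdef_def by (rule exI[of _ Zero]) simp

lemma tdef_1 [fdef_intros]: "tdef (\<lambda>e. 1)"
  unfolding tdef_def by (rule exI[of _ One]) simp

lemma tdef_plus [fdef_intros]: "tdef s \<Longrightarrow> tdef t \<Longrightarrow> tdef (\<lambda>e. s e + t e)"
  unfolding tdef_def by (metis tm_val.simps(4))

lemma tdef_uminus [fdef_intros]: "tdef t \<Longrightarrow> tdef (\<lambda>e. - t e)"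
  unfolding tdef_def by (metis tm_val.simps(5))

lemma tdef_times [fdef_intros]: "tdef s \<Longrightarrow> tdef t \<Longrightarrow> tdef (\<lambda>e. s e * t e)"
  unfolding tdef_def by (metis tm_val.simps(6))

lemma tdef_minus [fdef_intros]: "tdef s \<Longrightarrow> tdef t \<Longrightarrow> tdef (\<lambda>e. s e - t e)"
  using tdef_plus[OF _ tdef_uminus] by simp

lemma tdef_sum [fdef_intros]: "(\<And>i. i \<in> A \<Longrightarrow> tdef (f i)) \<Longrightarrow> tdef (\<lambda>e. \<Sum>i\<in>A. f i e)"
  by (induction A rule: infinite_finite_induct) (auto intro: fdef_intros)

lemma tdef_if [fdef_intros]: "(b \<Longrightarrow> tdef s) \<Longrightarrow> (\<not> b \<Longrightarrow> tdef t) \<Longrightarrow> tdef (\<lambda>e. if b then s e else t e)"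
  by (cases b) simp_all

text \<open>Besides substituting terms this allows a change of layout: a property shown definable
  for one arrangement of the variables is transported to another by listing the term that goes to
  each position.\<close>

lemma fdef_subst:
  assumes "fdef v P" "\<And>i. tdef (t i)"
  shows "fdef v (\<lambda>e. P (\<lambda>i. t i e))"
proof -
  obtain \<phi> where \<phi>: "\<And>e. sat v e \<phi> \<longleftrightarrow> P e" using assms(1) unfolding fdef_def by blast
  obtain r where r: "\<And>i e. tm_val e (r i) = t i e"
    using assms(2) unfolding tdef_def by metis
  show ?thesis unfolding fdef_def
    by (rule exI[of _ "fm_subst r \<phi>"]) (simp add: sat_subst \<phi> r)
qed

lemma fdef_sat: "fdef v (\<lambda>e. sat v e \<phi>)"
  unfolding fdef_def by blast

lemma fdef_eq [fdef_intros]: "tdef s \<Longrightarrow> tdef t \<Longrightarrow> fdef v (\<lambda>e. s e = t e)"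
  unfolding fdef_def tdef_def by (metis sat.simps(1))

lemma fdef_vdiv [fdef_intros]: "tdef s \<Longrightarrow> tdef t \<Longrightarrow> fdef v (\<lambda>e. vdiv v (s e) (t e))"
  unfolding fdef_def tdef_def by (metis sat.simps(2))

lemma fdef_not [fdef_intros]: "fdef v P \<Longrightarrow> fdef v (\<lambda>e. \<not> P e)"
  unfolding fdef_def by (metis sat.simps(3))

lemma fdef_conj [fdef_intros]: "fdef v P \<Longrightarrow> fdef v Q \<Longrightarrow> fdef v (\<lambda>e. P e \<and> Q e)"
  unfolding fdef_def by (metis sat.simps(4))

lemma fdef_disj [fdef_intros]:
  assumes "fdef v P" "fdef v Q"
  shows "fdef v (\<lambda>e. P e \<or> Q e)"
proof -
  have "fdef v (\<lambda>e. \<not> (\<not> P e \<and> \<not> Q e))"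
    by (intro fdef_conj fdef_not assms)
  then show ?thesis by (simp only: de_Morgan_conj not_not)
qed

lemma fdef_imp [fdef_intros]:
  assumes "fdef v P" "fdef v Q"
  shows "fdef v (\<lambda>e. P e \<longrightarrow> Q e)"
  unfolding imp_conv_disj by (intro fdef_disj fdef_not assms)

lemma fdef_iff [fdef_intros]:
  assumes "fdef v P" "fdef v Q"
  shows "fdef v (\<lambda>e. P e \<longleftrightarrow> Q e)"
proof -
  have "fdef v (\<lambda>e. (P e \<longrightarrow> Q e) \<and> (Q e \<longrightarrow> P e))"
    by (intro fdef_conj fdef_imp assms)
  moreover have "(P e \<longrightarrow> Q e) \<and> (Q e \<longrightarrow> P e) \<longleftrightarrow> (P e \<longleftrightarrow> Q e)" for e by blast
  ultimately show ?thesis by (simp only:)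
qed

lemma fdef_const [fdef_intros]: "fdef v (\<lambda>e. b)"
proof (cases b)
  case True
  then show ?thesis using fdef_eq[OF tdef_0 tdef_0, of v] by simp
next
  case False
  then show ?thesis using fdef_not[OF fdef_eq[OF tdef_0 tdef_0, of v]] by simp
qed

lemma fdef_if [fdef_intros]: "(b \<Longrightarrow> fdef v P) \<Longrightarrow> (\<not> b \<Longrightarrow> fdef v Q) \<Longrightarrow> fdef v (\<lambda>e. if b then P e else Q e)"
  by (cases b) simp_all

lemma fdef_case_nat: "fdef v P \<Longrightarrow> fdef v (\<lambda>e. \<exists>a. P (case_nat a e))"
  unfolding fdef_def by (metis sat.simps(5))

text \<open>The premise reads the bound value as \<open>e 0\<close> and the old environment as the
  tail, in accordance with de Bruijn indices. With \<open>P\<close> taking two arguments the rule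
  unifies with any quantified property.\<close>

lemma fdef_ex [fdef_intros]:
  assumes "fdef v (\<lambda>e. P (e 0) (\<lambda>i. e (Suc i)))"
  shows "fdef v (\<lambda>e. \<exists>a. P a e)"
  using fdef_case_nat[OF assms] by simp

lemma fdef_all [fdef_intros]:
  assumes "fdef v (\<lambda>e. P (e 0) (\<lambda>i. e (Suc i)))"
  shows "fdef v (\<lambda>e. \<forall>a. P a e)"
  using fdef_not[OF fdef_ex[where P = "\<lambda>x e. \<not> P x e", OF fdef_not[OF assms]]] by simp

lemma fdef_Ball [fdef_intros]:
  "finite A \<Longrightarrow> (\<And>i. i \<in> A \<Longrightarrow> fdef v (P i)) \<Longrightarrow> fdef v (\<lambda>e. \<forall>i\<in>A. P i e)"
  by (induction A rule: finite_induct) (auto intro: fdef_intros)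

lemma fdef_all_less [fdef_intros]:
  fixes n :: nat
  assumes "\<And>i. i < n \<Longrightarrow> fdef v (P i)"
  shows "fdef v (\<lambda>e. \<forall>i<n. P i e)"
proof -
  have "fdef v (\<lambda>e. \<forall>i\<in>{..<n}. P i e)" by (rule fdef_Ball) (use assms in auto)
  then show ?thesis unfolding Ball_def lessThan_iff .
qed

definition app :: "'k list \<Rightarrow> (nat \<Rightarrow> 'k) \<Rightarrow> nat \<Rightarrow> 'k" where
  "app xs e i = (if i < length xs then xs ! i else e (i - length xs))"

lemma app_snoc: "app (xs @ [a]) e = app xs (case_nat a e)"
proof
  fix i
  show "app (xs @ [a]) e i = app xs (case_nat a e) i"
    by (cases "i - length xs") (auto simp: app_def nth_append less_Suc_eq dest: arg_cong[of _ _ "\<lambda>k. k - 1"])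
qed

lemma fdef_ex_list:
  "fdef v Q \<Longrightarrow> fdef v (\<lambda>e. \<exists>xs. length xs = n \<and> Q (app xs e))"
proof (induction n)
  case 0
  have "app [] e = e" for e :: "nat \<Rightarrow> 'a" by (simp add: app_def fun_eq_iff)
  then show ?case using 0 by simp
next
  case (Suc n)
  \<comment> \<open>The last entry is split off, because \<open>app\<close> places it next to the
    old environment, where the outermost quantifier puts its value.\<close>
  have "(\<exists>xs. length xs = Suc n \<and> Q (app xs e)) \<longleftrightarrow>
        (\<exists>a xs. length xs = n \<and> Q (app xs (case_nat a e)))" for e
    unfolding length_Suc_conv_rev by (metis app_snoc)
  then show ?case using fdef_case_nat[OF Suc.IH[OF Suc.prems]] by simp
qed

text \<open>A block of \<open>n\<close> quantifiers: the bound vector occupies the positions below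
  \<open>n\<close>, and the old environment is shifted by \<open>n\<close>.\<close>

lemma fdef_ex_vec [fdef_intros]:
  assumes "fdef v (\<lambda>e. P (vec n e) (\<lambda>i. e (i + n)))"
  shows "fdef v (\<lambda>e. \<exists>x\<in>carrier_vec n. P x e)"
proof -
  have 1: "vec (length xs) (app xs e) = vec_of_list xs" for xs :: "'a list" and e
    by (rule eq_vecI) (auto simp: app_def vec_of_list_index)
  have 2: "(\<lambda>i. app xs e (i + length xs)) = e" for xs :: "'a list" and e
    by (simp add: app_def fun_eq_iff)
  have 3: "(\<exists>xs. length xs = n \<and> P (vec n (app xs e)) (\<lambda>i. app xs e (i + n))) \<longleftrightarrow>
        (\<exists>x\<in>carrier_vec n. P x e)" for e
  proof (rule iffI)
    assume "\<exists>xs. length xs = n \<and> P (vec n (app xs e)) (\<lambda>i. app xs e (i + n))"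
    then obtain xs where xs: "length xs = n" "P (vec n (app xs e)) (\<lambda>i. app xs e (i + n))" by blast
    then have "P (vec_of_list xs) e" using 1[of xs e] 2[of xs e] by simp
    moreover have "vec_of_list xs \<in> carrier_vec n" using xs(1) by (intro carrier_vecI) simp
    ultimately show "\<exists>x\<in>carrier_vec n. P x e" by blast
  next
    assume "\<exists>x\<in>carrier_vec n. P x e"
    then obtain x where x: "x \<in> carrier_vec n" "P x e" by blast
    then have "length (list_of_vec x) = n" "vec_of_list (list_of_vec x) = x"
      by (simp_all add: vec_list)
    then show "\<exists>xs. length xs = n \<and> P (vec n (app xs e)) (\<lambda>i. app xs e (i + n))"
      using x(2) 1[of "list_of_vec x" e] 2[of "list_of_vec x" e] by (intro exI[of _ "list_of_vec x"]) simp
  qed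
  show ?thesis using fdef_ex_list[OF assms, of n] by (simp only: 3)
qed

lemma fdef_all_vec [fdef_intros]:
  assumes "fdef v (\<lambda>e. P (vec n e) (\<lambda>i. e (i + n)))"
  shows "fdef v (\<lambda>e. \<forall>x\<in>carrier_vec n. P x e)"
  using fdef_not[OF fdef_ex_vec[where P = "\<lambda>x e. \<not> P x e", OF fdef_not[OF assms]]] by simp

lemma env_append: "env (xs @ ys) = app xs (env ys)"
  by (auto simp: env_def app_def fun_eq_iff nth_append)

lemma definableI:
  assumes "fdef v P"
  shows "definable v {} {xs. length xs = N \<and> P (env xs)}"
proof -
  obtain \<phi> where "\<And>e. sat v e \<phi> \<longleftrightarrow> P e" using assms unfolding fdef_def by blast
  then show ?thesis unfolding definable_def
    by (intro exI[of _ N] exI[of _ \<phi>] exI[of _ "[]"]) simp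
qed

lemma definableE:
  assumes "definable v {} X"
  obtains N P where "fdef v P" "\<And>xs. xs \<in> X \<longleftrightarrow> length xs = N \<and> P (env xs)"
proof -
  obtain N \<phi> where "X = {xs. length xs = N \<and> sat v (env xs) \<phi>}"
    using assms unfolding definable_def by auto
  then show thesis using that[OF fdef_sat, of N \<phi>] by auto
qed

text \<open>Saturation for types over the countably many values of one environment. A formula reads
  only finitely many positions, so an initial segment of \<open>e\<close> serves as its parameter
  list, and all these lists lie in \<open>range e\<close>, which is small as \<kappa> is
  uncountable.\<close>

lemma saturated_env:
  assumes sat: "saturated \<kappa> v" and \<kappa>: "natLeq <o \<kappa>"
    and def: "\<And>P. P \<in> \<P> \<Longrightarrow> fdef v P"
    and fin: "\<And>F. F \<subseteq> \<P> \<Longrightarrow> finite F \<Longrightarrow> \<exists>a. \<forall>P\<in>F. P (case_nat a e)"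
  shows "\<exists>a. \<forall>P\<in>\<P>. P (case_nat a e)"
proof -
  obtain \<Phi> where \<Phi>: "\<And>P e. P \<in> \<P> \<Longrightarrow> sat v e (\<Phi> P) \<longleftrightarrow> P e"
    using def unfolding fdef_def by metis
  define par where "par P = map e [0..<fm_bound (\<Phi> P)]" for P
  have par: "sat v (env (a # par P)) (\<Phi> P) \<longleftrightarrow> P (case_nat a e)" if "P \<in> \<P>" for a P
  proof -
    have "sat v (env (a # par P)) (\<Phi> P) \<longleftrightarrow> sat v (case_nat a e) (\<Phi> P)"
      by (rule sat_cong) (auto simp: env_def par_def nth_Cons' split: nat.split)
    then show ?thesis using \<Phi>[OF that] by simp
  qed
  have "|range e| \<le>o |UNIV :: nat set|" by (rule card_of_image)
  also have "|UNIV :: nat set| =o natLeq" by (rule card_of_nat)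
  finally have card: "|range e| <o \<kappa>" using \<kappa> by (rule ordLeq_ordLess_trans)
  let ?F = "(\<lambda>P. (\<Phi> P, par P)) ` \<P>"
  have sub: "?F \<subseteq> {(\<phi>, ps). set ps \<subseteq> range e}" by (auto simp: par_def)
  have "\<exists>a. \<forall>(\<phi>, ps)\<in>F0. sat v (env (a # ps)) \<phi>" if F0: "F0 \<subseteq> ?F" "finite F0" for F0
  proof -
    obtain F where F: "F \<subseteq> \<P>" "finite F" "F0 = (\<lambda>P. (\<Phi> P, par P)) ` F"
      using finite_subset_image[OF F0(2,1)] by blast
    obtain a where "\<forall>P\<in>F. P (case_nat a e)" using fin[OF F(1,2)] by blast
    then show ?thesis using F par by (intro exI[of _ a]) auto
  qed
  then have "\<exists>a. \<forall>(\<phi>, ps)\<in>?F. sat v (env (a # ps)) \<phi>"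
    using sat card sub unfolding saturated_def by blast
  then show ?thesis using par by auto
qed

section \<open>Valuations\<close>

locale valued_field =
  fixes v :: "'k::field \<Rightarrow> 'g::linordered_ab_group_add"
  assumes valuation: "valuation v"
begin

text \<open>Comparisons go through \<open>vdiv\<close>, an atomic formula of the language that
  already gives 0 an infinite value. This saves case distinctions at 0 and makes comparisons
  definable as they stand. In \<open>x \<prec> y\<close> it is \<open>x\<close> that has the smaller
  value.\<close>

abbreviation vle (infix \<open>\<preceq>\<close> 50) where "x \<preceq> y \<equiv> vdiv v x y"
definition vless (infix \<open>\<prec>\<close> 50) where "x \<prec> y \<longleftrightarrow> \<not> y \<preceq> x"
definition veq (infix \<open>\<approx>\<close> 50) where "x \<approx> y \<longleftrightarrow> x \<preceq> y \<and> y \<preceq> x"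

lemma v_mult: "x \<noteq> 0 \<Longrightarrow> y \<noteq> 0 \<Longrightarrow> v (x * y) = v x + v y"
  using valuation unfolding valuation_def by blast

lemma v_one [simp]: "v 1 = 0"
  using v_mult[of 1 1] by simp

lemma v_uminus [simp]: "v (- x) = v x"
proof (cases "x = 0")
  case False
  have "v (-1) + v (-1) = 0" using v_mult[of "-1" "-1"] by simp
  then have "v (-1) = 0" by (simp add: double_zero)
  then show ?thesis using v_mult[of "-1" x] False by simp
qed simp

lemma v_inverse: "x \<noteq> 0 \<Longrightarrow> v (inverse x) = - v x"
  using v_mult[of x "inverse x"] by (simp add: eq_neg_iff_add_eq_0 add.commute)

lemma vle_refl [simp]: "x \<preceq> x" by (auto simp: vdiv_def)
lemma vle_trans [trans]: "x \<preceq> y \<Longrightarrow> y \<preceq> z \<Longrightarrow> x \<preceq> z" by (auto simp: vdiv_def)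
lemma vle_linear: "x \<preceq> y \<or> y \<preceq> x" by (auto simp: vdiv_def)
lemma vle_0_right [simp]: "x \<preceq> 0" by (auto simp: vdiv_def)
lemma vle_0_left [simp]: "0 \<preceq> x \<longleftrightarrow> x = 0" by (auto simp: vdiv_def)
lemma vle_nz: "x \<noteq> 0 \<Longrightarrow> y \<noteq> 0 \<Longrightarrow> x \<preceq> y \<longleftrightarrow> v x \<le> v y" by (auto simp: vdiv_def)

lemma vless_trans [trans]: "x \<prec> y \<Longrightarrow> y \<prec> z \<Longrightarrow> x \<prec> z"
  unfolding vless_def using vle_linear vle_trans by blast
lemma vle_vless_trans [trans]: "x \<preceq> y \<Longrightarrow> y \<prec> z \<Longrightarrow> x \<prec> z"
  unfolding vless_def using vle_linear vle_trans by blast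
lemma vless_vle_trans [trans]: "x \<prec> y \<Longrightarrow> y \<preceq> z \<Longrightarrow> x \<prec> z"
  unfolding vless_def using vle_linear vle_trans by blast
lemma vless_imp_vle: "x \<prec> y \<Longrightarrow> x \<preceq> y"
  unfolding vless_def using vle_linear by blast
lemma vless_irrefl [simp]: "\<not> x \<prec> x" by (simp add: vless_def)
lemma vless_0 [simp]: "x \<prec> 0 \<longleftrightarrow> x \<noteq> 0" by (simp add: vless_def)
lemma not_0_vless [simp]: "\<not> 0 \<prec> x" by (simp add: vless_def)
lemma vless_nz: "x \<noteq> 0 \<Longrightarrow> y \<noteq> 0 \<Longrightarrow> x \<prec> y \<longleftrightarrow> v x < v y"
  by (auto simp: vless_def vle_nz)

lemma veq_refl [simp]: "x \<approx> x" by (simp add: veq_def)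
lemma veq_sym: "x \<approx> y \<Longrightarrow> y \<approx> x" by (simp add: veq_def)
lemma veq_trans [trans]: "x \<approx> y \<Longrightarrow> y \<approx> z \<Longrightarrow> x \<approx> z"
  unfolding veq_def using vle_trans by blast
lemma veq_0 [simp]: "x \<approx> 0 \<longleftrightarrow> x = 0" "0 \<approx> x \<longleftrightarrow> x = 0" by (auto simp: veq_def)
lemma veq_iff: "x \<approx> y \<longleftrightarrow> (x = 0 \<longleftrightarrow> y = 0) \<and> (x \<noteq> 0 \<longrightarrow> v x = v y)"
  by (auto simp: veq_def vdiv_def)
lemma vle_cong: "x \<approx> x' \<Longrightarrow> y \<approx> y' \<Longrightarrow> x \<preceq> y \<longleftrightarrow> x' \<preceq> y'"
  unfolding veq_def using vle_trans by blast
lemma vless_cong: "x \<approx> x' \<Longrightarrow> y \<approx> y' \<Longrightarrow> x \<prec> y \<longleftrightarrow> x' \<prec> y'"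
  unfolding vless_def using vle_cong by blast
lemma vle_cases: "x \<prec> y \<or> x \<approx> y \<or> y \<prec> x"
  unfolding vless_def veq_def by blast
lemma veq_not_vless: "x \<approx> y \<Longrightarrow> \<not> x \<prec> y" unfolding veq_def vless_def by blast

lemma vle_mult: "c \<noteq> 0 \<Longrightarrow> c * x \<preceq> c * y \<longleftrightarrow> x \<preceq> y"
  by (auto simp: vdiv_def v_mult)

lemma vle_mult_right: "c \<noteq> 0 \<Longrightarrow> x * c \<preceq> y * c \<longleftrightarrow> x \<preceq> y"
  using vle_mult by (simp add: mult.commute)

lemma vless_mult: "c \<noteq> 0 \<Longrightarrow> c * x \<prec> c * y \<longleftrightarrow> x \<prec> y"
  unfolding vless_def by (simp add: vle_mult)

lemma vle_mult_mono: "a \<preceq> b \<Longrightarrow> c \<preceq> d \<Longrightarrow> a * c \<preceq> b * d"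
  by (auto simp: vdiv_def v_mult intro: add_mono)

lemma veq_mult: "a \<approx> b \<Longrightarrow> c \<approx> d \<Longrightarrow> a * c \<approx> b * d"
  unfolding veq_def using vle_mult_mono by blast

lemma vless_mult_mono1: "a \<prec> b \<Longrightarrow> c \<preceq> d \<Longrightarrow> c \<noteq> 0 \<Longrightarrow> a * c \<prec> b * d"
proof -
  assume "a \<prec> b" "c \<preceq> d" "c \<noteq> 0"
  then have "a * c \<prec> b * c" using vless_mult[of c a b] by (simp add: mult.commute)
  moreover have "b * c \<preceq> b * d" using \<open>c \<preceq> d\<close> by (rule vle_mult_mono[OF vle_refl])
  ultimately show ?thesis by (rule vless_vle_trans)
qed

lemma vless_mult_mono2: "a \<preceq> b \<Longrightarrow> c \<prec> d \<Longrightarrow> a \<noteq> 0 \<Longrightarrow> a * c \<prec> b * d"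
  using vless_mult_mono1[of c d a b] by (simp add: mult.commute)

lemma vle_power: "n > 0 \<Longrightarrow> x ^ n \<preceq> y ^ n \<longleftrightarrow> x \<preceq> y"
proof -
  have mono: "x ^ n \<preceq> y ^ n" if "x \<preceq> y" for x y n
    using that by (induction n) (auto intro: vle_mult_mono)
  have smono: "x ^ Suc n \<prec> y ^ Suc n" if less: "x \<prec> y" for x y n
  proof (induction n)
    case (Suc n)
    have "x \<noteq> 0" using less by auto
    then show ?case using vless_mult_mono2[OF vless_imp_vle[OF less] Suc.IH] by simp
  qed (use less in simp)
  assume "n > 0"
  then show ?thesis using mono smono[of y x "n - 1"] unfolding vless_def by auto
qed

lemma vless_power: "n > 0 \<Longrightarrow> x ^ n \<prec> y ^ n \<longleftrightarrow> x \<prec> y"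
  unfolding vless_def by (simp add: vle_power)

lemma veq_power: "n > 0 \<Longrightarrow> x ^ n \<approx> y ^ n \<longleftrightarrow> x \<approx> y"
  unfolding veq_def by (simp add: vle_power)

lemma vle_uminus [simp]: "- x \<preceq> y \<longleftrightarrow> x \<preceq> y" "x \<preceq> - y \<longleftrightarrow> x \<preceq> y"
  by (auto simp: vdiv_def)

lemma vless_uminus [simp]: "- x \<prec> y \<longleftrightarrow> x \<prec> y" "x \<prec> - y \<longleftrightarrow> x \<prec> y"
  by (auto simp: vless_def)

lemma veq_uminus [simp]: "- x \<approx> y \<longleftrightarrow> x \<approx> y" "x \<approx> - y \<longleftrightarrow> x \<approx> y"
  by (auto simp: veq_def)

lemma veq_minus_commute: "x - y \<approx> y - x"
  using veq_uminus(1)[of "x - y" "x - y"] by (simp del: veq_uminus add: veq_sym)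

lemma vle_add: "z \<preceq> x \<Longrightarrow> z \<preceq> y \<Longrightarrow> z \<preceq> x + y"
proof -
  assume *: "z \<preceq> x" "z \<preceq> y"
  show ?thesis
  proof (cases "x = 0 \<or> y = 0 \<or> x + y = 0")
    case False
    then have "min (v x) (v y) \<le> v (x + y)" using valuation unfolding valuation_def by blast
    moreover have "z \<noteq> 0" "v z \<le> v x" "v z \<le> v y" using * False by (auto simp: vdiv_def)
    ultimately show ?thesis unfolding vdiv_def by (meson min.boundedI order_trans)
  qed (use * in auto)
qed

lemma vle_diff: "z \<preceq> x \<Longrightarrow> z \<preceq> y \<Longrightarrow> z \<preceq> x - y"
  using vle_add[of z x "- y"] by simp

lemma vless_add: "z \<prec> x \<Longrightarrow> z \<prec> y \<Longrightarrow> z \<prec> x + y"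
  using vle_linear[of x y] vle_add[of x x y] vle_add[of y x y] vless_vle_trans vle_refl by blast

lemma vless_diff: "z \<prec> x \<Longrightarrow> z \<prec> y \<Longrightarrow> z \<prec> x - y"
  using vless_add[of z x "- y"] by simp

lemma veq_add: "x \<prec> y \<Longrightarrow> x + y \<approx> x"
proof -
  assume "x \<prec> y"
  then have "x \<preceq> x + y" using vle_add vless_imp_vle by simp
  moreover have "x + y \<preceq> x"
  proof (rule ccontr)
    assume "\<not> x + y \<preceq> x"
    then have "x \<prec> (x + y) - y" using \<open>x \<prec> y\<close> by (intro vless_diff) (simp_all add: vless_def)
    then show False by simp
  qed
  ultimately show ?thesis by (simp add: veq_def)
qed

lemma vle_sum: "(\<And>i. i \<in> A \<Longrightarrow> z \<preceq> f i) \<Longrightarrow> z \<preceq> sum f A"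
  by (induction A rule: infinite_finite_induct) (auto intro: vle_add)

lemma vless_sum: "(\<And>i. i \<in> A \<Longrightarrow> z \<prec> f i) \<Longrightarrow> z \<noteq> 0 \<Longrightarrow> z \<prec> sum f A"
  by (induction A rule: infinite_finite_induct) (auto intro: vless_add)

lemma veq_sum:
  assumes "finite A" "i \<in> A" "f i \<noteq> 0" "\<And>j. j \<in> A \<Longrightarrow> j \<noteq> i \<Longrightarrow> f i \<prec> f j"
  shows "sum f A \<approx> f i"
proof -
  have "f i \<prec> sum f (A - {i})" using assms by (intro vless_sum) auto
  then show ?thesis using veq_add sum.remove[OF assms(1,2), of f] by simp
qed

lemma ex_vle_min: "finite A \<Longrightarrow> A \<noteq> {} \<Longrightarrow> \<exists>i\<in>A. \<forall>j\<in>A. f i \<preceq> f j"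
proof (induction A rule: finite_ne_induct)
  case (singleton x)
  show ?case by (intro bexI[of _ x] ballI) auto
next
  case (insert x F)
  then obtain i where i: "i \<in> F" "\<forall>j\<in>F. f i \<preceq> f j" by blast
  show ?case
  proof (cases "f i \<preceq> f x")
    case True
    then show ?thesis using i by blast
  next
    case False
    then have "f x \<preceq> f i" using vle_linear by blast
    then have "f x \<preceq> f j" if "j \<in> insert x F" for j
      using i that vle_trans[of "f x" "f i" "f j"] by (cases "j = x") simp_all
    then show ?thesis by (intro bexI[of _ x]) blast+
  qed
qed

text \<open>If the nonzero terms have pairwise different values, exactly one of them has least value
  and dominates the sum, so only the values of the terms matter.\<close>

lemma veq_sum_cong:
  assumes "finite A" "\<And>i. i \<in> A \<Longrightarrow> f i \<approx> g i"
    and distinct: "\<And>i j. i \<in> A \<Longrightarrow> j \<in> A \<Longrightarrow> i \<noteq> j \<Longrightarrow> f i \<approx> f j \<Longrightarrow> f i = 0"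
  shows "sum f A \<approx> sum g A" "\<exists>i\<in>A. f i \<noteq> 0 \<Longrightarrow> \<exists>i\<in>A. f i \<noteq> 0 \<and> sum f A \<approx> f i \<and> (\<forall>j\<in>A. f i \<preceq> f j)"
proof -
  have *: "\<exists>i\<in>A. f i \<noteq> 0 \<and> (\<forall>j\<in>A. j \<noteq> i \<longrightarrow> f i \<prec> f j)" if ex: "\<exists>i\<in>A. f i \<noteq> 0"
  proof -
    obtain i where i: "i \<in> A" "\<forall>j\<in>A. f i \<preceq> f j" using ex assms(1) ex_vle_min[of A f] by blast
    obtain k where k: "k \<in> A" "f k \<noteq> 0" using ex by blast
    have "f i \<noteq> 0" using i k by (metis vle_0_left)
    then have "f i \<prec> f j" if "j \<in> A" "j \<noteq> i" for j
      using i that distinct[of i j] unfolding vless_def veq_def by blast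
    then show ?thesis using i \<open>f i \<noteq> 0\<close> by blast
  qed
  show "sum f A \<approx> sum g A"
  proof (cases "\<exists>i\<in>A. f i \<noteq> 0")
    case True
    then obtain i where i: "i \<in> A" "f i \<noteq> 0" "\<forall>j\<in>A. j \<noteq> i \<longrightarrow> f i \<prec> f j" using * by blast
    have "g i \<noteq> 0" using assms(2)[OF i(1)] i(2) by (auto simp: veq_iff)
    moreover have "g i \<prec> g j" if "j \<in> A" "j \<noteq> i" for j
      using i(3) that vless_cong[OF assms(2)[OF i(1)] assms(2)[OF that(1)]] by blast
    ultimately have "sum g A \<approx> g i" using veq_sum[of A i g] assms(1) i(1) by blast
    moreover have "sum f A \<approx> f i" using veq_sum[of A i f] assms(1) i by blast
    ultimately show ?thesis using assms(2)[OF i(1)] veq_sym veq_trans by blast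
  next
    case False
    then have "\<forall>i\<in>A. g i = 0" using assms(2) by (metis veq_0(2))
    then show ?thesis using False by simp
  qed
  show "\<exists>i\<in>A. f i \<noteq> 0 \<and> sum f A \<approx> f i \<and> (\<forall>j\<in>A. f i \<preceq> f j)" if ex: "\<exists>i\<in>A. f i \<noteq> 0"
  proof -
    obtain i where i: "i \<in> A" "f i \<noteq> 0" "\<forall>j\<in>A. j \<noteq> i \<longrightarrow> f i \<prec> f j" using *[OF ex] by blast
    then have "sum f A \<approx> f i" using veq_sum[of A i f] assms(1) by blast
    moreover have "f i \<preceq> f j" if "j \<in> A" for j
      using i(3) that vless_imp_vle[of "f i" "f j"] by (cases "j = i") simp_all
    ultimately show ?thesis using i by blast
  qed
qed

subsection \<open>Residue degrees\<close>

text \<open>\<open>res_deg p i\<close> says that \<open>p\<close>, scaled to Gauss norm 1, reduces to a polynomial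
  of degree \<open>i\<close> over the residue field.\<close>

definition res_deg :: "'k poly \<Rightarrow> nat \<Rightarrow> bool" where
  "res_deg p i \<longleftrightarrow> coeff p i \<noteq> 0 \<and> (\<forall>j. coeff p i \<preceq> coeff p j) \<and> (\<forall>j>i. coeff p i \<prec> coeff p j)"

lemma res_deg_unique: "res_deg p i \<Longrightarrow> res_deg p j \<Longrightarrow> i = j"
  unfolding res_deg_def vless_def by (metis linorder_neqE_nat)

text \<open>Gauss's lemma. In the coefficient of degree \<open>i + j\<close> the product of the two
  distinguished coefficients is the only term of least value; in higher degrees every term has
  larger value.\<close>

lemma res_deg_mult:
  assumes p: "res_deg p i" and q: "res_deg q j"
  shows "res_deg (p * q) (i + j)"
proof -
  define z where "z = coeff p i * coeff q j"
  have nz: "coeff p i \<noteq> 0" "coeff q j \<noteq> 0" "z \<noteq> 0"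
    using p q by (auto simp: res_deg_def z_def)
  have le: "z \<preceq> coeff p k * coeff q l" for k l
    unfolding z_def using p q by (auto simp: res_deg_def intro: vle_mult_mono)
  have less: "z \<prec> coeff p k * coeff q l" if "k > i \<or> l > j" for k l
    unfolding z_def using p q that nz
    by (auto simp: res_deg_def intro: vless_mult_mono1 vless_mult_mono2)
  have "z \<preceq> coeff (p * q) k" for k unfolding coeff_mult by (rule vle_sum) (rule le)
  moreover have "z \<prec> coeff (p * q) k" if "k > i + j" for k
    unfolding coeff_mult using that nz by (intro vless_sum less) auto
  moreover have "coeff (p * q) (i + j) \<approx> z"
  proof -
    have "(\<Sum>l\<le>i + j. coeff p l * coeff q (i + j - l)) \<approx> coeff p i * coeff q (i + j - i)"
      proof (rule veq_sum)
      fix l assume "l \<in> {..i + j}" "l \<noteq> i"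
      then have "l > i \<or> i + j - l > j" by auto
      then show "coeff p i * coeff q (i + j - i) \<prec> coeff p l * coeff q (i + j - l)"
        using less[of l "i + j - l"] by (simp add: z_def)
    qed (use nz in auto)
    then show ?thesis by (simp add: coeff_mult z_def)
  qed
  ultimately show ?thesis unfolding res_deg_def veq_def
    using nz(3) vle_trans[of "coeff (p * q) (i + j)" z] vle_vless_trans[of "coeff (p * q) (i + j)" z]
    by (auto dest!: vle_0_left[THEN iffD1])
qed

lemma res_deg_prod:
  "finite A \<Longrightarrow> (\<And>a. a \<in> A \<Longrightarrow> res_deg (p a) (d a)) \<Longrightarrow> res_deg (\<Prod>a\<in>A. p a) (\<Sum>a\<in>A. d a)"
proof (induction A rule: finite_induct)
  case empty
  have "res_deg 1 0" by (auto simp: res_deg_def)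
  then show ?case by simp
qed (auto intro: res_deg_mult)

end

section \<open>Partial isomorphisms of valued fields\<close>

text \<open>The graph of an isomorphism between two valued subfields. As a relation it is inverted
  by swapping arguments and extended by inclusion. That it is single valued in both directions
  follows from the clause on \<open>vdiv\<close>, since 0 is the only element of infinite
  value.\<close>

definition partial_iso :: "('k::field \<Rightarrow> 'g::linordered_ab_group_add) \<Rightarrow> ('k \<Rightarrow> 'k \<Rightarrow> bool) \<Rightarrow> bool" where
  "partial_iso v I \<longleftrightarrow> I 0 0 \<and> I 1 1 \<and>
     (\<forall>x x' y y'. I x x' \<longrightarrow> I y y' \<longrightarrow> I (x + y) (x' + y') \<and> I (x * y) (x' * y') \<and>
        (vdiv v x y \<longleftrightarrow> vdiv v x' y')) \<and>
     (\<forall>x x'. I x x' \<longrightarrow> I (- x) (- x') \<and> I (inverse x) (inverse x'))"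

definition relp :: "('k::field \<Rightarrow> 'k \<Rightarrow> bool) \<Rightarrow> 'k poly \<Rightarrow> 'k poly \<Rightarrow> bool" where
  "relp I p q \<longleftrightarrow> (\<forall>i. I (coeff p i) (coeff q i))"

locale valued_iso = valued_field v for v :: "'k::field \<Rightarrow> 'g::linordered_ab_group_add" +
  fixes I :: "'k \<Rightarrow> 'k \<Rightarrow> bool"
  assumes partial_iso: "partial_iso v I"
begin

lemma I_0 [simp]: "I 0 0" and I_1 [simp]: "I 1 1"
  and I_add: "I x x' \<Longrightarrow> I y y' \<Longrightarrow> I (x + y) (x' + y')"
  and I_mult: "I x x' \<Longrightarrow> I y y' \<Longrightarrow> I (x * y) (x' * y')"
  and I_uminus: "I x x' \<Longrightarrow> I (- x) (- x')"
  and I_inverse: "I x x' \<Longrightarrow> I (inverse x) (inverse x')"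
  and I_vle: "I x x' \<Longrightarrow> I y y' \<Longrightarrow> x \<preceq> y \<longleftrightarrow> x' \<preceq> y'"
  using partial_iso unfolding partial_iso_def by blast+

lemma I_vless: "I x x' \<Longrightarrow> I y y' \<Longrightarrow> x \<prec> y \<longleftrightarrow> x' \<prec> y'"
  unfolding vless_def using I_vle by blast

lemma I_diff: "I x x' \<Longrightarrow> I y y' \<Longrightarrow> I (x - y) (x' - y')"
  using I_add[OF _ I_uminus] by fastforce

lemma I_divide: "I x x' \<Longrightarrow> I y y' \<Longrightarrow> I (x / y) (x' / y')"
  using I_mult[OF _ I_inverse] by (simp add: divide_inverse)

lemma I_power: "I x x' \<Longrightarrow> I (x ^ n) (x' ^ n)"
  by (induction n) (auto intro: I_mult)

lemma I_zero_iff: "I x x' \<Longrightarrow> x = 0 \<longleftrightarrow> x' = 0"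
  using I_vle[of 0 0 x x'] by simp

lemma I_unique: "I x y \<Longrightarrow> I x y' \<Longrightarrow> y = y'"
  using I_zero_iff[OF I_diff, of x y x y'] by simp

lemma I_sum: "(\<And>i. i \<in> A \<Longrightarrow> I (f i) (g i)) \<Longrightarrow> I (sum f A) (sum g A)"
  by (induction A rule: infinite_finite_induct) (auto intro: I_add)

lemma relp_coeff: "relp I p q \<Longrightarrow> I (coeff p i) (coeff q i)"
  by (simp add: relp_def)

lemma relp_0 [simp]: "relp I 0 0" by (simp add: relp_def)
lemma relp_1 [simp]: "relp I 1 1" by (simp add: relp_def coeff_1)

lemma relp_monom: "I a b \<Longrightarrow> relp I (monom a n) (monom b n)"
  by (simp add: relp_def coeff_monom)

lemma relp_pCons: "I a b \<Longrightarrow> relp I p q \<Longrightarrow> relp I (pCons a p) (pCons b q)"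
  by (simp add: relp_def coeff_pCons split: nat.split)

lemma relp_add: "relp I p p' \<Longrightarrow> relp I q q' \<Longrightarrow> relp I (p + q) (p' + q')"
  by (simp add: relp_def I_add)

lemma relp_uminus: "relp I p p' \<Longrightarrow> relp I (- p) (- p')"
  by (simp add: relp_def I_uminus)

lemma relp_diff: "relp I p p' \<Longrightarrow> relp I q q' \<Longrightarrow> relp I (p - q) (p' - q')"
  by (simp add: relp_def I_diff)

lemma relp_mult: "relp I p p' \<Longrightarrow> relp I q q' \<Longrightarrow> relp I (p * q) (p' * q')"
  unfolding relp_def coeff_mult by (auto intro!: I_sum I_mult)

lemma relp_smult: "I c c' \<Longrightarrow> relp I q q' \<Longrightarrow> relp I (Polynomial.smult c q) (Polynomial.smult c' q')"
  by (simp add: relp_def I_mult)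

lemma relp_sum: "(\<And>i. i \<in> A \<Longrightarrow> relp I (f i) (g i)) \<Longrightarrow> relp I (sum f A) (sum g A)"
  by (induction A rule: infinite_finite_induct) (auto intro: relp_add)

lemma relp_prod: "(\<And>i. i \<in> A \<Longrightarrow> relp I (f i) (g i)) \<Longrightarrow> relp I (prod f A) (prod g A)"
  by (induction A rule: infinite_finite_induct) (auto intro: relp_mult)

lemma relp_zero_iff: "relp I p q \<Longrightarrow> p = 0 \<longleftrightarrow> q = 0"
  using I_zero_iff unfolding relp_def poly_eq_iff coeff_0 by blast

lemma relp_degree: "relp I p q \<Longrightarrow> degree p = degree q"
proof -
  assume "relp I p q"
  then have "coeff p i = 0 \<longleftrightarrow> coeff q i = 0" for i using I_zero_iff relp_coeff by blast
  then show ?thesis unfolding degree_def by simp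
qed

lemma relp_unique: "relp I p q \<Longrightarrow> relp I p q' \<Longrightarrow> q = q'"
  unfolding relp_def poly_eq_iff using I_unique by blast

lemma relp_poly: "relp I p q \<Longrightarrow> I x y \<Longrightarrow> I (poly p x) (poly q y)"
proof -
  assume *: "relp I p q" "I x y"
  have "I (\<Sum>i\<le>degree p. coeff p i * x ^ i) (\<Sum>i\<le>degree p. coeff q i * y ^ i)"
    by (intro I_sum I_mult I_power relp_coeff *)
  then show ?thesis using relp_degree[OF *(1)] by (simp add: poly_altdef)
qed

lemma relp_res_deg: "relp I p q \<Longrightarrow> res_deg p i \<longleftrightarrow> res_deg q i"
proof -
  assume *: "relp I p q"
  show ?thesis unfolding res_deg_def
    by (simp only: I_vle[OF relp_coeff[OF *] relp_coeff[OF *]] I_vless[OF relp_coeff[OF *] relp_coeff[OF *]]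
        I_zero_iff[OF relp_coeff[OF *]])
qed

text \<open>Long division uses only field operations on coefficients. The induction on a bound of
  the degree cancels one leading term, by the multiple \<open>c\<close> of the divisor, at each
  step.\<close>

lemma relp_divmod:
  assumes q: "relp I q q'" "q \<noteq> 0"
  shows "relp I p p' \<Longrightarrow> p = 0 \<or> degree p < n \<Longrightarrow>
    relp I (p div q) (p' div q') \<and> relp I (p mod q) (p' mod q')"
proof (induction n arbitrary: p p')
  case 0
  then have "p = 0" "p' = 0" using relp_zero_iff by auto
  then show ?case by simp
next
  case (Suc n)
  have q': "q' \<noteq> 0" "degree q' = degree q" using q relp_zero_iff relp_degree by metis+
  have p': "degree p' = degree p" using Suc.prems(1) relp_degree by metis
  consider "p = 0" | "degree p < degree q" | "p \<noteq> 0" "degree q \<le> degree p" by linarith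
  then show ?case
  proof cases
    case 1
    moreover have "p' = 0" using 1 Suc.prems(1) relp_zero_iff by blast
    ultimately show ?thesis by simp
  next
    case 2
    then show ?thesis using p' q' Suc.prems(1) by (simp add: div_poly_less mod_poly_less)
  next
    case 3
    define c where "c = monom (lead_coeff p / lead_coeff q) (degree p - degree q)"
    define c' where "c' = monom (lead_coeff p' / lead_coeff q') (degree p' - degree q')"
    have c: "relp I c c'" unfolding c_def c'_def p' q'(2)
      by (intro relp_monom I_divide relp_coeff q Suc.prems(1))
    have deg: "degree (c * q) \<le> degree p"
      using 3 q(2) by (simp add: c_def degree_mult_eq degree_monom_eq)
    have "coeff (c * q) (degree p) = lead_coeff p"
      using 3 q(2) unfolding c_def coeff_monom_mult by simp
    then have "coeff (p - c * q) (degree p) = 0" by simp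
    moreover have "degree (p - c * q) \<le> degree p" using deg by (simp add: degree_diff_le)
    ultimately have "p - c * q = 0 \<or> degree (p - c * q) < degree p"
      by (metis leading_coeff_0_iff le_neq_implies_less)
    then have "p - c * q = 0 \<or> degree (p - c * q) < n" using Suc.prems(2) 3 by auto
    moreover have "relp I (p - c * q) (p' - c' * q')"
      by (intro relp_diff relp_mult c q Suc.prems(1))
    ultimately have IH: "relp I ((p - c * q) div q) ((p' - c' * q') div q')"
      "relp I ((p - c * q) mod q) ((p' - c' * q') mod q')" using Suc.IH by blast+
    have "p div q = c + (p - c * q) div q" "p mod q = (p - c * q) mod q"
      using div_mult_self3[of q c "p - c * q"] mod_mult_self3[of c q "p - c * q"] q(2) by simp_all
    moreover have "p' div q' = c' + (p' - c' * q') div q'" "p' mod q' = (p' - c' * q') mod q'"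
      using div_mult_self3[of q' c' "p' - c' * q'"] mod_mult_self3[of c' q' "p' - c' * q'"] q'(1) by simp_all
    ultimately show ?thesis using IH relp_add[OF c IH(1)] by simp
  qed
qed

lemma relp_div: "relp I p p' \<Longrightarrow> relp I q q' \<Longrightarrow> q \<noteq> 0 \<Longrightarrow> relp I (p div q) (p' div q')"
  and relp_mod: "relp I p p' \<Longrightarrow> relp I q q' \<Longrightarrow> q \<noteq> 0 \<Longrightarrow> relp I (p mod q) (p' mod q')"
  using relp_divmod[of q q' p p' "Suc (degree p)"] lessI by blast+

end

section \<open>Algebraic extensions of partial isomorphisms\<close>

text \<open>Newton's interpolation basis: dividing the cofactor of \<open>B k\<close> by X - r k
  leaves its value at \<open>r k\<close> as the coefficient of \<open>B k\<close> and raises the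
  divisor to \<open>B (Suc k)\<close>. The vanishing of the first \<open>k\<close> coordinates is
  what makes matrices in this basis triangular.\<close>

lemma linear_products_basis:
  fixes r :: "nat \<Rightarrow> 'a::field"
  defines "B \<equiv> \<lambda>i. \<Prod>k<i. [:- r k, 1:]"
  assumes "k \<le> n" "B k dvd q" "q = 0 \<or> degree q < n"
  shows "\<exists>t. q = (\<Sum>l<n. Polynomial.smult (t l) (B l)) \<and> (\<forall>l<k. t l = 0)"
  using assms(2-)
proof (induction "n - k" arbitrary: k q)
  case 0
  have "degree (B n) = n" "B n \<noteq> 0" unfolding B_def
    by (simp_all add: degree_prod_sum_eq)
  then have "q = 0" using 0 by (metis diff_is_0_eq dvd_imp_degree_le leD le_antisym)
  then show ?case by (intro exI[of _ "\<lambda>_. 0"]) simp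
next
  case (Suc d)
  have k: "k < n" using Suc.hyps(2) by simp
  obtain g where g: "q = B k * g" using Suc.prems(2) by blast
  define c where "c = poly g (r k)"
  define h where "h = synthetic_div g (r k)"
  have gh: "g = [:- r k, 1:] * h + [:c:]"
    unfolding c_def h_def by (rule synthetic_div_correct'[symmetric])
  have q: "q = B (Suc k) * h + Polynomial.smult c (B k)"
    unfolding g by (subst gh) (simp add: B_def algebra_simps)
  have "degree (B k) = k" unfolding B_def by (simp add: degree_prod_sum_eq)
  then have "degree (q - Polynomial.smult c (B k)) < n"
    using Suc.prems(3) k by (intro degree_diff_less) (auto simp: degree_smult_eq)
  then have dh: "B (Suc k) * h = 0 \<or> degree (B (Suc k) * h) < n" by (simp add: q)
  have d: "d = n - Suc k" using Suc.hyps(2) by simp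
  have "\<exists>t. B (Suc k) * h = (\<Sum>l<n. Polynomial.smult (t l) (B l)) \<and> (\<forall>l<Suc k. t l = 0)"
    by (rule Suc.hyps(1)[OF d _ _ dh]) (use k in auto)
  then obtain t where t: "B (Suc k) * h = (\<Sum>l<n. Polynomial.smult (t l) (B l))" "\<forall>l<Suc k. t l = 0"
    by blast
  define u where "u = t(k := c)"
  have "(\<Sum>l<n. Polynomial.smult (u l) (B l)) =
        (\<Sum>l<n. Polynomial.smult (t l) (B l) + (if l = k then Polynomial.smult c (B k) else 0))"
    using t(2) by (intro sum.cong) (auto simp: u_def)
  also have "\<dots> = q" using k by (simp add: sum.distrib t(1)[symmetric] q)
  finally show ?case using t(2) by (intro exI[of _ u]) (auto simp: u_def)
qed

lemma mod_sum_poly: "(\<Sum>i\<in>A. f i) mod (P :: 'a::field poly) = (\<Sum>i\<in>A. f i mod P)"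
  by (induction A rule: infinite_finite_induct) (auto simp: poly_mod_add_left)

text \<open>The norm of \<open>\<Sum>\<^sub>s T\<^bsup>w s\<^esup> m\<^sub>s\<close> from \<open>K[X]/(P)\<close>, by triangularizing the
  multiplication matrix in the basis of the products \<open>\<Prod>\<^bsub>k<i\<^esub> (X - r k)\<close>.\<close>

lemma det_mult_mod:
  fixes r :: "nat \<Rightarrow> 'a::field" and n :: nat
  defines "P \<equiv> \<Prod>i<n. [:- r i, 1:]"
  shows "det (mat n n (\<lambda>(i, j). \<Sum>s\<in>S. monom (coeff ((monom 1 i * m s) mod P) j) (w s))) =
         (\<Prod>i<n. \<Sum>s\<in>S. monom (poly (m s) (r i)) (w s))" (is "det ?N = _")
proof -
  define B where "B i = (\<Prod>k<i. [:- r k, 1:])" for i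
  have deg: "degree (B i) = i" for i unfolding B_def by (simp add: degree_prod_sum_eq)
  have BP: "P = B n" by (simp add: B_def P_def)
  have P: "P \<noteq> 0" "degree P = n" using deg[of n] unfolding BP by (auto simp: B_def)
  have lpb: "\<exists>t. q = (\<Sum>l<n. Polynomial.smult (t l) (B l)) \<and> (\<forall>l<k. t l = 0)"
    if "k \<le> n" "B k dvd q" "q = 0 \<or> degree q < n" for k q
    using that unfolding B_def by (rule linear_products_basis)
  have "\<exists>t. (B i * m s) mod P = (\<Sum>l<n. Polynomial.smult (t l) (B l)) \<and>
      (\<forall>l<i. t l = 0) \<and> t i = poly (m s) (r i)" if i: "i < n" for i s
  proof -
    define c where "c = poly (m s) (r i)"
    define h where "h = synthetic_div (m s) (r i)"
    have gh: "m s = [:- r i, 1:] * h + [:c:]"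
      unfolding c_def h_def by (rule synthetic_div_correct'[symmetric])
    have "B i * m s = B (Suc i) * h + Polynomial.smult c (B i)"
      by (subst gh) (simp add: B_def algebra_simps)
    then have 1: "(B i * m s) mod P = (B (Suc i) * h) mod P + Polynomial.smult c (B i)"
      using i deg P by (simp add: poly_mod_add_left mod_smult_left mod_poly_less)
    have "{..<n} = {..<Suc i} \<union> {Suc i..<n}" using i by auto
    moreover have "(\<Prod>k\<in>{..<Suc i} \<union> {Suc i..<n}. [:- r k, 1:]) =
        B (Suc i) * (\<Prod>k\<in>{Suc i..<n}. [:- r k, 1:])"
      unfolding B_def by (rule prod.union_disjoint) auto
    ultimately have "P = B (Suc i) * (\<Prod>k\<in>{Suc i..<n}. [:- r k, 1:])"
      unfolding P_def by (simp only:)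
    then have "B (Suc i) dvd P" by simp
    then have "B (Suc i) dvd (B (Suc i) * h) mod P" by (simp add: dvd_mod)
    moreover have "(B (Suc i) * h) mod P = 0 \<or> degree ((B (Suc i) * h) mod P) < n"
      using degree_mod_less[OF P(1)] P(2) by simp
    ultimately have "\<exists>t. (B (Suc i) * h) mod P = (\<Sum>l<n. Polynomial.smult (t l) (B l)) \<and> (\<forall>l<Suc i. t l = 0)"
      by (rule lpb[OF Suc_leI[OF i]])
    then obtain t where t: "(B (Suc i) * h) mod P = (\<Sum>l<n. Polynomial.smult (t l) (B l))"
      "\<forall>l<Suc i. t l = 0" by blast
    define u where "u = t(i := c)"
    have "(\<Sum>l<n. Polynomial.smult (u l) (B l)) =
          (\<Sum>l<n. Polynomial.smult (t l) (B l) + (if l = i then Polynomial.smult c (B i) else 0))"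
      using t(2) by (intro sum.cong) (auto simp: u_def)
    also have "\<dots> = (B i * m s) mod P" using i by (simp add: sum.distrib t(1)[symmetric] 1)
    finally show ?thesis using t(2) by (intro exI[of _ u]) (auto simp: u_def c_def)
  qed
  then obtain t where t: "\<And>i s. i < n \<Longrightarrow> (B i * m s) mod P = (\<Sum>l<n. Polynomial.smult (t i s l) (B l))"
    "\<And>i s l. l < i \<Longrightarrow> i < n \<Longrightarrow> t i s l = 0" "\<And>i s. i < n \<Longrightarrow> t i s i = poly (m s) (r i)"
    by metis
  \<comment> \<open>\<open>U\<close> passes from the monomials to the Newton basis and
    \<open>T\<close> is multiplication in the Newton basis, both over polynomials in a new variable
    that carries the weights \<open>w\<close>. As \<open>U\<close> has determinant 1, the
    determinants of \<open>?N\<close> and \<open>T\<close> agree.\<close>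
  define U where "U = mat n n (\<lambda>(i, j). [:coeff (B i) j:])"
  define T where "T = mat n n (\<lambda>(i, l). \<Sum>s\<in>S. monom (t i s l) (w s))"
  have cm: "[:c:] * monom a l = monom (c * a) l" for c a :: 'a and l by (simp add: smult_monom)
  have "U * ?N = T * U"
  proof (rule eq_matI)
    fix i l assume "i < dim_row (T * U)" "l < dim_col (T * U)"
    then have i: "i < n" and l: "l < n" by (auto simp: T_def U_def)
    have Bi: "B i = (\<Sum>j<n. Polynomial.smult (coeff (B i) j) (monom 1 j))"
    proof -
      have "B i = (\<Sum>j\<le>n - 1. monom (coeff (B i) j) j)"
        using i deg by (intro poly_as_sum_of_monoms'[symmetric]) auto
      then show ?thesis using i by (simp add: smult_monom lessThan_Suc_atMost[symmetric])
    qed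
    have "(U * ?N) $$ (i, l) =
        (\<Sum>j<n. [:coeff (B i) j:] * (\<Sum>s\<in>S. monom (coeff ((monom 1 j * m s) mod P) l) (w s)))"
      using i l by (simp add: U_def scalar_prod_def atLeast0LessThan)
    also have "\<dots> = (\<Sum>s\<in>S. \<Sum>j<n. monom (coeff (B i) j * coeff ((monom 1 j * m s) mod P) l) (w s))"
      by (subst sum.swap) (simp only: sum_distrib_left cm)
    also have "\<dots> = (\<Sum>s\<in>S. monom (coeff ((B i * m s) mod P) l) (w s))"
    proof (rule sum.cong[OF refl])
      fix s
      have "(B i * m s) mod P = (\<Sum>j<n. Polynomial.smult (coeff (B i) j) ((monom 1 j * m s) mod P))"
        by (subst Bi) (simp add: sum_distrib_right mod_sum_poly mod_smult_left)
      then show "(\<Sum>j<n. monom (coeff (B i) j * coeff ((monom 1 j * m s) mod P) l) (w s)) =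
          monom (coeff ((B i * m s) mod P) l) (w s)"
        by (simp add: coeff_sum monom_sum)
    qed
    also have "\<dots> = (\<Sum>s\<in>S. \<Sum>k<n. monom (t i s k) (w s) * [:coeff (B k) l:])"
      using i by (simp add: t(1) coeff_sum monom_sum smult_monom mult.commute)
    also have "\<dots> = (\<Sum>k<n. (\<Sum>s\<in>S. monom (t i s k) (w s)) * [:coeff (B k) l:])"
      by (subst sum.swap) (simp only: sum_distrib_right)
    also have "\<dots> = (T * U) $$ (i, l)"
      using i l by (simp add: T_def U_def scalar_prod_def atLeast0LessThan)
    finally show "(U * ?N) $$ (i, l) = (T * U) $$ (i, l)" .
  qed (auto simp: T_def U_def)
  moreover have "det U = 1"
  proof -
    have "coeff (B i) i = 1" for i
      using lead_coeff_prod[of "\<lambda>k. [:- r k, 1:]" "{..<i}"] deg[of i] unfolding B_def by simp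
    then have "prod_list (diag_mat U) = 1"
      unfolding prod_list_diag_prod by (simp add: U_def one_pCons[symmetric])
    moreover have "det U = prod_list (diag_mat U)"
      by (rule det_lower_triangular[of n]) (auto simp: U_def coeff_eq_0 deg)
    ultimately show ?thesis by simp
  qed
  moreover have "det T = (\<Prod>i<n. \<Sum>s\<in>S. monom (poly (m s) (r i)) (w s))"
  proof -
    have "det T = prod_list (diag_mat T)"
      by (rule det_upper_triangular[of _ n]) (auto simp: T_def t(2) intro!: upper_triangularI)
    also have "\<dots> = (\<Prod>i<n. \<Sum>s\<in>S. monom (poly (m s) (r i)) (w s))"
      unfolding prod_list_diag_prod by (simp add: T_def t(3) atLeast0LessThan)
    finally show ?thesis .
  qed
  moreover have "det (U * ?N) = det U * det ?N" "det (T * U) = det T * det U"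
    by (rule det_mult[of _ n]; simp add: U_def T_def)+
  ultimately show ?thesis by simp
qed

text \<open>A multiset of subsets is determined by its statistics \<open>\<Sum>\<^sub>i Max (w ` J\<^sub>i)\<close>:
  with a heavy weight on a set \<open>T\<close> they count the members meeting \<open>T\<close>.\<close>

lemma set_family_eqI:
  fixes J J' :: "nat \<Rightarrow> 's set"
  assumes S: "finite S"
    and J: "\<And>i. i < n \<Longrightarrow> J i \<subseteq> S \<and> J i \<noteq> {}" and J': "\<And>i. i < n \<Longrightarrow> J' i \<subseteq> S \<and> J' i \<noteq> {}"
    and w: "\<And>w :: 's \<Rightarrow> nat. inj_on w S \<Longrightarrow> (\<Sum>i<n. Max (w ` J i)) = (\<Sum>i<n. Max (w ` J' i))"
    and i: "i < n"
  shows "\<exists>i'<n. J' i' = J i"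
proof -
  obtain f :: "'s \<Rightarrow> nat" where f: "inj_on f S" "f ` S = {..<card S}"
    using ex_bij_betw_finite_nat[OF S] unfolding bij_betw_def atLeast0LessThan by blast
  \<comment> \<open>\<open>D\<close> exceeds the total of \<open>n\<close> small contributions of at
    most \<open>card S\<close> each, so division by \<open>D\<close> isolates the number of members
    that meet \<open>T\<close>.\<close>
  define D where "D = n * card S + 1"
  have count: "card {i. i < n \<and> J i \<inter> T \<noteq> {}} = (\<Sum>i<n. Max ((\<lambda>s. (if s \<in> T then D else 0) + f s) ` J i)) div D"
    if J: "\<And>i. i < n \<Longrightarrow> J i \<subseteq> S \<and> J i \<noteq> {}" for J :: "nat \<Rightarrow> 's set" and T
  proof -
    define w where "w s = (if s \<in> T then D else 0) + f s" for s
    define c where "c i = (if J i \<inter> T \<noteq> {} then 1 else 0 :: nat)" for i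
    define q where "q i = Max (w ` J i) - D * c i" for i
    have q: "Max (w ` J i) = D * c i + q i \<and> q i \<le> card S" if i: "i < n" for i
    proof -
      have fin: "finite (w ` J i)" "w ` J i \<noteq> {}" using J[OF i] S by (auto intro: finite_subset)
      have fS: "f s < card S" if "s \<in> J i" for s using f(2) J[OF i] that by auto
      have "D * c i \<le> Max (w ` J i)"
      proof (cases "J i \<inter> T = {}")
        case False
        then obtain s where "s \<in> J i" "s \<in> T" by blast
        then have "D * c i \<le> w s" by (auto simp: w_def c_def)
        moreover have "w s \<le> Max (w ` J i)" using fin(1) \<open>s \<in> J i\<close> by (intro Max_ge) auto
        ultimately show ?thesis by simp
      qed (simp add: c_def)
      moreover have "Max (w ` J i) \<le> D * c i + card S"
        using fin fS by (subst Max_le_iff) (auto simp: w_def c_def intro: less_imp_le trans_le_add2)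
      ultimately show ?thesis unfolding q_def by simp
    qed
    have "(\<Sum>i<n. Max (w ` J i)) = D * (\<Sum>i<n. c i) + (\<Sum>i<n. q i)"
      using q by (simp add: sum.distrib sum_distrib_left)
    moreover have "(\<Sum>i<n. q i) < D"
      using sum_mono[of "{..<n}" q "\<lambda>_. card S"] q by (simp add: D_def)
    ultimately have "(\<Sum>i<n. Max (w ` J i)) div D = (\<Sum>i<n. c i)" by simp
    also have "(\<Sum>i<n. c i) = card {i. i < n \<and> J i \<inter> T \<noteq> {}}"
      by (simp add: c_def sum.If_cases) (rule arg_cong[of _ _ card], auto)
    finally show ?thesis by (simp add: w_def)
  qed
  have "inj_on (\<lambda>s. (if s \<in> T then D else 0) + f s) S" for T
  proof (rule inj_onI)
    fix s t assume s: "s \<in> S" "t \<in> S" and e: "(if s \<in> T then D else 0) + f s = (if t \<in> T then D else 0) + f t"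
    have "f s < card S" "f t < card S" using f(2) s by auto
    moreover have "card S < D" using mult_le_mono1[of 1 n "card S"] i unfolding D_def by linarith
    ultimately have "f s = f t" using e by (auto split: if_splits)
    then show "s = t" using f(1) s by (auto dest: inj_onD)
  qed
  then have meet: "card {i. i < n \<and> J i \<inter> T \<noteq> {}} = card {i. i < n \<and> J' i \<inter> T \<noteq> {}}" for T
    using count[OF J] count[OF J'] w by simp
  \<comment> \<open>A member lies in \<open>U\<close> exactly if it misses the complement of
    \<open>U\<close>.\<close>
  have sub: "card {i. i < n \<and> J i \<subseteq> U} = card {i. i < n \<and> J' i \<subseteq> U}" for U
  proof -
    have "card {i. i < n \<and> J i \<subseteq> U} = n - card {i. i < n \<and> J i \<inter> (- U) \<noteq> {}}" for J :: "nat \<Rightarrow> 's set"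
    proof -
      have "{i. i < n \<and> J i \<subseteq> U} = {..<n} - {i. i < n \<and> J i \<inter> (- U) \<noteq> {}}" by auto
      moreover have "card ({..<n} - {i. i < n \<and> J i \<inter> (- U) \<noteq> {}}) =
          card {..<n} - card {i. i < n \<and> J i \<inter> (- U) \<noteq> {}}"
        by (rule card_Diff_subset) auto
      ultimately show ?thesis by simp
    qed
    then show ?thesis using meet by simp
  qed
  \<comment> \<open>Inclusion counts determine the multiplicity of \<open>U\<close> itself once the
    multiplicities of its proper subsets are known: Moebius inversion by induction on the
    size.\<close>
  have "finite U \<Longrightarrow> card {i. i < n \<and> J i = U} = card {i. i < n \<and> J' i = U}" for U
  proof (induction "card U" arbitrary: U rule: less_induct)
    case less
    have dec: "card {i. i < n \<and> J i \<subseteq> U} = card {i. i < n \<and> J i = U} + (\<Sum>V\<in>{V. V \<subset> U}. card {i. i < n \<and> J i = V})"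
      for J :: "nat \<Rightarrow> 's set"
    proof -
      have fin: "finite {V. V \<subset> U}" using less.prems by (auto intro: finite_subset[of _ "Pow U"])
      have "{i. i < n \<and> J i \<subseteq> U} = (\<Union>V\<in>insert U {V. V \<subset> U}. {i. i < n \<and> J i = V})" by auto
      also have "card \<dots> = (\<Sum>V\<in>insert U {V. V \<subset> U}. card {i. i < n \<and> J i = V})"
        by (rule card_UN_disjoint) (use fin in auto)
      also have "\<dots> = card {i. i < n \<and> J i = U} + (\<Sum>V\<in>{V. V \<subset> U}. card {i. i < n \<and> J i = V})"
        using fin by (subst sum.insert) auto
      finally show ?thesis .
    qed
    have "(\<Sum>V\<in>{V. V \<subset> U}. card {i. i < n \<and> J i = V}) = (\<Sum>V\<in>{V. V \<subset> U}. card {i. i < n \<and> J' i = V})"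
      using less.hyps less.prems by (intro sum.cong refl) (auto intro: psubset_card_mono finite_subset)
    then show ?case using dec[of J] dec[of J'] sub[of U] by simp
  qed
  moreover have "finite (J i)" using J[OF i] S finite_subset by blast
  moreover have "card {k. k < n \<and> J k = J i} > 0" using i by (subst card_gt_0_iff) auto
  ultimately have "card {k. k < n \<and> J' k = J i} > 0" by metis
  then show ?thesis by (auto simp: card_gt_0_iff)
qed

context valued_field begin

definition argmin :: "('s \<Rightarrow> 'k) \<Rightarrow> 's set \<Rightarrow> 's set" where
  "argmin f S = {s \<in> S. \<forall>t\<in>S. f s \<preceq> f t}"

text \<open>After scaling, the terms that survive in the residue field are those with
  \<open>f s\<close> of least value, and injectivity of \<open>w\<close> keeps them from colliding.
  The residue degree thus reads off one of the statistics of \<open>argmin f S\<close> that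
  \<open>set_family_eqI\<close> asks for.\<close>

lemma res_deg_family:
  fixes f :: "'s \<Rightarrow> 'k" and w :: "'s \<Rightarrow> nat"
  assumes S: "finite S" "S \<noteq> {}" and f: "\<And>s. s \<in> S \<Longrightarrow> f s \<noteq> 0" and w: "inj_on w S"
  shows "res_deg (\<Sum>s\<in>S. monom (f s) (w s)) (Max (w ` argmin f S))"
proof -
  define p where "p = (\<Sum>s\<in>S. monom (f s) (w s))"
  have cf: "coeff p (w s) = f s" if "s \<in> S" for s
  proof -
    have "coeff p (w s) = (\<Sum>t\<in>S. if t = s then f t else 0)"
      unfolding p_def coeff_sum coeff_monom using w that by (intro sum.cong refl) (auto dest: inj_onD)
    then show ?thesis using S(1) that by simp
  qed
  have c0: "coeff p i = 0" if "i \<notin> w ` S" for i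
    unfolding p_def coeff_sum coeff_monom using that by (intro sum.neutral) auto
  have fin: "finite (w ` argmin f S)" using S(1) by (simp add: argmin_def)
  have ne: "w ` argmin f S \<noteq> {}" using ex_vle_min[OF S, of f] by (auto simp: argmin_def)
  obtain s where s: "s \<in> argmin f S" "w s = Max (w ` argmin f S)" using Max_in[OF fin ne] by auto
  then have sS: "s \<in> S" by (simp add: argmin_def)
  have "f s \<preceq> coeff p j" for j
    using c0[of j] cf s(1) by (cases "j \<in> w ` S") (auto simp: argmin_def)
  moreover have "f s \<prec> coeff p j" if "j > w s" for j
  proof (cases "j \<in> w ` S")
    case True
    then obtain t where t: "t \<in> S" "j = w t" by blast
    then have "t \<notin> argmin f S" using that s(2) Max_ge[OF fin, of j] by auto
    then obtain u where "u \<in> S" "\<not> f t \<preceq> f u" using t by (auto simp: argmin_def)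
    then have "f s \<preceq> f u" "f u \<prec> f t" using s(1) by (auto simp: argmin_def vless_def)
    then show ?thesis using cf t vle_vless_trans by auto
  qed (use c0 f sS in auto)
  ultimately show ?thesis unfolding res_deg_def p_def[symmetric] s(2)[symmetric]
    using cf[OF sS] f[OF sS] by simp
qed

text \<open>One set of minimizers stores the whole preorder of values: choosing a member from every
  pair gives a product, and the product has least value exactly if each choice has least value in
  its pair.\<close>

lemma argmin_pairs:
  fixes f :: "'s \<Rightarrow> 'k"
  assumes S: "finite S" and f: "\<And>s. s \<in> S \<Longrightarrow> f s \<noteq> 0" and pq: "p \<in> S" "q \<in> S"
  shows "f p \<preceq> f q \<longleftrightarrow>
    (\<exists>A \<in> argmin (\<lambda>A. \<Prod>x\<in>S \<times> S. if x \<in> A then f (fst x) else f (snd x)) (Pow (S \<times> S)). (p, q) \<in> A)"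
    (is "_ \<longleftrightarrow> (\<exists>A \<in> argmin ?F _. _)")
proof
  assume "f p \<preceq> f q"
  define A where "A = {x \<in> S \<times> S. f (fst x) \<preceq> f (snd x)}"
  have "?F A \<preceq> ?F B" for B
  proof -
    have "(\<Prod>x\<in>X. if x \<in> A then f (fst x) else f (snd x)) \<preceq> (\<Prod>x\<in>X. if x \<in> B then f (fst x) else f (snd x))"
      if "finite X" "X \<subseteq> S \<times> S" for X
      using that
    proof (induction X rule: finite_induct)
      case (insert x X)
      have "(if x \<in> A then f (fst x) else f (snd x)) \<preceq> (if x \<in> B then f (fst x) else f (snd x))"
        using insert.prems vle_linear[of "f (fst x)" "f (snd x)"] by (auto simp: A_def)
      then show ?case using insert by (simp add: vle_mult_mono)
    qed simp
    then show ?thesis using S by simp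
  qed
  then have "A \<in> argmin ?F (Pow (S \<times> S))" by (auto simp: argmin_def A_def)
  moreover have "(p, q) \<in> A" using \<open>f p \<preceq> f q\<close> pq by (simp add: A_def)
  ultimately show "\<exists>A \<in> argmin ?F (Pow (S \<times> S)). (p, q) \<in> A" by blast
next
  assume "\<exists>A \<in> argmin ?F (Pow (S \<times> S)). (p, q) \<in> A"
  then obtain A where A: "A \<subseteq> S \<times> S" "\<And>B. B \<subseteq> S \<times> S \<Longrightarrow> ?F A \<preceq> ?F B" "(p, q) \<in> A"
    by (auto simp: argmin_def)
  \<comment> \<open>Reversing the choice at the single pair (p, q) replaces the factor
    \<open>f p\<close> by \<open>f q\<close> and leaves the cofactor \<open>c\<close>
    unchanged.\<close>
  define B where "B = A - {(p, q)}"
  define c where "c = (\<Prod>x\<in>S \<times> S - {(p, q)}. if x \<in> A then f (fst x) else f (snd x))"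
  have c: "c \<noteq> 0" unfolding c_def using S f by auto
  have pqS: "(p, q) \<in> S \<times> S" using pq by simp
  have "?F A = f p * c" unfolding c_def
    using A(3) S by (subst prod.remove[OF _ pqS]) auto
  moreover have "?F B = f q * c" unfolding c_def
    using S by (subst prod.remove[OF _ pqS]) (auto simp: B_def intro!: prod.cong)
  moreover have "?F A \<preceq> ?F B" using A(1) by (intro A(2)) (auto simp: B_def)
  ultimately show "f p \<preceq> f q" using c by (simp add: vle_mult_right)
qed

end

context valued_iso begin

lemma relp_det:
  assumes "\<And>i j. i < n \<Longrightarrow> j < n \<Longrightarrow> relp I (f (i, j)) (g (i, j))"
  shows "relp I (det (mat n n f)) (det (mat n n g))"
proof -
  have sg: "relp I (signof p) (signof p)" for p :: "nat \<Rightarrow> nat"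
    using relp_uminus[OF relp_1] by (simp add: sign_def)
  have "(\<Prod>i = 0..<n. mat n n h $$ (i, p i)) = (\<Prod>i = 0..<n. h (i, p i))"
    if "p permutes {0..<n}" for p and h :: "nat \<times> nat \<Rightarrow> 'k poly"
    using permutes_in_image[OF that] by (intro prod.cong refl) auto
  moreover have "relp I (\<Prod>i = 0..<n. f (i, p i)) (\<Prod>i = 0..<n. g (i, p i))" if "p permutes {0..<n}" for p
    using permutes_in_image[OF that] by (intro relp_prod assms) auto
  ultimately show ?thesis
    unfolding det_def'[OF mat_carrier] by (intro relp_sum relp_mult sg) auto
qed

text \<open>The norm is a determinant whose entries come from the coefficients of the modulus and of
  the \<open>m s\<close>. It is therefore transported, although the individual roots need not lie in
  the domain of \<open>I\<close>.\<close>

lemma norm_transfer: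
  fixes r r' :: "nat \<Rightarrow> 'k"
  assumes P: "relp I (\<Prod>i<n. [:- r i, 1:]) (\<Prod>i<n. [:- r' i, 1:])"
    and m: "\<And>s. s \<in> S \<Longrightarrow> relp I (m s) (m' s)"
  shows "relp I (\<Prod>i<n. \<Sum>s\<in>S. monom (poly (m s) (r i)) (w s))
                (\<Prod>i<n. \<Sum>s\<in>S. monom (poly (m' s) (r' i)) (w s))"
proof -
  have nz: "(\<Prod>i<n. [:- r i, 1:]) \<noteq> 0" by auto
  show ?thesis unfolding det_mult_mod[symmetric]
  proof (rule relp_det, unfold split)
    fix i j assume "i < n" "j < n"
    show "relp I (\<Sum>s\<in>S. monom (coeff (monom 1 i * m s mod (\<Prod>i<n. [:- r i, 1:])) j) (w s))
      (\<Sum>s\<in>S. monom (coeff (monom 1 i * m' s mod (\<Prod>i<n. [:- r' i, 1:])) j) (w s))"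
      by (intro relp_sum relp_monom relp_coeff relp_mod P nz relp_mult I_1 m)
  qed
qed

text \<open>The norm of \<open>m\<close> vanishes iff \<open>m\<close> vanishes at some root. A
  one-element index set with weight 0 reduces \<open>norm_transfer\<close> to the ordinary
  norm.\<close>

lemma conjugate_nonzero:
  fixes r r' :: "nat \<Rightarrow> 'k"
  assumes P: "relp I (\<Prod>i<n. [:- r i, 1:]) (\<Prod>i<n. [:- r' i, 1:])"
    and m: "relp I m m'" and nz: "\<And>i. i < n \<Longrightarrow> poly m (r i) \<noteq> 0" and i: "i < n"
  shows "poly m' (r' i) \<noteq> 0"
proof -
  have "relp I (\<Prod>i<n. \<Sum>s\<in>{()}. monom (poly m (r i)) 0) (\<Prod>i<n. \<Sum>s\<in>{()}. monom (poly m' (r' i)) 0)"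
    by (rule norm_transfer[where m = "\<lambda>_. m" and m' = "\<lambda>_. m'", OF P m])
  moreover have "(\<Prod>i<n. \<Sum>s\<in>{()}. monom (poly m (r i)) 0) \<noteq> 0" using nz by (auto simp: monom_eq_0_iff)
  ultimately have "(\<Prod>i<n. \<Sum>s\<in>{()}. monom (poly m' (r' i)) 0) \<noteq> 0" using relp_zero_iff by metis
  then show ?thesis using i by auto
qed

text \<open>For every injective weight the residue degrees of the two norms agree, and each is the
  sum of the statistics of the minimizer sets at the single roots. So the two multisets of minimizer
  sets coincide, without any matching of \<open>r\<close> with \<open>r'\<close> by Galois
  theory.\<close>

lemma conjugate_argmin:
  fixes r r' :: "nat \<Rightarrow> 'k"
  assumes P: "relp I (\<Prod>i<n. [:- r i, 1:]) (\<Prod>i<n. [:- r' i, 1:])"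
    and S: "finite S" "S \<noteq> {}"
    and m: "\<And>s. s \<in> S \<Longrightarrow> relp I (m s) (m' s)"
    and nz: "\<And>s i. s \<in> S \<Longrightarrow> i < n \<Longrightarrow> poly (m s) (r i) \<noteq> 0"
    and i: "i < n"
  shows "\<exists>i'<n. argmin (\<lambda>s. poly (m' s) (r' i')) S = argmin (\<lambda>s. poly (m s) (r i)) S"
proof -
  have nz': "poly (m' s) (r' i) \<noteq> 0" if "s \<in> S" "i < n" for s i
    using conjugate_nonzero[OF P m nz] that by blast
  have ne: "argmin f S \<subseteq> S \<and> argmin f S \<noteq> {}" for f
    using ex_vle_min[OF S, of f] by (auto simp: argmin_def)
  show ?thesis
  proof (rule set_family_eqI[where J = "\<lambda>i. argmin (\<lambda>s. poly (m s) (r i)) S"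
        and J' = "\<lambda>i. argmin (\<lambda>s. poly (m' s) (r' i)) S", OF S(1) ne ne _ i])
    fix w :: "_ \<Rightarrow> nat" assume w: "inj_on w S"
    have "res_deg (\<Prod>i<n. \<Sum>s\<in>S. monom (poly (m s) (r i)) (w s))
        (\<Sum>i<n. Max (w ` argmin (\<lambda>s. poly (m s) (r i)) S))"
      by (intro res_deg_prod res_deg_family S w nz) auto
    then have "res_deg (\<Prod>i<n. \<Sum>s\<in>S. monom (poly (m' s) (r' i)) (w s))
        (\<Sum>i<n. Max (w ` argmin (\<lambda>s. poly (m s) (r i)) S))"
      using relp_res_deg[OF norm_transfer[where m = m and m' = m' and w = w, OF P m]] by blast
    moreover have "res_deg (\<Prod>i<n. \<Sum>s\<in>S. monom (poly (m' s) (r' i)) (w s))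
        (\<Sum>i<n. Max (w ` argmin (\<lambda>s. poly (m' s) (r' i)) S))"
      by (intro res_deg_prod res_deg_family S w nz') auto
    ultimately show "(\<Sum>i<n. Max (w ` argmin (\<lambda>s. poly (m s) (r i)) S)) =
        (\<Sum>i<n. Max (w ` argmin (\<lambda>s. poly (m' s) (r' i)) S))"
      using res_deg_unique by blast
  qed
qed

end

section \<open>Minimal polynomials over the domain of a partial isomorphism\<close>

context valued_iso begin

text \<open>Minimality is imposed on \<open>R\<close> only. For the transported \<open>R'\<close>
  the divisibility in \<open>min_poly_dvd\<close> takes its place.\<close>

definition min_poly :: "'k \<Rightarrow> 'k poly \<Rightarrow> 'k poly \<Rightarrow> bool" where
  "min_poly b R R' \<longleftrightarrow> relp I R R' \<and> R \<noteq> 0 \<and> poly R b = 0 \<and>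
     (\<forall>Q Q'. relp I Q Q' \<longrightarrow> Q \<noteq> 0 \<longrightarrow> poly Q b = 0 \<longrightarrow> degree R \<le> degree Q)"

lemma min_poly_exists:
  assumes "relp I Q Q'" "Q \<noteq> 0" "poly Q b = 0"
  shows "\<exists>R R'. min_poly b R R'"
proof -
  let ?P = "\<lambda>x. relp I (fst x) (snd x) \<and> fst x \<noteq> 0 \<and> poly (fst x) b = 0"
  obtain x where x: "?P x" "\<forall>y. ?P y \<longrightarrow> degree (fst x) \<le> degree (fst y)"
    using ex_has_least_nat[of ?P "(Q, Q')" "\<lambda>x. degree (fst x)"] assms by auto
  have "min_poly b (fst x) (snd x)" unfolding min_poly_def using x(1) x(2) by simp
  then show ?thesis by blast
qed

lemma min_poly_dvd:
  assumes R: "min_poly b R R'" and Q: "relp I Q Q'" "poly Q b = 0"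
  shows "R dvd Q" "R' dvd Q'"
proof -
  have R0: "relp I R R'" "R \<noteq> 0" "poly R b = 0" using R by (auto simp: min_poly_def)
  have m: "relp I (Q mod R) (Q' mod R')" by (rule relp_mod[OF Q(1) R0(1,2)])
  have "poly (Q mod R) b = 0"
    using Q(2) R0(3) by (metis div_mult_mod_eq poly_add poly_mult mult_zero_right add_0)
  then have "Q mod R = 0 \<or> degree R \<le> degree (Q mod R)"
    using R m unfolding min_poly_def by blast
  then have "Q mod R = 0" using degree_mod_less'[OF R0(2), of Q] by fastforce
  moreover have "Q' mod R' = 0" using relp_zero_iff[OF m] calculation by simp
  ultimately show "R dvd Q" "R' dvd Q'" by (simp_all add: dvd_eq_mod_eq_0)
qed

text \<open>A minimal polynomial is irreducible, so all its roots satisfy the same equations.\<close>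

lemma min_poly_root:
  assumes P: "min_poly a P P'" and b: "poly P b = 0" and Q: "relp I Q Q'" "poly Q b = 0"
  shows "poly Q a = 0"
proof -
  have P0: "relp I P P'" "P \<noteq> 0" "poly P a = 0" using P by (auto simp: min_poly_def)
  obtain R R' where R: "min_poly b R R'" using min_poly_exists[OF P0(1,2) b] by blast
  then have R0: "relp I R R'" "R \<noteq> 0" "poly R b = 0" by (auto simp: min_poly_def)
  have "R dvd P" using min_poly_dvd(1)[OF R P0(1) b] .
  then have PRS: "P = R * (P div R)" by simp
  have S: "relp I (P div R) (P' div R')" by (rule relp_div[OF P0(1) R0(1,2)])
  have S0: "P div R \<noteq> 0" using PRS P0(2) by auto
  have "degree R > 0"
  proof (rule ccontr)
    assume "\<not> degree R > 0"
    then obtain c where "R = [:c:]" using degree_eq_zeroE by blast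
    then show False using R0(2,3) by simp
  qed
  moreover have "degree P = degree R + degree (P div R)"
    by (subst PRS) (rule degree_mult_eq[OF R0(2) S0])
  ultimately have "poly (P div R) a \<noteq> 0" using P S S0 unfolding min_poly_def by fastforce
  then have "poly R a = 0" using P0(3) by (subst (asm) PRS) simp
  moreover have "R dvd Q" using min_poly_dvd(1)[OF R Q] .
  ultimately show ?thesis by (auto elim: dvdE)
qed

end

lemma monic_factor:
  fixes p :: "'k::alg_closed_field poly"
  assumes "lead_coeff p = 1"
  shows "\<exists>r. p = (\<Prod>i<degree p. [:- r i, 1:])"
proof -
  have "p \<noteq> 0" using assms by auto
  from alg_closed_imp_factorization[OF this] obtain A where
    A: "size A = degree p" "p = (\<Prod>x\<in>#A. [:- x, 1:])" using assms by auto
  obtain xs where xs: "mset xs = A" using ex_mset by blast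
  have "p = (\<Prod>x\<leftarrow>xs. [:- x, 1:])" using A(2) xs by (metis mset_map prod_mset_prod_list)
  also have "\<dots> = (\<Prod>i<degree p. [:- (xs ! i), 1:])"
    using A(1) xs by (auto simp: prod.list_conv_set_nth atLeast0LessThan)
  finally show ?thesis by blast
qed

section \<open>Density of the value group and infinitude of the residue field\<close>

locale acvf = valued_field v for v :: "'k::alg_closed_field \<Rightarrow> 'g::linordered_ab_group_add" +
  assumes nontrivial: "\<exists>x. x \<noteq> 0 \<and> v x \<noteq> 0"
begin

lemma nth_root: "n > 0 \<Longrightarrow> \<exists>y :: 'k. y ^ n = x"
proof -
  assume n: "n > 0"
  have "degree (monom 1 n + [:- x:]) = n"
    using n by (subst degree_add_eq_left) (auto simp: degree_monom_eq)
  then obtain y where "poly (monom 1 n + [:- x:]) y = 0"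
    using alg_closed_imp_poly_has_root[of "monom 1 n + [:- x:]"] n by auto
  then show ?thesis by (auto simp: poly_monom)
qed

lemma ex_vless: "\<exists>t. t \<noteq> 0 \<and> 1 \<prec> t"
proof -
  obtain x where x: "x \<noteq> 0" "v x \<noteq> 0" using nontrivial by blast
  show ?thesis
  proof (cases "v x > 0")
    case True
    then show ?thesis using x by (intro exI[of _ x]) (simp add: vless_nz)
  next
    case False
    then have "v (inverse x) > 0" using x by (simp add: v_inverse)
    then show ?thesis using x by (intro exI[of _ "inverse x"]) (simp add: vless_nz)
  qed
qed

lemma vless_dense:
  assumes "x \<prec> y" "x \<noteq> 0"
  shows "\<exists>z. z \<noteq> 0 \<and> x \<prec> z \<and> z \<prec> y"
proof (cases "y = 0")
  case True
  obtain t where t: "t \<noteq> 0" "1 \<prec> t" using ex_vless by blast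
  then have "x * 1 \<prec> x * t" using assms vless_mult by blast
  then show ?thesis using True t assms by (intro exI[of _ "x * t"]) simp
next
  case False
  \<comment> \<open>The value of a square root of \<open>x * y\<close> is the midpoint of the two
    values.\<close>
  obtain s where s: "s ^ 2 = x * y" using nth_root[of 2] by auto
  then have "s \<noteq> 0" using False assms by auto
  have "x ^ 2 \<prec> s ^ 2" unfolding s using assms by (simp add: power2_eq_square vless_mult)
  moreover have "s ^ 2 \<prec> y ^ 2" unfolding s
    using assms(1) False vless_mult[of y x y] by (simp add: power2_eq_square mult.commute)
  ultimately show ?thesis using \<open>s \<noteq> 0\<close> vless_power[of 2] by auto
qed

lemma ex_below: "\<exists>z. z \<noteq> 0 \<and> z \<prec> x"
proof (cases "x = 0")
  case False
  obtain t where t: "t \<noteq> 0" "1 \<prec> t" using ex_vless by blast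
  have "x * inverse t * 1 \<prec> x * inverse t * t" using t False vless_mult[of "x * inverse t" 1 t] by simp
  moreover have "x * inverse t * t = x" using t by (simp add: mult.assoc)
  ultimately have "x * inverse t \<prec> x" by simp
  then show ?thesis using t False by (intro exI[of _ "x * inverse t"]) simp
qed (auto intro!: exI[of _ 1])

lemma ex_vle_max: "finite A \<Longrightarrow> A \<noteq> {} \<Longrightarrow> \<exists>i\<in>A. \<forall>j\<in>A. f j \<preceq> f i"
proof (induction A rule: finite_ne_induct)
  case (singleton x)
  show ?case by (intro bexI[of _ x] ballI) auto
next
  case (insert x F)
  then obtain i where i: "i \<in> F" "\<forall>j\<in>F. f j \<preceq> f i" by blast
  show ?case
  proof (cases "f x \<preceq> f i")
    case True
    then show ?thesis using i by blast
  next
    case False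
    then have "f i \<preceq> f x" using vle_linear by blast
    then have "f j \<preceq> f x" if "j \<in> insert x F" for j
      using i that vle_trans[of "f j" "f i" "f x"] by (cases "j = x") simp_all
    then show ?thesis by (intro bexI[of _ x]) blast+
  qed
qed

lemma vless_between:
  assumes fin: "finite A" "finite B" and nz: "0 \<notin> A"
    and less: "\<And>a b. a \<in> A \<Longrightarrow> b \<in> B \<Longrightarrow> a \<prec> b"
  shows "\<exists>z. z \<noteq> 0 \<and> (\<forall>a\<in>A. a \<prec> z) \<and> (\<forall>b\<in>B. z \<prec> b)"
proof -
  have B: "\<exists>b. (\<forall>x\<in>B. b \<preceq> x) \<and> (\<forall>a\<in>A. a \<prec> b)"
  proof (cases "B = {}")
    case True
    \<comment> \<open>Without upper conditions 0 serves as the bound, its value being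
      infinite.\<close>
    have "\<forall>a\<in>A. a \<prec> 0" using nz by auto
    then show ?thesis using True by (intro exI[of _ 0]) simp
  next
    case False
    then obtain b where "b \<in> B" "\<forall>x\<in>B. b \<preceq> x" using ex_vle_min[OF fin(2), of "\<lambda>x. x"] by blast
    then show ?thesis using less by blast
  qed
  then obtain b where b: "\<forall>x\<in>B. b \<preceq> x" "\<forall>a\<in>A. a \<prec> b" by blast
  show ?thesis
  proof (cases "A = {}")
    case True
    obtain z where "z \<noteq> 0" "z \<prec> b" using ex_below by blast
    then show ?thesis using b True vless_vle_trans by blast
  next
    case False
    then obtain a where a: "a \<in> A" "\<forall>x\<in>A. x \<preceq> a" using ex_vle_max[OF fin(1), of "\<lambda>x. x"] by blast
    then have "a \<prec> b" "a \<noteq> 0" using b nz by auto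
    then obtain z where "z \<noteq> 0" "a \<prec> z" "z \<prec> b" using vless_dense by blast
    then show ?thesis using a b vless_vle_trans vle_vless_trans by blast
  qed
qed

text \<open>The residue field is infinite: a root of \<open>X \<Prod> (X + u) - 1\<close> is integral and
  avoids the residues of all \<open>- u\<close>.\<close>

lemma generic_unit:
  assumes fin: "finite U" and U: "\<And>u. u \<in> U \<Longrightarrow> 1 \<preceq> u"
  shows "\<exists>t. t \<approx> 1 \<and> (\<forall>u\<in>U. t + u \<approx> 1)"
proof -
  \<comment> \<open>Adding 0 to \<open>U\<close> makes \<open>t\<close> itself one of the factors,
    hence a unit like the others.\<close>
  define W where "W = insert 0 U"
  define p where "p = (\<Prod>u\<in>W. [:u, 1:]) - 1"
  have W: "finite W" "\<And>u. u \<in> W \<Longrightarrow> 1 \<preceq> u" "W \<noteq> {}" using fin U by (auto simp: W_def)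
  have "degree (\<Prod>u\<in>W. [:u, 1:]) = card W" by (simp add: degree_prod_sum_eq)
  moreover have "card W > 0" using W by (simp add: card_gt_0_iff)
  ultimately have "degree p > 0" unfolding p_def
    using degree_add_eq_left[of "-1" "\<Prod>u\<in>W. [:u, 1:]"] by simp
  then obtain t where "poly p t = 0" using alg_closed_imp_poly_has_root by blast
  then have t: "(\<Prod>u\<in>W. t + u) = 1" by (simp add: p_def poly_prod add.commute)
  have "1 \<preceq> t"
  proof (rule ccontr)
    assume "\<not> 1 \<preceq> t"
    then have less: "t \<prec> 1" by (simp add: vless_def)
    have "t \<noteq> 0" using less by auto
    \<comment> \<open>If \<open>t\<close> had negative value, it would dominate in every factor, and
      the product could not be 1.\<close>
    have "t + u \<prec> 1" if "u \<in> W" for u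
      using veq_add[OF vless_vle_trans[OF less W(2)[OF that]]] less vless_cong veq_refl by blast
    moreover have "(\<Prod>u\<in>X. t + u) \<prec> 1" if "finite X" "X \<noteq> {}" "\<forall>u\<in>X. t + u \<prec> 1" for X
      using that
    proof (induction X rule: finite_ne_induct)
      case (insert x F)
      have IH: "(\<Prod>u\<in>F. t + u) \<prec> 1" using insert.IH insert.prems by blast
      have x: "t + x \<prec> 1" using insert.prems by blast
      have "(\<Prod>u\<in>F. t + u) \<noteq> 0" using IH by (metis not_0_vless)
      then have "(t + x) * (\<Prod>u\<in>F. t + u) \<prec> 1 * 1"
        by (rule vless_mult_mono1[OF x vless_imp_vle[OF IH]])
      then show ?case using insert.hyps by simp
    qed simp
    ultimately have "(\<Prod>u\<in>W. t + u) \<prec> 1" using W by blast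
    then show False using t by simp
  qed
  then have int: "1 \<preceq> t + u" if "u \<in> W" for u using W(2)[OF that] by (rule vle_add)
  have unit: "t + u \<approx> 1" if u: "u \<in> W" for u
  proof -
    have "(t + u) * (\<Prod>u\<in>W - {u}. t + u) = 1"
      using t prod.remove[OF W(1) u, of "\<lambda>u. t + u"] by simp
    moreover have "1 \<preceq> (\<Prod>u\<in>X. t + u)" if "finite X" "X \<subseteq> W" for X
      using that
    proof (induction X rule: finite_induct)
      case (insert x F)
      then have "1 * 1 \<preceq> (t + x) * (\<Prod>u\<in>F. t + u)" by (intro vle_mult_mono int) simp_all
      then show ?case using insert.hyps by simp
    qed simp
    then have "1 \<preceq> (\<Prod>u\<in>W - {u}. t + u)" using W by blast
    then have "(t + u) * 1 \<preceq> (t + u) * (\<Prod>u\<in>W - {u}. t + u)" by (intro vle_mult_mono) auto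
    ultimately have "t + u \<preceq> 1" by simp
    then show ?thesis using int[OF u] by (simp add: veq_def)
  qed
  show ?thesis using unit[of 0] unit by (intro exI[of _ t]) (auto simp: W_def)
qed

end

locale acvf_iso = acvf v + valued_iso v I
  for v :: "'k::alg_closed_field \<Rightarrow> 'g::linordered_ab_group_add" and I
begin

text \<open>All roots of the minimal polynomial of \<open>a\<close> satisfy the same equations, so
  only comparisons of values are at stake. \<open>argmin_pairs\<close> encodes them in the minimizer
  set of a single family of polynomials, and \<open>conjugate_argmin\<close> finds a root on the
  other side with the same minimizer set.\<close>

lemma algebraic_match:
  assumes alg: "relp I Q0 Q0'" "Q0 \<noteq> 0" "poly Q0 a = 0"
    and fin: "finite QQ" and rel: "\<And>x. x \<in> QQ \<Longrightarrow> relp I (fst x) (snd x)"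
  shows "\<exists>a'. \<forall>x\<in>QQ. \<forall>y\<in>QQ. poly (fst x) a \<preceq> poly (fst y) a \<longleftrightarrow> poly (snd x) a' \<preceq> poly (snd y) a'"
proof -
  obtain R R' where R: "min_poly a R R'" using min_poly_exists[OF alg] by blast
  define P where "P = Polynomial.smult (inverse (lead_coeff R)) R"
  define P' where "P' = Polynomial.smult (inverse (lead_coeff R')) R'"
  have R0: "relp I R R'" "R \<noteq> 0" "poly R a = 0" using R by (auto simp: min_poly_def)
  have R'0: "R' \<noteq> 0" "degree R' = degree R" using R0 relp_zero_iff relp_degree[OF R0(1)] by auto
  have relP: "relp I P P'" unfolding P_def P'_def
    using R0(1) relp_coeff[OF R0(1), of "degree R"] R'0(2) by (intro relp_smult I_inverse) auto
  have mP: "min_poly a P P'" using R R0 relP unfolding min_poly_def by (simp add: P_def)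
  have "lead_coeff P = 1" using R0 by (simp add: P_def)
  then obtain r where r: "P = (\<Prod>i<degree R. [:- r i, 1:])"
    using monic_factor[of P] R0 by (auto simp: P_def)
  have dP': "degree P' = degree R" using R'0(2) leading_coeff_neq_0[OF R'0(1)] unfolding P'_def by simp
  have "lead_coeff P' = 1" using R'0(1) by (simp add: P'_def)
  then obtain r' where r': "P' = (\<Prod>i<degree R. [:- r' i, 1:])"
    using monic_factor[of P'] dP' by auto
  define n where "n = degree R"
  note relP' = relP[unfolded r r', folded n_def]
  have "poly P a = 0" using mP by (simp add: min_poly_def)
  then obtain i where i: "i < n" "a = r i" unfolding r n_def by (auto simp: poly_prod)
  have roots: "poly P (r j) = 0" if "j < n" for j
    unfolding r using that by (auto simp: poly_prod n_def)
  have roots': "poly P' (r' j) = 0" if "j < n" for j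
    unfolding r' using that by (auto simp: poly_prod n_def)
  \<comment> \<open>Polynomials vanishing at \<open>a\<close> have infinite value on both sides and
    are set aside. The others are nonzero at every root, as \<open>conjugate_argmin\<close>
    requires.\<close>
  define S where "S = {x \<in> QQ. poly (fst x) a \<noteq> 0}"
  have S: "finite S" "\<And>x. x \<in> S \<Longrightarrow> relp I (fst x) (snd x)" using fin rel by (auto simp: S_def)
  have nz: "poly (fst x) (r j) \<noteq> 0" if "x \<in> S" "j < n" for x j
    using min_poly_root[OF mP roots[OF that(2)] S(2)[OF that(1)]] that(1) by (auto simp: S_def)
  define m where "m A = (\<Prod>x\<in>S \<times> S. if x \<in> A then fst (fst x) else fst (snd x))" for A
  define m' where "m' A = (\<Prod>x\<in>S \<times> S. if x \<in> A then snd (fst x) else snd (snd x))" for A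
  have relm: "relp I (m A) (m' A)" for A unfolding m_def m'_def using S(2) by (intro relp_prod) auto
  have pm: "poly (m A) z = (\<Prod>x\<in>S \<times> S. if x \<in> A then poly (fst (fst x)) z else poly (fst (snd x)) z)"
    "poly (m' A) z = (\<Prod>x\<in>S \<times> S. if x \<in> A then poly (snd (fst x)) z else poly (snd (snd x)) z)" for A z
    unfolding m_def m'_def poly_prod by (intro prod.cong refl; simp)+
  have "poly (m A) (r j) \<noteq> 0" if "j < n" for A j
    unfolding pm using nz that S(1) by auto
  then obtain i' where i': "i' < n" and
    J: "argmin (\<lambda>A. poly (m' A) (r' i')) (Pow (S \<times> S)) = argmin (\<lambda>A. poly (m A) a) (Pow (S \<times> S))"
    using conjugate_argmin[OF relP', of "Pow (S \<times> S)" m m' i] S(1) relm i by blast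
  define a' where "a' = r' i'"
  have nz': "poly (snd x) a' \<noteq> 0" if "x \<in> S" for x
    unfolding a'_def by (rule conjugate_nonzero[OF relP' S(2)[OF that] nz[OF that] i'])
  have z': "poly (snd x) a' = 0" if x: "x \<in> QQ" "x \<notin> S" for x
  proof -
    have "P' dvd snd x" using min_poly_dvd(2)[OF mP rel[OF x(1)]] x by (simp add: S_def)
    then show ?thesis using roots'[OF i'] by (auto simp: a'_def elim!: dvdE)
  qed
  have "poly (fst x) a \<preceq> poly (fst y) a \<longleftrightarrow> poly (snd x) a' \<preceq> poly (snd y) a'"
    if xy: "x \<in> S" "y \<in> S" for x y
    using argmin_pairs[OF S(1), of "\<lambda>x. poly (fst x) a" x y] argmin_pairs[OF S(1), of "\<lambda>x. poly (snd x) a'" x y]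
      J nz' xy unfolding pm a'_def[symmetric] by (auto simp: S_def)
  then have "poly (fst x) a \<preceq> poly (fst y) a \<longleftrightarrow> poly (snd x) a' \<preceq> poly (snd y) a'"
    if "x \<in> QQ" "y \<in> QQ" for x y
    using that z'[of x] z'[of y] nz'[of x] nz'[of y] by (cases "x \<in> S"; cases "y \<in> S") (auto simp: S_def)
  then show ?thesis by blast
qed

text \<open>The value group is divisible. If some positive power \<open>y ^ n\<close> has a value
  from the domain, \<open>y'\<close> is an \<open>n\<close>-th root of its image; otherwise all
  conditions with positive exponent are strict, and \<open>y'\<close> is taken from a finite cut in
  a dense order without endpoints.\<close>

lemma value_match:
  assumes fin: "finite C" and y: "y \<noteq> 0"
    and C: "\<And>n c c' d d'. (n, c, c', d, d') \<in> C \<Longrightarrow> I c c' \<and> I d d' \<and> c \<noteq> 0 \<and> d \<noteq> 0"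
  shows "\<exists>y'. y' \<noteq> 0 \<and> (\<forall>(n, c, c', d, d') \<in> C.
    (c * y ^ n \<preceq> d \<longleftrightarrow> c' * y' ^ n \<preceq> d') \<and> (d \<preceq> c * y ^ n \<longleftrightarrow> d' \<preceq> c' * y' ^ n))"
proof -
  have C': "c' \<noteq> 0 \<and> d' \<noteq> 0" if "(n, c, c', d, d') \<in> C" for n c c' d d'
    using C[OF that] I_zero_iff by blast
  show ?thesis
  proof (cases "\<exists>(n, c, c', d, d') \<in> C. n > 0 \<and> c * y ^ n \<approx> d")
    case True
    then obtain n c c' d d' where x: "(n, c, c', d, d') \<in> C" "n > 0" "c * y ^ n \<approx> d" by blast
    obtain y' where y': "y' ^ n = d' / c'" using nth_root[OF x(2)] by blast
    have "y' \<noteq> 0" using y' C'[OF x(1)] x(2) by (auto simp: power_0_left split: if_splits)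
    have yn: "y ^ n \<approx> d / c"
    proof -
      have "inverse c * (c * y ^ n) \<approx> inverse c * d" by (rule veq_mult[OF veq_refl x(3)])
      then show ?thesis using C[OF x(1)] by (simp add: field_simps)
    qed
    have "(e * y ^ k \<preceq> f \<longleftrightarrow> e' * y' ^ k \<preceq> f') \<and> (f \<preceq> e * y ^ k \<longleftrightarrow> f' \<preceq> e' * y' ^ k)"
      if z: "(k, e, e', f, f') \<in> C" for k e e' f f'
    proof -
      \<comment> \<open>Up to value, the \<open>n\<close>-th power replaces \<open>y\<close> by an
        element of the domain, so that the comparison can be transported by
        \<open>I\<close>.\<close>
      have 1: "(e * y ^ k) ^ n \<approx> e ^ n * (d / c) ^ k"
      proof -
        have "(y ^ n) ^ k \<approx> (d / c) ^ k"
          using yn by (cases "k = 0") (auto simp: veq_power)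
        then have "e ^ n * (y ^ n) ^ k \<approx> e ^ n * (d / c) ^ k" by (rule veq_mult[OF veq_refl])
        then show ?thesis by (simp add: power_mult_distrib power_mult[symmetric] mult.commute)
      qed
      have 2: "(e' * y' ^ k) ^ n = e' ^ n * (d' / c') ^ k"
        by (simp add: y'[symmetric] power_mult_distrib power_mult[symmetric] mult.commute)
      have I: "I (e ^ n * (d / c) ^ k) (e' ^ n * (d' / c') ^ k)" "I (f ^ n) (f' ^ n)"
        using C[OF z] C[OF x(1)] by (auto intro!: I_mult I_power I_divide)
      have "e * y ^ k \<preceq> f \<longleftrightarrow> e ^ n * (d / c) ^ k \<preceq> f ^ n"
        using vle_power[OF x(2), of "e * y ^ k" f] vle_cong[OF 1 veq_refl] by simp
      moreover have "f \<preceq> e * y ^ k \<longleftrightarrow> f ^ n \<preceq> e ^ n * (d / c) ^ k"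
        using vle_power[OF x(2), of f "e * y ^ k"] vle_cong[OF veq_refl 1] by simp
      moreover have "e' * y' ^ k \<preceq> f' \<longleftrightarrow> e' ^ n * (d' / c') ^ k \<preceq> f' ^ n"
        using vle_power[OF x(2), of "e' * y' ^ k" f'] 2 by simp
      moreover have "f' \<preceq> e' * y' ^ k \<longleftrightarrow> f' ^ n \<preceq> e' ^ n * (d' / c') ^ k"
        using vle_power[OF x(2), of f' "e' * y' ^ k"] 2 by simp
      ultimately show ?thesis using I_vle[OF I] I_vle[OF I(2,1)] by simp
    qed
    then show ?thesis using \<open>y' \<noteq> 0\<close> by (intro exI[of _ y']) blast
  next
    case False
    \<comment> \<open>\<open>z\<close> collects the points of the cut: roots of
      \<open>d' / c'\<close>, whose values bound that of \<open>y'\<close> from one side.\<close>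
    have "\<exists>z. \<forall>n c c' d d'. (n, c, c', d, d') \<in> C \<longrightarrow> n > 0 \<longrightarrow> z (n, c, c', d, d') ^ n = d' / c'"
    proof -
      have "\<forall>x :: nat \<times> 'k \<times> 'k \<times> 'k \<times> 'k. \<exists>w. \<forall>n c c' d d'. x = (n, c, c', d, d') \<longrightarrow> n > 0 \<longrightarrow> w ^ n = d' / c'"
      proof
        fix x :: "nat \<times> 'k \<times> 'k \<times> 'k \<times> 'k"
        obtain n c c' d d' where x: "x = (n, c, c', d, d')" by (cases x)
        show "\<exists>w. \<forall>n c c' d d'. x = (n, c, c', d, d') \<longrightarrow> n > 0 \<longrightarrow> w ^ n = d' / c'"
          using nth_root[of n "d' / c'"] unfolding x by (cases "n > 0") auto
      qed
      then have "\<exists>z. \<forall>x :: nat \<times> 'k \<times> 'k \<times> 'k \<times> 'k. \<forall>n c c' d d'. x = (n, c, c', d, d') \<longrightarrow> n > 0 \<longrightarrow> z x ^ n = d' / c'"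
        by (rule choice)
      then show ?thesis by blast
    qed
    then obtain z where z: "\<And>n c c' d d'. (n, c, c', d, d') \<in> C \<Longrightarrow> n > 0 \<Longrightarrow> z (n, c, c', d, d') ^ n = d' / c'"
      by blast
    define L where "L = {(n, c, c', d, d'). (n, c, c', d, d') \<in> C \<and> n > 0 \<and> d \<prec> c * y ^ n}"
    define U where "U = {(n, c, c', d, d'). (n, c, c', d, d') \<in> C \<and> n > 0 \<and> c * y ^ n \<prec> d}"
    have LU: "L \<subseteq> C" "U \<subseteq> C" by (auto simp: L_def U_def)
    have less: "z a \<prec> z b" if ab: "a \<in> L" "b \<in> U" for a b
    proof -
      obtain n c c' d d' where a: "a = (n, c, c', d, d')" "a \<in> C" "n > 0" "d \<prec> c * y ^ n"
        using ab(1) by (auto simp: L_def)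
      obtain k e e' f f' where b: "b = (k, e, e', f, f')" "b \<in> C" "k > 0" "e * y ^ k \<prec> f"
        using ab(2) by (auto simp: U_def)
      have ca: "I c c'" "I d d'" "c \<noteq> 0" using C[of n c c' d d'] a by auto
      have cb: "I e e'" "I f f'" "e \<noteq> 0" using C[of k e e' f f'] b by auto
      \<comment> \<open>Raising to the common exponent \<open>n * k\<close> turns a comparison
        between values of roots into one inside the domain of \<open>I\<close>.\<close>
      have "d / c \<prec> y ^ n" using vless_mult[of c "d / c" "y ^ n"] a(4) ca(3) by simp
      then have 1: "(d / c) ^ k \<prec> (y ^ n) ^ k" using b(3) by (simp add: vless_power)
      have "y ^ k \<prec> f / e" using vless_mult[of e "y ^ k" "f / e"] b(4) cb(3) by simp
      then have 2: "(y ^ k) ^ n \<prec> (f / e) ^ n" using a(3) by (simp add: vless_power)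
      have "(d / c) ^ k \<prec> (f / e) ^ n"
        using 1 2 vless_trans by (simp add: power_mult[symmetric] mult.commute)
      then have "(d' / c') ^ k \<prec> (f' / e') ^ n"
        using I_vless[OF I_power[OF I_divide[OF ca(2,1)]] I_power[OF I_divide[OF cb(2,1)]], of k n] by simp
      moreover have "z a ^ n = d' / c'" "z b ^ k = f' / e'" using z a b by auto
      ultimately have "(z a ^ n) ^ k \<prec> (z b ^ k) ^ n" by simp
      then have "z a ^ (n * k) \<prec> z b ^ (n * k)" by (simp add: power_mult[symmetric] mult.commute)
      then show ?thesis using a(3) b(3) vless_power[of "n * k"] by simp
    qed
    have nz: "z a \<noteq> 0" if aL: "a \<in> L" for a
    proof -
      obtain n c c' d d' where a: "a = (n, c, c', d, d')" "a \<in> C" "n > 0" using aL by (auto simp: L_def)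
      then have "z a ^ n = d' / c'" "c' \<noteq> 0" "d' \<noteq> 0" using z C' by auto
      then show ?thesis using a(3) by (auto simp: power_0_left)
    qed
    have "finite L" "finite U" using fin LU finite_subset by blast+
    then have "finite (z ` L)" "finite (z ` U)" by blast+
    moreover have "0 \<notin> z ` L" using nz by (metis imageE)
    moreover have "a \<prec> b" if "a \<in> z ` L" "b \<in> z ` U" for a b using that less by blast
    ultimately have "\<exists>y'. y' \<noteq> 0 \<and> (\<forall>a\<in>z ` L. a \<prec> y') \<and> (\<forall>b\<in>z ` U. y' \<prec> b)" by (rule vless_between)
    then obtain y' where y': "y' \<noteq> 0" "\<forall>a\<in>L. z a \<prec> y'" "\<forall>b\<in>U. y' \<prec> z b" by blast
    have "(c * y ^ n \<preceq> d \<longleftrightarrow> c' * y' ^ n \<preceq> d') \<and> (d \<preceq> c * y ^ n \<longleftrightarrow> d' \<preceq> c' * y' ^ n)"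
      if x: "(n, c, c', d, d') \<in> C" for n c c' d d'
    proof (cases "n = 0")
      case True
      then show ?thesis using C[OF x] I_vle[of c c' d d'] I_vle[of d d' c c'] by simp
    next
      case n: False
      have zn: "c' * z (n, c, c', d, d') ^ n = d'" using z[OF x] n C'[OF x] by simp
      have "\<not> c * y ^ n \<approx> d" using False x n by blast
      then consider "d \<prec> c * y ^ n" | "c * y ^ n \<prec> d" using vle_cases by blast
      then show ?thesis
      proof cases
        case 1
        then have "z (n, c, c', d, d') \<prec> y'" using y'(2) x n by (auto simp: L_def)
        then have "c' * z (n, c, c', d, d') ^ n \<prec> c' * y' ^ n"
          using n C'[OF x] by (simp add: vless_mult vless_power)
        then have "d' \<prec> c' * y' ^ n" using zn by simp
        then show ?thesis using 1 vless_imp_vle unfolding vless_def by blast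
      next
        case 2
        then have "y' \<prec> z (n, c, c', d, d')" using y'(3) x n by (auto simp: U_def)
        then have "c' * y' ^ n \<prec> c' * z (n, c, c', d, d') ^ n"
          using n C'[OF x] by (simp add: vless_mult vless_power)
        then have "c' * y' ^ n \<prec> d'" using zn by simp
        then show ?thesis using 2 vless_imp_vle unfolding vless_def by blast
      qed
    qed
    then show ?thesis using y'(1) by (intro exI[of _ y']) blast
  qed
qed

end

section \<open>Elements over a domain that contains all roots of the polynomials\<close>

context acvf_iso begin

text \<open>\<open>y\<close> is the difference between the new element and the center
  \<open>r0\<close>, and \<open>z\<close> transports the roots. The second clause forbids
  cancellation between \<open>y'\<close> and a difference of at least the same value, which is a
  condition on the residue of \<open>y'\<close> and not only on its value.\<close>

definition center_match :: "'k set \<Rightarrow> ('k \<Rightarrow> 'k) \<Rightarrow> 'k \<Rightarrow> 'k \<Rightarrow> 'k \<Rightarrow> bool" where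
  "center_match Z z r0 y y' \<longleftrightarrow> (\<forall>r\<in>Z. (r0 - r \<prec> y \<longleftrightarrow> z r0 - z r \<prec> y') \<and>
     (\<not> r0 - r \<prec> y \<longrightarrow> y' + (z r0 - z r) \<approx> y'))"

text \<open>If \<open>r0\<close> is closest to the new element, each factor
  \<open>y + (r0 - r)\<close> has the value of \<open>r0 - r\<close> or of \<open>y\<close>. The
  product then has the value of a monomial in \<open>y\<close> with coefficient in the domain, and
  \<open>center_match\<close> keeps the same count valid on the other side.\<close>

lemma linear_factors_value:
  assumes z: "\<And>r. r \<in> Z \<Longrightarrow> I r (z r)" and r0: "r0 \<in> Z"
    and y: "y \<noteq> 0" "\<And>r. r \<in> Z \<Longrightarrow> y + (r0 - r) \<preceq> y"
    and rs: "set rs \<subseteq> Z"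
  shows "\<exists>g g' k. I g g' \<and> g \<noteq> 0 \<and> (\<Prod>r\<leftarrow>rs. y + (r0 - r)) \<approx> g * y ^ k \<and>
    (\<forall>y'. center_match Z z r0 y y' \<longrightarrow> (\<Prod>r\<leftarrow>rs. y' + (z r0 - z r)) \<approx> g' * y' ^ k)"
  using rs
proof (induction rs)
  case Nil
  show ?case by (rule exI[of _ 1], rule exI[of _ 1], rule exI[of _ 0]) simp
next
  case (Cons r rs)
  then obtain g g' k where g: "I g g'" "g \<noteq> 0" "(\<Prod>r\<leftarrow>rs. y + (r0 - r)) \<approx> g * y ^ k"
    "\<And>y'. center_match Z z r0 y y' \<Longrightarrow> (\<Prod>r\<leftarrow>rs. y' + (z r0 - z r)) \<approx> g' * y' ^ k" by auto
  have r: "r \<in> Z" using Cons.prems by simp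
  show ?case
  proof (cases "r0 - r \<prec> y")
    case True
    have "y + (r0 - r) \<approx> r0 - r" using veq_add[OF True] by (simp add: add.commute)
    then have 1: "(y + (r0 - r)) * (\<Prod>r\<leftarrow>rs. y + (r0 - r)) \<approx> (r0 - r) * (g * y ^ k)"
      using g(3) by (rule veq_mult)
    have 2: "(y' + (z r0 - z r)) * (\<Prod>r\<leftarrow>rs. y' + (z r0 - z r)) \<approx> (z r0 - z r) * (g' * y' ^ k)"
      if m: "center_match Z z r0 y y'" for y'
    proof -
      have "z r0 - z r \<prec> y'" using m True r by (auto simp: center_match_def)
      then have "y' + (z r0 - z r) \<approx> z r0 - z r" using veq_add[of "z r0 - z r" y'] by (simp add: add.commute)
      then show ?thesis using g(4)[OF m] by (rule veq_mult)
    qed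
    have "I ((r0 - r) * g) ((z r0 - z r) * g')" by (intro I_mult I_diff z r0 r g(1))
    moreover have "(r0 - r) * g \<noteq> 0" using True g(2) by auto
    ultimately show ?thesis using 1 2
      by (intro exI[of _ "(r0 - r) * g"] exI[of _ "(z r0 - z r) * g'"] exI[of _ k]) (simp add: mult.assoc)
  next
    case False
    have "y \<preceq> y + (r0 - r)" using False by (intro vle_add) (auto simp: vless_def)
    then have "y + (r0 - r) \<approx> y" using y(2)[OF r] by (simp add: veq_def)
    then have 1: "(y + (r0 - r)) * (\<Prod>r\<leftarrow>rs. y + (r0 - r)) \<approx> y * (g * y ^ k)"
      using g(3) by (rule veq_mult)
    have 2: "(y' + (z r0 - z r)) * (\<Prod>r\<leftarrow>rs. y' + (z r0 - z r)) \<approx> y' * (g' * y' ^ k)"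
      if m: "center_match Z z r0 y y'" for y'
    proof -
      have "y' + (z r0 - z r) \<approx> y'" using m False r by (auto simp: center_match_def)
      then show ?thesis using g(4)[OF m] by (rule veq_mult)
    qed
    show ?thesis using 1 2 g(1,2)
      by (intro exI[of _ g] exI[of _ g'] exI[of _ "Suc k"]) (simp add: mult.left_commute)
  qed
qed

text \<open>Expanding around a closest point of \<open>Z\<close> reduces all values to monomials in
  \<open>y = a - r0\<close>. \<open>value_match\<close> provides an element of the right value, and
  a factor from \<open>generic_unit\<close> moves its residue away from the finitely many residues
  that would cause cancellation.\<close>

lemma split_match:
  assumes fin: "finite QQ" and rel: "\<And>x. x \<in> QQ \<Longrightarrow> relp I (fst x) (snd x)"
    and roots: "\<And>x r. x \<in> QQ \<Longrightarrow> fst x \<noteq> 0 \<Longrightarrow> poly (fst x) r = 0 \<Longrightarrow> \<exists>r'. I r r'"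
  shows "\<exists>a'. \<forall>x\<in>QQ. \<forall>y\<in>QQ. poly (fst x) a \<preceq> poly (fst y) a \<longleftrightarrow> poly (snd x) a' \<preceq> poly (snd y) a'"
proof (cases "\<exists>a'. I a a'")
  case True
  then show ?thesis using I_vle relp_poly rel by meson
next
  case na: False
  \<comment> \<open>0 is included so that a center exists even if there are no roots.\<close>
  define Z where "Z = insert 0 (\<Union>x\<in>{x \<in> QQ. fst x \<noteq> 0}. {r. poly (fst x) r = 0})"
  have Z: "finite Z" "Z \<noteq> {}" using fin by (auto simp: Z_def poly_roots_finite)
  have "\<forall>r\<in>Z. \<exists>r'. I r r'" using roots I_0 by (auto simp: Z_def simp del: I_0)
  then obtain z where z: "\<And>r. r \<in> Z \<Longrightarrow> I r (z r)" by metis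
  obtain r0 where r0: "r0 \<in> Z" "\<forall>r\<in>Z. a - r \<preceq> a - r0" using ex_vle_max[OF Z, of "\<lambda>r. a - r"] by blast
  define y where "y = a - r0"
  have y: "y \<noteq> 0" using na z r0(1) by (auto simp: y_def)
  have ay: "a - r = y + (r0 - r)" for r by (simp add: y_def)
  have yZ: "y + (r0 - r) \<preceq> y" if "r \<in> Z" for r using r0(2) that ay y_def by metis
  have "\<exists>g g' k. I g g' \<and> g \<noteq> 0 \<and> poly (fst x) a \<approx> g * y ^ k \<and>
      (\<forall>y'. center_match Z z r0 y y' \<longrightarrow> poly (snd x) (z r0 + y') \<approx> g' * y' ^ k)"
    if x: "x \<in> QQ" "fst x \<noteq> 0" for x
  proof -
    obtain A where A: "fst x = Polynomial.smult (lead_coeff (fst x)) (\<Prod>r\<in>#A. [:- r, 1:])"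
      using alg_closed_imp_factorization[OF x(2)] by blast
    obtain rs where rs: "mset rs = A" using ex_mset by blast
    have fx: "fst x = Polynomial.smult (lead_coeff (fst x)) (\<Prod>r\<leftarrow>rs. [:- r, 1:])"
      using A rs by (metis mset_map prod_mset_prod_list)
    have pl: "poly (\<Prod>r\<leftarrow>rs. [:- f r, 1:]) b = (\<Prod>r\<leftarrow>rs. b - f r)" for f :: "'k \<Rightarrow> 'k" and b and rs :: "'k list"
      by (induction rs) (auto simp: left_diff_distrib)
    have rZ: "set rs \<subseteq> Z"
    proof
      fix r assume "r \<in> set rs"
      then have "poly (fst x) r = 0" by (subst fx) (auto simp: pl[of id, simplified] prod_list_zero_iff)
      then show "r \<in> Z" using x unfolding Z_def by blast
    qed
    have "relp I (\<Prod>r\<leftarrow>rs. [:- r, 1:]) (\<Prod>r\<leftarrow>rs. [:- z r, 1:])" using rZ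
    proof (induction rs)
      case (Cons r rs)
      then have "relp I [:- r, 1:] [:- z r, 1:]" using z by (auto intro!: relp_pCons I_uminus)
      moreover have "relp I (\<Prod>r\<leftarrow>rs. [:- r, 1:]) (\<Prod>r\<leftarrow>rs. [:- z r, 1:])" using Cons by simp
      ultimately show ?case by (simp only: list.map prod_list.Cons relp_mult)
    qed simp
    then have "relp I (fst x) (Polynomial.smult (lead_coeff (snd x)) (\<Prod>r\<leftarrow>rs. [:- z r, 1:]))"
      using relp_coeff[OF rel[OF x(1)], of "degree (fst x)"] relp_degree[OF rel[OF x(1)]]
      by (subst fx) (auto intro: relp_smult)
    then have sx: "snd x = Polynomial.smult (lead_coeff (snd x)) (\<Prod>r\<leftarrow>rs. [:- z r, 1:])"
      using relp_unique[OF rel[OF x(1)]] by blast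
    have "\<exists>g g' k. I g g' \<and> g \<noteq> 0 \<and> (\<Prod>r\<leftarrow>rs. y + (r0 - r)) \<approx> g * y ^ k \<and>
        (\<forall>y'. center_match Z z r0 y y' \<longrightarrow> (\<Prod>r\<leftarrow>rs. y' + (z r0 - z r)) \<approx> g' * y' ^ k)"
      by (rule linear_factors_value[OF z r0(1) y yZ rZ])
    then obtain g g' k where g: "I g g'" "g \<noteq> 0" "(\<Prod>r\<leftarrow>rs. y + (r0 - r)) \<approx> g * y ^ k"
      "\<And>y'. center_match Z z r0 y y' \<Longrightarrow> (\<Prod>r\<leftarrow>rs. y' + (z r0 - z r)) \<approx> g' * y' ^ k"
      by blast
    let ?c = "lead_coeff (fst x)" and ?c' = "lead_coeff (snd x)"
    have "poly (fst x) a = ?c * (\<Prod>r\<leftarrow>rs. y + (r0 - r))"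
      by (subst fx) (simp add: pl[of "\<lambda>x. x"] ay)
    then have 1: "poly (fst x) a \<approx> ?c * g * y ^ k" using veq_mult[OF veq_refl g(3), of ?c] by (simp add: mult.assoc)
    have 2: "poly (snd x) (z r0 + y') \<approx> ?c' * g' * y' ^ k" if m: "center_match Z z r0 y y'" for y'
    proof -
      have "poly (snd x) (z r0 + y') = ?c' * (\<Prod>r\<leftarrow>rs. y' + (z r0 - z r))"
        by (subst sx) (simp add: pl algebra_simps)
      then show ?thesis using veq_mult[OF veq_refl g(4)[OF m], of ?c'] by (simp add: mult.assoc)
    qed
    have "I (?c * g) (?c' * g')"
      using relp_coeff[OF rel[OF x(1)], of "degree (fst x)"] relp_degree[OF rel[OF x(1)]] g(1)
      by (auto intro: I_mult)
    moreover have "?c * g \<noteq> 0" using x g(2) by simp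
    ultimately show ?thesis using 1 2
      by (intro exI[of _ "?c * g"] exI[of _ "?c' * g'"] exI[of _ k]) simp
  qed
  then obtain g g' k where g: "\<And>x. x \<in> QQ \<Longrightarrow> fst x \<noteq> 0 \<Longrightarrow> I (g x) (g' x) \<and> g x \<noteq> 0 \<and>
      poly (fst x) a \<approx> g x * y ^ k x"
    and g': "\<And>x y'. x \<in> QQ \<Longrightarrow> fst x \<noteq> 0 \<Longrightarrow> center_match Z z r0 y y' \<Longrightarrow>
      poly (snd x) (z r0 + y') \<approx> g' x * y' ^ k x" by metis
  \<comment> \<open>\<open>C1\<close> fixes the position of \<open>y\<close> among the differences
    from the center, \<open>C2\<close> the comparison of any two monomials. Subtraction of exponents
    is truncated, but as both orders of a pair are present, one of the two conditions has the true
    difference.\<close>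
  define C1 where "C1 = (\<lambda>r. (1 :: nat, 1 :: 'k, 1 :: 'k, r0 - r, z r0 - z r)) ` (Z - {r0})"
  define C2 where "C2 = (\<lambda>(p, q). (k p - k q, g p, g' p, g q, g' q)) ` ({x \<in> QQ. fst x \<noteq> 0} \<times> {x \<in> QQ. fst x \<noteq> 0})"
  have "finite (C1 \<union> C2)" using Z fin by (auto simp: C1_def C2_def)
  moreover have "I c c' \<and> I d d' \<and> c \<noteq> 0 \<and> d \<noteq> 0" if "(n, c, c', d, d') \<in> C1 \<union> C2" for n c c' d d'
    using that z r0(1) g by (auto simp: C1_def C2_def intro: I_diff)
  ultimately have "\<exists>y'. y' \<noteq> 0 \<and> (\<forall>(n, c, c', d, d') \<in> C1 \<union> C2.
    (c * y ^ n \<preceq> d \<longleftrightarrow> c' * y' ^ n \<preceq> d') \<and> (d \<preceq> c * y ^ n \<longleftrightarrow> d' \<preceq> c' * y' ^ n))"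
    by (rule value_match[OF _ y]) blast+
  then obtain y1 where y1a: "y1 \<noteq> 0" and y1b: "\<forall>(n, c, c', d, d') \<in> C1 \<union> C2.
    (c * y ^ n \<preceq> d \<longleftrightarrow> c' * y1 ^ n \<preceq> d') \<and> (d \<preceq> c * y ^ n \<longleftrightarrow> d' \<preceq> c' * y1 ^ n)" by blast
  have "(c * y ^ n \<preceq> d \<longleftrightarrow> c' * y1 ^ n \<preceq> d') \<and> (d \<preceq> c * y ^ n \<longleftrightarrow> d' \<preceq> c' * y1 ^ n)"
    if "(n, c, c', d, d') \<in> C1 \<union> C2" for n c c' d d'
    using bspec[OF y1b that] by simp
  note y1 = y1a this
  \<comment> \<open>The terms whose residues are to be avoided, normalized by \<open>y1\<close>:
    only differences of at least the value of \<open>y1\<close> can disturb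
    \<open>y'\<close>.\<close>
  define U where "U = (\<lambda>r. (z r0 - z r) / y1) ` {r \<in> Z. y1 \<preceq> z r0 - z r}"
  have "finite U" using Z by (simp add: U_def)
  moreover have "1 \<preceq> u" if "u \<in> U" for u
    using that vle_mult[OF y1(1), of 1 u] y1(1) by (auto simp: U_def)
  ultimately have "\<exists>t. t \<approx> 1 \<and> (\<forall>u\<in>U. t + u \<approx> 1)" by (rule generic_unit)
  then obtain t where t: "t \<approx> 1" "\<And>u. u \<in> U \<Longrightarrow> t + u \<approx> 1" by blast
  define y' where "y' = t * y1"
  have y'1: "y' \<approx> y1" unfolding y'_def using veq_mult[OF t(1) veq_refl, of y1] by simp
  then have "y' \<noteq> 0" using y1(1) by auto
  have yn: "c * y' ^ n \<approx> c * y1 ^ n" for c n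
    using y'1 by (cases "n = 0") (auto intro!: veq_mult simp: veq_power)
  have cm: "center_match Z z r0 y y'"
    unfolding center_match_def
  proof (intro ballI conjI impI)
    fix r assume r: "r \<in> Z"
    have 1: "r0 - r \<prec> y \<longleftrightarrow> z r0 - z r \<prec> y1"
    proof (cases "r = r0")
      case False
      then have "(1, 1, 1, r0 - r, z r0 - z r) \<in> C1 \<union> C2" using r by (auto simp: C1_def)
      from y1(2)[OF this] show ?thesis by (simp add: vless_def)
    qed simp
    then show "r0 - r \<prec> y \<longleftrightarrow> z r0 - z r \<prec> y'" using vless_cong[OF veq_refl y'1] by blast
    assume "\<not> r0 - r \<prec> y"
    then have "y1 \<preceq> z r0 - z r" using 1 by (simp add: vless_def)
    then have "(z r0 - z r) / y1 \<in> U" using r by (auto simp: U_def)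
    then have "(t + (z r0 - z r) / y1) * y1 \<approx> 1 * y1" using t(2) by (intro veq_mult) auto
    then have "y' + (z r0 - z r) \<approx> y1" using y1(1) by (simp add: y'_def distrib_right)
    then show "y' + (z r0 - z r) \<approx> y'" using veq_trans veq_sym[OF y'1] by blast
  qed
  have main: "poly (fst p) a \<preceq> poly (fst q) a \<longleftrightarrow> poly (snd p) (z r0 + y') \<preceq> poly (snd q) (z r0 + y')"
    if p: "p \<in> QQ" "fst p \<noteq> 0" and q: "q \<in> QQ" "fst q \<noteq> 0" for p q
  proof -
    have 1: "poly (fst p) a \<preceq> poly (fst q) a \<longleftrightarrow> g p * y ^ k p \<preceq> g q * y ^ k q"
      using g p q vle_cong by blast
    have 2: "poly (snd p) (z r0 + y') \<preceq> poly (snd q) (z r0 + y') \<longleftrightarrow> g' p * y' ^ k p \<preceq> g' q * y' ^ k q"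
      using g'[OF p cm] g'[OF q cm] vle_cong by blast
    have "(k p - k q, g p, g' p, g q, g' q) \<in> C1 \<union> C2" "(k q - k p, g q, g' q, g p, g' p) \<in> C1 \<union> C2"
      using p q by (auto simp: C2_def)
    from this[THEN y1(2)] have 3:
      "g p * y ^ (k p - k q) \<preceq> g q \<longleftrightarrow> g' p * y' ^ (k p - k q) \<preceq> g' q"
      "g p \<preceq> g q * y ^ (k q - k p) \<longleftrightarrow> g' p \<preceq> g' q * y' ^ (k q - k p)"
      using vle_cong[OF yn veq_refl] vle_cong[OF veq_refl yn] by blast+
    show ?thesis
    proof (cases "k q \<le> k p")
      case True
      then have e: "y ^ k p = y ^ k q * y ^ (k p - k q)" "y' ^ k p = y' ^ k q * y' ^ (k p - k q)"
        by (simp_all flip: power_add)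
      have "g p * y ^ k p \<preceq> g q * y ^ k q \<longleftrightarrow> g p * y ^ (k p - k q) \<preceq> g q"
        using vle_mult[of "y ^ k q" "g p * y ^ (k p - k q)" "g q"] y by (simp add: e mult_ac)
      moreover have "g' p * y' ^ k p \<preceq> g' q * y' ^ k q \<longleftrightarrow> g' p * y' ^ (k p - k q) \<preceq> g' q"
        using vle_mult[of "y' ^ k q" "g' p * y' ^ (k p - k q)" "g' q"] \<open>y' \<noteq> 0\<close> by (simp add: e mult_ac)
      ultimately show ?thesis using 1 2 3 by simp
    next
      case False
      then have e: "y ^ k q = y ^ k p * y ^ (k q - k p)" "y' ^ k q = y' ^ k p * y' ^ (k q - k p)"
        by (simp_all flip: power_add)
      have "g p * y ^ k p \<preceq> g q * y ^ k q \<longleftrightarrow> g p \<preceq> g q * y ^ (k q - k p)"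
        using vle_mult[of "y ^ k p" "g p" "g q * y ^ (k q - k p)"] y by (simp add: e mult_ac)
      moreover have "g' p * y' ^ k p \<preceq> g' q * y' ^ k q \<longleftrightarrow> g' p \<preceq> g' q * y' ^ (k q - k p)"
        using vle_mult[of "y' ^ k p" "g' p" "g' q * y' ^ (k q - k p)"] \<open>y' \<noteq> 0\<close> by (simp add: e mult_ac)
      ultimately show ?thesis using 1 2 3 by simp
    qed
  qed
  have nz: "poly (fst p) a \<noteq> 0 \<and> poly (snd p) (z r0 + y') \<noteq> 0" if p: "p \<in> QQ" "fst p \<noteq> 0" for p
  proof -
    have "g p * y ^ k p \<noteq> 0" "g' p * y' ^ k p \<noteq> 0"
      using g[OF p] I_zero_iff y \<open>y' \<noteq> 0\<close> by auto
    then show ?thesis using g[OF p] g'[OF p cm] by (metis veq_0(2))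
  qed
  have "poly (fst p) a \<preceq> poly (fst q) a \<longleftrightarrow> poly (snd p) (z r0 + y') \<preceq> poly (snd q) (z r0 + y')"
    if p: "p \<in> QQ" and q: "q \<in> QQ" for p q
  proof (cases "fst p \<noteq> 0 \<and> fst q \<noteq> 0")
    case False
    have "snd p = 0 \<longleftrightarrow> fst p = 0" "snd q = 0 \<longleftrightarrow> fst q = 0" using rel p q relp_zero_iff by blast+
    then show ?thesis using False nz[OF p] nz[OF q] by (cases "fst p = 0"; cases "fst q = 0") auto
  qed (use main p q in blast)
  then show ?thesis by blast
qed

end

section \<open>Simple extensions of partial isomorphisms\<close>

definition iso_ext :: "('k::field \<Rightarrow> 'k \<Rightarrow> bool) \<Rightarrow> 'k \<Rightarrow> 'k \<Rightarrow> 'k \<Rightarrow> 'k \<Rightarrow> bool" where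
  "iso_ext I a a' x y \<longleftrightarrow> (\<exists>p p' q q'. relp I p p' \<and> relp I q q' \<and> poly q a \<noteq> 0 \<and> poly q' a' \<noteq> 0 \<and>
     x = poly p a / poly q a \<and> y = poly p' a' / poly q' a')"

lemma Poly_map_coeff: "degree p \<le> n \<Longrightarrow> Poly (map (coeff p) [0..<Suc n]) = p"
  by (intro poly_eqI) (auto simp: coeff_Poly_eq nth_default_def coeff_eq_0 simp del: upt_Suc)

context valued_iso begin

lemma iso_extI: "relp I p p' \<Longrightarrow> relp I q q' \<Longrightarrow> poly q a \<noteq> 0 \<Longrightarrow> poly q' a' \<noteq> 0 \<Longrightarrow>
    x = poly p a / poly q a \<Longrightarrow> y = poly p' a' / poly q' a' \<Longrightarrow> iso_ext I a a' x y"
  unfolding iso_ext_def by blast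

lemma iso_ext_base: "I x y \<Longrightarrow> iso_ext I a a' x y"
  by (rule iso_extI[of "[:x:]" "[:y:]" 1 1]) (auto intro: relp_pCons)

lemma iso_ext_new: "iso_ext I a a' a a'"
  by (rule iso_extI[of "[:0, 1:]" "[:0, 1:]" 1 1]) (simp_all add: relp_pCons)

text \<open>Comparison with the zero polynomial decides which expressions vanish, and fractions are
  compared after multiplication by their denominators. So comparisons of polynomial values are all
  that has to be matched.\<close>

lemma partial_iso_ext:
  assumes match: "\<And>p p' q q'. relp I p p' \<Longrightarrow> relp I q q' \<Longrightarrow>
    poly p a \<preceq> poly q a \<longleftrightarrow> poly p' a' \<preceq> poly q' a'"
  shows "partial_iso v (iso_ext I a a')"
  unfolding partial_iso_def
proof (intro conjI allI impI)
  show "iso_ext I a a' 0 0" "iso_ext I a a' 1 1" by (simp_all add: iso_ext_base)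
  have zero: "poly p a = 0 \<longleftrightarrow> poly p' a' = 0" if "relp I p p'" for p p'
    using match[OF relp_0 that] by simp
  fix x x' assume "iso_ext I a a' x x'"
  then obtain p p' q q' where x: "relp I p p'" "relp I q q'" "poly q a \<noteq> 0" "poly q' a' \<noteq> 0"
     "x = poly p a / poly q a" "x' = poly p' a' / poly q' a'" unfolding iso_ext_def by blast
  show "iso_ext I a a' (- x) (- x')"
    by (rule iso_extI[OF relp_uminus[OF x(1)] x(2-4)]) (auto simp: x)
  show "iso_ext I a a' (inverse x) (inverse x')"
  proof (cases "poly p a = 0")
    case True
    then show ?thesis using zero[OF x(1)] x(5,6) by (simp add: iso_ext_base)
  next
    case False
    then show ?thesis using zero[OF x(1)] x by (intro iso_extI[OF x(2,1)]) auto
  qed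
  fix y y' assume "iso_ext I a a' y y'"
  then obtain r r' s s' where y: "relp I r r'" "relp I s s'" "poly s a \<noteq> 0" "poly s' a' \<noteq> 0"
     "y = poly r a / poly s a" "y' = poly r' a' / poly s' a'" unfolding iso_ext_def by blast
  have qs: "relp I (q * s) (q' * s')" "poly (q * s) a \<noteq> 0" "poly (q' * s') a' \<noteq> 0"
    using x y by (auto intro: relp_mult)
  show "iso_ext I a a' (x + y) (x' + y')"
    by (rule iso_extI[OF relp_add[OF relp_mult[OF x(1) y(2)] relp_mult[OF y(1) x(2)]] qs])
      (use x(3,4) y(3,4) in \<open>simp_all add: x(5,6) y(5,6) add_frac_eq\<close>)
  show "iso_ext I a a' (x * y) (x' * y')"
    by (rule iso_extI[OF relp_mult[OF x(1) y(1)] qs]) (use x y in simp_all)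
  have "x \<preceq> y \<longleftrightarrow> poly (p * s) a \<preceq> poly (r * q) a"
    using vle_mult[of "poly q a * poly s a" x y] x y by (simp add: mult_ac)
  moreover have "x' \<preceq> y' \<longleftrightarrow> poly (p' * s') a' \<preceq> poly (r' * q') a'"
    using vle_mult[of "poly q' a' * poly s' a'" x' y'] x y by (simp add: mult_ac)
  ultimately show "x \<preceq> y \<longleftrightarrow> x' \<preceq> y'"
    using match[OF relp_mult[OF x(1) y(2)] relp_mult[OF y(1) x(2)]] by simp
qed

lemma countable_relp:
  assumes "countable {(x, y). I x y}"
  shows "countable {(p, q). relp I p q}"
proof -
  let ?f = "\<lambda>xs. (Poly (map fst xs), Poly (map snd xs))"
  have "{(p, q). relp I p q} \<subseteq> ?f ` lists {(x, y). I x y}"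
  proof safe
    fix p q assume pq: "relp I p q"
    let ?xs = "map (\<lambda>i. (coeff p i, coeff q i)) [0..<Suc (degree p)]"
    have m: "map fst ?xs = map (coeff p) [0..<Suc (degree p)]" "map snd ?xs = map (coeff q) [0..<Suc (degree p)]"
      by (simp_all del: upt_Suc)
    have "Poly (map fst ?xs) = p" "Poly (map snd ?xs) = q"
      unfolding m using relp_degree[OF pq] by (intro Poly_map_coeff; simp)+
    moreover have "?xs \<in> lists {(x, y). I x y}" using relp_coeff[OF pq] by auto
    ultimately show "(p, q) \<in> ?f ` lists {(x, y). I x y}" by (intro image_eqI[of _ _ ?xs]) simp_all
  qed
  moreover have "countable (?f ` lists {(x, y). I x y})" using assms by (intro countable_image countable_lists)
  ultimately show ?thesis by (rule countable_subset)
qed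

lemma countable_iso_ext:
  assumes "countable {(x, y). I x y}"
  shows "countable {(x, y). iso_ext I a a' x y}"
proof -
  let ?R = "{(p, q). relp I p q}"
  have "{(x, y). iso_ext I a a' x y} \<subseteq>
      (\<lambda>((p, p'), (q, q')). (poly p a / poly q a, poly p' a' / poly q' a')) ` (?R \<times> ?R)"
    unfolding iso_ext_def by (auto simp: image_iff) blast
  then show ?thesis using countable_relp[OF assms] by (meson countable_SIGMA countable_image countable_subset)
qed

end

text \<open>Polynomials over an enumerated field as terms: \<open>ks\<close> lists the positions of
  the coefficients, shifted by one because position 0 holds the argument.\<close>

primrec horner :: "nat list \<Rightarrow> (nat \<Rightarrow> 'k::field) \<Rightarrow> 'k" where
  "horner [] e = 0"
| "horner (k # ks) e = e (Suc k) + e 0 * horner ks e"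

lemma tdef_horner: "tdef (horner ks :: (nat \<Rightarrow> 'k::field) \<Rightarrow> 'k)"
proof (induction ks)
  case Nil
  then show ?case using tdef_0 by (simp add: horner.simps(1)[abs_def])
next
  case (Cons k ks)
  have "tdef (\<lambda>e :: nat \<Rightarrow> 'k. e (Suc k) + e 0 * horner ks e)" by (intro fdef_intros Cons)
  then show ?case by (simp add: horner.simps(2)[abs_def])
qed

lemma horner_eq: "horner ks (case_nat a e) = poly (Poly (map e ks)) a"
  by (induction ks) auto

section \<open>Back-and-forth in a saturated model\<close>

locale monster = acvf v for v :: "'k::alg_closed_field \<Rightarrow> 'g::linordered_ab_group_add" +
  fixes \<kappa> :: "'c rel"
  assumes saturated: "saturated \<kappa> v" and uncountable: "natLeq <o \<kappa>"
begin

lemmas saturation = saturated_env[OF saturated uncountable]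

lemma iso_enum:
  assumes "partial_iso v I" "countable {(x, y). I x y}"
  obtains e e' where "\<And>i. I (e i) (e' i)" "\<And>x y. I x y \<Longrightarrow> \<exists>i :: nat. e i = x \<and> e' i = y"
proof -
  let ?S = "{(x, y). I x y}"
  have "?S \<noteq> {}" using assms(1) by (auto simp: partial_iso_def)
  then have r: "range (from_nat_into ?S) = ?S" using assms(2) by (rule range_from_nat_into)
  show thesis
  proof (rule that[of "\<lambda>i. fst (from_nat_into ?S i)" "\<lambda>i. snd (from_nat_into ?S i)"])
    fix i
    have "from_nat_into ?S i \<in> ?S" using rangeI[of "from_nat_into ?S" i] unfolding r .
    then show "I (fst (from_nat_into ?S i)) (snd (from_nat_into ?S i))" by auto
  next
    fix x y assume "I x y"
    then have "(x, y) \<in> range (from_nat_into ?S)" using r by simp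
    then obtain i where i: "(x, y) = from_nat_into ?S i" by (rule rangeE)
    show "\<exists>i. fst (from_nat_into ?S i) = x \<and> snd (from_nat_into ?S i) = y"
      by (rule exI[of _ i]) (simp only: i[symmetric] prod.sel simp_thms)
  qed
qed

text \<open>Each condition on \<open>a'\<close> compares two polynomials with coefficients among the
  countably many \<open>e'\<close>. Together they form a type over the range of the isomorphism, and
  \<open>fl\<close> is its finite satisfiability.\<close>

lemma saturated_match:
  assumes I: "partial_iso v I" "countable {(x, y). I x y}"
    and fl: "\<And>QQ. finite QQ \<Longrightarrow> (\<And>x. x \<in> QQ \<Longrightarrow> relp I (fst x) (snd x)) \<Longrightarrow>
      \<exists>a'. \<forall>x\<in>QQ. \<forall>y\<in>QQ. poly (fst x) a \<preceq> poly (fst y) a \<longleftrightarrow> poly (snd x) a' \<preceq> poly (snd y) a'"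
  shows "\<exists>a'. \<forall>p p' q q'. relp I p p' \<longrightarrow> relp I q q' \<longrightarrow>
      (poly p a \<preceq> poly q a \<longleftrightarrow> poly p' a' \<preceq> poly q' a')"
proof -
  interpret I: valued_iso v I by unfold_locales (rule I(1))
  obtain e e' where e: "\<And>i. I (e i) (e' i)" "\<And>x y. I x y \<Longrightarrow> \<exists>i :: nat. e i = x \<and> e' i = y"
    using iso_enum[OF I] by blast
  have rel1: "relp I (Poly (map e ks)) (Poly (map e' ks))" for ks
    by (induction ks) (auto intro: I.relp_pCons e(1))
  have rel2: "\<exists>ks. p = Poly (map e ks) \<and> q = Poly (map e' ks)" if pq: "relp I p q" for p q
  proof -
    obtain f where f: "\<And>i. e (f i) = coeff p i \<and> e' (f i) = coeff q i"
      using e(2)[OF I.relp_coeff[OF pq]] by metis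
    let ?ks = "map f [0..<Suc (degree p)]"
    have m: "map e ?ks = map (coeff p) [0..<Suc (degree p)]" "map e' ?ks = map (coeff q) [0..<Suc (degree p)]"
      using f by (simp_all del: upt_Suc)
    have "Poly (map e ?ks) = p" "Poly (map e' ?ks) = q"
      unfolding m using I.relp_degree[OF pq] by (intro Poly_map_coeff; simp)+
    then show ?thesis by (intro exI[of _ ?ks] conjI; simp del: upt_Suc map_map)
  qed
  define P where "P = (\<lambda>(ks, ls) \<epsilon>. (horner ks \<epsilon> \<preceq> horner ls \<epsilon>) \<longleftrightarrow>
      (poly (Poly (map e ks)) a \<preceq> poly (Poly (map e ls)) a))"
  have "\<exists>a'. \<forall>Q\<in>range P. Q (case_nat a' e')"
  proof (rule saturation)
    fix Q assume "Q \<in> range P"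
    then show "fdef v Q" by (auto simp: P_def intro!: fdef_intros tdef_horner)
  next
    fix F assume "F \<subseteq> range P" "finite F"
    then obtain K where K: "finite K" "F = P ` K" by (metis finite_subset_image)
    define QQ where "QQ = (\<lambda>ks. (Poly (map e ks), Poly (map e' ks))) ` (fst ` K \<union> snd ` K)"
    have "finite QQ" using K by (simp add: QQ_def)
    moreover have "relp I (fst x) (snd x)" if "x \<in> QQ" for x using that rel1 by (auto simp: QQ_def)
    ultimately obtain a' where a': "\<forall>x\<in>QQ. \<forall>y\<in>QQ. poly (fst x) a \<preceq> poly (fst y) a \<longleftrightarrow> poly (snd x) a' \<preceq> poly (snd y) a'"
      using fl by blast
    have "P k (case_nat a' e')" if k: "k \<in> K" for k
    proof -
      obtain ks ls where kl: "k = (ks, ls)" by (cases k)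
      have "(Poly (map e ks), Poly (map e' ks)) \<in> QQ" "(Poly (map e ls), Poly (map e' ls)) \<in> QQ"
        using k kl by (force simp: QQ_def)+
      then show ?thesis using a' by (fastforce simp: P_def kl horner_eq)
    qed
    then show "\<exists>a'. \<forall>Q\<in>F. Q (case_nat a' e')" using K by blast
  qed
  then obtain a' where a': "\<And>k. P k (case_nat a' e')" by auto
  have "poly p a \<preceq> poly q a \<longleftrightarrow> poly p' a' \<preceq> poly q' a'" if pq: "relp I p p'" "relp I q q'" for p p' q q'
  proof -
    obtain ks ls where "p = Poly (map e ks)" "p' = Poly (map e' ks)" "q = Poly (map e ls)" "q' = Poly (map e' ls)"
      using rel2 pq by metis
    then show ?thesis using a'[of "(ks, ls)"] by (auto simp: P_def horner_eq)
  qed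
  then show ?thesis by blast
qed

lemma extend_by_match:
  assumes I: "partial_iso v I" "countable {(x, y). I x y}"
    and fl: "\<And>QQ. finite QQ \<Longrightarrow> (\<And>x. x \<in> QQ \<Longrightarrow> relp I (fst x) (snd x)) \<Longrightarrow>
      \<exists>a'. \<forall>x\<in>QQ. \<forall>y\<in>QQ. poly (fst x) a \<preceq> poly (fst y) a \<longleftrightarrow> poly (snd x) a' \<preceq> poly (snd y) a'"
  shows "\<exists>J a'. partial_iso v J \<and> countable {(x, y). J x y} \<and> I \<le> J \<and> J a a'"
proof -
  interpret I: valued_iso v I by unfold_locales (rule I(1))
  obtain a' where a': "\<And>p p' q q'. relp I p p' \<Longrightarrow> relp I q q' \<Longrightarrow>
      poly p a \<preceq> poly q a \<longleftrightarrow> poly p' a' \<preceq> poly q' a'"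
    using saturated_match[OF I fl] by blast
  show ?thesis
    by (rule exI[of _ "iso_ext I a a'"], rule exI[of _ a'])
      (use I.partial_iso_ext[OF a'] I.countable_iso_ext[OF I(2)] I.iso_ext_base I.iso_ext_new in auto)
qed

lemma extend_algebraic:
  assumes I: "partial_iso v I" "countable {(x, y). I x y}"
    and alg: "relp I Q Q'" "Q \<noteq> 0" "poly Q a = 0"
  shows "\<exists>J a'. partial_iso v J \<and> countable {(x, y). J x y} \<and> I \<le> J \<and> J a a'"
proof -
  interpret I: acvf_iso v I by unfold_locales (rule I(1))
  show ?thesis by (rule extend_by_match[OF I]) (rule I.algebraic_match[OF alg])
qed

lemma relp_mono: "relp I p q \<Longrightarrow> I \<le> J \<Longrightarrow> relp J p q"
  by (auto simp: relp_def)

lemma extend_algebraic_set: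
  assumes I: "partial_iso v I" "countable {(x, y). I x y}" and "finite A"
    and alg: "\<And>a. a \<in> A \<Longrightarrow> \<exists>Q Q'. relp I Q Q' \<and> Q \<noteq> 0 \<and> poly Q a = 0"
  shows "\<exists>J. partial_iso v J \<and> countable {(x, y). J x y} \<and> I \<le> J \<and> (\<forall>a\<in>A. \<exists>a'. J a a')"
  using assms(3,4)
proof (induction A rule: finite_induct)
  case empty
  show ?case using I by blast
next
  case (insert a A)
  have "\<exists>J. partial_iso v J \<and> countable {(x, y). J x y} \<and> I \<le> J \<and> (\<forall>a\<in>A. \<exists>a'. J a a')"
    by (rule insert.IH) (rule insert.prems, simp)
  then obtain J where J: "partial_iso v J" "countable {(x, y). J x y}" "I \<le> J" "\<forall>a\<in>A. \<exists>a'. J a a'" by blast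
  obtain Q Q' where "relp I Q Q'" "Q \<noteq> 0" "poly Q a = 0" using insert.prems by blast
  then obtain L a' where "partial_iso v L" "countable {(x, y). L x y}" "J \<le> L" "L a a'"
    using extend_algebraic[OF J(1,2) relp_mono[OF _ J(3)]] by blast
  then show ?case using J(3,4) by (intro exI[of _ L]) (auto 0 3 intro: order_trans)
qed

text \<open>Finite satisfiability may be tested over a larger domain: the roots of finitely many
  polynomials over \<open>I\<close> are algebraic and are adjoined first, and over the resulting
  \<open>J\<close> the polynomials split. \<open>J\<close> depends on the finite set; one element
  matching all polynomials then comes from saturation.\<close>

lemma extend:
  assumes I: "partial_iso v I" "countable {(x, y). I x y}"
  shows "\<exists>J a'. partial_iso v J \<and> countable {(x, y). J x y} \<and> I \<le> J \<and> J a a'"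
proof (rule extend_by_match[OF I])
  fix QQ :: "('k poly \<times> 'k poly) set"
  assume fin: "finite QQ" and rel: "\<And>x. x \<in> QQ \<Longrightarrow> relp I (fst x) (snd x)"
  define A where "A = (\<Union>x\<in>{x \<in> QQ. fst x \<noteq> 0}. {r. poly (fst x) r = 0})"
  have A: "finite A" using fin by (auto simp: A_def poly_roots_finite)
  have "\<exists>Q Q'. relp I Q Q' \<and> Q \<noteq> 0 \<and> poly Q a = 0" if aA: "a \<in> A" for a
  proof -
    obtain x where "x \<in> QQ" "fst x \<noteq> 0" "poly (fst x) a = 0" using aA unfolding A_def by blast
    then show ?thesis using rel by blast
  qed
  then obtain J where J: "partial_iso v J" "countable {(x, y). J x y}" "I \<le> J" "\<forall>a\<in>A. \<exists>a'. J a a'"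
    using extend_algebraic_set[OF I A] by blast
  interpret J: acvf_iso v J by unfold_locales (rule J(1))
  show "\<exists>a'. \<forall>x\<in>QQ. \<forall>y\<in>QQ. poly (fst x) a \<preceq> poly (fst y) a \<longleftrightarrow> poly (snd x) a' \<preceq> poly (snd y) a'"
  proof (rule J.split_match[OF fin])
    fix x assume x: "x \<in> QQ"
    show "relp J (fst x) (snd x)" using relp_mono[OF rel[OF x] J(3)] .
    fix r assume "fst x \<noteq> 0" "poly (fst x) r = 0"
    then have "r \<in> A" using x unfolding A_def by blast
    then show "\<exists>r'. J r r'" using J(4) by blast
  qed
qed

lemma partial_iso_converse: "partial_iso v I \<Longrightarrow> partial_iso v (\<lambda>x y. I y x)"
  unfolding partial_iso_def by blast

text \<open>Countable partial isomorphisms form a back-and-forth system: at a quantifier,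
  \<open>extend\<close> gives the forth direction and the converse relation gives back.\<close>

theorem partial_iso_sat:
  assumes "partial_iso v I" "countable {(x, y). I x y}" "\<And>i. I (e i) (e' i)"
  shows "sat v e \<phi> \<longleftrightarrow> sat v e' \<phi>"
  using assms
proof (induction \<phi> arbitrary: I e e')
  case (Equal s t)
  interpret I: valued_iso v I by unfold_locales (rule Equal(1))
  have tm: "I (tm_val e t) (tm_val e' t)" for t
    by (induction t) (auto intro: I.I_add I.I_mult I.I_uminus Equal(3))
  show ?case using I.I_zero_iff[OF I.I_diff[OF tm tm]] by simp
next
  case (VLe s t)
  interpret I: valued_iso v I by unfold_locales (rule VLe(1))
  have tm: "I (tm_val e t) (tm_val e' t)" for t
    by (induction t) (auto intro: I.I_add I.I_mult I.I_uminus VLe(3))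
  show ?case using I.I_vle[OF tm tm] by simp
next
  case (Not \<phi>)
  then show ?case by (metis sat.simps(3))
next
  case (And \<phi> \<psi>)
  then show ?case by (metis sat.simps(4))
next
  case (Ex \<phi>)
  have half: "\<exists>a'. sat v (case_nat a' e') \<phi>"
    if I: "partial_iso v I" "countable {(x, y). I x y}" "\<And>i. I (e i) (e' i)" and a: "sat v (case_nat a e) \<phi>"
    for I e e' a
  proof -
    obtain J a' where J: "partial_iso v J" "countable {(x, y). J x y}" "I \<le> J" "J a a'"
      using extend[OF I(1,2)] by blast
    have "J (case_nat a e i) (case_nat a' e' i)" for i
      using J(3,4) I(3) by (auto split: nat.split)
    then show ?thesis using Ex.IH[OF J(1,2)] a by metis
  qed
  have "{(x, y). I y x} = prod.swap ` {(x, y). I x y}" by auto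
  then have c: "countable {(x, y). I y x}" using Ex.prems(2) by simp
  show ?case
  proof
    assume "sat v e (Ex \<phi>)"
    then show "sat v e' (Ex \<phi>)" using half[OF Ex.prems] by auto
  next
    assume "sat v e' (Ex \<phi>)"
    then show "sat v e (Ex \<phi>)" using half[OF partial_iso_converse[OF Ex.prems(1)] c Ex.prems(3)] by auto
  qed
qed

lemma partial_iso_fdef:
  assumes "partial_iso v I" "countable {(x, y). I x y}" "\<And>i. I (e i) (e' i)" "fdef v P"
  shows "P e \<longleftrightarrow> P e'"
  using assms partial_iso_sat unfolding fdef_def by metis

end

section \<open>Definable cuts and definable chains of balls\<close>

lemma tdef_case_nat [fdef_intros]:
  "tdef s \<Longrightarrow> (\<And>j. tdef (t j)) \<Longrightarrow> tdef (\<lambda>e. case_nat (s e) (\<lambda>j. t j e) i)"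
  by (cases i) simp_all

context valued_iso begin

lemma vle_iff_vless: "\<not> x \<approx> y \<Longrightarrow> x \<preceq> y \<longleftrightarrow> x \<prec> y"
  unfolding veq_def vless_def using vle_linear by blast

lemma vle_iff_not_vless: "y \<preceq> x \<longleftrightarrow> \<not> x \<prec> y"
  by (simp add: vless_def)

text \<open>No positive power of \<open>a\<close> shares its value with the domain, so the nonzero
  monomials of a polynomial have pairwise different values and the least one gives the value of the
  polynomial. Comparing two monomials only asks on which side of a domain element some
  \<open>a ^ n\<close> lies, and this is what \<open>cut\<close> transports.\<close>

lemma monomial_match:
  assumes a: "a \<noteq> 0" "a' \<noteq> 0"
    and new: "\<And>c c' n. I c c' \<Longrightarrow> n > 0 \<Longrightarrow> \<not> a ^ n \<approx> c \<and> \<not> a' ^ n \<approx> c'"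
    and cut: "\<And>c c' n. I c c' \<Longrightarrow> n > 0 \<Longrightarrow> a ^ n \<prec> c \<longleftrightarrow> a' ^ n \<prec> c'"
    and pq: "relp I p p'" "relp I q q'"
  shows "poly p a \<preceq> poly q a \<longleftrightarrow> poly p' a' \<preceq> poly q' a'"
proof -
  have up: "c * a ^ n \<preceq> d \<longleftrightarrow> c' * a' ^ n \<preceq> d'" "\<not> c * a ^ n \<approx> d" "\<not> c' * a' ^ n \<approx> d'"
    "d \<preceq> c * a ^ n \<longleftrightarrow> d' \<preceq> c' * a' ^ n"
    if cd: "I c c'" "I d d'" "c \<noteq> 0" "n > 0" for c c' d d' n
  proof -
    have c': "c' \<noteq> 0" using cd I_zero_iff by blast
    have I: "I (d / c) (d' / c')" using cd I_divide by blast
    have le: "c * a ^ n \<preceq> d \<longleftrightarrow> a ^ n \<preceq> d / c" "c' * a' ^ n \<preceq> d' \<longleftrightarrow> a' ^ n \<preceq> d' / c'"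
      "d \<preceq> c * a ^ n \<longleftrightarrow> d / c \<preceq> a ^ n" "d' \<preceq> c' * a' ^ n \<longleftrightarrow> d' / c' \<preceq> a' ^ n"
      using vle_mult[OF cd(3), of "a ^ n" "d / c"] vle_mult[OF c', of "a' ^ n" "d' / c'"]
        vle_mult[OF cd(3), of "d / c" "a ^ n"] vle_mult[OF c', of "d' / c'" "a' ^ n"] cd(3) c' by simp_all
    note n = new[OF I cd(4)] cut[OF I cd(4)]
    show "\<not> c * a ^ n \<approx> d" "\<not> c' * a' ^ n \<approx> d'" using n(1) le unfolding veq_def by blast+
    show "c * a ^ n \<preceq> d \<longleftrightarrow> c' * a' ^ n \<preceq> d'" "d \<preceq> c * a ^ n \<longleftrightarrow> d' \<preceq> c' * a' ^ n"
      unfolding le vle_iff_not_vless[of "d / c"] vle_iff_not_vless[of "d' / c'"] using n vle_iff_vless by blast+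
  qed
  have mono: "(c * a ^ n \<preceq> d * a ^ k \<longleftrightarrow> c' * a' ^ n \<preceq> d' * a' ^ k) \<and>
      (n \<noteq> k \<longrightarrow> (c * a ^ n \<approx> d * a ^ k \<longrightarrow> c = 0) \<and> (c' * a' ^ n \<approx> d' * a' ^ k \<longrightarrow> c' = 0))"
    if cd: "I c c'" "I d d'" for c c' d d' n k
  proof -
    have z: "c = 0 \<longleftrightarrow> c' = 0" "d = 0 \<longleftrightarrow> d' = 0" using cd I_zero_iff by blast+
    consider "c = 0" | "c \<noteq> 0" "d = 0" | "c \<noteq> 0" "d \<noteq> 0" "n = k" | "c \<noteq> 0" "d \<noteq> 0" "n > k" | "c \<noteq> 0" "d \<noteq> 0" "n < k"
      by linarith
    then show ?thesis
    proof cases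
      case 3
      then show ?thesis using a cd I_vle vle_mult_right[of "a ^ k" c d] vle_mult_right[of "a' ^ k" c' d'] by simp
    next
      case 4
      then have e: "a ^ n = a ^ (n - k) * a ^ k" "a' ^ n = a' ^ (n - k) * a' ^ k" by (simp_all flip: power_add)
      have "c * a ^ n \<preceq> d * a ^ k \<longleftrightarrow> c * a ^ (n - k) \<preceq> d" "d * a ^ k \<preceq> c * a ^ n \<longleftrightarrow> d \<preceq> c * a ^ (n - k)"
        "c' * a' ^ n \<preceq> d' * a' ^ k \<longleftrightarrow> c' * a' ^ (n - k) \<preceq> d'" "d' * a' ^ k \<preceq> c' * a' ^ n \<longleftrightarrow> d' \<preceq> c' * a' ^ (n - k)"
        unfolding e mult.assoc[symmetric] using a by (simp_all add: vle_mult_right)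
      then show ?thesis using up[OF cd 4(1), of "n - k"] 4 unfolding veq_def by auto
    next
      case 5
      then have e: "a ^ k = a ^ (k - n) * a ^ n" "a' ^ k = a' ^ (k - n) * a' ^ n" by (simp_all flip: power_add)
      have "c * a ^ n \<preceq> d * a ^ k \<longleftrightarrow> c \<preceq> d * a ^ (k - n)" "d * a ^ k \<preceq> c * a ^ n \<longleftrightarrow> d * a ^ (k - n) \<preceq> c"
        "c' * a' ^ n \<preceq> d' * a' ^ k \<longleftrightarrow> c' \<preceq> d' * a' ^ (k - n)" "d' * a' ^ k \<preceq> c' * a' ^ n \<longleftrightarrow> d' * a' ^ (k - n) \<preceq> c'"
        unfolding e mult.assoc[symmetric] using a by (simp_all add: vle_mult_right)
      then show ?thesis using up[OF cd(2,1) 5(2), of "k - n"] 5 unfolding veq_def by auto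
    qed (use a z in auto)
  qed
  \<comment> \<open>The same index dominates on both sides, because domination is a matter of
    comparing monomials, which \<open>mono\<close> transports.\<close>
  have dom: "\<exists>i. coeff p i \<noteq> 0 \<and> poly p a \<approx> coeff p i * a ^ i \<and> poly p' a' \<approx> coeff p' i * a' ^ i"
    if p: "relp I p p'" "p \<noteq> 0" for p p'
  proof -
    let ?f = "\<lambda>i. coeff p i * a ^ i" and ?f' = "\<lambda>i. coeff p' i * a' ^ i" and ?n = "degree p"
    have sums: "poly p a = (\<Sum>i\<le>?n. ?f i)" "poly p' a' = (\<Sum>i\<le>?n. ?f' i)"
      using relp_degree[OF p(1)] by (simp_all add: poly_altdef)
    note m = mono[OF relp_coeff[OF p(1)] relp_coeff[OF p(1)]]
    have lead: "coeff p ?n \<noteq> 0" "coeff p' ?n \<noteq> 0"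
      using p(2) I_zero_iff[OF relp_coeff[OF p(1)]] by (metis leading_coeff_0_iff)+
    have "\<exists>i\<in>{..?n}. ?f i \<noteq> 0 \<and> sum ?f {..?n} \<approx> ?f i \<and> (\<forall>j\<in>{..?n}. ?f i \<preceq> ?f j)"
    proof (rule veq_sum_cong(2)[where g = ?f])
      show "\<exists>i\<in>{..?n}. ?f i \<noteq> 0" using lead a by (intro bexI[of _ ?n]) auto
      show "?f i = 0" if "i \<noteq> j" "?f i \<approx> ?f j" for i j using m[of i i j j] that by simp
    qed simp_all
    then obtain i where i: "i \<le> ?n" "?f i \<noteq> 0" "sum ?f {..?n} \<approx> ?f i" "\<forall>j\<le>?n. ?f i \<preceq> ?f j" by auto
    have "\<exists>i\<in>{..?n}. ?f' i \<noteq> 0 \<and> sum ?f' {..?n} \<approx> ?f' i \<and> (\<forall>j\<in>{..?n}. ?f' i \<preceq> ?f' j)"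
    proof (rule veq_sum_cong(2)[where g = ?f'])
      show "\<exists>i\<in>{..?n}. ?f' i \<noteq> 0" using lead a by (intro bexI[of _ ?n]) auto
      show "?f' i = 0" if "i \<noteq> j" "?f' i \<approx> ?f' j" for i j using m[of i i j j] that by simp
    qed simp_all
    then obtain i' where i': "i' \<le> ?n" "?f' i' \<noteq> 0" "sum ?f' {..?n} \<approx> ?f' i'" "\<forall>j\<le>?n. ?f' i' \<preceq> ?f' j" by auto
    have "?f i \<preceq> ?f i'" "?f' i' \<preceq> ?f' i" using i(1,4) i'(1,4) by blast+
    then have "?f' i \<approx> ?f' i'" using m[of i i i' i'] unfolding veq_def by blast
    then have "sum ?f' {..?n} \<approx> ?f' i" using i'(3) veq_trans veq_sym by blast
    then show ?thesis using i sums by (intro exI[of _ i]) auto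
  qed
  show ?thesis
  proof (cases "p = 0 \<or> q = 0")
    case True
    have z: "p' = 0 \<longleftrightarrow> p = 0" "q' = 0 \<longleftrightarrow> q = 0" using pq relp_zero_iff by blast+
    have nz: "poly p a \<noteq> 0 \<and> poly p' a' \<noteq> 0" if pp: "relp I p p'" "p \<noteq> 0" for p p'
    proof -
      obtain i where i: "coeff p i \<noteq> 0" "poly p a \<approx> coeff p i * a ^ i" "poly p' a' \<approx> coeff p' i * a' ^ i"
        using dom[OF pp] by blast
      have "coeff p' i \<noteq> 0" using i(1) I_zero_iff[OF relp_coeff[OF pp(1)]] by blast
      then show ?thesis using i a by (auto simp: veq_iff)
    qed
    show ?thesis using True z nz[OF pq(1)] nz[OF pq(2)] by (cases "p = 0"; cases "q = 0") auto
  next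
    case False
    then obtain i j where i: "poly p a \<approx> coeff p i * a ^ i" "poly p' a' \<approx> coeff p' i * a' ^ i"
      and j: "poly q a \<approx> coeff q j * a ^ j" "poly q' a' \<approx> coeff q' j * a' ^ j"
      using dom[OF pq(1)] dom[OF pq(2)] by blast
    show ?thesis unfolding vle_cong[OF i(1) j(1)] vle_cong[OF i(2) j(2)]
      using mono[OF relp_coeff[OF pq(1)] relp_coeff[OF pq(2)]] by blast
  qed
qed

end

text \<open>An algebraically closed subfield. Its value group is divisible, so a value outside it
  has all its positive multiples outside.\<close>

definition root_closed :: "'k::field set \<Rightarrow> bool" where
  "root_closed F \<longleftrightarrow> 0 \<in> F \<and> 1 \<in> F \<and> (\<forall>x\<in>F. \<forall>y\<in>F. x + y \<in> F \<and> x * y \<in> F) \<and>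
     (\<forall>x\<in>F. - x \<in> F \<and> inverse x \<in> F) \<and>
     (\<forall>p r. p \<noteq> 0 \<longrightarrow> set (coeffs p) \<subseteq> F \<longrightarrow> poly p r = 0 \<longrightarrow> r \<in> F)"

text \<open>The additional function \<open>g\<close> will be a Skolem function: closing under it
  keeps chosen witnesses inside the subfield.\<close>

lemma ex_root_closed:
  fixes S :: "'k::field set"
  assumes "countable S"
  shows "\<exists>F. countable F \<and> S \<subseteq> F \<and> root_closed F \<and> g ` F \<subseteq> F"
proof -
  define step where "step T = T \<union> {0, 1} \<union> (\<lambda>(x, y). x + y) ` (T \<times> T) \<union> (\<lambda>(x, y). x * y) ` (T \<times> T) \<union>
    uminus ` T \<union> inverse ` T \<union> g ` T \<union> (\<Union>p\<in>Poly ` lists T - {0}. {r. poly p r = 0})" for T :: "'k set"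
  define F where "F = (\<Union>n. (step ^^ n) S)"
  have c: "countable ((step ^^ n) S)" for n
  proof (induction n)
    case (Suc n)
    have "countable (step T)" if T: "countable T" for T
    proof -
      have "countable (\<Union>p\<in>Poly ` lists T - {0}. {r. poly p r = 0})"
        using T by (intro countable_UN countable_Diff countable_image countable_lists)
          (auto intro!: countable_finite poly_roots_finite)
      moreover have "countable (f ` (T \<times> T))" for f :: "'k \<times> 'k \<Rightarrow> 'k"
        using T by (intro countable_image countable_SIGMA)
      ultimately show ?thesis unfolding step_def using T
        by (simp only: countable_Un_iff countable_image countable_insert countable_empty simp_thms)
    qed
    then show ?case using Suc by simp
  qed (use assms in simp)
  have sub: "T \<subseteq> step T" for T by (auto simp: step_def)
  have mono: "(step ^^ n) S \<subseteq> (step ^^ m) S" if "n \<le> m" for n m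
    by (rule lift_Suc_mono_le[OF _ that]) (use sub in simp)
  have F: "step ((step ^^ n) S) \<subseteq> F" for n
  proof -
    have "step ((step ^^ n) S) = (step ^^ Suc n) S" by simp
    then show ?thesis unfolding F_def by blast
  qed
  have st: "0 \<in> step T" "1 \<in> step T" "x \<in> T \<Longrightarrow> - x \<in> step T" "x \<in> T \<Longrightarrow> inverse x \<in> step T"
    "x \<in> T \<Longrightarrow> g x \<in> step T" for T x
    unfolding step_def by blast+
  have st2: "x + y \<in> step T" "x * y \<in> step T" if "x \<in> T" "y \<in> T" for x y T
  proof -
    have "(x, y) \<in> T \<times> T" using that by simp
    from imageI[OF this, of "\<lambda>(x, y). x + y"] imageI[OF this, of "\<lambda>(x, y). x * y"]
    show "x + y \<in> step T" "x * y \<in> step T" unfolding step_def by simp_all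
  qed
  have fin: "\<exists>n. set xs \<subseteq> (step ^^ n) S" if "set xs \<subseteq> F" for xs
    using that
  proof (induction xs)
    case (Cons x xs)
    obtain n where "set xs \<subseteq> (step ^^ n) S" using Cons by auto
    moreover obtain k where "x \<in> (step ^^ k) S" using Cons.prems unfolding F_def by auto
    ultimately have "set (x # xs) \<subseteq> (step ^^ max n k) S"
      using mono[of n "max n k"] mono[of k "max n k"] by auto
    then show ?case by blast
  qed auto
  have "root_closed F" unfolding root_closed_def
  proof (intro conjI ballI allI impI)
    show "0 \<in> F" "1 \<in> F" using F[of 0] st(1,2) by blast+
    fix x assume x: "x \<in> F"
    then obtain n where n: "x \<in> (step ^^ n) S" unfolding F_def by blast
    show "- x \<in> F" "inverse x \<in> F" using st(3,4)[OF n] F[of n] by blast+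
    fix y assume "y \<in> F"
    then obtain n where n: "x \<in> (step ^^ n) S" "y \<in> (step ^^ n) S" using fin[of "[x, y]"] x by auto
    show "x + y \<in> F" "x * y \<in> F" using st2[OF n] F[of n] by blast+
  next
    fix p and r :: 'k assume p: "p \<noteq> 0" "set (coeffs p) \<subseteq> F" "poly p r = 0"
    then obtain n where n: "set (coeffs p) \<subseteq> (step ^^ n) S" using fin by blast
    then have "p \<in> Poly ` lists ((step ^^ n) S) - {0}"
      using p(1) by (auto intro!: image_eqI[of _ _ "coeffs p"])
    then have "r \<in> step ((step ^^ n) S)" using p(3) unfolding step_def by blast
    then show "r \<in> F" using F[of n] by blast
  qed
  moreover have "g ` F \<subseteq> F"
  proof safe
    fix x assume "x \<in> F"
    then obtain n where n: "x \<in> (step ^^ n) S" unfolding F_def by blast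
    show "g x \<in> F" using st(5)[OF n] F[of n] by blast
  qed
  moreover have "S \<subseteq> F" using F[of 0] sub[of S] by auto
  moreover have "countable F" using c by (auto simp: F_def)
  ultimately show ?thesis by blast
qed

definition id_on :: "'k set \<Rightarrow> 'k \<Rightarrow> 'k \<Rightarrow> bool" where
  "id_on F x y \<longleftrightarrow> x = y \<and> x \<in> F"

lemma countable_id_on: "countable F \<Longrightarrow> countable {(x, y). id_on F x y}"
proof -
  have "{(x, y). id_on F x y} = (\<lambda>x. (x, x)) ` F" by (auto simp: id_on_def)
  then show "countable F \<Longrightarrow> ?thesis" by simp
qed

context monster begin

lemma id_on_partial_iso:
  fixes F :: "'k set"
  assumes "root_closed F"
  shows "partial_iso v (id_on F)"
  using assms unfolding root_closed_def partial_iso_def id_on_def by blast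

lemma root_closed_nth_root:
  fixes F :: "'k set"
  assumes F: "root_closed F" and c: "c \<in> F" and n: "n > 0"
  shows "\<exists>w\<in>F. w ^ n = c"
proof -
  obtain w where w: "w ^ n = c" using nth_root[OF n] by blast
  have "poly (monom 1 n - [:c:]) w = 0" using w by (simp add: poly_monom)
  moreover have "coeff (monom 1 n - [:c:]) n \<noteq> 0" using n by (simp add: coeff_pCons split: nat.split)
  then have "monom 1 n - [:c:] \<noteq> 0" by (metis coeff_0)
  moreover have "set (coeffs (monom 1 n - [:c:])) \<subseteq> F"
  proof -
    have "coeff (monom 1 n - [:c:]) i \<in> F" for i
      using F c n unfolding root_closed_def by (cases i) (auto simp: coeff_pCons)
    then show ?thesis by (auto simp: coeffs_def)
  qed
  ultimately have "w \<in> F" using F unfolding root_closed_def by blast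
  then show ?thesis using w by blast
qed

lemma root_closed_enum:
  fixes F :: "'k set"
  assumes "countable F" "root_closed F"
  obtains e :: "nat \<Rightarrow> 'k" where "range e = F" "\<And>e0 :: nat \<Rightarrow> 'k. range e0 \<subseteq> F \<Longrightarrow> \<exists>g :: nat \<Rightarrow> nat. \<forall>j. e0 j = e (g j)"
proof
  have "F \<noteq> {}" using assms(2) by (auto simp: root_closed_def)
  then show r: "range (from_nat_into F) = F" using assms(1) by (rule range_from_nat_into)
  fix e0 :: "nat \<Rightarrow> 'k" assume "range e0 \<subseteq> F"
  then have "\<forall>j. \<exists>i. e0 j = from_nat_into F i" using r by blast
  then show "\<exists>g. \<forall>j. e0 j = from_nat_into F (g j)" by metis
qed

text \<open>If \<open>D\<close> had no endpoint, it would contain some \<open>x\<close> below all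
  its members in a countable algebraically closed field \<open>F\<close> of parameters, and omit
  some \<open>y\<close> above all elements of \<open>F\<close> outside \<open>D\<close>. Both have
  new values and lie in the same cut over \<open>F\<close>, so a partial isomorphism fixing
  \<open>F\<close> takes \<open>x\<close> to \<open>y\<close>, against the definition of
  \<open>D\<close>.\<close>

theorem definable_cut:
  assumes Q: "fdef v Q"
    and D: "\<And>x. x \<in> D \<longleftrightarrow> Q (case_nat x e0)"
    and up: "\<And>x y. x \<in> D \<Longrightarrow> x \<preceq> y \<Longrightarrow> y \<in> D" and zero: "0 \<in> D"
  shows "D = UNIV \<or> (\<exists>c. D = {y. c \<preceq> y}) \<or> (\<exists>c. c \<noteq> 0 \<and> D = {y. c \<prec> y})"
proof (rule ccontr)
  assume not: "\<not> ?thesis"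
  have no_min: "\<exists>y\<in>D. y \<prec> x" if x: "x \<in> D" for x
  proof (rule ccontr)
    assume "\<not> (\<exists>y\<in>D. y \<prec> x)"
    then have "D = {y. x \<preceq> y}" using up[OF x] by (auto simp: vless_def)
    then show False using not by blast
  qed
  have no_max: "\<exists>y. y \<notin> D \<and> x \<prec> y" if x: "x \<notin> D" for x
  proof (rule ccontr)
    assume *: "\<not> (\<exists>y. y \<notin> D \<and> x \<prec> y)"
    have "y \<in> D \<longleftrightarrow> x \<prec> y" for y using * up[of y x] x by (auto simp: vless_def)
    then have "D = {y. x \<prec> y}" by blast
    moreover have "x \<noteq> 0" using x zero by blast
    ultimately show False using not by blast
  qed
  obtain F where F: "countable F" "range e0 \<subseteq> F" "root_closed F"
    using ex_root_closed[of "range e0" id] by auto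
  obtain e :: "nat \<Rightarrow> 'k" where e: "range e = F"
    "\<And>e0 :: nat \<Rightarrow> 'k. range e0 \<subseteq> F \<Longrightarrow> \<exists>g :: nat \<Rightarrow> nat. \<forall>j. e0 j = e (g j)"
    using root_closed_enum[OF F(1,3)] by blast
  \<comment> \<open>The parameters of \<open>Q\<close> are re-read through the enumeration of
    \<open>F\<close>, so that \<open>Q\<close> and the order conditions share one
    environment.\<close>
  obtain g :: "nat \<Rightarrow> nat" where g: "e0 = (\<lambda>j. e (g j))" using e(2)[OF F(2)] by auto
  define PQ where "PQ \<epsilon> \<longleftrightarrow> Q (case_nat (\<epsilon> 0) (\<lambda>j. \<epsilon> (Suc (g j))))" for \<epsilon> :: "nat \<Rightarrow> 'k"
  have PQ: "fdef v PQ" unfolding PQ_def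
    by (rule fdef_subst[OF Q, of "\<lambda>i \<epsilon>. case_nat (\<epsilon> 0) (\<lambda>j. \<epsilon> (Suc (g j))) i"])
      (intro fdef_intros)
  have PQe: "PQ (case_nat x e) \<longleftrightarrow> x \<in> D" for x by (simp add: PQ_def D g)
  have "\<exists>x. \<forall>P\<in>insert PQ ((\<lambda>i \<epsilon>. \<epsilon> 0 \<prec> \<epsilon> (Suc i)) ` {i. e i \<in> D}). P (case_nat x e)"
  proof (rule saturation)
    fix P assume "P \<in> insert PQ ((\<lambda>i \<epsilon>. \<epsilon> 0 \<prec> \<epsilon> (Suc i)) ` {i. e i \<in> D})"
    then show "fdef v P" using PQ by (auto simp: vless_def intro!: fdef_intros)
  next
    fix G assume G: "G \<subseteq> insert PQ ((\<lambda>i \<epsilon>. \<epsilon> 0 \<prec> \<epsilon> (Suc i)) ` {i. e i \<in> D})" "finite G"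
    then have "finite (G - {PQ})" "G - {PQ} \<subseteq> (\<lambda>i \<epsilon>. \<epsilon> 0 \<prec> \<epsilon> (Suc i)) ` {i. e i \<in> D}" by auto
    then obtain K where K: "finite K" "K \<subseteq> {i. e i \<in> D}" "G - {PQ} = (\<lambda>i \<epsilon>. \<epsilon> 0 \<prec> \<epsilon> (Suc i)) ` K"
      by (meson finite_subset_image)
    have fin: "finite (insert 0 (e ` K))" using K(1) by simp
    obtain z where z: "z \<in> insert 0 (e ` K)" "\<forall>y\<in>insert 0 (e ` K). z \<preceq> y"
      using ex_vle_min[OF fin, of "\<lambda>x. x"] by blast
    then have "z \<in> D" using K(2) zero by auto
    then obtain x where "x \<in> D" "x \<prec> z" using no_min by blast
    then have "\<forall>P\<in>insert PQ (G - {PQ}). P (case_nat x e)"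
      unfolding K(3) using z(2) PQe vless_vle_trans by auto
    then show "\<exists>x. \<forall>P\<in>G. P (case_nat x e)" by blast
  qed
  then obtain x where x: "x \<in> D" "\<And>i. e i \<in> D \<Longrightarrow> x \<prec> e i" using PQe by auto
  have "\<exists>y. \<forall>P\<in>insert (\<lambda>\<epsilon>. \<not> PQ \<epsilon>) ((\<lambda>i \<epsilon>. \<epsilon> (Suc i) \<prec> \<epsilon> 0) ` {i. e i \<notin> D}). P (case_nat y e)"
  proof (rule saturation)
    fix P assume "P \<in> insert (\<lambda>\<epsilon>. \<not> PQ \<epsilon>) ((\<lambda>i \<epsilon>. \<epsilon> (Suc i) \<prec> \<epsilon> 0) ` {i. e i \<notin> D})"
    then show "fdef v P" using PQ by (auto simp: vless_def intro!: fdef_intros)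
  next
    fix G assume G: "G \<subseteq> insert (\<lambda>\<epsilon>. \<not> PQ \<epsilon>) ((\<lambda>i \<epsilon>. \<epsilon> (Suc i) \<prec> \<epsilon> 0) ` {i. e i \<notin> D})" "finite G"
    then have "finite (G - {\<lambda>\<epsilon>. \<not> PQ \<epsilon>})"
      "G - {\<lambda>\<epsilon>. \<not> PQ \<epsilon>} \<subseteq> (\<lambda>i \<epsilon>. \<epsilon> (Suc i) \<prec> \<epsilon> 0) ` {i. e i \<notin> D}" by auto
    then obtain K where K: "finite K" "K \<subseteq> {i. e i \<notin> D}"
      "G - {\<lambda>\<epsilon>. \<not> PQ \<epsilon>} = (\<lambda>i \<epsilon>. \<epsilon> (Suc i) \<prec> \<epsilon> 0) ` K"
      by (meson finite_subset_image)
    obtain y0 where "y0 \<notin> D" using not by blast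
    have fin: "finite (insert y0 (e ` K))" using K(1) by simp
    obtain z where z: "z \<in> insert y0 (e ` K)" "\<forall>y\<in>insert y0 (e ` K). y \<preceq> z"
      using ex_vle_max[OF fin, of "\<lambda>x. x"] by blast
    then have "z \<notin> D" using K(2) \<open>y0 \<notin> D\<close> by auto
    then obtain y where "y \<notin> D" "z \<prec> y" using no_max by blast
    then have "\<forall>P\<in>insert (\<lambda>\<epsilon>. \<not> PQ \<epsilon>) (G - {\<lambda>\<epsilon>. \<not> PQ \<epsilon>}). P (case_nat y e)"
      unfolding K(3) using z(2) PQe vle_vless_trans by auto
    then show "\<exists>y. \<forall>P\<in>G. P (case_nat y e)" by blast
  qed
  then obtain y where y: "y \<notin> D" "\<And>i. e i \<notin> D \<Longrightarrow> e i \<prec> y" using PQe by auto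
  have xw: "x \<prec> w \<longleftrightarrow> w \<in> D" "\<not> x \<approx> w" and yw: "y \<prec> w \<longleftrightarrow> w \<in> D" "\<not> y \<approx> w" if w: "w \<in> F" for w
  proof -
    obtain i where i: "w = e i" using w e(1) by blast
    show "x \<prec> w \<longleftrightarrow> w \<in> D" using x(2)[of i] x(1) up i vless_imp_vle by blast
    show "y \<prec> w \<longleftrightarrow> w \<in> D" using y(2)[of i] y(1) up i unfolding vless_def by (meson vle_linear)
    show "\<not> x \<approx> w" using x(2)[of i] up[OF x(1), of w] i unfolding veq_def vless_def by blast
    show "\<not> y \<approx> w" using y(2)[of i] up[of w y] y(1) i unfolding veq_def vless_def by blast
  qed
  have I: "partial_iso v (id_on F)" by (rule id_on_partial_iso[OF F(3)])
  interpret I: valued_iso v "id_on F" by unfold_locales (rule I)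
  have "0 \<in> F" using F(3) unfolding root_closed_def by blast
  from xw(2)[OF this] have nz: "x \<noteq> 0" "y \<noteq> 0" using y(1) zero by auto
  have nw: "\<not> x ^ n \<approx> c \<and> \<not> y ^ n \<approx> c'" "x ^ n \<prec> c \<longleftrightarrow> y ^ n \<prec> c'"
    if c: "id_on F c c'" and n: "n > 0" for c c' n
  proof -
    have c': "c' = c" "c \<in> F" using c by (auto simp: id_on_def)
    obtain w where w: "w \<in> F" "w ^ n = c" using root_closed_nth_root[OF F(3) c'(2) n] by blast
    show "\<not> x ^ n \<approx> c \<and> \<not> y ^ n \<approx> c'" "x ^ n \<prec> c \<longleftrightarrow> y ^ n \<prec> c'"
      unfolding c'(1) w(2)[symmetric] veq_power[OF n] vless_power[OF n]
      using xw[OF w(1)] yw[OF w(1)] by blast+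
  qed
  have J: "partial_iso v (iso_ext (id_on F) x y)"
    by (rule I.partial_iso_ext) (rule I.monomial_match[OF nz nw])
  have "Q (case_nat x e0) \<longleftrightarrow> Q (case_nat y e0)"
  proof (rule partial_iso_fdef[OF J I.countable_iso_ext[OF countable_id_on[OF F(1)]] _ Q])
    fix i show "iso_ext (id_on F) x y (case_nat x e0 i) (case_nat y e0 i)"
      using subsetD[OF F(2) rangeI] by (cases i) (auto simp: I.iso_ext_new id_on_def intro!: I.iso_ext_base)
  qed
  then show False using D x(1) y(1) by blast
qed

end

section \<open>Common points of definable chains of balls\<close>

context monster begin

text \<open>A polynomial over \<open>F\<close> factors into differences from elements of
  \<open>F\<close>, and for each of these both points have a common value, attained in
  \<open>F\<close>.\<close>

lemma poly_value_root_closed: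
  fixes F :: "'k set"
  assumes F: "root_closed F" and p: "set (coeffs p) \<subseteq> F" "p \<noteq> 0"
    and lin: "\<And>r. r \<in> F \<Longrightarrow> \<exists>h\<in>F. x - r \<approx> h \<and> y - r \<approx> h"
  shows "\<exists>h\<in>F. poly p x \<approx> h \<and> poly p y \<approx> h"
proof -
  obtain A where A: "p = Polynomial.smult (lead_coeff p) (\<Prod>r\<in>#A. [:- r, 1:])"
    using alg_closed_imp_factorization[OF p(2)] by blast
  obtain rs where "mset rs = A" using ex_mset by blast
  then have f: "p = Polynomial.smult (lead_coeff p) (\<Prod>r\<leftarrow>rs. [:- r, 1:])"
    using A by (metis mset_map prod_mset_prod_list)
  have pl: "poly (\<Prod>r\<leftarrow>rs. [:- r, 1:]) b = (\<Prod>r\<leftarrow>rs. b - r)" for b and rs :: "'k list"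
    by (induction rs) (auto simp: left_diff_distrib)
  have "set rs \<subseteq> F"
  proof
    fix r assume "r \<in> set rs"
    then have "poly p r = 0" by (subst f) (auto simp: pl prod_list_zero_iff)
    then show "r \<in> F" using F p unfolding root_closed_def by blast
  qed
  then have "\<exists>h\<in>F. (\<Prod>r\<leftarrow>rs. x - r) \<approx> h \<and> (\<Prod>r\<leftarrow>rs. y - r) \<approx> h"
  proof (induction rs)
    case Nil
    then show ?case using F by (auto simp: root_closed_def intro!: bexI[of _ 1])
  next
    case (Cons r rs)
    then obtain h where h: "h \<in> F" "(\<Prod>r\<leftarrow>rs. x - r) \<approx> h" "(\<Prod>r\<leftarrow>rs. y - r) \<approx> h" by auto
    obtain k where k: "k \<in> F" "x - r \<approx> k" "y - r \<approx> k" using lin[of r] Cons.prems by auto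
    have "k * h \<in> F" using F h(1) k(1) by (auto simp: root_closed_def)
    then show ?case using veq_mult[OF k(2) h(2)] veq_mult[OF k(3) h(3)] by auto
  qed
  then obtain h where h: "h \<in> F" "(\<Prod>r\<leftarrow>rs. x - r) \<approx> h" "(\<Prod>r\<leftarrow>rs. y - r) \<approx> h" by blast
  have "lead_coeff p \<in> F" using p by (auto simp: coeffs_def)
  then have "lead_coeff p * h \<in> F" using F h(1) by (auto simp: root_closed_def)
  moreover have "poly p x \<approx> lead_coeff p * h" "poly p y \<approx> lead_coeff p * h"
    using veq_mult[OF veq_refl h(2)] veq_mult[OF veq_refl h(3)] by (subst f; simp add: pl)+
  ultimately show ?thesis by blast
qed

text \<open>If the balls had no common point, a point \<open>b1\<close> deep in the chain and a slightly
  shallower \<open>b2\<close> could be exchanged by a partial isomorphism fixing the parameters: all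
  polynomials over \<open>F\<close> have the same value at both, and \<open>v (b1 - b2)\<close> is a new value.\<close>

theorem definable_chain_of_balls:
  fixes B :: "'i \<Rightarrow> 'k set"
  assumes Q: "fdef v Q" and lt: "\<And>a b. (\<exists>i\<in>A. b \<in> B i \<and> a \<notin> B i) \<longleftrightarrow> Q (case_nat a (case_nat b e0))"
    and ne: "\<And>i. i \<in> A \<Longrightarrow> B i \<noteq> {}"
    and chain: "\<And>i j. i \<in> A \<Longrightarrow> j \<in> A \<Longrightarrow> B i \<subseteq> B j \<or> B j \<subseteq> B i"
    and ball: "\<And>i a b c. i \<in> A \<Longrightarrow> a \<in> B i \<Longrightarrow> b \<in> B i \<Longrightarrow> a - b \<preceq> a - c \<Longrightarrow> c \<in> B i"
  shows "\<exists>a. \<forall>i\<in>A. a \<in> B i"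
proof (rule ccontr)
  assume "\<not> ?thesis"
  then have out: "\<exists>i\<in>A. a \<notin> B i" for a by blast
  \<comment> \<open>\<open>lt a b\<close> says that \<open>b\<close> lies deeper in the chain than
    \<open>a\<close>. It is a strict weak order, definable by \<open>Q\<close>.\<close>
  define lt where "lt a b \<longleftrightarrow> (\<exists>i\<in>A. b \<in> B i \<and> a \<notin> B i)" for a b
  have ltQ: "lt a b \<longleftrightarrow> Q (case_nat a (case_nat b e0))" for a b using lt by (simp add: lt_def)
  have asym: "\<not> lt b a" if "lt a b" for a b
    using that chain unfolding lt_def by blast
  have irr: "\<not> lt a a" for a by (simp add: lt_def)
  have trans: "lt a c" if "lt a b" "lt b c" for a b c
    using that chain unfolding lt_def by blast
  have weak: "lt f c" if "lt x c" "\<not> lt x f" for x f c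
    using that unfolding lt_def by blast
  have "\<exists>b. lt a b" for a using out[of a] ne unfolding lt_def by blast
  \<comment> \<open>Every point is omitted by some ball; \<open>w\<close> picks a point of such a
    ball, and \<open>F\<close> will be closed under \<open>w\<close>.\<close>
  then obtain w where w: "\<And>a. lt a (w a)" by metis
  \<comment> \<open>\<open>b\<close> and \<open>c\<close> share a ball that omits \<open>a\<close>.
    So they are closer to each other than to \<open>a\<close>, and \<open>a\<close> is equally far
    from both.\<close>
  have near: "b - a \<prec> b - c" "a - c \<approx> a - b" if ab: "lt a b" and ac: "lt a c" for a b c
  proof -
    obtain k where k: "k \<in> A" "b \<in> B k" "c \<in> B k" "a \<notin> B k"
      using ab ac chain unfolding lt_def by blast
    show 1: "b - a \<prec> b - c" using ball[OF k(1-3), of a] k(4) by (auto simp: vless_def)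
    have "a - b \<prec> b - c" using vless_cong[OF veq_minus_commute veq_refl] 1 by blast
    from veq_add[OF this] show "a - c \<approx> a - b" by simp
  qed
  obtain F where F: "countable F" "range e0 \<subseteq> F" "root_closed F" "w ` F \<subseteq> F"
    using ex_root_closed[of "range e0" w] by auto
  have F0: "0 \<in> F" "\<And>x. x \<in> F \<Longrightarrow> w x \<in> F" "\<And>x y. x \<in> F \<Longrightarrow> y \<in> F \<Longrightarrow> x - y \<in> F"
    using F(3,4) unfolding root_closed_def by (auto, metis add_uminus_conv_diff)
  have cofinal: "\<exists>f\<in>F. \<forall>s\<in>S. lt s f" if "finite S" "S \<subseteq> F" for S
    using that
  proof (induction S rule: finite_induct)
    case (insert x S)
    then obtain f where f: "f \<in> F" "\<forall>s\<in>S. lt s f" by blast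
    show ?case
    proof (cases "lt x f")
      case False
      then have "lt f (w x)" using weak w by blast
      then have "\<forall>s\<in>insert x S. lt s (w x)" using f(2) trans[of _ f "w x"] w by simp
      moreover have "w x \<in> F" using F0(2) insert.prems by simp
      ultimately show ?thesis by blast
    qed (use f in blast)
  qed (use F0 in blast)
  obtain e :: "nat \<Rightarrow> 'k" where e: "range e = F"
    "\<And>e0 :: nat \<Rightarrow> 'k. range e0 \<subseteq> F \<Longrightarrow> \<exists>g :: nat \<Rightarrow> nat. \<forall>j. e0 j = e (g j)"
    using root_closed_enum[OF F(1,3)] by blast
  obtain g :: "nat \<Rightarrow> nat" where g: "e0 = (\<lambda>j. e (g j))" using e(2)[OF F(2)] by auto
  have QQ: "fdef v (\<lambda>\<epsilon>. Q (case_nat (s \<epsilon>) (case_nat (t \<epsilon>) (\<lambda>j. u j \<epsilon>))))"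
    if "tdef s" "tdef t" "\<And>j. tdef (u j)" for s t u
    by (rule fdef_subst[OF Q, of "\<lambda>i \<epsilon>. case_nat (s \<epsilon>) (case_nat (t \<epsilon>) (\<lambda>j. u j \<epsilon>)) i"])
      (intro fdef_intros that)
  define P1 where "P1 i \<epsilon> \<longleftrightarrow> Q (case_nat (\<epsilon> (Suc i)) (case_nat (\<epsilon> 0) (\<lambda>j. \<epsilon> (Suc (g j)))))" for i and \<epsilon> :: "nat \<Rightarrow> 'k"
  have P1: "P1 i (case_nat x e) \<longleftrightarrow> lt (e i) x" for i x by (simp add: P1_def ltQ g)
  have "\<exists>x. \<forall>P\<in>range P1. P (case_nat x e)"
  proof (rule saturation)
    show "fdef v P" if "P \<in> range P1" for P using that unfolding P1_def by (auto intro!: QQ fdef_intros)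
    fix G assume "G \<subseteq> range P1" "finite G"
    then obtain K where K: "finite K" "G = P1 ` K" by (meson finite_subset_image)
    then obtain f where "f \<in> F" "\<forall>s\<in>e ` K. lt s f" using cofinal[of "e ` K"] e(1) by auto
    then show "\<exists>x. \<forall>P\<in>G. P (case_nat x e)" using K P1 by (intro exI[of _ f]) auto
  qed
  then obtain b1 where "\<And>i. lt (e i) b1" using P1 by auto
  then have b1: "lt f b1" if "f \<in> F" for f using e(1) that by auto
  \<comment> \<open>The elements of \<open>F\<close> whose values exceed those of all differences
    between \<open>F\<close> and \<open>b1\<close>. If \<open>b2 - b1\<close> has smaller value than
    all of \<open>H\<close>, while its value exceeds those of the differences, then no value of
    \<open>F\<close> is left for it.\<close>
  define H where "H = {h \<in> F. \<forall>f\<in>F. f - b1 \<prec> h}"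
  let ?e = "case_nat b1 e"
  define P2 where "P2 i \<epsilon> \<longleftrightarrow> Q (case_nat (\<epsilon> (Suc (Suc i))) (case_nat (\<epsilon> 0) (\<lambda>j. \<epsilon> (Suc (Suc (g j))))))" for i and \<epsilon> :: "nat \<Rightarrow> 'k"
  define P3 where "P3 \<epsilon> \<longleftrightarrow> Q (case_nat (\<epsilon> 0) (case_nat (\<epsilon> 1) (\<lambda>j. \<epsilon> (Suc (Suc (g j))))))" for \<epsilon> :: "nat \<Rightarrow> 'k"
  define P4 where "P4 i \<epsilon> \<longleftrightarrow> \<epsilon> 0 - \<epsilon> 1 \<prec> \<epsilon> (Suc (Suc i))" for i and \<epsilon> :: "nat \<Rightarrow> 'k"
  have P: "P2 i (case_nat x ?e) \<longleftrightarrow> lt (e i) x" "P3 (case_nat x ?e) \<longleftrightarrow> lt x b1"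
    "P4 i (case_nat x ?e) \<longleftrightarrow> x - b1 \<prec> e i" for i x
    by (simp_all add: P2_def P3_def P4_def ltQ g)
  have "\<exists>x. \<forall>P\<in>insert P3 (range P2 \<union> P4 ` {i. e i \<in> H}). P (case_nat x ?e)"
  proof (rule saturation)
    show "fdef v P" if "P \<in> insert P3 (range P2 \<union> P4 ` {i. e i \<in> H})" for P
      using that unfolding P2_def P3_def P4_def vless_def by (auto intro!: QQ fdef_intros)
    fix G assume G: "G \<subseteq> insert P3 (range P2 \<union> P4 ` {i. e i \<in> H})" "finite G"
    have "G \<inter> range P2 \<subseteq> range P2" "finite (G \<inter> range P2)" using G by auto
    then obtain K where K: "finite K" "G \<inter> range P2 = P2 ` K" by (meson finite_subset_image)
    then obtain f where f: "f \<in> F" "\<forall>s\<in>e ` K. lt s f" using cofinal[of "e ` K"] e(1) by auto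
    \<comment> \<open>An element of \<open>F\<close> satisfies any finite part: it is less deep than
      \<open>b1\<close> by the choice of \<open>b1\<close>, and its difference from
      \<open>b1\<close> lies below \<open>H\<close> by definition of \<open>H\<close>.\<close>
    have "P (case_nat f ?e)" if PG: "P \<in> G" for P
    proof -
      consider "P = P3" | i where "P = P4 i" "e i \<in> H" | "P \<in> P2 ` K" using G(1) PG K(2) by blast
      then show ?thesis
      proof cases
        case 1
        then show ?thesis using P b1 f by simp
      next
        case 2
        then show ?thesis using P(3) f(1) by (simp add: H_def)
      next
        case 3
        then show ?thesis using P f(2) by auto
      qed
    qed
    then show "\<exists>x. \<forall>P\<in>G. P (case_nat x ?e)" by blast
  qed
  then obtain b2 where b2P: "\<forall>P\<in>insert P3 (range P2 \<union> P4 ` {i. e i \<in> H}). P (case_nat b2 ?e)" by blast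
  have b21: "lt b2 b1" using b2P P(2)[of b2] by blast
  have b2: "lt f b2" if fF: "f \<in> F" for f
  proof -
    obtain i where i: "f = e i" using e(1) fF by blast
    then show ?thesis using b2P P(1)[of i b2] by blast
  qed
  have b2H: "b2 - b1 \<prec> h" if hH: "h \<in> H" for h
  proof -
    obtain i where i: "h = e i" using e(1) hH unfolding H_def by blast
    then show ?thesis using b2P P(3)[of i b2] hH by blast
  qed
  define d where "d = b2 - b1"
  have d0: "d \<noteq> 0" using b21 irr by (auto simp: d_def)
  have d_new: "\<not> d \<approx> h" if h: "h \<in> F" for h
  proof
    assume dh: "d \<approx> h"
    have "f - b1 \<prec> h" if f: "f \<in> F" for f
    proof -
      have "b1 - f \<prec> b1 - b2" by (rule near(1)[OF b1[OF f] b2[OF f]])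
      then have "f - b1 \<prec> d" unfolding d_def using vless_cong[OF veq_minus_commute veq_minus_commute] by blast
      then show ?thesis using vless_cong[OF veq_refl dh] by blast
    qed
    then have "d \<prec> h" using b2H h by (simp add: H_def d_def)
    then show False using veq_not_vless[OF dh] by blast
  qed
  have I: "partial_iso v (id_on F)" by (rule id_on_partial_iso[OF F(3)])
  interpret I: valued_iso v "id_on F" by unfold_locales (rule I)
  have pv: "\<exists>h\<in>F. poly p b1 \<approx> h \<and> poly p' b2 \<approx> h" if r: "relp (id_on F) p p'" for p p'
  proof (cases "p = 0")
    case True
    then show ?thesis using r I.relp_zero_iff F0(1) by fastforce
  next
    case False
    have p': "p' = p" using r by (simp add: relp_def poly_eq_iff id_on_def)
    have "coeff p i \<in> F" for i using r unfolding relp_def id_on_def by blast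
    then have "set (coeffs p) \<subseteq> F" by (auto simp: coeffs_def)
    moreover have "\<exists>h\<in>F. b1 - f \<approx> h \<and> b2 - f \<approx> h" if f: "f \<in> F" for f
    proof (rule bexI[of _ "f - w f"])
      show "f - w f \<in> F" using F0 f by blast
      have "f - b1 \<approx> f - w f" "f - b2 \<approx> f - w f"
        using near(2)[OF w b1[OF f]] near(2)[OF w b2[OF f]] by blast+
      then show "b1 - f \<approx> f - w f \<and> b2 - f \<approx> f - w f"
        using veq_minus_commute veq_trans by blast
    qed
    ultimately show ?thesis using poly_value_root_closed[OF F(3) _ False] p' by blast
  qed
  have veq_vle: "x \<approx> h \<Longrightarrow> x' \<approx> h \<Longrightarrow> y \<approx> k \<Longrightarrow> y' \<approx> k \<Longrightarrow> x \<preceq> y \<longleftrightarrow> x' \<preceq> y'" for x x' y y' h k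
    using vle_cong by blast
  define I1 where "I1 = iso_ext (id_on F) b1 b2"
  have I1: "partial_iso v I1" unfolding I1_def
  proof (rule I.partial_iso_ext)
    fix p p' q q' assume pq: "relp (id_on F) p p'" "relp (id_on F) q q'"
    obtain h k where "poly p b1 \<approx> h" "poly p' b2 \<approx> h" "poly q b1 \<approx> k" "poly q' b2 \<approx> k"
      using pv[OF pq(1)] pv[OF pq(2)] by blast
    then show "poly p b1 \<preceq> poly q b1 \<longleftrightarrow> poly p' b2 \<preceq> poly q' b2" by (rule veq_vle)
  qed
  interpret I1: valued_iso v I1 by unfold_locales (rule I1)
  have I1v: "\<exists>h\<in>F. x \<approx> h \<and> y \<approx> h" if xy: "I1 x y" for x y
  proof -
    obtain p p' q q' where pq: "relp (id_on F) p p'" "relp (id_on F) q q'" "x = poly p b1 / poly q b1" "y = poly p' b2 / poly q' b2"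
      "poly q b1 \<noteq> 0" "poly q' b2 \<noteq> 0" using xy unfolding I1_def iso_ext_def by blast
    obtain h k where hk: "h \<in> F" "poly p b1 \<approx> h" "poly p' b2 \<approx> h" "k \<in> F" "poly q b1 \<approx> k" "poly q' b2 \<approx> k"
      using pv[OF pq(1)] pv[OF pq(2)] by blast
    have inv: "inverse a \<approx> inverse b" if "a \<approx> b" "a \<noteq> 0" for a b
      using that by (auto simp: veq_iff v_inverse)
    have "h * inverse k \<in> F" using hk F(3) by (auto simp: root_closed_def)
    moreover have "x \<approx> h * inverse k" "y \<approx> h * inverse k"
      unfolding pq(3,4) divide_inverse using hk inv pq(5,6) by (auto intro!: veq_mult)
    ultimately show ?thesis by blast
  qed
  have nw: "\<not> d ^ n \<approx> c \<and> \<not> (- d) ^ n \<approx> c'" "d ^ n \<prec> c \<longleftrightarrow> (- d) ^ n \<prec> c'"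
    if c: "I1 c c'" and n: "n > 0" for c c' n
  proof -
    obtain h where h: "h \<in> F" "c \<approx> h" "c' \<approx> h" using I1v[OF c] by blast
    obtain u where u: "u \<in> F" "h = u ^ n" using root_closed_nth_root[OF F(3) h(1) n] by blast
    have m: "(- d) ^ n \<approx> d ^ n" using n by (simp add: veq_power)
    have "\<not> d ^ n \<approx> h" using d_new[OF u(1)] n by (simp add: u(2) veq_power)
    then show "\<not> d ^ n \<approx> c \<and> \<not> (- d) ^ n \<approx> c'"
      using veq_trans[OF _ h(2), of "d ^ n"] veq_trans[OF veq_trans[OF veq_sym[OF m] _] h(3)] by blast
    show "d ^ n \<prec> c \<longleftrightarrow> (- d) ^ n \<prec> c'"
      using vless_cong[OF veq_refl h(2)] vless_cong[OF m h(3)] by blast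
  qed
  \<comment> \<open>The extension by \<open>b1\<close> and \<open>b2\<close> adds no values, so
    \<open>d\<close> has a new value over it and may be sent to \<open>- d\<close>. As
    \<open>b2\<close> is \<open>b1 + d\<close>, the resulting map exchanges \<open>b1\<close> and
    \<open>b2\<close>.\<close>
  define J where "J = iso_ext I1 d (- d)"
  have J: "partial_iso v J" unfolding J_def
    by (rule I1.partial_iso_ext) (rule I1.monomial_match[OF d0 _ nw], use d0 in auto)
  interpret J: valued_iso v J by unfold_locales (rule J)
  have I1J: "J x y" if "I1 x y" for x y unfolding J_def using that by (rule I1.iso_ext_base)
  have J1: "J b1 b2" by (rule I1J) (simp add: I1_def I.iso_ext_new)
  have "J d (- d)" by (simp add: J_def I1.iso_ext_new)
  from J.I_add[OF J1 this] have J2: "J b2 b1" by (simp add: d_def)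
  have JF: "J f f" if "f \<in> F" for f
    by (rule I1J) (unfold I1_def, rule I.iso_ext_base, simp add: id_on_def that)
  have cJ: "countable {(x, y). J x y}"
    unfolding J_def by (rule I1.countable_iso_ext) (unfold I1_def, rule I.countable_iso_ext[OF countable_id_on[OF F(1)]])
  have "Q (case_nat b2 (case_nat b1 e0)) \<longleftrightarrow> Q (case_nat b1 (case_nat b2 e0))"
  proof (rule partial_iso_fdef[OF J cJ _ Q])
    fix i show "J (case_nat b2 (case_nat b1 e0) i) (case_nat b1 (case_nat b2 e0) i)"
      using subsetD[OF F(2) rangeI] J1 J2 by (auto intro!: JF split: nat.split)
  qed
  then show False using b21 asym ltQ by blast
qed

end

section \<open>Splitting bases\<close>

lemma tdef_vec_index [fdef_intros]:
  "(\<And>j. j < n \<Longrightarrow> tdef (t j)) \<Longrightarrow> i < n \<Longrightarrow> tdef (\<lambda>e. vec n (\<lambda>j. t j e) $ i)"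
  by simp

text \<open>The valued vector space seen through its relation alone, the value set being eliminated.
  In \<open>R_definable\<close> the first vector occupies the positions below \<open>m\<close>, the
  second the next \<open>m\<close>, and the parameters follow.\<close>

locale vvs_rel = monster v \<kappa>
  for v :: "'k::alg_closed_field \<Rightarrow> 'g::linordered_ab_group_add" and \<kappa> :: "'c rel" +
  fixes m :: nat and R :: "'k vec rel"
  assumes R_carrier: "(x, y) \<in> R \<Longrightarrow> x \<in> carrier_vec m \<and> y \<in> carrier_vec m"
    and R_linear: "x \<in> carrier_vec m \<Longrightarrow> y \<in> carrier_vec m \<Longrightarrow> (x, y) \<in> R \<or> (y, x) \<in> R"
    and R_trans: "(x, y) \<in> R \<Longrightarrow> (y, z) \<in> R \<Longrightarrow> (x, z) \<in> R"
    and R_zero: "x \<in> carrier_vec m \<Longrightarrow> (x, 0\<^sub>v m) \<in> R" "(0\<^sub>v m, y) \<in> R \<Longrightarrow> y = 0\<^sub>v m"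
    and R_add: "(x, y) \<in> R \<Longrightarrow> (x, z) \<in> R \<Longrightarrow> (x, y + z) \<in> R"
    and R_scale: "x \<in> carrier_vec m \<Longrightarrow> x \<noteq> 0\<^sub>v m \<Longrightarrow> (a \<cdot>\<^sub>v x, b \<cdot>\<^sub>v x) \<in> R \<longleftrightarrow> vdiv v a b"
    and R_smult: "(x, y) \<in> R \<Longrightarrow> a \<noteq> 0 \<Longrightarrow> (a \<cdot>\<^sub>v x, a \<cdot>\<^sub>v y) \<in> R"
    and R_definable: "\<exists>RP e0. fdef v RP \<and> (\<forall>x\<in>carrier_vec m. \<forall>y\<in>carrier_vec m. (x, y) \<in> R \<longleftrightarrow>
       RP (\<lambda>n. if n < m then x $ n else if n < 2 * m then y $ (n - m) else e0 (n - 2 * m)))"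
begin

lemma R_refl: "x \<in> carrier_vec m \<Longrightarrow> (x, x) \<in> R"
  using R_linear by blast

lemma R_uminus: "(x, y) \<in> R \<Longrightarrow> (x, - y) \<in> R"
proof -
  assume xy: "(x, y) \<in> R"
  then have y: "y \<in> carrier_vec m" using R_carrier by blast
  show ?thesis
  proof (cases "y = 0\<^sub>v m")
    case True
    then show ?thesis using xy by simp
  next
    case False
    have "(1 \<cdot>\<^sub>v y, (- 1) \<cdot>\<^sub>v y) \<in> R" using R_scale[OF y False, of 1 "- 1"] by simp
    moreover have "(- 1) \<cdot>\<^sub>v y = - y" using y by (intro eq_vecI) auto
    ultimately show ?thesis using R_trans[OF xy] y by simp
  qed
qed

lemma R_diff: "(x, y) \<in> R \<Longrightarrow> (x, z) \<in> R \<Longrightarrow> (x, y - z) \<in> R"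
  using R_add[of x y "- z"] R_uminus[of x z] R_carrier
  by (metis minus_add_uminus_vec)

text \<open>A best approximation of a unit vector from the span of the earlier columns.
  \<open>S i a\<close> is a ball around \<open>a $ i\<close>, and a better approximation gives a
  smaller ball, so these balls form a definable chain. Common points of the chains, one for each
  coordinate, are the coordinates of a best approximation, because the earlier columns
  split.\<close>

lemma splitting_step:
  assumes B: "B \<in> carrier_mat m m" and k: "k < m"
    and diag: "\<And>i. i < m \<Longrightarrow> B $$ (i, i) = 1" and tri: "\<And>i j. j < i \<Longrightarrow> i < m \<Longrightarrow> B $$ (i, j) = 0"
    and unit: "\<And>j. k \<le> j \<Longrightarrow> j < m \<Longrightarrow> col B j = unit_vec m j"
    and split: "\<And>a y. a \<in> carrier_vec m \<Longrightarrow> (\<forall>i<m. k \<le> i \<longrightarrow> a $ i = 0) \<Longrightarrow> y \<in> carrier_vec m \<Longrightarrow>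
      (y, B *\<^sub>v a) \<in> R \<longleftrightarrow> (\<forall>i<k. (y, a $ i \<cdot>\<^sub>v col B i) \<in> R)"
  shows "\<exists>a\<in>carrier_vec m. (\<forall>i<m. k \<le> i \<longrightarrow> a $ i = 0) \<and>
    (\<forall>b\<in>carrier_vec m. (\<forall>i<m. k \<le> i \<longrightarrow> b $ i = 0) \<longrightarrow> (unit_vec m k - B *\<^sub>v b, unit_vec m k - B *\<^sub>v a) \<in> R)"
proof -
  define A :: "'k vec set" where "A = {a \<in> carrier_vec m. \<forall>i<m. k \<le> i \<longrightarrow> a $ i = 0}"
  define y where "y a = unit_vec m k - B *\<^sub>v a" for a
  have yC: "y a \<in> carrier_vec m" for a using carrier_matD[OF B] by (intro carrier_vecI) (simp add: y_def)
  have Adiff: "a - b \<in> A" if "a \<in> A" "b \<in> A" for a b using that by (auto simp: A_def)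
  have yd: "y a - y b = B *\<^sub>v (b - a)" if "a \<in> A" "b \<in> A" for a b
  proof -
    have "B *\<^sub>v (b - a) = B *\<^sub>v b - B *\<^sub>v a"
      using B that by (auto simp: A_def mult_minus_distrib_mat_vec)
    then show ?thesis using B by (intro eq_vecI) (auto simp: y_def)
  qed
  have colC: "col B i \<in> carrier_vec m" for i using B by auto
  have col0: "col B i \<noteq> 0\<^sub>v m" if "i < m" for i
  proof
    assume "col B i = 0\<^sub>v m"
    then have "col B i $ i = 0" using that by simp
    then show False using diag[OF that] that B by simp
  qed
  define S where "S i a = {c. (y a, (c - a $ i) \<cdot>\<^sub>v col B i) \<in> R}" for i a
  have "\<exists>c. \<forall>a\<in>A. c \<in> S i a" if i: "i < k" for i
  proof -
    have im: "i < m" using i k by simp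
    obtain RP eR where RP: "fdef v RP" and R: "\<And>x y. x \<in> carrier_vec m \<Longrightarrow> y \<in> carrier_vec m \<Longrightarrow> (x, y) \<in> R \<longleftrightarrow>
       RP (\<lambda>n. if n < m then x $ n else if n < 2 * m then y $ (n - m) else eR (n - 2 * m))"
      using R_definable by blast
    \<comment> \<open>Parameters of the chain: the entries of \<open>B\<close> row by row, followed
      by the parameters of \<open>R\<close>.\<close>
    define e0 where "e0 j = (if j < m * m then B $$ (j div m, j mod m) else eR (j - m * m))" for j
    have e0B: "e0 (r * m + j) = B $$ (r, j)" if "r < m" "j < m" for r j
    proof -
      have "r * m + j < m * m" using mult_le_mono1[of "Suc r" m m] that by simp
      then show ?thesis using that by (simp add: e0_def)
    qed
    have e0R: "e0 (m * m + n - 2 * m) = eR (n - 2 * m)" if "\<not> n < 2 * m" for n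
    proof -
      have "m * m + n - 2 * m = m * m + (n - 2 * m)" using that by simp
      then show ?thesis unfolding e0_def by simp
    qed
    define yy where "yy \<epsilon> a n = (if n = k then 1 else 0) - (\<Sum>j<m. \<epsilon> (Suc (Suc (n * m + j))) * a $ j)"
      for \<epsilon> :: "nat \<Rightarrow> 'k" and a n
    define RQ where "RQ \<epsilon> a c \<longleftrightarrow> RP (\<lambda>n. if n < m then yy \<epsilon> a n else if n < 2 * m
      then (c - a $ i) * \<epsilon> (Suc (Suc ((n - m) * m + i))) else \<epsilon> (Suc (Suc (m * m + (n - 2 * m)))))"
      for \<epsilon> :: "nat \<Rightarrow> 'k" and a c
    \<comment> \<open>Positions 0 and 1 hold the two points that a ball is to separate; the index
      \<open>a\<close> of the ball is quantified.\<close>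
    define Q where "Q \<epsilon> \<longleftrightarrow> (\<exists>a\<in>carrier_vec m. (\<forall>j<m. k \<le> j \<longrightarrow> a $ j = 0) \<and> RQ \<epsilon> a (\<epsilon> 1) \<and> \<not> RQ \<epsilon> a (\<epsilon> 0))"
      for \<epsilon> :: "nat \<Rightarrow> 'k"
    have "fdef v Q" unfolding Q_def RQ_def yy_def
      by (intro fdef_intros fdef_subst[OF RP] im; simp)
    have yy: "yy (case_nat c (case_nat d e0)) a n = y a $ n" if "a \<in> carrier_vec m" "n < m" for c d a n
      using that B k by (simp add: yy_def y_def e0B scalar_prod_def lessThan_atLeast0)
    have RQ: "RQ (case_nat c (case_nat d e0)) a b \<longleftrightarrow> b \<in> S i a" if a: "a \<in> carrier_vec m" for c d a b
    proof -
      have "(\<lambda>n. if n < m then yy (case_nat c (case_nat d e0)) a n else if n < 2 * m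
          then (b - a $ i) * e0 ((n - m) * m + i) else e0 (m * m + (n - 2 * m))) =
        (\<lambda>n. if n < m then y a $ n else if n < 2 * m then ((b - a $ i) \<cdot>\<^sub>v col B i) $ (n - m) else eR (n - 2 * m))"
        using B im a by (intro ext) (auto simp: yy e0B e0R)
      then show ?thesis using R[OF yC iffD2[OF smult_carrier_vec colC], of a "b - a $ i" i]
        by (simp only: RQ_def S_def mem_Collect_eq nat.case)
    qed
    show ?thesis
    proof (rule definable_chain_of_balls[OF \<open>fdef v Q\<close>, of A "S i" e0])
      show "(\<exists>a\<in>A. d \<in> S i a \<and> c \<notin> S i a) \<longleftrightarrow> Q (case_nat c (case_nat d e0))" for c d
        unfolding Q_def using RQ by (auto simp: A_def)
      show "S i a \<noteq> {}" if "a \<in> A" for a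
      proof -
        have "0 \<cdot>\<^sub>v col B i = 0\<^sub>v m" using colC[of i] B by (intro eq_vecI) auto
        then have "a $ i \<in> S i a" using R_zero(1)[OF yC] by (simp add: S_def)
        then show ?thesis by blast
      qed
      have sub: "S i b \<subseteq> S i a" if ab: "a \<in> A" "b \<in> A" and le: "(y a, y b) \<in> R" for a b
      proof
        fix c assume "c \<in> S i b"
        then have 1: "(y a, (c - b $ i) \<cdot>\<^sub>v col B i) \<in> R" using R_trans[OF le] by (simp add: S_def)
        have "(y a, B *\<^sub>v (b - a)) \<in> R"
          using R_diff[OF R_refl[OF yC] le] yd[OF ab] by simp
        then have 2: "(y a, (b - a) $ i \<cdot>\<^sub>v col B i) \<in> R"
          using split[of "b - a" "y a"] Adiff[OF ab(2,1)] yC i by (simp add: A_def)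
        have "(c - b $ i) \<cdot>\<^sub>v col B i + (b - a) $ i \<cdot>\<^sub>v col B i = (c - a $ i) \<cdot>\<^sub>v col B i"
          using ab im colC[of i] B by (intro eq_vecI) (auto simp: A_def left_diff_distrib)
        then show "c \<in> S i a" using R_add[OF 1 2] by (simp add: S_def)
      qed
      show "S i a \<subseteq> S i b \<or> S i b \<subseteq> S i a" if "a \<in> A" "b \<in> A" for a b
        using sub[OF that] sub[OF that(2,1)] R_linear[OF yC yC] by blast
      show "d \<in> S i a" if "a \<in> A" "b \<in> S i a" "c \<in> S i a" "b - c \<preceq> b - d" for a b c d
      proof -
        have b: "(y a, (b - a $ i) \<cdot>\<^sub>v col B i) \<in> R" and c: "(y a, (c - a $ i) \<cdot>\<^sub>v col B i) \<in> R"
          using that(2,3) by (auto simp: S_def)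
        have e: "(b - a $ i) \<cdot>\<^sub>v col B i - (c - a $ i) \<cdot>\<^sub>v col B i = (b - c) \<cdot>\<^sub>v col B i"
          "(b - a $ i) \<cdot>\<^sub>v col B i - (b - d) \<cdot>\<^sub>v col B i = (d - a $ i) \<cdot>\<^sub>v col B i"
          using colC[of i] B by (intro eq_vecI; simp add: algebra_simps)+
        have "(y a, (b - c) \<cdot>\<^sub>v col B i) \<in> R" using R_diff[OF b c] e by simp
        moreover have "((b - c) \<cdot>\<^sub>v col B i, (b - d) \<cdot>\<^sub>v col B i) \<in> R"
          using R_scale[OF colC col0[OF im]] that(4) by simp
        ultimately have "(y a, (b - d) \<cdot>\<^sub>v col B i) \<in> R" by (rule R_trans)
        then have "(y a, (d - a $ i) \<cdot>\<^sub>v col B i) \<in> R" using R_diff[OF b] e(2) by metis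
        then show ?thesis by (simp add: S_def)
      qed
    qed
  qed
  then obtain c where c: "\<And>i a. i < k \<Longrightarrow> a \<in> A \<Longrightarrow> c i \<in> S i a" by metis
  define a where "a = vec m (\<lambda>i. if i < k then c i else 0)"
  have aA: "a \<in> A" by (auto simp: A_def a_def)
  have "(y b, y a) \<in> R" if b: "b \<in> A" for b
  proof -
    have "(y b, B *\<^sub>v (a - b)) \<in> R"
    proof (subst split)
      show "\<forall>i<k. (y b, (a - b) $ i \<cdot>\<^sub>v col B i) \<in> R"
        using c[OF _ b] k b by (auto simp: S_def a_def A_def)
    qed (use Adiff[OF aA b] yC in \<open>auto simp: A_def\<close>)
    then have "(y b, y b - (y b - y a)) \<in> R" using R_diff[OF R_refl[OF yC]] yd[OF b aA] by simp
    moreover have "y b - (y b - y a) = y a" using yC[of a] yC[of b] by (intro eq_vecI) auto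
    ultimately show ?thesis by simp
  qed
  then show ?thesis using aA unfolding A_def y_def by blast
qed

text \<open>A Gram-Schmidt process: each unit vector is corrected by its best approximation from the
  earlier columns. The matrix stays unitriangular, hence invertible.\<close>

theorem splitting_basis:
  "\<exists>B\<in>carrier_mat m m. det B \<noteq> 0 \<and> (\<forall>a\<in>carrier_vec m. \<forall>y\<in>carrier_vec m.
     (y, B *\<^sub>v a) \<in> R \<longleftrightarrow> (\<forall>i<m. (y, a $ i \<cdot>\<^sub>v col B i) \<in> R))"
proof -
  have "\<exists>B\<in>carrier_mat m m. (\<forall>i<m. B $$ (i, i) = 1) \<and> (\<forall>i<m. \<forall>j<i. B $$ (i, j) = 0) \<and>
      (\<forall>j<m. k \<le> j \<longrightarrow> col B j = unit_vec m j) \<and>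
      (\<forall>a\<in>carrier_vec m. \<forall>y\<in>carrier_vec m. (\<forall>i<m. k \<le> i \<longrightarrow> a $ i = 0) \<longrightarrow>
        (y, B *\<^sub>v a) \<in> R \<longleftrightarrow> (\<forall>i<k. (y, a $ i \<cdot>\<^sub>v col B i) \<in> R))" if "k \<le> m" for k
    using that
  proof (induction k)
    case 0
    have "1\<^sub>m m *\<^sub>v a = 0\<^sub>v m" if "a \<in> carrier_vec m" "\<forall>i<m. a $ i = 0" for a :: "'k vec"
      using that by (intro eq_vecI) auto
    then show ?case using R_zero(1) by (intro bexI[of _ "1\<^sub>m m"]) auto
  next
    case (Suc k)
    then have k: "k < m" by simp
    obtain B where B: "B \<in> carrier_mat m m" "\<And>i. i < m \<Longrightarrow> B $$ (i, i) = 1"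
      "\<And>i j. j < i \<Longrightarrow> i < m \<Longrightarrow> B $$ (i, j) = 0" "\<And>j. k \<le> j \<Longrightarrow> j < m \<Longrightarrow> col B j = unit_vec m j"
      "\<And>a y. a \<in> carrier_vec m \<Longrightarrow> \<forall>i<m. k \<le> i \<longrightarrow> a $ i = 0 \<Longrightarrow> y \<in> carrier_vec m \<Longrightarrow>
        (y, B *\<^sub>v a) \<in> R \<longleftrightarrow> (\<forall>i<k. (y, a $ i \<cdot>\<^sub>v col B i) \<in> R)"
      using Suc.IH k by auto
    obtain a0 where a0: "a0 \<in> carrier_vec m" "\<forall>i<m. k \<le> i \<longrightarrow> a0 $ i = 0"
      "\<And>b. b \<in> carrier_vec m \<Longrightarrow> \<forall>i<m. k \<le> i \<longrightarrow> b $ i = 0 \<Longrightarrow>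
        (unit_vec m k - B *\<^sub>v b, unit_vec m k - B *\<^sub>v a0) \<in> R"
      using splitting_step[OF B(1) k B(2-5)] by blast
    define b where "b = unit_vec m k - B *\<^sub>v a0"
    have bC: "b \<in> carrier_vec m" using carrier_matD[OF B(1)] by (intro carrier_vecI) (simp add: b_def)
    define B' where "B' = mat m m (\<lambda>(i, j). if j = k then b $ i else B $$ (i, j))"
    have B'C: "B' \<in> carrier_mat m m" by (simp add: B'_def)
    have Ba0: "(B *\<^sub>v a0) $ i = 0" if "i < m" "k \<le> i" for i
    proof -
      have "(B *\<^sub>v a0) $ i = (\<Sum>j<m. B $$ (i, j) * a0 $ j)"
        using B(1) a0(1) that(1) by (simp add: scalar_prod_def lessThan_atLeast0)
      also have "\<dots> = 0"
      proof (rule sum.neutral, rule ballI)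
        fix j assume "j \<in> {..<m}"
        then show "B $$ (i, j) * a0 $ j = 0"
          using a0(2) B(3)[of j i] that by (cases "k \<le> j") auto
      qed
      finally show ?thesis .
    qed
    have colk: "col B' k = b" using k bC by (intro eq_vecI) (auto simp: B'_def)
    have coli: "col B' j = col B j" if "j < m" "j \<noteq> k" for j
      using that B(1) by (intro eq_vecI) (auto simp: B'_def)
    have B'a: "B' *\<^sub>v a = B *\<^sub>v a' + a $ k \<cdot>\<^sub>v b"
      if a: "a \<in> carrier_vec m" and a': "a' = vec m (\<lambda>i. if i = k then 0 else a $ i)" for a a'
    proof (rule eq_vecI)
      fix i assume "i < dim_vec (B *\<^sub>v a' + a $ k \<cdot>\<^sub>v b)"
      then have i: "i < m" using bC by simp
      have "(B' *\<^sub>v a) $ i = (\<Sum>j<m. (if j = k then b $ i else B $$ (i, j)) * a $ j)"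
        using a i by (simp add: B'_def scalar_prod_def lessThan_atLeast0)
      also have "\<dots> = (\<Sum>j<m. B $$ (i, j) * a' $ j + (if j = k then a $ k * b $ i else 0))"
        by (intro sum.cong) (auto simp: a')
      also have "\<dots> = (B *\<^sub>v a' + a $ k \<cdot>\<^sub>v b) $ i"
        using i k B(1) bC by (simp add: sum.distrib scalar_prod_def lessThan_atLeast0 a')
      finally show "(B' *\<^sub>v a) $ i = (B *\<^sub>v a' + a $ k \<cdot>\<^sub>v b) $ i" .
    qed (use bC in \<open>simp add: B'_def\<close>)
    have main: "(y, B' *\<^sub>v a) \<in> R \<longleftrightarrow> (\<forall>i<Suc k. (y, a $ i \<cdot>\<^sub>v col B' i) \<in> R)"
      if a: "a \<in> carrier_vec m" "\<forall>i<m. Suc k \<le> i \<longrightarrow> a $ i = 0" and y: "y \<in> carrier_vec m" for a y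
    proof -
      define a' where "a' = vec m (\<lambda>i. if i = k then 0 else a $ i)"
      define w where "w = B *\<^sub>v a'"
      have a'C: "a' \<in> carrier_vec m" "\<forall>i<m. k \<le> i \<longrightarrow> a' $ i = 0" using a by (auto simp: a'_def)
      have wC: "w \<in> carrier_vec m" using carrier_matD[OF B(1)] by (intro carrier_vecI) (simp add: w_def)
      have z: "B' *\<^sub>v a = w + a $ k \<cdot>\<^sub>v b" unfolding w_def by (rule B'a[OF a(1) a'_def])
      \<comment> \<open>Divided by \<open>a $ k\<close>, the left side is a competitor of
        \<open>b\<close> in the approximation of the unit vector, and \<open>b\<close> has the
        greatest value among these. So adding \<open>w\<close> cannot increase the value.\<close>
      have zb: "(w + a $ k \<cdot>\<^sub>v b, a $ k \<cdot>\<^sub>v b) \<in> R"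
      proof (cases "a $ k = 0")
        case True
        then have "a $ k \<cdot>\<^sub>v b = 0\<^sub>v m" using bC by (intro eq_vecI) auto
        then show ?thesis using R_zero(1) wC by simp
      next
        case False
        define a1 where "a1 = a0 - inverse (a $ k) \<cdot>\<^sub>v a'"
        have a1: "a1 \<in> carrier_vec m" "\<forall>i<m. k \<le> i \<longrightarrow> a1 $ i = 0"
          using a0(1,2) a'C by (auto simp: a1_def)
        have "B *\<^sub>v a1 = B *\<^sub>v a0 - inverse (a $ k) \<cdot>\<^sub>v w"
          unfolding a1_def w_def using B(1) a0(1) a'C(1)
          by (simp add: mult_minus_distrib_mat_vec mult_mat_vec)
        then have "a $ k \<cdot>\<^sub>v (unit_vec m k - B *\<^sub>v a1) = w + a $ k \<cdot>\<^sub>v b"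
          using wC B(1) False by (intro eq_vecI) (auto simp: b_def field_simps)
        then show ?thesis using R_smult[OF a0(3)[OF a1] False] by (simp add: b_def)
      qed
      have "(y, w + a $ k \<cdot>\<^sub>v b) \<in> R \<longleftrightarrow> (y, w) \<in> R \<and> (y, a $ k \<cdot>\<^sub>v b) \<in> R"
      proof
        assume *: "(y, w + a $ k \<cdot>\<^sub>v b) \<in> R"
        then have 1: "(y, a $ k \<cdot>\<^sub>v b) \<in> R" using zb R_trans by blast
        have "w + a $ k \<cdot>\<^sub>v b - a $ k \<cdot>\<^sub>v b = w" using wC bC by (intro eq_vecI) auto
        then show "(y, w) \<in> R \<and> (y, a $ k \<cdot>\<^sub>v b) \<in> R" using R_diff[OF * 1] 1 by simp
      qed (use R_add in blast)
      moreover have "(y, w) \<in> R \<longleftrightarrow> (\<forall>i<k. (y, a $ i \<cdot>\<^sub>v col B' i) \<in> R)"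
        unfolding w_def B(5)[OF a'C y] using k coli by (auto simp: a'_def)
      ultimately show ?thesis unfolding z by (auto simp: less_Suc_eq colk)
    qed
    have "B' $$ (i, i) = 1" if "i < m" for i
      using that B(1,2) Ba0 by (auto simp: B'_def b_def)
    moreover have "B' $$ (i, j) = 0" if "j < i" "i < m" for i j
      using that B(1,3) Ba0 k by (auto simp: B'_def b_def)
    moreover have "col B' j = unit_vec m j" if "Suc k \<le> j" "j < m" for j
      using coli[of j] B(4)[of j] that by simp
    ultimately show ?case using B'C main by (intro bexI[of _ B']) blast+
  qed
  from this[of m] obtain B where B: "B \<in> carrier_mat m m" "\<forall>i<m. B $$ (i, i) = 1" "\<forall>i<m. \<forall>j<i. B $$ (i, j) = 0"
    "\<And>a y. a \<in> carrier_vec m \<Longrightarrow> y \<in> carrier_vec m \<Longrightarrow>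
      (y, B *\<^sub>v a) \<in> R \<longleftrightarrow> (\<forall>i<m. (y, a $ i \<cdot>\<^sub>v col B i) \<in> R)" by auto
  have "det B = prod_list (diag_mat B)"
    by (rule det_upper_triangular[of _ m]) (use B in \<open>auto intro!: upper_triangularI\<close>)
  also have "\<dots> = 1" unfolding prod_list_diag_prod using B(1,2) by simp
  finally show ?thesis using B by (intro bexI[of _ B]) auto
qed

end

section \<open>The endomorphism module of a valued vector space\<close>

lemma monster_of_monster_model: "monster_model \<kappa> v \<Longrightarrow> monster v \<kappa>"
  by unfold_locales (auto simp: monster_model_def ACVF_def)

lemma rel_tuples_iff:
  assumes "\<And>x y. (x, y) \<in> R \<Longrightarrow> x \<in> carrier_vec m \<and> y \<in> carrier_vec m"
    and "x \<in> carrier_vec m" "y \<in> carrier_vec m"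
  shows "list_of_vec x @ list_of_vec y \<in> rel_tuples R \<longleftrightarrow> (x, y) \<in> R"
proof
  assume "list_of_vec x @ list_of_vec y \<in> rel_tuples R"
  then obtain x' y' where xy: "list_of_vec x @ list_of_vec y = list_of_vec x' @ list_of_vec y'" "(x', y') \<in> R"
    unfolding rel_tuples_def by blast
  have "length (list_of_vec x) = length (list_of_vec x')" using assms(1)[OF xy(2)] assms(2) by auto
  then have "list_of_vec x = list_of_vec x'" "list_of_vec y = list_of_vec y'" using xy(1) by auto
  then have "x = x'" "y = y'" by (metis vec_list)+
  then show "(x, y) \<in> R" using xy(2) by simp
qed (auto simp: rel_tuples_def)

lemma vvs_rel_of_structure:
  fixes v :: "'k::alg_closed_field \<Rightarrow> 'g::linordered_ab_group_add"
  assumes mon: "monster v \<kappa>" and vvs: "vvs_structure v m R" and def: "definable v UNIV (rel_tuples R)"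
  shows "vvs_rel v \<kappa> m R"
proof -
  interpret monster v \<kappa> by (rule mon)
  let ?C = "carrier_vec m :: 'k vec set" and ?z = "0\<^sub>v m :: 'k vec"
  obtain G :: "'k vec set set" and leq act val where V: "valued_vector_space v m G leq act val"
    and R_eq: "R = {(x, y). x \<in> ?C \<and> y \<in> ?C \<and> (y = ?z \<or> (x \<noteq> ?z \<and> y \<noteq> ?z \<and> (val x, val y) \<in> leq))}"
    using vvs unfolding vvs_structure_def by blast
  have R: "(x, y) \<in> R \<longleftrightarrow> x \<in> ?C \<and> y \<in> ?C \<and> (y = ?z \<or> (x \<noteq> ?z \<and> y \<noteq> ?z \<and> (val x, val y) \<in> leq))" for x y
    by (simp add: R_eq)
  note V' = V[unfolded valued_vector_space_def]
  have lin: "linear_order_on G leq" using V' by (elim conjE)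
  have V1: "\<forall>a. \<forall>h\<in>G. act a h \<in> G" using V' by (elim conjE)
  have V2: "\<forall>a b. \<forall>h\<in>G. a < b \<longrightarrow> (act a h, act b h) \<in> leq - Id" using V' by (elim conjE)
  have V3: "\<forall>a. \<forall>h\<in>G. \<forall>h'\<in>G. (h, h') \<in> leq - Id \<longrightarrow> (act a h, act a h') \<in> leq - Id"
    using V' by (elim conjE)
  have V4: "val ` (?C - {?z}) = G" using V' by (elim conjE)
  have V5: "\<forall>x\<in>?C - {?z}. \<forall>y\<in>?C - {?z}. x + y \<noteq> ?z \<longrightarrow> (val x, val (x + y)) \<in> leq \<or> (val y, val (x + y)) \<in> leq"
    using V' by (elim conjE)
  have V6: "\<forall>a. \<forall>x\<in>?C - {?z}. a \<noteq> 0 \<longrightarrow> val (a \<cdot>\<^sub>v x) = act (v a) (val x)" using V' by (elim conjE)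
  have actG: "act a h \<in> G" if "h \<in> G" for a h using V1 that by blast
  have act1: "(act a h, act b h) \<in> leq - Id" if "h \<in> G" "a < b" for a b h using V2 that by blast
  have act2: "(act a h, act a h') \<in> leq - Id" if "h \<in> G" "h' \<in> G" "(h, h') \<in> leq - Id" for a h h'
    using V3 that by blast
  have valG: "val x \<in> G" if "x \<in> ?C" "x \<noteq> ?z" for x using V4 that by blast
  have vadd: "(val x, val (x + y)) \<in> leq \<or> (val y, val (x + y)) \<in> leq"
    if "x \<in> ?C" "x \<noteq> ?z" "y \<in> ?C" "y \<noteq> ?z" "x + y \<noteq> ?z" for x y using V5 that by blast
  have vsm: "val (a \<cdot>\<^sub>v x) = act (v a) (val x)" if "x \<in> ?C" "x \<noteq> ?z" "a \<noteq> 0" for a x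
    using V6 that by blast
  have refl: "\<And>g. g \<in> G \<Longrightarrow> (g, g) \<in> leq" and tr: "trans leq" and anti: "antisym leq"
    and tot: "\<And>g h. g \<in> G \<Longrightarrow> h \<in> G \<Longrightarrow> (g, h) \<in> leq \<or> (h, g) \<in> leq"
  proof -
    show "trans leq" "antisym leq" using lin unfolding linear_order_on_def partial_order_on_def preorder_on_def by blast+
    show rf: "\<And>g. g \<in> G \<Longrightarrow> (g, g) \<in> leq"
      using lin unfolding linear_order_on_def partial_order_on_def preorder_on_def refl_on_def by blast
    show "(g, h) \<in> leq \<or> (h, g) \<in> leq" if "g \<in> G" "h \<in> G" for g h
      using lin that rf[OF that(1)] unfolding linear_order_on_def total_on_def by (cases "g = h") blast+
  qed
  have nz: "a \<cdot>\<^sub>v x \<noteq> ?z" if "x \<in> ?C" "x \<noteq> ?z" "a \<noteq> 0" for a x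
  proof
    assume *: "a \<cdot>\<^sub>v x = ?z"
    have xi: "x $ i = 0" if "i < m" for i
    proof -
      have "(a \<cdot>\<^sub>v x) $ i = 0" using * that by simp
      then show ?thesis using that \<open>x \<in> ?C\<close> \<open>a \<noteq> 0\<close> by simp
    qed
    have "x = ?z" by (rule eq_vecI) (use xi that(1) in auto)
    then show False using that(2) by blast
  qed
  have z0: "0 \<cdot>\<^sub>v x = ?z" if "x \<in> ?C" for x using that by (intro eq_vecI) auto
  show ?thesis
  proof unfold_locales
    show "x \<in> ?C \<and> y \<in> ?C" if "(x, y) \<in> R" for x y using that R by blast
    show "(x, y) \<in> R \<or> (y, x) \<in> R" if "x \<in> ?C" "y \<in> ?C" for x y
      using that R tot[OF valG valG] by blast
    show "(x, z) \<in> R" if "(x, y) \<in> R" "(y, z) \<in> R" for x y z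
      using that R transD[OF tr] by blast
    show "(x, ?z) \<in> R" if "x \<in> ?C" for x using that R by simp
    show "y = ?z" if "(?z, y) \<in> R" for y using that R by blast
    show "(x, y + z) \<in> R" if xy: "(x, y) \<in> R" and xz: "(x, z) \<in> R" for x y z
    proof (cases "y = ?z \<or> z = ?z \<or> y + z = ?z")
      case True
      then show ?thesis using xy xz R by auto
    next
      case False
      then have "(val y, val (y + z)) \<in> leq \<or> (val z, val (y + z)) \<in> leq" using vadd xy xz R by blast
      then have "(val x, val (y + z)) \<in> leq" using xy xz R False transD[OF tr] by blast
      then show ?thesis using xy xz R False by simp
    qed
    show "(a \<cdot>\<^sub>v x, a \<cdot>\<^sub>v y) \<in> R" if xy: "(x, y) \<in> R" and a: "a \<noteq> 0" for x y a
    proof (cases "y = ?z")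
      case True
      then have "a \<cdot>\<^sub>v y = ?z" by (intro eq_vecI) auto
      then show ?thesis using R[of "a \<cdot>\<^sub>v x" "a \<cdot>\<^sub>v y"] R[of x y] xy True by auto
    next
      case False
      then have x: "x \<in> ?C" "x \<noteq> ?z" "y \<in> ?C" "(val x, val y) \<in> leq" using xy R by blast+
      have "(act (v a) (val x), act (v a) (val y)) \<in> leq"
      proof (cases "val x = val y")
        case True
        then show ?thesis using refl[OF actG[OF valG[OF x(1,2)]], of "v a"] by simp
      next
        case False
        then show ?thesis
          using act2[OF valG[OF x(1,2)] valG[OF x(3) \<open>y \<noteq> ?z\<close>], of "v a"] x(4) by blast
      qed
      then have "(val (a \<cdot>\<^sub>v x), val (a \<cdot>\<^sub>v y)) \<in> leq"
        using vsm[OF x(1,2) a] vsm[OF x(3) False a] by simp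
      then show ?thesis unfolding R[of "a \<cdot>\<^sub>v x" "a \<cdot>\<^sub>v y"]
        using x nz[OF x(1,2) a] nz[OF x(3) False a] by simp
    qed
    show "(a \<cdot>\<^sub>v x, b \<cdot>\<^sub>v x) \<in> R \<longleftrightarrow> vdiv v a b" if x: "x \<in> ?C" "x \<noteq> ?z" for x a b
    proof (cases "a = 0 \<or> b = 0")
      case True
      then show ?thesis unfolding R[of "a \<cdot>\<^sub>v x" "b \<cdot>\<^sub>v x"] vdiv_def
        using x nz[OF x, of a] nz[OF x, of b] z0[OF x(1)] by (cases "a = 0"; cases "b = 0") auto
    next
      case False
      have "(act (v a) (val x), act (v b) (val x)) \<in> leq \<longleftrightarrow> v a \<le> v b"
      proof
        assume le: "(act (v a) (val x), act (v b) (val x)) \<in> leq"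
        show "v a \<le> v b"
        proof (rule ccontr)
          assume "\<not> v a \<le> v b"
          then have "(act (v b) (val x), act (v a) (val x)) \<in> leq - Id" using act1[OF valG[OF x], of "v b" "v a"] by simp
          then show False using le antisymD[OF anti] by blast
        qed
      next
        assume "v a \<le> v b"
        then show "(act (v a) (val x), act (v b) (val x)) \<in> leq"
          using act1[OF valG[OF x], of "v a" "v b"] refl[OF actG[OF valG[OF x]], of "v b"] by (cases "v a = v b") auto
      qed
      then show ?thesis unfolding R[of "a \<cdot>\<^sub>v x" "b \<cdot>\<^sub>v x"] vdiv_def
        using x False nz[OF x, of a] nz[OF x, of b] vsm[OF x, of a] vsm[OF x, of b] by simp
    qed
    obtain N \<phi> ps where \<phi>: "rel_tuples R = {xs. length xs = N \<and> sat v (env (xs @ ps)) \<phi>}"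
      using def unfolding definable_def by blast
    \<comment> \<open>A tuple known to lie in the relation fixes the arity of the defining
      formula.\<close>
    have "list_of_vec ?z @ list_of_vec ?z \<in> rel_tuples R"
      using rel_tuples_iff[of R m ?z ?z] R by simp
    then have N: "N = 2 * m" using \<phi> by auto
    have "(x, y) \<in> R \<longleftrightarrow> sat v (\<lambda>n. if n < m then x $ n else if n < 2 * m then y $ (n - m) else env ps (n - 2 * m)) \<phi>"
      if xy: "x \<in> ?C" "y \<in> ?C" for x y
    proof -
      have "(x, y) \<in> R \<longleftrightarrow> list_of_vec x @ list_of_vec y \<in> rel_tuples R"
        using rel_tuples_iff[of R m x y] xy R by blast
      also have "\<dots> \<longleftrightarrow> sat v (env ((list_of_vec x @ list_of_vec y) @ ps)) \<phi>"
        unfolding \<phi> using xy N by simp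
      also have "env ((list_of_vec x @ list_of_vec y) @ ps) =
          (\<lambda>n. if n < m then x $ n else if n < 2 * m then y $ (n - m) else env ps (n - 2 * m))"
        using xy unfolding env_append by (intro ext) (auto simp: app_def env_append nth_append mult_2)
      finally show ?thesis .
    qed
    then show "\<exists>RP e0. fdef v RP \<and> (\<forall>x\<in>?C. \<forall>y\<in>?C. (x, y) \<in> R \<longleftrightarrow>
        RP (\<lambda>n. if n < m then x $ n else if n < 2 * m then y $ (n - m) else e0 (n - 2 * m)))"
      by (intro exI[of _ "\<lambda>e. sat v e \<phi>"] exI[of _ "env ps"]) (simp add: fdef_sat)
  qed
qed

lemma sum_square:
  fixes h :: "nat \<Rightarrow> nat \<Rightarrow> 'a::comm_monoid_add"
  shows
  "(\<Sum>q<m * m. h (q div m) (q mod m)) = (\<Sum>k<m. \<Sum>l<m. h k l)"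
proof -
  have "(\<Sum>k<m. \<Sum>l<m. h k l) = (\<Sum>p\<in>{..<m} \<times> {..<m}. h (fst p) (snd p))"
    by (simp add: sum.cartesian_product case_prod_beta)
  also have "\<dots> = (\<Sum>q<m * m. h (q div m) (q mod m))"
  proof (rule sum.reindex_bij_witness[where i = "\<lambda>q. (q div m, q mod m)" and j = "\<lambda>p. fst p * m + snd p"])
    fix p assume p: "p \<in> {..<m} \<times> {..<m}"
    then have lt: "fst p < m" "snd p < m" by auto
    show "((fst p * m + snd p) div m, (fst p * m + snd p) mod m) = p" using lt by (cases p) simp
    then show "h ((fst p * m + snd p) div m) ((fst p * m + snd p) mod m) = h (fst p) (snd p)" by (metis prod.sel)
    show "fst p * m + snd p \<in> {..<m * m}" using mult_le_mono1[of "Suc (fst p)" m m] lt by simp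
  next
    fix q assume q: "q \<in> {..<m * m}"
    then have "m > 0" by (cases m) auto
    then show "(q div m, q mod m) \<in> {..<m} \<times> {..<m}" using q by (simp add: less_mult_imp_div_less)
    show "fst (q div m, q mod m) * m + snd (q div m, q mod m) = q" by simp
  qed
  finally show ?thesis by simp
qed

text \<open>Endomorphisms are stored row by row as vectors, so that they form a submodule of some
  K^N, where lattices are available.\<close>

definition flat_mat :: "nat \<Rightarrow> 'a vec \<Rightarrow> 'a mat" where
  "flat_mat m f = mat m m (\<lambda>(i, j). f $ (i * m + j))"

definition endo_module :: "nat \<Rightarrow> 'k::field vec rel \<Rightarrow> 'k vec set" where
  "endo_module m R = {f \<in> carrier_vec (m * m). \<forall>x\<in>carrier_vec m. (x, flat_mat m f *\<^sub>v x) \<in> R}"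

lemma matrix_inverse:
  fixes B :: "'k::field mat"
  assumes "B \<in> carrier_mat n n" "det B \<noteq> 0"
  obtains B' where "B' \<in> carrier_mat n n" "B * B' = 1\<^sub>m n" "B' * B = 1\<^sub>m n"
  using det_non_zero_imp_unit[OF assms, of "()"] unfolding Units_def ring_mat_def by auto

context valued_field begin

definition basic_module :: "'k set \<Rightarrow> bool" where
  "basic_module J \<longleftrightarrow> J = UNIV \<or> J = {c. 1 \<preceq> c} \<or> J = {c. 1 \<prec> c} \<or> J = {0}"

end

context vvs_rel begin

text \<open>Expand \<open>x\<close> in a splitting basis and let \<open>a\<^sub>i b\<^sub>i\<close> be a term of least value. The rank one
  map sending \<open>b\<^sub>i\<close> to \<open>a\<^sub>i\<^sup>-\<^sup>1 y\<close> and the other basis vectors to 0 belongs to the module.\<close>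

theorem endo_module_determines:
  assumes x: "x \<in> carrier_vec m" and y: "y \<in> carrier_vec m"
  shows "(x, y) \<in> R \<longleftrightarrow> (\<exists>f\<in>endo_module m R. flat_mat m f *\<^sub>v x = y)"
proof
  assume "\<exists>f\<in>endo_module m R. flat_mat m f *\<^sub>v x = y"
  then show "(x, y) \<in> R" using x by (auto simp: endo_module_def)
next
  assume xy: "(x, y) \<in> R"
  show "\<exists>f\<in>endo_module m R. flat_mat m f *\<^sub>v x = y"
  proof (cases "x = 0\<^sub>v m")
    case True
    then have "y = 0\<^sub>v m" using R_zero(2) xy by blast
    have "flat_mat m (0\<^sub>v (m * m)) *\<^sub>v z = 0\<^sub>v m" if "z \<in> carrier_vec m" for z :: "'k vec"
    proof (rule eq_vecI)
      fix i assume "i < dim_vec (0\<^sub>v m)"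
      then have i: "i < m" by simp
      have "i * m + j < m * m" if "j < m" for j using mult_le_mono1[of "Suc i" m m] i that by simp
      then show "(flat_mat m (0\<^sub>v (m * m)) *\<^sub>v z) $ i = 0\<^sub>v m $ i"
        using i that by (simp add: flat_mat_def scalar_prod_def)
    qed (simp add: flat_mat_def)
    then show ?thesis using True \<open>y = 0\<^sub>v m\<close> R_zero(1) x
      by (intro bexI[of _ "0\<^sub>v (m * m)"]) (auto simp: endo_module_def)
  next
    case False
    obtain B where B: "B \<in> carrier_mat m m" "det B \<noteq> 0"
      and spl: "\<And>a y. a \<in> carrier_vec m \<Longrightarrow> y \<in> carrier_vec m \<Longrightarrow>
        (y, B *\<^sub>v a) \<in> R \<longleftrightarrow> (\<forall>i<m. (y, a $ i \<cdot>\<^sub>v col B i) \<in> R)" using splitting_basis by blast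
    obtain B' where B': "B' \<in> carrier_mat m m" "B * B' = 1\<^sub>m m" "B' * B = 1\<^sub>m m"
      using matrix_inverse[OF B] by blast
    have co: "B' *\<^sub>v z \<in> carrier_vec m" "B *\<^sub>v (B' *\<^sub>v z) = z" if "z \<in> carrier_vec m" for z
      using that B(1) B' by (auto simp flip: assoc_mult_mat_vec)
    have spl': "(w, z) \<in> R \<longleftrightarrow> (\<forall>i<m. (w, (B' *\<^sub>v z) $ i \<cdot>\<^sub>v col B i) \<in> R)"
      if "z \<in> carrier_vec m" "w \<in> carrier_vec m" for z w
      using spl[OF co(1)[OF that(1)] that(2)] co(2)[OF that(1)] by simp
    define a where "a = B' *\<^sub>v x"
    have "\<exists>i<m. (a $ i \<cdot>\<^sub>v col B i, x) \<in> R"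
    proof (rule ccontr)
      assume not: "\<not> ?thesis"
      let ?c = "\<lambda>i. a $ i \<cdot>\<^sub>v col B i"
      have C: "?c i \<in> carrier_vec m" for i using B(1) by auto
      have "m > 0"
      proof (rule ccontr)
        assume "\<not> m > 0"
        then show False using False x by (auto intro!: eq_vecI)
      qed
      have "\<exists>i\<in>I. \<forall>j\<in>I. (?c i, ?c j) \<in> R" if "finite I" "I \<noteq> {}" for I
        using that
      proof (induction I rule: finite_ne_induct)
        case (singleton i)
        then show ?case using R_refl[OF C] by simp
      next
        case (insert j I)
        then obtain i where i: "i \<in> I" "\<forall>j\<in>I. (?c i, ?c j) \<in> R" by blast
        show ?case
        proof (cases "(?c i, ?c j) \<in> R")
          case True
          then show ?thesis using i by blast
        next
          case False
          then have ji: "(?c j, ?c i) \<in> R" using R_linear[OF C C] by blast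
          have "(?c j, ?c l) \<in> R" if "l \<in> insert j I" for l
            using that R_trans[OF ji] i(2) R_refl[OF C] by blast
          then show ?thesis by blast
        qed
      qed
      from this[of "{..<m}"] obtain i where i: "i < m" "\<forall>j<m. (?c i, ?c j) \<in> R"
        using \<open>m > 0\<close> by auto
      then have "(?c i, x) \<in> R" using spl'[OF x C] unfolding a_def by blast
      then show False using not i(1) by blast
    qed
    then obtain i where i: "i < m" "(a $ i \<cdot>\<^sub>v col B i, x) \<in> R" by blast
    have colC: "col B i \<in> carrier_vec m" using B(1) by auto
    have ai: "a $ i \<noteq> 0"
    proof
      assume "a $ i = 0"
      then have "a $ i \<cdot>\<^sub>v col B i = 0\<^sub>v m" using colC B(1) i(1) by (intro eq_vecI) auto
      then show False using i(2) R_zero(2) False by auto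
    qed
    define f where "f = vec (m * m) (\<lambda>q. y $ (q div m) * B' $$ (i, q mod m) / a $ i)"
    have fz: "flat_mat m f *\<^sub>v z = ((B' *\<^sub>v z) $ i / a $ i) \<cdot>\<^sub>v y" if z: "z \<in> carrier_vec m" for z
    proof (rule eq_vecI)
      fix k assume "k < dim_vec (((B' *\<^sub>v z) $ i / a $ i) \<cdot>\<^sub>v y)"
      then have k: "k < m" using y by simp
      have "k * m + j < m * m" if "j < m" for j using mult_le_mono1[of "Suc k" m m] k that by simp
      then have "(flat_mat m f *\<^sub>v z) $ k = (\<Sum>j<m. y $ k * B' $$ (i, j) / a $ i * z $ j)"
        using k z by (simp add: flat_mat_def f_def scalar_prod_def lessThan_atLeast0)
      also have "\<dots> = (\<Sum>j<m. B' $$ (i, j) * z $ j) / a $ i * y $ k"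
        by (simp add: sum_divide_distrib sum_distrib_left sum_distrib_right mult_ac)
      also have "\<dots> = (((B' *\<^sub>v z) $ i / a $ i) \<cdot>\<^sub>v y) $ k"
        using k z i(1) B'(1) y by (simp add: scalar_prod_def lessThan_atLeast0)
      finally show "(flat_mat m f *\<^sub>v z) $ k = (((B' *\<^sub>v z) $ i / a $ i) \<cdot>\<^sub>v y) $ k" .
    qed (use y in \<open>simp add: flat_mat_def\<close>)
    have "(z, flat_mat m f *\<^sub>v z) \<in> R" if z: "z \<in> carrier_vec m" for z
    proof (cases "(B' *\<^sub>v z) $ i = 0")
      case True
      then have "flat_mat m f *\<^sub>v z = 0\<^sub>v m" unfolding fz[OF z] using y by (intro eq_vecI) auto
      then show ?thesis using R_zero(1)[OF z] by simp
    next
      case nz: False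
      \<comment> \<open>In a splitting basis no term of an expansion has smaller value than the
        vector itself.\<close>
      have "(z, (B' *\<^sub>v z) $ i \<cdot>\<^sub>v col B i) \<in> R"
        using spl'[OF z z] R_refl[OF z] i(1) by blast
      moreover have "(a $ i \<cdot>\<^sub>v col B i, y) \<in> R" using R_trans[OF i(2) xy] .
      then have "(((B' *\<^sub>v z) $ i / a $ i) \<cdot>\<^sub>v (a $ i \<cdot>\<^sub>v col B i), ((B' *\<^sub>v z) $ i / a $ i) \<cdot>\<^sub>v y) \<in> R"
        by (rule R_smult) (use nz ai in auto)
      then have "((B' *\<^sub>v z) $ i \<cdot>\<^sub>v col B i, ((B' *\<^sub>v z) $ i / a $ i) \<cdot>\<^sub>v y) \<in> R"
        using ai by (simp add: smult_smult_assoc)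
      ultimately show ?thesis unfolding fz[OF z] by (rule R_trans)
    qed
    then have "f \<in> endo_module m R" by (auto simp: endo_module_def f_def)
    moreover have "flat_mat m f *\<^sub>v x = y" using fz[OF x] ai y by (simp add: a_def)
    ultimately show ?thesis by blast
  qed
qed

text \<open>In a splitting basis the condition on an endomorphism decouples: the entry at (j, i) may
  be any \<open>c\<close> for which \<open>c\<close> times the \<open>j\<close>-th basis vector has
  at least the value of the \<open>i\<close>-th. These sets are definable cuts, and dividing by a
  suitable scalar normalizes them.\<close>

theorem endo_module_basic:
  "\<exists>D\<in>carrier_mat (m * m) (m * m). \<exists>J. det D \<noteq> 0 \<and> (\<forall>p<m * m. basic_module (J p)) \<and>
     endo_module m R = {f \<in> carrier_vec (m * m). \<forall>p<m * m. (D *\<^sub>v f) $ p \<in> J p}"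
proof -
  let ?N = "m * m"
  have lt: "k * m + l < ?N" if "k < m" "l < m" for k l using mult_le_mono1[of "Suc k" m m] that by simp
  have dm: "p div m < m" "p mod m < m" if "p < ?N" for p
  proof -
    have "m > 0" using that by (cases m) auto
    then show "p div m < m" "p mod m < m" using that by (auto simp: less_mult_imp_div_less)
  qed
  obtain B where B: "B \<in> carrier_mat m m" "det B \<noteq> 0"
    and spl: "\<And>a y. a \<in> carrier_vec m \<Longrightarrow> y \<in> carrier_vec m \<Longrightarrow>
      (y, B *\<^sub>v a) \<in> R \<longleftrightarrow> (\<forall>i<m. (y, a $ i \<cdot>\<^sub>v col B i) \<in> R)" using splitting_basis by blast
  obtain B' where B': "B' \<in> carrier_mat m m" "B * B' = 1\<^sub>m m" "B' * B = 1\<^sub>m m"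
    using matrix_inverse[OF B] by blast
  have colC: "col B i \<in> carrier_vec m" for i using B(1) by auto
  have co: "B' *\<^sub>v z \<in> carrier_vec m" "B *\<^sub>v (B' *\<^sub>v z) = z" if "z \<in> carrier_vec m" for z
    using that B(1) B' by (auto simp flip: assoc_mult_mat_vec)
  have spl': "(w, z) \<in> R \<longleftrightarrow> (\<forall>i<m. (w, (B' *\<^sub>v z) $ i \<cdot>\<^sub>v col B i) \<in> R)"
    if "z \<in> carrier_vec m" "w \<in> carrier_vec m" for z w
    using spl[OF co(1)[OF that(1)] that(2)] co(2)[OF that(1)] by simp
  have bb: "(\<Sum>k<m. B' $$ (i, k) * B $$ (k, j)) = (if i = j then 1 else 0)" if "i < m" "j < m" for i j
  proof -
    have "(B' * B) $$ (i, j) = (\<Sum>k<m. B' $$ (i, k) * B $$ (k, j))"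
      using that B(1) B'(1) by (simp add: scalar_prod_def lessThan_atLeast0)
    then show ?thesis using that B'(3) by simp
  qed
  have col0: "col B i \<noteq> 0\<^sub>v m" if i: "i < m" for i
  proof
    assume c0: "col B i = 0\<^sub>v m"
    have "B $$ (k, i) = 0" if "k < m" for k
    proof -
      have "col B i $ k = 0" using c0 that by simp
      then show ?thesis using that i B(1) by simp
    qed
    then show False using bb[OF i i] by simp
  qed
  define I where "I i j = {c. (col B i, c \<cdot>\<^sub>v col B j) \<in> R}" for i j
  have cut: "I i j = UNIV \<or> (\<exists>c. I i j = {y. c \<preceq> y}) \<or> (\<exists>c. c \<noteq> 0 \<and> I i j = {y. c \<prec> y})"
    if ij: "i < m" "j < m" for i j
  proof -
    obtain RP eR where RP: "fdef v RP" and R: "\<And>x y. x \<in> carrier_vec m \<Longrightarrow> y \<in> carrier_vec m \<Longrightarrow> (x, y) \<in> R \<longleftrightarrow>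
       RP (\<lambda>n. if n < m then x $ n else if n < 2 * m then y $ (n - m) else eR (n - 2 * m))"
      using R_definable by blast
    define e0 where "e0 q = (if q < m then col B i $ q else if q < 2 * m then col B j $ (q - m) else eR (q - 2 * m))" for q
    define Q where "Q \<epsilon> \<longleftrightarrow> RP (\<lambda>n. if n < m then \<epsilon> (Suc n) else if n < 2 * m then \<epsilon> 0 * \<epsilon> (Suc n) else \<epsilon> (Suc n))"
      for \<epsilon> :: "nat \<Rightarrow> 'k"
    have Q: "fdef v Q" unfolding Q_def by (intro fdef_intros fdef_subst[OF RP])
    show ?thesis
    proof (rule definable_cut[OF Q])
      fix c
      have "(\<lambda>n. if n < m then e0 n else if n < 2 * m then c * e0 n else e0 n) =
          (\<lambda>n. if n < m then col B i $ n else if n < 2 * m then (c \<cdot>\<^sub>v col B j) $ (n - m) else eR (n - 2 * m))"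
        using B(1) ij by (intro ext) (auto simp: e0_def)
      then show "c \<in> I i j \<longleftrightarrow> Q (case_nat c e0)"
        using R[OF colC iffD2[OF smult_carrier_vec colC], of i c j] by (simp only: I_def Q_def mem_Collect_eq nat.case)
    next
      fix x y assume "x \<in> I i j" "x \<preceq> y"
      then show "y \<in> I i j" using R_scale[OF colC col0[OF ij(2)]] R_trans by (auto simp: I_def)
    next
      have "0 \<cdot>\<^sub>v col B j = 0\<^sub>v m" using B(1) ij by (intro eq_vecI) auto
      then show "0 \<in> I i j" using R_zero(1)[OF colC] by (simp add: I_def)
    qed
  qed
  have "\<exists>s J. s \<noteq> 0 \<and> basic_module J \<and> (\<forall>c. c \<in> I i j \<longleftrightarrow> c / s \<in> J)" if ij: "i < m" "j < m" for i j
  proof -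
    have *: "c \<preceq> y \<longleftrightarrow> 1 \<preceq> y / c" "c \<prec> y \<longleftrightarrow> 1 \<prec> y / c" if "c \<noteq> 0" for c y
      using vle_mult[OF that, of 1 "y / c"] vless_mult[OF that, of 1 "y / c"] that by simp_all
    consider "I i j = UNIV" | "I i j = {0}" | c where "c \<noteq> 0" "I i j = {y. c \<preceq> y}" | c where "c \<noteq> 0" "I i j = {y. c \<prec> y}"
    proof -
      have "{y. 0 \<preceq> y} = {0}" by auto
      then show ?thesis using cut[OF ij] that by metis
    qed
    then show ?thesis
    proof cases
      case 1
      then show ?thesis by (intro exI[of _ 1] exI[of _ UNIV]) (simp add: basic_module_def)
    next
      case 2
      then show ?thesis by (intro exI[of _ 1] exI[of _ "{0}"]) (simp add: basic_module_def)
    next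
      case 3
      then show ?thesis using *(1)[OF 3(1)] by (intro exI[of _ c] exI[of _ "{c. 1 \<preceq> c}"]) (simp add: basic_module_def)
    next
      case 4
      then show ?thesis using *(2)[OF 4(1)] by (intro exI[of _ c] exI[of _ "{c. 1 \<prec> c}"]) (simp add: basic_module_def)
    qed
  qed
  then obtain s0 J0 where s0: "\<And>i j. i < m \<Longrightarrow> j < m \<Longrightarrow> s0 i j \<noteq> 0 \<and> basic_module (J0 i j) \<and>
      (\<forall>c. c \<in> I i j \<longleftrightarrow> c / s0 i j \<in> J0 i j)" by metis
  \<comment> \<open>Position \<open>p\<close> is the entry in row \<open>p div m\<close> and column
    \<open>p mod m\<close>, whereas \<open>I\<close> takes the column first; hence the exchanged
    arguments.\<close>
  define s where "s p = s0 (p mod m) (p div m)" for p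
  define J where "J p = J0 (p mod m) (p div m)" for p
  have s: "s p \<noteq> 0" if "p < ?N" for p using s0 dm[OF that] by (simp add: s_def)
  have bJ: "basic_module (J p)" if "p < ?N" for p using s0 dm[OF that] by (simp add: J_def)
  \<comment> \<open>Conjugation by \<open>B\<close>, followed by division by \<open>s\<close>, as a
    linear map on flattened matrices; \<open>C\<close> is its inverse.\<close>
  define D where "D = mat ?N ?N (\<lambda>(p, q). B' $$ (p div m, q div m) * B $$ (q mod m, p mod m) / s p)"
  define C where "C = mat ?N ?N (\<lambda>(q, p). B $$ (q div m, p div m) * B' $$ (p mod m, q mod m) * s p)"
  have "D * C = 1\<^sub>m ?N"
  proof (rule eq_matI)
    fix p p' assume "p < dim_row (1\<^sub>m ?N :: 'k mat)" "p' < dim_col (1\<^sub>m ?N :: 'k mat)"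
    then have p: "p < ?N" "p' < ?N" by auto
    have "(D * C) $$ (p, p') = (\<Sum>q<?N. (B' $$ (p div m, q div m) * B $$ (q mod m, p mod m) / s p) *
        (B $$ (q div m, p' div m) * B' $$ (p' mod m, q mod m) * s p'))"
      using p by (simp add: D_def C_def scalar_prod_def lessThan_atLeast0)
    also have "\<dots> = (\<Sum>k<m. \<Sum>l<m. (B' $$ (p div m, k) * B $$ (l, p mod m) / s p) *
        (B $$ (k, p' div m) * B' $$ (p' mod m, l) * s p'))" by (rule sum_square)
    also have "\<dots> = s p' / s p * ((\<Sum>k<m. B' $$ (p div m, k) * B $$ (k, p' div m)) *
        (\<Sum>l<m. B' $$ (p' mod m, l) * B $$ (l, p mod m)))"
      by (subst sum_product) (simp add: sum_distrib_left mult_ac)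
    also have "\<dots> = (if p = p' then 1 else 0)"
    proof -
      have "p div m = p' div m \<and> p' mod m = p mod m \<longleftrightarrow> p = p'" by (metis div_mult_mod_eq)
      then show ?thesis using bb dm p s by auto
    qed
    finally show "(D * C) $$ (p, p') = 1\<^sub>m ?N $$ (p, p')" using p by simp
  qed (auto simp: D_def C_def)
  moreover have DC: "D \<in> carrier_mat ?N ?N" "C \<in> carrier_mat ?N ?N" by (auto simp: D_def C_def)
  ultimately have det: "det D \<noteq> 0" using det_mult[OF DC] by auto
  have "f \<in> endo_module m R \<longleftrightarrow> (\<forall>p<?N. (D *\<^sub>v f) $ p \<in> J p)" if f: "f \<in> carrier_vec ?N" for f
  proof -
    define A where "A = flat_mat m f"
    have A: "A \<in> carrier_mat m m" by (simp add: A_def flat_mat_def)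
    define G where "G = B' * (A * B)"
    have G: "G \<in> carrier_mat m m" using A B B' by (simp add: G_def)
    have Gji: "G $$ (j, i) = s p * (D *\<^sub>v f) $ p" if p: "p < ?N" "j = p div m" "i = p mod m" for j i p
    proof -
      have ij: "j < m" "i < m" using dm[OF p(1)] p by auto
      have "G $$ (j, i) = (\<Sum>k<m. B' $$ (j, k) * (\<Sum>l<m. A $$ (k, l) * B $$ (l, i)))"
        using A B(1) B'(1) ij by (simp add: G_def scalar_prod_def lessThan_atLeast0)
      also have "\<dots> = (\<Sum>k<m. \<Sum>l<m. B' $$ (j, k) * f $ (k * m + l) * B $$ (l, i))"
        unfolding sum_distrib_left by (intro sum.cong refl) (simp add: A_def flat_mat_def)
      also have "\<dots> = (\<Sum>q<?N. B' $$ (j, q div m) * f $ (q div m * m + q mod m) * B $$ (q mod m, i))"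
        by (rule sum_square[symmetric])
      also have "\<dots> = s p * (\<Sum>q<?N. B' $$ (j, q div m) * B $$ (q mod m, i) / s p * f $ q)"
        using s[OF p(1)] by (simp add: sum_distrib_left mult_ac)
      also have "(\<Sum>q<?N. B' $$ (j, q div m) * B $$ (q mod m, i) / s p * f $ q) = (D *\<^sub>v f) $ p"
        using p f by (simp add: D_def scalar_prod_def lessThan_atLeast0)
      finally show ?thesis .
    qed
    have AB: "A * B = B * G"
      unfolding G_def using A B(1) B'(1,2) by (simp flip: assoc_mult_mat[of B m m B' m "A * B" m])
    have Ab: "B' *\<^sub>v (A *\<^sub>v z) = G *\<^sub>v (B' *\<^sub>v z)" if z: "z \<in> carrier_vec m" for z
    proof -
      have "G *\<^sub>v (B' *\<^sub>v z) = B' *\<^sub>v (A *\<^sub>v (B *\<^sub>v (B' *\<^sub>v z)))"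
        using assoc_mult_mat_vec[OF B'(1) mult_carrier_mat[OF A B(1)] co(1)[OF z]]
          assoc_mult_mat_vec[OF A B(1) co(1)[OF z]] by (simp add: G_def)
      then show ?thesis using co(2)[OF z] by simp
    qed
    have bcol: "B' *\<^sub>v col B i = unit_vec m i" if "i < m" for i
    proof -
      have "col (B' * B) i = B' *\<^sub>v col B i" using B(1) B'(1) that by (intro col_mult2)
      then show ?thesis using B'(3) that by simp
    qed
    have "f \<in> endo_module m R \<longleftrightarrow> (\<forall>i<m. \<forall>j<m. G $$ (j, i) \<in> I i j)"
    proof
      assume "f \<in> endo_module m R"
      then have *: "(z, A *\<^sub>v z) \<in> R" if "z \<in> carrier_vec m" for z using that by (auto simp: endo_module_def A_def)
      show "\<forall>i<m. \<forall>j<m. G $$ (j, i) \<in> I i j"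
      proof (intro allI impI)
        fix i j assume ij: "i < m" "j < m"
        have AC: "A *\<^sub>v col B i \<in> carrier_vec m" using A colC[of i] by simp
        have "(col B i, (B' *\<^sub>v (A *\<^sub>v col B i)) $ j \<cdot>\<^sub>v col B j) \<in> R"
          using spl'[OF AC colC] *[OF colC] ij by blast
        moreover have "(B' *\<^sub>v (A *\<^sub>v col B i)) $ j = G $$ (j, i)"
          using Ab[OF colC] bcol[OF ij(1)] G ij by simp
        ultimately show "G $$ (j, i) \<in> I i j" by (simp add: I_def)
      qed
    next
      assume g: "\<forall>i<m. \<forall>j<m. G $$ (j, i) \<in> I i j"
      have "(z, A *\<^sub>v z) \<in> R" if z: "z \<in> carrier_vec m" for z
      proof -
        define a where "a = B' *\<^sub>v z"
        have aC: "a \<in> carrier_vec m" using co(1)[OF z] by (simp add: a_def)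
        have AC: "A *\<^sub>v z \<in> carrier_vec m" using A z by simp
        have "(z, (G *\<^sub>v a) $ j \<cdot>\<^sub>v col B j) \<in> R" if j: "j < m" for j
        proof -
          have "(z, (\<Sum>i\<in>X. G $$ (j, i) * a $ i) \<cdot>\<^sub>v col B j) \<in> R" if "finite X" "X \<subseteq> {..<m}" for X
            using that
          proof (induction X rule: finite_induct)
            case empty
            have "0 \<cdot>\<^sub>v col B j = 0\<^sub>v m" using B(1) j by (intro eq_vecI) auto
            then show ?case using R_zero(1)[OF z] by simp
          next
            case (insert i X)
            have i: "i < m" using insert.prems by simp
            have za: "(z, a $ i \<cdot>\<^sub>v col B i) \<in> R" using spl'[OF z z] R_refl[OF z] i by (simp add: a_def)
            have "(z, (G $$ (j, i) * a $ i) \<cdot>\<^sub>v col B j) \<in> R"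
            proof (cases "a $ i = 0")
              case True
              have "0 \<cdot>\<^sub>v col B j = 0\<^sub>v m" using B(1) j by (intro eq_vecI) auto
              then show ?thesis using True R_zero(1)[OF z] by simp
            next
              case False
              have "(col B i, G $$ (j, i) \<cdot>\<^sub>v col B j) \<in> R" using g i j by (simp add: I_def)
              from R_smult[OF this False]
              have "(a $ i \<cdot>\<^sub>v col B i, (G $$ (j, i) * a $ i) \<cdot>\<^sub>v col B j) \<in> R"
                by (simp add: smult_smult_assoc mult.commute)
              then show ?thesis by (rule R_trans[OF za])
            qed
            from R_add[OF this insert.IH] insert.prems
            show ?case using insert.hyps by (simp add: add_smult_distrib_vec)
          qed
          from this[of "{..<m}"] show ?thesis
            using G aC j by (simp add: scalar_prod_def lessThan_atLeast0)
        qed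
        then show ?thesis using spl'[OF AC z] Ab[OF z] by (simp add: a_def)
      qed
      then show "f \<in> endo_module m R" using f by (auto simp: endo_module_def A_def)
    qed
    also have "\<dots> \<longleftrightarrow> (\<forall>p<?N. (D *\<^sub>v f) $ p \<in> J p)"
    proof
      assume *: "\<forall>i<m. \<forall>j<m. G $$ (j, i) \<in> I i j"
      show "\<forall>p<?N. (D *\<^sub>v f) $ p \<in> J p"
      proof (intro allI impI)
        fix p assume p: "p < ?N"
        have "G $$ (p div m, p mod m) \<in> I (p mod m) (p div m)" using * dm[OF p] by blast
        then have "G $$ (p div m, p mod m) / s p \<in> J p" using s0 dm[OF p] by (simp add: s_def J_def)
        then show "(D *\<^sub>v f) $ p \<in> J p" using Gji[OF p refl refl] s[OF p] by simp
      qed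
    next
      assume *: "\<forall>p<?N. (D *\<^sub>v f) $ p \<in> J p"
      show "\<forall>i<m. \<forall>j<m. G $$ (j, i) \<in> I i j"
      proof (intro allI impI)
        fix i j assume ij: "i < m" "j < m"
        define p where "p = j * m + i"
        have p: "p < ?N" "j = p div m" "i = p mod m" using lt ij by (auto simp: p_def)
        have "G $$ (j, i) / s p \<in> J p" using * Gji[OF p] s[OF p(1)] p(1) by simp
        then show "G $$ (j, i) \<in> I i j" using s0[OF ij(2) ij(1)] s0[OF ij(1,2)] p by (simp add: s_def J_def)
      qed
    qed
    finally show ?thesis .
  qed
  then have "endo_module m R = {f \<in> carrier_vec ?N. \<forall>p<?N. (D *\<^sub>v f) $ p \<in> J p}"
    by (auto simp: endo_module_def)
  then show ?thesis using DC(1) det bJ by blast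
qed

end

lemma minus_add_minus_vec_eq: "x \<in> carrier_vec n \<Longrightarrow> y \<in> carrier_vec n \<Longrightarrow> x - y + y = (x :: 'a::ring vec)"
  by (intro eq_vecI) auto

section \<open>Linear algebra over a valued field\<close>

definition lin_subspace :: "nat \<Rightarrow> 'k::field vec set \<Rightarrow> bool" where
  "lin_subspace N U \<longleftrightarrow> U \<subseteq> carrier_vec N \<and> 0\<^sub>v N \<in> U \<and>
     (\<forall>x\<in>U. \<forall>y\<in>U. x + y \<in> U) \<and> (\<forall>x\<in>U. \<forall>a. a \<cdot>\<^sub>v x \<in> U)"

definition coord_space :: "nat \<Rightarrow> nat set \<Rightarrow> 'k::field vec set" where
  "coord_space N P = {x \<in> carrier_vec N. \<forall>i<N. i \<notin> P \<longrightarrow> x $ i = 0}"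

text \<open>The complement is a coordinate space, so that \<open>U\<close> and the finite set
  \<open>P\<close> determine \<open>pr\<close>. This makes the entries of \<open>pr\<close>
  definable from \<open>U\<close>.\<close>

definition projection :: "nat \<Rightarrow> 'k::field vec set \<Rightarrow> nat set \<Rightarrow> 'k mat \<Rightarrow> bool" where
  "projection N U P pr \<longleftrightarrow> pr \<in> carrier_mat N N \<and> P \<subseteq> {..<N} \<and> U \<inter> coord_space N P \<subseteq> {0\<^sub>v N} \<and>
     (\<forall>x\<in>carrier_vec N. pr *\<^sub>v x \<in> U \<and> x - pr *\<^sub>v x \<in> coord_space N P)"

lemma lin_subspace_coord: "lin_subspace N (coord_space N P)"
  by (auto simp: lin_subspace_def coord_space_def)

lemma lin_subspace_kernel:
  assumes "D \<in> carrier_mat N N"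
  shows "lin_subspace N {u \<in> carrier_vec N. \<forall>p<N. Q p \<longrightarrow> (D *\<^sub>v u) $ p = 0}"
  using assms unfolding lin_subspace_def
  by (auto simp: mult_add_distrib_mat_vec mult_mat_vec scalar_prod_def simp del: index_mult_mat_vec)
    (simp add: scalar_prod_def)

lemma lin_subspace_diff:
  assumes "lin_subspace N U" "x \<in> U" "y \<in> U"
  shows "x - y \<in> U"
proof -
  have C: "x \<in> carrier_vec N" "y \<in> carrier_vec N" using assms by (auto simp: lin_subspace_def)
  have "x + (- 1) \<cdot>\<^sub>v y \<in> U" using assms unfolding lin_subspace_def by blast
  moreover have "x + (- 1) \<cdot>\<^sub>v y = x - y" using C by (intro eq_vecI) auto
  ultimately show ?thesis by simp
qed

text \<open>The hypothesis concerns scaled columns and not the columns themselves, so that the lemma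
  also covers \<O>-modules containing only small multiples of a column.\<close>

lemma mat_vec_closed:
  fixes A :: "'k::field mat"
  assumes z: "0\<^sub>v N \<in> U" and add: "\<And>x y. x \<in> U \<Longrightarrow> y \<in> U \<Longrightarrow> x + y \<in> U"
    and A: "A \<in> carrier_mat N n" and cols: "\<And>j. j < n \<Longrightarrow> x $ j \<cdot>\<^sub>v col A j \<in> U"
    and x: "x \<in> carrier_vec n"
  shows "A *\<^sub>v x \<in> U"
proof -
  have "A *\<^sub>v vec n (\<lambda>i. if i < k then x $ i else 0) \<in> U" if "k \<le> n" for k
    using that
  proof (induction k)
    case 0
    have "A *\<^sub>v vec n (\<lambda>i. if i < 0 then x $ i else 0) = 0\<^sub>v N"
      using A by (intro eq_vecI) (auto simp: scalar_prod_def)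
    then show ?case using z by simp
  next
    case (Suc k)
    have "A *\<^sub>v vec n (\<lambda>i. if i < Suc k then x $ i else 0) =
        A *\<^sub>v vec n (\<lambda>i. if i < k then x $ i else 0) + x $ k \<cdot>\<^sub>v col A k"
    proof (rule eq_vecI)
      fix i assume "i < dim_vec (A *\<^sub>v vec n (\<lambda>i. if i < k then x $ i else 0) + x $ k \<cdot>\<^sub>v col A k)"
      then have i: "i < N" using A by simp
      have "(A *\<^sub>v vec n (\<lambda>i. if i < Suc k then x $ i else 0)) $ i =
          (\<Sum>j<n. A $$ (i, j) * (if j < k then x $ j else 0) + (if j = k then A $$ (i, k) * x $ k else 0))"
      proof -
        have "(A *\<^sub>v vec n (\<lambda>i. if i < Suc k then x $ i else 0)) $ i =
            (\<Sum>j<n. A $$ (i, j) * (if j < Suc k then x $ j else 0))"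
          using A i by (simp add: scalar_prod_def lessThan_atLeast0)
        also have "\<dots> = (\<Sum>j<n. A $$ (i, j) * (if j < k then x $ j else 0) + (if j = k then A $$ (i, k) * x $ k else 0))"
          by (intro sum.cong) (auto simp: less_Suc_eq)
        finally show ?thesis .
      qed
      also have "\<dots> = (\<Sum>j<n. A $$ (i, j) * (if j < k then x $ j else 0)) + A $$ (i, k) * x $ k"
        using Suc.prems by (simp add: sum.distrib)
      also have "\<dots> = (A *\<^sub>v vec n (\<lambda>i. if i < k then x $ i else 0) + x $ k \<cdot>\<^sub>v col A k) $ i"
        using A i Suc.prems by (simp add: scalar_prod_def lessThan_atLeast0)
      finally show "(A *\<^sub>v vec n (\<lambda>i. if i < Suc k then x $ i else 0)) $ i =
          (A *\<^sub>v vec n (\<lambda>i. if i < k then x $ i else 0) + x $ k \<cdot>\<^sub>v col A k) $ i" .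
    qed (use A in simp)
    then show ?case using Suc add cols[of k] by simp
  qed
  from this[of n] have "A *\<^sub>v vec n (\<lambda>i. if i < n then x $ i else 0) \<in> U" by simp
  moreover have "vec n (\<lambda>i. if i < n then x $ i else 0) = x" using x by (intro eq_vecI) auto
  ultimately show ?thesis by simp
qed

lemma mat_vec_subspace:
  assumes U: "lin_subspace N U" and A: "A \<in> carrier_mat N n" and cols: "\<And>j. j < n \<Longrightarrow> col A j \<in> U"
    and x: "x \<in> carrier_vec n"
  shows "A *\<^sub>v x \<in> U"
  by (rule mat_vec_closed[OF _ _ A _ x]) (use U cols in \<open>auto simp: lin_subspace_def\<close>)

text \<open>Choose \<open>P\<close> maximal with trivial intersection. Adding another index produces
  a vector of \<open>U\<close> with nonzero entry there, and after scaling it agrees with the unit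
  vector modulo the coordinate space.\<close>

lemma ex_projection:
  assumes U: "lin_subspace N U"
  shows "\<exists>P pr. projection N U P pr"
proof -
  define S where "S = {P. P \<subseteq> {..<N} \<and> U \<inter> coord_space N P \<subseteq> {0\<^sub>v N}}"
  have "finite S" by (rule finite_subset[of _ "Pow {..<N}"]) (auto simp: S_def)
  moreover have "{} \<in> S"
  proof -
    have "x = 0\<^sub>v N" if "x \<in> coord_space N {}" for x :: "'a vec"
      using that by (intro eq_vecI) (auto simp: coord_space_def)
    then show ?thesis by (auto simp: S_def)
  qed
  ultimately have "\<exists>P\<in>S. \<forall>Q\<in>S. P \<subseteq> Q \<longrightarrow> P = Q"
    using finite_has_maximal[of S] by blast
  then obtain P where P: "P \<in> S" "\<And>Q. Q \<in> S \<Longrightarrow> P \<subseteq> Q \<Longrightarrow> P = Q" by blast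
  have "\<exists>u\<in>U. unit_vec N j - u \<in> coord_space N P" if j: "j < N" for j
  proof (cases "j \<in> P")
    case True
    then have "unit_vec N j - 0\<^sub>v N \<in> coord_space N P"
      using j by (auto simp: coord_space_def unit_vec_def)
    then show ?thesis using U unfolding lin_subspace_def by blast
  next
    case False
    then have "insert j P \<notin> S" using P(2)[of "insert j P"] by blast
    then obtain x where x: "x \<in> U" "x \<in> coord_space N (insert j P)" "x \<noteq> 0\<^sub>v N"
      using P(1) j by (auto simp: S_def)
    have xj: "x $ j \<noteq> 0"
    proof
      assume "x $ j = 0"
      then have "x \<in> coord_space N P" using x(2) by (auto simp: coord_space_def)
      then show False using P(1) x by (auto simp: S_def)
    qed
    have "unit_vec N j - inverse (x $ j) \<cdot>\<^sub>v x \<in> coord_space N P"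
      using x(2) xj j by (auto simp: coord_space_def)
    then show ?thesis using U x(1) unfolding lin_subspace_def by blast
  qed
  then obtain u where u: "\<And>j. j < N \<Longrightarrow> u j \<in> U \<and> unit_vec N j - u j \<in> coord_space N P" by metis
  have uC: "u j \<in> carrier_vec N" if "j < N" for j using u[OF that] U by (auto simp: lin_subspace_def)
  define pr where "pr = mat N N (\<lambda>(i, j). u j $ i)"
  have pr: "pr \<in> carrier_mat N N" by (simp add: pr_def)
  have c1: "col pr j = u j" if "j < N" for j using that uC[OF that] by (intro eq_vecI) (auto simp: pr_def)
  have c2: "col (1\<^sub>m N - pr) j = unit_vec N j - u j" if "j < N" for j
    using that uC[OF that] by (intro eq_vecI) (auto simp: pr_def)
  have "pr *\<^sub>v x \<in> U" if "x \<in> carrier_vec N" for x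
    by (rule mat_vec_subspace[OF U pr _ that]) (use c1 u in simp)
  moreover have "x - pr *\<^sub>v x \<in> coord_space N P" if x: "x \<in> carrier_vec N" for x
  proof -
    have "(1\<^sub>m N - pr) *\<^sub>v x \<in> coord_space N P"
      by (rule mat_vec_subspace[OF lin_subspace_coord _ _ x]) (use c2 u pr in auto)
    moreover have "(1\<^sub>m N - pr) *\<^sub>v x = x - pr *\<^sub>v x"
      using minus_mult_distrib_mat_vec[OF one_carrier_mat pr x] x by simp
    ultimately show ?thesis by simp
  qed
  ultimately have "projection N U P pr" using P(1) pr by (auto simp: projection_def S_def)
  then show ?thesis by blast
qed

lemma projection_unique:
  assumes U: "lin_subspace N U" and pr: "projection N U P pr" and x: "x \<in> carrier_vec N"
    and u: "u \<in> U" "x - u \<in> coord_space N P"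
  shows "pr *\<^sub>v x = u"
proof -
  have p: "pr *\<^sub>v x \<in> U" "x - pr *\<^sub>v x \<in> coord_space N P" using pr x by (auto simp: projection_def)
  have C: "u \<in> carrier_vec N" "pr *\<^sub>v x \<in> carrier_vec N" using u(1) p(1) U by (auto simp: lin_subspace_def)
  have "(x - u) - (x - pr *\<^sub>v x) \<in> coord_space N P"
    by (rule lin_subspace_diff[OF lin_subspace_coord u(2) p(2)])
  moreover have "x - u - (x - y) = y - u" if "y \<in> carrier_vec N" for y
    using C(1) x that by (intro eq_vecI) auto
  note this[OF C(2)]
  ultimately have "pr *\<^sub>v x - u \<in> U \<inter> coord_space N P"
    using lin_subspace_diff[OF U p(1) u(1)] by simp
  then have z: "pr *\<^sub>v x - u = 0\<^sub>v N" using pr by (auto simp: projection_def)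
  show ?thesis
  proof (rule eq_vecI)
    fix i assume "i < dim_vec u"
    then have i: "i < N" using C by simp
    then have "(pr *\<^sub>v x - u) $ i = 0" using z by simp
    then show "(pr *\<^sub>v x) $ i = u $ i" using i C(1) carrier_vecD[OF C(2)] by simp
  qed (use C(1) carrier_vecD[OF C(2)] in simp)
qed

text \<open>With fewer rows than columns, padding by zero rows gives a square matrix whose transpose
  kills a unit vector. So it is singular and has a kernel.\<close>

lemma injective_dim_le:
  fixes A :: "'k::field mat"
  assumes A: "A \<in> carrier_mat n N" and inj: "\<And>x. x \<in> carrier_vec N \<Longrightarrow> A *\<^sub>v x = 0\<^sub>v n \<Longrightarrow> x = 0\<^sub>v N"
  shows "N \<le> n"
proof (rule ccontr)
  assume "\<not> N \<le> n"
  then have n: "n < N" by simp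
  define B where "B = mat N N (\<lambda>(i, j). if i < n then A $$ (i, j) else 0)"
  have B: "B \<in> carrier_mat N N" by (simp add: B_def)
  have "transpose_mat B *\<^sub>v unit_vec N n = 0\<^sub>v N"
    using n by (intro eq_vecI) (auto simp: B_def)
  moreover have "unit_vec N n \<noteq> (0\<^sub>v N :: 'k vec)" using n by (metis index_unit_vec(2) index_zero_vec(1) zero_neq_one)
  ultimately have "det (transpose_mat B) = 0"
    using det_0_iff_vec_prod_zero_field[of "transpose_mat B" N] B by (auto intro!: exI[of _ "unit_vec N n"])
  then have "det B = 0" using det_transpose[OF B] by simp
  then obtain x where x: "x \<in> carrier_vec N" "x \<noteq> 0\<^sub>v N" "B *\<^sub>v x = 0\<^sub>v N"
    using det_0_iff_vec_prod_zero_field[OF B] by blast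
  have "A *\<^sub>v x = 0\<^sub>v n"
  proof (rule eq_vecI)
    fix i assume "i < dim_vec (0\<^sub>v n :: 'k vec)"
    then have i: "i < n" by simp
    have "(B *\<^sub>v x) $ i = 0" using x(3) i n by simp
    moreover have "(B *\<^sub>v x) $ i = (A *\<^sub>v x) $ i" using i n A x(1) by (simp add: B_def scalar_prod_def)
    ultimately show "(A *\<^sub>v x) $ i = 0\<^sub>v n $ i" using i by simp
  qed (use A in simp)
  then show False using inj x by blast
qed

section \<open>Modules that are products of basic modules in some coordinates\<close>

context valued_field begin

text \<open>For \<open>l = N\<close> this is \<O>^N and for \<open>l = 0\<close> it is \<MM>^N, so
  the same closure lemmas serve lattices, their multiples by \<MM>, and modules between the
  two.\<close>

definition flag_module :: "nat \<Rightarrow> nat \<Rightarrow> 'k vec set" where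
  "flag_module l N = {z \<in> carrier_vec N. (\<forall>i<l. 1 \<preceq> z $ i) \<and> (\<forall>i<N. l \<le> i \<longrightarrow> 1 \<prec> z $ i)}"

abbreviation flag_image :: "nat \<Rightarrow> nat \<Rightarrow> 'k mat \<Rightarrow> 'k vec set" where
  "flag_image l n A \<equiv> (\<lambda>x. A *\<^sub>v x) ` flag_module l n"

lemma basic_module_closed:
  assumes "basic_module J"
  shows "0 \<in> J" "x \<in> J \<Longrightarrow> y \<in> J \<Longrightarrow> x + y \<in> J" "x \<in> J \<Longrightarrow> - x \<in> J"
    "J \<noteq> {0} \<Longrightarrow> 1 \<prec> x \<Longrightarrow> x \<in> J"
  using assms unfolding basic_module_def by (auto intro: vle_add vless_add vless_imp_vle)

end

context acvf begin

text \<open>All complements are spanned by standard basis vectors, with index sets \<open>P0\<close> and \<open>T\<close>, so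
  that defining the two projections from \<open>M\<close> needs no parameters.\<close>

theorem module_code:
  fixes D :: "'k mat" and N :: nat
  assumes D: "D \<in> carrier_mat N N" "det D \<noteq> 0" and J: "\<And>p. p < N \<Longrightarrow> basic_module (J p)"
    and M: "M = {f \<in> carrier_vec N. \<forall>p<N. (D *\<^sub>v f) $ p \<in> J p}"
  defines "U0 \<equiv> {u \<in> carrier_vec N. \<forall>c. c \<cdot>\<^sub>v u \<in> M}"
  shows "\<exists>P0 pr T om A l. lin_subspace N U0 \<and> projection N U0 P0 pr \<and>
    lin_subspace N ({w \<in> carrier_vec N. \<exists>c. c \<noteq> 0 \<and> c \<cdot>\<^sub>v w \<in> M} \<inter> coord_space N P0) \<and>
    projection N ({w \<in> carrier_vec N. \<exists>c. c \<noteq> 0 \<and> c \<cdot>\<^sub>v w \<in> M} \<inter> coord_space N P0) T om \<and>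
    A \<in> carrier_mat N N \<and> det A \<noteq> 0 \<and> l \<le> N \<and>
    flag_image l N A = {x \<in> carrier_vec N. om *\<^sub>v x \<in> M \<and> (\<forall>i<N. 1 \<prec> (x - om *\<^sub>v x) $ i)} \<and>
    (\<forall>f\<in>carrier_vec N. f \<in> M \<longleftrightarrow> om *\<^sub>v (f - pr *\<^sub>v f) = f - pr *\<^sub>v f \<and>
       f - pr *\<^sub>v f \<in> flag_image l N A)"
proof -
  let ?C = "carrier_vec N :: 'k vec set"
  define U1 where "U1 = {w \<in> carrier_vec N. \<exists>c. c \<noteq> 0 \<and> c \<cdot>\<^sub>v w \<in> M}"
  define \<phi> where "\<phi> p x = (D *\<^sub>v x) $ p" for p x
  have add: "\<phi> p (x + y) = \<phi> p x + \<phi> p y" and diff: "\<phi> p (x - y) = \<phi> p x - \<phi> p y"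
    and sm: "\<phi> p (a \<cdot>\<^sub>v x) = a * \<phi> p x" if "p < N" "x \<in> ?C" "y \<in> ?C" for p x y a
    using that D(1) by (simp_all add: \<phi>_def mult_add_distrib_mat_vec mult_minus_distrib_mat_vec mult_mat_vec)
  have z\<phi>: "\<phi> p (0\<^sub>v N) = 0" if "p < N" for p using that D(1) by (simp add: \<phi>_def scalar_prod_def)
  have M\<phi>: "f \<in> M \<longleftrightarrow> (\<forall>p<N. \<phi> p f \<in> J p)" if "f \<in> ?C" for f using that by (simp add: M \<phi>_def)
  have MC: "M \<subseteq> ?C" by (auto simp: M)
  obtain C where C: "C \<in> carrier_mat N N" "D * C = 1\<^sub>m N" using matrix_inverse[OF D] by blast
  have \<phi>C: "\<phi> p (C *\<^sub>v a) = a $ p" if "a \<in> ?C" "p < N" for a p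
    unfolding \<phi>_def using that D(1) C by (simp flip: assoc_mult_mat_vec)
  \<comment> \<open>In the coordinates \<open>\<phi> p\<close> a line lies in the module iff each
    coordinate is zero or unrestricted.\<close>
  have U0: "u \<in> U0 \<longleftrightarrow> u \<in> ?C \<and> (\<forall>p<N. J p = UNIV \<or> \<phi> p u = 0)" for u
  proof -
    have "(\<forall>c. c \<cdot>\<^sub>v u \<in> M) \<longleftrightarrow> (\<forall>p<N. J p = UNIV \<or> \<phi> p u = 0)" if u: "u \<in> ?C"
    proof
      assume all: "\<forall>c. c \<cdot>\<^sub>v u \<in> M"
      show "\<forall>p<N. J p = UNIV \<or> \<phi> p u = 0"
      proof (intro allI impI, rule ccontr)
        fix p assume p: "p < N" and "\<not> (J p = UNIV \<or> \<phi> p u = 0)"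
        then obtain t where t: "t \<notin> J p" "\<phi> p u \<noteq> 0" by blast
        have "\<phi> p ((t / \<phi> p u) \<cdot>\<^sub>v u) \<in> J p" using all M\<phi>[of "(t / \<phi> p u) \<cdot>\<^sub>v u"] u p by simp
        then show False using t sm[OF p u u] by simp
      qed
    next
      assume "\<forall>p<N. J p = UNIV \<or> \<phi> p u = 0"
      then show "\<forall>c. c \<cdot>\<^sub>v u \<in> M"
        using M\<phi>[of "_ \<cdot>\<^sub>v u"] u sm[OF _ u u] basic_module_closed(1)[OF J] by auto
    qed
    then show ?thesis by (auto simp: U0_def)
  qed
  have U1: "u \<in> U1 \<longleftrightarrow> u \<in> ?C \<and> (\<forall>p<N. J p = {0} \<longrightarrow> \<phi> p u = 0)" for u
  proof -
    have "(\<exists>c. c \<noteq> 0 \<and> c \<cdot>\<^sub>v u \<in> M) \<longleftrightarrow> (\<forall>p<N. J p = {0} \<longrightarrow> \<phi> p u = 0)" if u: "u \<in> ?C"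
    proof
      assume "\<exists>c. c \<noteq> 0 \<and> c \<cdot>\<^sub>v u \<in> M"
      then obtain c where c: "c \<noteq> 0" "c \<cdot>\<^sub>v u \<in> M" by blast
      have "c * \<phi> p u \<in> J p" if p: "p < N" for p
      proof -
        have "\<phi> p (c \<cdot>\<^sub>v u) \<in> J p" using c(2) M\<phi>[of "c \<cdot>\<^sub>v u"] u p by simp
        then show ?thesis by (simp only: sm[OF p u u])
      qed
      then show "\<forall>p<N. J p = {0} \<longrightarrow> \<phi> p u = 0" using c(1) by fastforce
    next
      assume *: "\<forall>p<N. J p = {0} \<longrightarrow> \<phi> p u = 0"
      \<comment> \<open>The multiplier will be \<open>t / x\<close>, where \<open>x\<close> has
        least value among 1 and the coordinates: dividing by \<open>x\<close> makes all coordinates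
        integral, and \<open>t\<close> moves them into \<MM>.\<close>
      obtain t where t: "t \<noteq> 0" "1 \<prec> t" using ex_vless by blast
      have fin: "finite (insert 1 ((\<lambda>p. \<phi> p u) ` {..<N}))" by simp
      have "\<exists>x\<in>insert 1 ((\<lambda>p. \<phi> p u) ` {..<N}). \<forall>y\<in>insert 1 ((\<lambda>p. \<phi> p u) ` {..<N}). x \<preceq> y"
        using ex_vle_min[OF fin] by simp
      then obtain x where x: "\<forall>y\<in>insert 1 ((\<lambda>p. \<phi> p u) ` {..<N}). x \<preceq> y" by (elim bexE)
      have "x \<preceq> 1" using x by simp
      then have "x \<noteq> 0" by auto
      have "t / x * \<phi> p u \<in> J p" if p: "p < N" for p
      proof (cases "J p = {0}")
        case True
        then show ?thesis using * p by simp
      next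
        case False
        have "x \<preceq> \<phi> p u" using x p by simp
        then have "t / x * x \<preceq> t / x * \<phi> p u" using vle_mult[of "t / x" x "\<phi> p u"] t(1) \<open>x \<noteq> 0\<close> by simp
        then have "1 \<prec> t / x * \<phi> p u" using t(2) vless_vle_trans \<open>x \<noteq> 0\<close> by simp
        then show ?thesis using basic_module_closed(4)[OF J[OF p] False] by blast
      qed
      then have "(t / x) \<cdot>\<^sub>v u \<in> M" using M\<phi>[of "(t / x) \<cdot>\<^sub>v u"] u sm[OF _ u u] by simp
      then show "\<exists>c. c \<noteq> 0 \<and> c \<cdot>\<^sub>v u \<in> M" using t(1) \<open>x \<noteq> 0\<close> by (intro exI[of _ "t / x"]) simp
    qed
    then show ?thesis by (auto simp: U1_def)
  qed
  have "U0 = {u \<in> ?C. \<forall>p<N. J p \<noteq> UNIV \<longrightarrow> \<phi> p u = 0}" using U0 by blast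
  then have sub0: "lin_subspace N U0" using lin_subspace_kernel[OF D(1), of "\<lambda>p. J p \<noteq> UNIV"] by (simp add: \<phi>_def)
  have "U1 = {u \<in> ?C. \<forall>p<N. J p = {0} \<longrightarrow> \<phi> p u = 0}" using U1 by blast
  then have sub1: "lin_subspace N U1" using lin_subspace_kernel[OF D(1), of "\<lambda>p. J p = {0}"] by (simp add: \<phi>_def)
  have "U0 \<subseteq> U1"
  proof
    fix u assume "u \<in> U0"
    moreover have "(UNIV :: 'k set) \<noteq> {0}" using UNIV_I[of "1 :: 'k"] by (metis singletonD zero_neq_one)
    ultimately show "u \<in> U1" using U0[of u] U1[of u] by metis
  qed
  have "M \<subseteq> U1"
  proof
    fix f assume f: "f \<in> M"
    then have fC: "f \<in> ?C" using MC by blast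
    then show "f \<in> U1" using f M\<phi>[OF fC] U1[of f] by auto
  qed
  have "U0 \<subseteq> M"
  proof
    fix u assume u: "u \<in> U0"
    then have "1 \<cdot>\<^sub>v u \<in> M" unfolding U0_def by blast
    then show "u \<in> M" by simp
  qed
  have Mdiff: "f - g \<in> M" and Madd: "f + g \<in> M" if "f \<in> M" "g \<in> M" for f g
  proof -
    have C: "f \<in> ?C" "g \<in> ?C" using that MC by blast+
    show "f - g \<in> M"
    proof (subst M\<phi>)
      show "\<forall>p<N. \<phi> p (f - g) \<in> J p"
      proof (intro allI impI)
        fix p assume p: "p < N"
        have "\<phi> p f + - \<phi> p g \<in> J p"
          using that p M\<phi> C by (intro basic_module_closed(2,3)[OF J[OF p]]) auto
        then show "\<phi> p (f - g) \<in> J p" using diff[OF p C] by simp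
      qed
    qed (use C in simp)
    show "f + g \<in> M"
    proof (subst M\<phi>)
      show "\<forall>p<N. \<phi> p (f + g) \<in> J p"
      proof (intro allI impI)
        fix p assume p: "p < N"
        have "\<phi> p f + \<phi> p g \<in> J p"
          using that p M\<phi> C by (intro basic_module_closed(2)[OF J[OF p]]) auto
        then show "\<phi> p (f + g) \<in> J p" using add[OF p C] by simp
      qed
    qed (use C in simp)
  qed
  obtain P0 pr where pr: "projection N U0 P0 pr" using ex_projection[OF sub0] by blast
  \<comment> \<open>A complement of \<open>U0\<close> in the span \<open>U1\<close>, definable from
    the module and the index set \<open>P0\<close>.\<close>
  define W where "W = U1 \<inter> coord_space N P0"
  have subW: "lin_subspace N W"
    using sub1 lin_subspace_coord[of N P0] unfolding W_def lin_subspace_def by blast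
  obtain T om where om: "projection N W T om" using ex_projection[OF subW] by blast
  have piU: "pr *\<^sub>v x \<in> U0" "x - pr *\<^sub>v x \<in> coord_space N P0" "pr *\<^sub>v x \<in> ?C" if "x \<in> ?C" for x
    using pr that sub0 by (auto simp: projection_def lin_subspace_def)
  have omW: "om *\<^sub>v x \<in> W" "x - om *\<^sub>v x \<in> coord_space N T" "om *\<^sub>v x \<in> ?C" if "x \<in> ?C" for x
    using om that subW by (auto simp: projection_def lin_subspace_def)
  have omC: "om \<in> carrier_mat N N" and TN: "T \<subseteq> {..<N}" using om by (auto simp: projection_def)
  have WC: "W \<subseteq> ?C" using subW by (simp add: lin_subspace_def)
  have om_id: "om *\<^sub>v w = w" if w: "w \<in> W" for w
  proof (rule projection_unique[OF subW om _ w])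
    have "w - w = 0\<^sub>v N" using w WC by (intro eq_vecI) auto
    then show "w - w \<in> coord_space N T" by (simp add: coord_space_def)
  qed (use w WC in blast)
  define Os where "Os = sorted_list_of_set {p. p < N \<and> J p = {c. 1 \<preceq> c}}"
  define Ms where "Ms = sorted_list_of_set {p. p < N \<and> J p = {c. 1 \<prec> c}}"
  define Ts where "Ts = sorted_list_of_set T"
  have fin: "finite T" using TN finite_subset by blast
  have Os: "set Os = {p. p < N \<and> J p = {c. 1 \<preceq> c}}" "distinct Os" by (simp_all add: Os_def)
  have Ms: "set Ms = {p. p < N \<and> J p = {c. 1 \<prec> c}}" "distinct Ms" by (simp_all add: Ms_def)
  have Ts: "set Ts = T" "distinct Ts" using fin by (simp_all add: Ts_def)
  have OM: "set Os \<inter> set Ms = {}"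
  proof -
    have "{c. 1 \<preceq> c} \<noteq> {c. 1 \<prec> c}" using vle_refl[of 1] vless_irrefl[of 1] by blast
    then show ?thesis by (auto simp: Os Ms)
  qed
  define l where "l = length Os"
  define k where "k = length Ms"
  define n where "n = l + k + length Ts"
  \<comment> \<open>The rows read off the \<O>-type and \<MM>-type coordinates of
    \<open>om x\<close> and the \<open>T\<close>-coordinates of the rest \<open>x - om x\<close>.
    Elements of \<open>W\<close> are determined by their coordinates of these two types. The matrix
    \<open>A\<close> will be the inverse of \<open>L\<close>.\<close>
  define L where "L = mat n N (\<lambda>(r, j). if r < l then (D * om) $$ (Os ! r, j)
    else if r < l + k then (D * om) $$ (Ms ! (r - l), j) else (1\<^sub>m N - om) $$ (Ts ! (r - l - k), j))"
  have L: "L \<in> carrier_mat n N" by (simp add: L_def)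
  have OsN: "Os ! r < N" if "r < l" for r using that Os(1) nth_mem[of r Os] by (auto simp: l_def)
  have MsN: "Ms ! r < N" if "r < k" for r using that Ms(1) nth_mem[of r Ms] by (auto simp: k_def)
  have TsN: "Ts ! r < N" "Ts ! r \<in> T" if "r < length Ts" for r using that Ts(1) nth_mem[of r Ts] TN by auto
  have row_eq: "(L *\<^sub>v x) $ r = (H *\<^sub>v x) $ i"
    if "r < n" "i < N" "H \<in> carrier_mat N N" "x \<in> ?C" "\<And>j. j < N \<Longrightarrow> L $$ (r, j) = H $$ (i, j)" for r i x H
    using that L by (simp add: scalar_prod_def)
  have L1: "(L *\<^sub>v x) $ r = \<phi> (Os ! r) (om *\<^sub>v x)" if "r < l" "x \<in> ?C" for r x
  proof -
    have "(L *\<^sub>v x) $ r = ((D * om) *\<^sub>v x) $ (Os ! r)"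
      using that OsN[OF that(1)] D(1) omC
      by (intro row_eq) (simp_all add: L_def n_def del: index_mult_mat(1))
    then show ?thesis by (simp only: \<phi>_def assoc_mult_mat_vec[OF D(1) omC that(2)])
  qed
  have L2: "(L *\<^sub>v x) $ (l + r) = \<phi> (Ms ! r) (om *\<^sub>v x)" if "r < k" "x \<in> ?C" for r x
  proof -
    have "(L *\<^sub>v x) $ (l + r) = ((D * om) *\<^sub>v x) $ (Ms ! r)"
      using that MsN[OF that(1)] D(1) omC
      by (intro row_eq) (simp_all add: L_def n_def del: index_mult_mat(1))
    then show ?thesis by (simp only: \<phi>_def assoc_mult_mat_vec[OF D(1) omC that(2)])
  qed
  have L3: "(L *\<^sub>v x) $ (l + k + r) = (x - om *\<^sub>v x) $ (Ts ! r)" if "r < length Ts" "x \<in> ?C" for r x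
  proof -
    have "(L *\<^sub>v x) $ (l + k + r) = ((1\<^sub>m N - om) *\<^sub>v x) $ (Ts ! r)"
      using that TsN[OF that(1)] omC minus_carrier_mat[OF omC]
      by (intro row_eq) (simp_all add: L_def n_def)
    then show ?thesis by (simp only: minus_mult_distrib_mat_vec[OF one_carrier_mat omC that(2)] one_mult_mat_vec[OF that(2)])
  qed
  have split_r: "P r" if P: "\<And>r. r < l \<Longrightarrow> P r" "\<And>r. r < k \<Longrightarrow> P (l + r)"
      "\<And>r. r < length Ts \<Longrightarrow> P (l + k + r)" and r: "r < n" for P :: "nat \<Rightarrow> bool" and r
  proof -
    consider "r < l" | "l \<le> r" "r < l + k" | "l + k \<le> r" by linarith
    then show "P r"
    proof cases
      case 2
      then show ?thesis using P(2)[of "r - l"] by simp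
    next
      case 3
      then show ?thesis using P(3)[of "r - (l + k)"] r by (simp add: n_def)
    qed (rule P(1))
  qed
  have Jcases: "J p = UNIV \<or> p \<in> set Os \<or> p \<in> set Ms \<or> J p = {0}" if "p < N" for p
    using J[OF that] that by (auto simp: basic_module_def Os Ms)
  have inj: "x = 0\<^sub>v N" if x: "x \<in> ?C" and Lx: "L *\<^sub>v x = 0\<^sub>v n" for x
  proof -
    have 0: "(L *\<^sub>v x) $ r = 0" if "r < n" for r using Lx that by simp
    have w: "om *\<^sub>v x \<in> U1" "om *\<^sub>v x \<in> coord_space N P0" using omW[OF x] by (auto simp: W_def)
    have "J p = UNIV \<or> \<phi> p (om *\<^sub>v x) = 0" if p: "p < N" for p
    proof -
      have "\<phi> p (om *\<^sub>v x) = 0" if pp: "p \<in> set Os"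
      proof -
        obtain r where "r < l" "p = Os ! r" using pp unfolding in_set_conv_nth l_def by blast
        then show ?thesis using L1[OF _ x] 0[of r] by (simp add: n_def)
      qed
      moreover have "\<phi> p (om *\<^sub>v x) = 0" if pp: "p \<in> set Ms"
      proof -
        obtain r where "r < k" "p = Ms ! r" using pp unfolding in_set_conv_nth k_def by blast
        then show ?thesis using L2[OF _ x] 0[of "l + r"] by (simp add: n_def)
      qed
      ultimately show ?thesis using Jcases[OF p] w(1) U1 p by blast
    qed
    then have "om *\<^sub>v x \<in> U0" using U0 omW(3)[OF x] by blast
    then have omx: "om *\<^sub>v x = 0\<^sub>v N" using w(2) pr by (auto simp: projection_def)
    have "x $ i = 0" if i: "i < N" for i
    proof (cases "i \<in> T")
      case True
      then obtain r where "r < length Ts" "i = Ts ! r" using Ts(1) by (metis in_set_conv_nth)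
      then have "(x - om *\<^sub>v x) $ i = 0" using L3[OF _ x] 0[of "l + k + r"] by (simp add: n_def)
      then show ?thesis using omx x i by simp
    next
      case False
      then have "(x - om *\<^sub>v x) $ i = 0" using omW(2)[OF x] i by (auto simp: coord_space_def)
      then show ?thesis using omx x i by simp
    qed
    then show ?thesis using x by (intro eq_vecI) auto
  qed
  \<comment> \<open>Dual vectors inside \<open>W\<close>: the correction by \<open>pr\<close>
    changes only coordinates with \<open>J q = UNIV\<close>.\<close>
  have lift: "\<exists>w\<in>W. \<forall>q\<in>set Os \<union> set Ms. \<phi> q w = (if q = p then 1 else 0)" if p: "p \<in> set Os \<union> set Ms" for p
  proof -
    have pN: "p < N" using p Os Ms by blast
    have Jp: "J p \<noteq> {0}"
    proof -
      obtain t where "t \<noteq> 0" "1 \<prec> t" using ex_vless by blast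
      then have "t \<in> J p" using p vless_imp_vle by (auto simp: Os Ms)
      then show ?thesis using \<open>t \<noteq> 0\<close> by auto
    qed
    define u where "u = C *\<^sub>v unit_vec N p"
    have uC: "u \<in> ?C" using C(1) by (simp add: u_def)
    have \<phi>u: "\<phi> q u = (if q = p then 1 else 0)" if "q < N" for q
      using \<phi>C[OF unit_vec_carrier that, of p] pN that by (simp add: u_def)
    have "u \<in> U1" using U1 uC \<phi>u Jp by auto
    define w where "w = u - pr *\<^sub>v u"
    have "w \<in> U1" unfolding w_def
      using lin_subspace_diff[OF sub1 \<open>u \<in> U1\<close>] piU(1)[OF uC] \<open>U0 \<subseteq> U1\<close> by blast
    then have "w \<in> W" using piU(2)[OF uC] by (simp add: W_def w_def)
    moreover have "\<phi> q w = (if q = p then 1 else 0)" if q: "q \<in> set Os \<union> set Ms" for q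
    proof -
      have qN: "q < N" using q Os Ms by blast
      have "J q \<noteq> UNIV"
      proof
        assume "J q = UNIV"
        obtain s where s: "s \<noteq> 0" "s \<prec> 1" using ex_below by blast
        then have "\<not> 1 \<preceq> s" "\<not> 1 \<prec> s" using vless_imp_vle unfolding vless_def by blast+
        then show False using q \<open>J q = UNIV\<close> by (auto simp: Os Ms)
      qed
      then have "\<phi> q (pr *\<^sub>v u) = 0" using piU(1)[OF uC] U0 qN by blast
      then show ?thesis unfolding w_def using diff[OF qN uC piU(3)[OF uC]] \<phi>u[OF qN] by simp
    qed
    ultimately show ?thesis by blast
  qed
  have surj: "\<exists>x\<in>?C. L *\<^sub>v x = unit_vec n r" if r: "r < n" for r
  proof -
    have WL: "\<exists>x\<in>?C. L *\<^sub>v x = unit_vec n r" if w: "w \<in> W" "\<forall>q\<in>set Os \<union> set Ms. \<phi> q w = (if q = p then 1 else 0)"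
      and p1: "\<And>r'. r' < l \<Longrightarrow> Os ! r' = p \<longleftrightarrow> r' = r" and p2: "\<And>r'. r' < k \<Longrightarrow> Ms ! r' = p \<longleftrightarrow> l + r' = r"
      and p3: "r < l + k" for w p
    proof (rule bexI)
      show wC: "w \<in> ?C" using w(1) WC by blast
      have ww: "w - om *\<^sub>v w = 0\<^sub>v N" using om_id[OF w(1)] wC by (intro eq_vecI) auto
      show "L *\<^sub>v w = unit_vec n r"
      proof (rule eq_vecI)
        have "r' < n \<Longrightarrow> (L *\<^sub>v w) $ r' = (if r' = r then 1 else 0)" for r'
        proof (rule split_r[of "\<lambda>r'. (L *\<^sub>v w) $ r' = (if r' = r then 1 else 0)"])
          fix r' assume r': "r' < l"
          show "(L *\<^sub>v w) $ r' = (if r' = r then 1 else 0)"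
            using L1[OF r' wC] om_id[OF w(1)] w(2) p1[OF r'] r' by (simp add: l_def)
        next
          fix r' assume r': "r' < k"
          show "(L *\<^sub>v w) $ (l + r') = (if l + r' = r then 1 else 0)"
            using L2[OF r' wC] om_id[OF w(1)] w(2) p2[OF r'] r' by (simp add: k_def)
        next
          fix r' assume r': "r' < length Ts"
          show "(L *\<^sub>v w) $ (l + k + r') = (if l + k + r' = r then 1 else 0)"
            using L3[OF r' wC] ww p3 TsN[OF r'] by simp
        qed
        then show "(L *\<^sub>v w) $ i = unit_vec n r $ i" if "i < dim_vec (unit_vec n r :: 'k vec)" for i
          using that r by simp
      qed (use L in simp)
    qed
    consider "r < l" | r' where "r = l + r'" "r' < k" | r' where "r = l + k + r'" "r' < length Ts"
    proof -
      consider "r < l" | "l \<le> r" "r < l + k" | "l + k \<le> r" by linarith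
      then show thesis
      proof cases
        case 2
        then show ?thesis using that(2)[of "r - l"] by simp
      next
        case 3
        then show ?thesis using that(3)[of "r - (l + k)"] r by (simp add: n_def)
      qed (rule that(1))
    qed
    then show ?thesis
    proof cases
      case 1
      have p: "Os ! r \<in> set Os" using 1 by (simp add: l_def)
      then obtain w where w: "w \<in> W" "\<forall>q\<in>set Os \<union> set Ms. \<phi> q w = (if q = Os ! r then 1 else 0)"
        using lift[of "Os ! r"] by blast
      show ?thesis
      proof (rule WL[OF w])
        show "Os ! r' = Os ! r \<longleftrightarrow> r' = r" if "r' < l" for r'
          using that 1 Os(2) by (simp add: l_def nth_eq_iff_index_eq)
        show "Ms ! r' = Os ! r \<longleftrightarrow> l + r' = r" if r': "r' < k" for r'
        proof -
          have "Ms ! r' \<in> set Ms" using r' by (simp add: k_def)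
          then have "Ms ! r' \<noteq> Os ! r" using p OM by (metis disjoint_iff)
          then show ?thesis using 1 by simp
        qed
      qed (use 1 in simp)
    next
      case 2
      have p: "Ms ! r' \<in> set Ms" using 2 by (simp add: k_def)
      then obtain w where w: "w \<in> W" "\<forall>q\<in>set Os \<union> set Ms. \<phi> q w = (if q = Ms ! r' then 1 else 0)"
        using lift[of "Ms ! r'"] by blast
      show ?thesis
      proof (rule WL[OF w])
        show "Os ! s = Ms ! r' \<longleftrightarrow> s = r" if "s < l" for s
          using that 2 p OM nth_mem[of s Os] unfolding l_def by (metis disjoint_iff less_not_refl not_add_less1)
        show "Ms ! s = Ms ! r' \<longleftrightarrow> l + s = r" if "s < k" for s
          using that 2 Ms(2) by (simp add: k_def nth_eq_iff_index_eq)
      qed (use 2 in simp)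
    next
      case 3
      define x where "x = (unit_vec N (Ts ! r') :: 'k vec)"
      have xC: "x \<in> ?C" by (simp add: x_def)
      have om0: "om *\<^sub>v x = 0\<^sub>v N"
      proof (rule projection_unique[OF subW om xC])
        show "0\<^sub>v N \<in> W" using subW by (simp add: lin_subspace_def)
        show "x - 0\<^sub>v N \<in> coord_space N T" using TsN[OF 3(2)] by (auto simp: x_def coord_space_def)
      qed
      have "L *\<^sub>v x = unit_vec n r"
      proof (rule eq_vecI)
        have "s < n \<Longrightarrow> (L *\<^sub>v x) $ s = (if s = r then 1 else 0)" for s
        proof (rule split_r[of "\<lambda>s. (L *\<^sub>v x) $ s = (if s = r then 1 else 0)"])
          fix s assume s: "s < l"
          show "(L *\<^sub>v x) $ s = (if s = r then 1 else 0)"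
            using L1[OF s xC] om0 z\<phi>[OF OsN[OF s]] s 3 by simp
        next
          fix s assume s: "s < k"
          show "(L *\<^sub>v x) $ (l + s) = (if l + s = r then 1 else 0)"
            using L2[OF s xC] om0 z\<phi>[OF MsN[OF s]] s 3 by simp
        next
          fix s assume s: "s < length Ts"
          show "(L *\<^sub>v x) $ (l + k + s) = (if l + k + s = r then 1 else 0)"
            using L3[OF s xC] om0 TsN[OF s] TsN[OF 3(2)] s 3 Ts(2) xC
            by (simp add: x_def nth_eq_iff_index_eq)
        qed
        then show "(L *\<^sub>v x) $ i = unit_vec n r $ i" if "i < dim_vec (unit_vec n r :: 'k vec)" for i
          using that r by simp
      qed (use L in simp)
      then show ?thesis using xC by blast
    qed
  qed
  \<comment> \<open>\<open>L\<close> is square by comparing dimensions in both directions: it is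
    injective, and so is a right inverse of it.\<close>
  have "N \<le> n" using injective_dim_le[OF L] inj by blast
  moreover have "n \<le> N"
  proof -
    obtain x where x: "\<And>r. r < n \<Longrightarrow> x r \<in> ?C \<and> L *\<^sub>v x r = unit_vec n r" using surj by metis
    define B where "B = mat N n (\<lambda>(i, r). x r $ i)"
    have B: "B \<in> carrier_mat N n" by (simp add: B_def)
    have LB: "L * B = 1\<^sub>m n"
    proof (rule mat_col_eqI)
      fix r assume "r < dim_col (1\<^sub>m n :: 'k mat)"
      then have r: "r < n" by simp
      have "col B r = x r" using x[OF r] r by (intro eq_vecI) (auto simp: B_def)
      then show "col (L * B) r = col (1\<^sub>m n) r" using x[OF r] r by (simp add: col_mult2[OF L B r])
    qed (use L B in auto)
    show ?thesis
    proof (rule injective_dim_le[OF B])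
      fix y assume y: "y \<in> carrier_vec n" "B *\<^sub>v y = 0\<^sub>v N"
      have "y = L *\<^sub>v (B *\<^sub>v y)" using LB L B y(1) by (simp flip: assoc_mult_mat_vec)
      then show "y = 0\<^sub>v n" using y(2) L by (auto intro!: eq_vecI simp: scalar_prod_def)
    qed
  qed
  ultimately have nN: "n = N" by simp
  note L = L[unfolded nN]
  have detL: "det L \<noteq> 0" using det_0_iff_vec_prod_zero_field[OF L] inj nN by blast
  obtain A where A: "A \<in> carrier_mat N N" "L * A = 1\<^sub>m N" "A * L = 1\<^sub>m N" using matrix_inverse[OF L detL] by blast
  have detA: "det A \<noteq> 0" using det_mult[OF A(1) L] A(3) by auto
  have image: "flag_image l N A = {x \<in> ?C. om *\<^sub>v x \<in> M \<and> (\<forall>i<N. 1 \<prec> (x - om *\<^sub>v x) $ i)}"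
  proof -
    have key: "L *\<^sub>v x \<in> flag_module l N \<longleftrightarrow> om *\<^sub>v x \<in> M \<and> (\<forall>i<N. 1 \<prec> (x - om *\<^sub>v x) $ i)" if x: "x \<in> ?C" for x
    proof -
      have U1x: "om *\<^sub>v x \<in> U1" using omW(1)[OF x] by (simp add: W_def)
      have "om *\<^sub>v x \<in> M \<longleftrightarrow> (\<forall>r<l. 1 \<preceq> (L *\<^sub>v x) $ r) \<and> (\<forall>r<k. 1 \<prec> (L *\<^sub>v x) $ (l + r))"
      proof -
        have "om *\<^sub>v x \<in> M \<longleftrightarrow> (\<forall>p\<in>set Os. 1 \<preceq> \<phi> p (om *\<^sub>v x)) \<and> (\<forall>p\<in>set Ms. 1 \<prec> \<phi> p (om *\<^sub>v x))"
        proof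
          assume "om *\<^sub>v x \<in> M"
          then show "(\<forall>p\<in>set Os. 1 \<preceq> \<phi> p (om *\<^sub>v x)) \<and> (\<forall>p\<in>set Ms. 1 \<prec> \<phi> p (om *\<^sub>v x))"
            using M\<phi>[OF omW(3)[OF x]] by (auto simp: Os Ms)
        next
          assume *: "(\<forall>p\<in>set Os. 1 \<preceq> \<phi> p (om *\<^sub>v x)) \<and> (\<forall>p\<in>set Ms. 1 \<prec> \<phi> p (om *\<^sub>v x))"
          have "\<phi> p (om *\<^sub>v x) \<in> J p" if p: "p < N" for p
            using Jcases[OF p] * U1x U1 p by (auto simp: Os Ms)
          then show "om *\<^sub>v x \<in> M" using M\<phi>[OF omW(3)[OF x]] by blast
        qed
        also have "\<dots> \<longleftrightarrow> (\<forall>r<l. 1 \<preceq> \<phi> (Os ! r) (om *\<^sub>v x)) \<and> (\<forall>r<k. 1 \<prec> \<phi> (Ms ! r) (om *\<^sub>v x))"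
          by (simp add: all_set_conv_all_nth l_def k_def)
        finally show ?thesis using L1[OF _ x] L2[OF _ x] by simp
      qed
      moreover have "(\<forall>i<N. 1 \<prec> (x - om *\<^sub>v x) $ i) \<longleftrightarrow> (\<forall>r<length Ts. 1 \<prec> (L *\<^sub>v x) $ (l + k + r))"
      proof -
        have "(\<forall>i<N. 1 \<prec> (x - om *\<^sub>v x) $ i) \<longleftrightarrow> (\<forall>i\<in>set Ts. 1 \<prec> (x - om *\<^sub>v x) $ i)"
        proof
          assume *: "\<forall>i\<in>set Ts. 1 \<prec> (x - om *\<^sub>v x) $ i"
          show "\<forall>i<N. 1 \<prec> (x - om *\<^sub>v x) $ i"
          proof (intro allI impI)
            fix i assume i: "i < N"
            show "1 \<prec> (x - om *\<^sub>v x) $ i"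
            proof (cases "i \<in> T")
              case False
              then have "(x - om *\<^sub>v x) $ i = 0" using omW(2)[OF x] i unfolding coord_space_def by blast
              then show ?thesis by simp
            qed (use * Ts in blast)
          qed
        qed (use Ts TN in blast)
        then show ?thesis using L3[OF _ x] by (simp add: all_set_conv_all_nth)
      qed
      moreover have "(\<forall>i<N. l \<le> i \<longrightarrow> 1 \<prec> (L *\<^sub>v x) $ i) \<longleftrightarrow>
          (\<forall>r<k. 1 \<prec> (L *\<^sub>v x) $ (l + r)) \<and> (\<forall>r<length Ts. 1 \<prec> (L *\<^sub>v x) $ (l + k + r))"
      proof
        assume "(\<forall>r<k. 1 \<prec> (L *\<^sub>v x) $ (l + r)) \<and> (\<forall>r<length Ts. 1 \<prec> (L *\<^sub>v x) $ (l + k + r))"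
        then have "l \<le> r \<longrightarrow> 1 \<prec> (L *\<^sub>v x) $ r" if "r < n" for r
          by (intro split_r[of "\<lambda>r. l \<le> r \<longrightarrow> 1 \<prec> (L *\<^sub>v x) $ r" r, OF _ _ _ that])
            (simp_all del: index_mult_mat_vec)
        then show "\<forall>i<N. l \<le> i \<longrightarrow> 1 \<prec> (L *\<^sub>v x) $ i" using nN by blast
      qed (use nN in \<open>auto simp: n_def\<close>)
      moreover have "L *\<^sub>v x \<in> ?C" using L x by simp
      ultimately show ?thesis unfolding flag_module_def by blast
    qed
    have AL: "A *\<^sub>v (L *\<^sub>v x) = x" if "x \<in> ?C" for x using that A L by (simp flip: assoc_mult_mat_vec)
    have LA: "L *\<^sub>v (A *\<^sub>v x) = x" if "x \<in> ?C" for x using that A L by (simp flip: assoc_mult_mat_vec)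
    show ?thesis
    proof (intro equalityI subsetI)
      fix x assume "x \<in> flag_image l N A"
      then obtain z where z: "z \<in> flag_module l N" "x = A *\<^sub>v z" by blast
      have zC: "z \<in> ?C" using z(1) by (simp add: flag_module_def)
      then have xC: "x \<in> ?C" using z(2) A(1) by simp
      have "L *\<^sub>v x \<in> flag_module l N" using LA[OF zC] z by simp
      then show "x \<in> {x \<in> ?C. om *\<^sub>v x \<in> M \<and> (\<forall>i<N. 1 \<prec> (x - om *\<^sub>v x) $ i)}" using key[OF xC] xC by blast
    next
      fix x assume x: "x \<in> {x \<in> ?C. om *\<^sub>v x \<in> M \<and> (\<forall>i<N. 1 \<prec> (x - om *\<^sub>v x) $ i)}"
      then have xC: "x \<in> ?C" and "L *\<^sub>v x \<in> flag_module l N" using key by blast+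
      then show "x \<in> flag_image l N A" using AL[OF xC] by (metis image_eqI)
    qed
  qed
  \<comment> \<open>The module is a union of cosets of \<open>U0\<close>, so membership of
    \<open>f\<close> depends only on \<open>w\<close>. The equation for \<open>om\<close> puts
    \<open>w\<close> into \<open>W\<close>, where filling in the directions of \<open>T\<close> has
    changed nothing.\<close>
  have recover: "f \<in> M \<longleftrightarrow> om *\<^sub>v (f - pr *\<^sub>v f) = f - pr *\<^sub>v f \<and> f - pr *\<^sub>v f \<in> flag_image l N A"
    if f: "f \<in> ?C" for f
  proof
    define w where "w = f - pr *\<^sub>v f"
    have wC: "w \<in> ?C" using f piU(3)[OF f] by (simp add: w_def)
    have fw: "w + pr *\<^sub>v f = f" using minus_add_minus_vec_eq[OF f piU(3)[OF f]] by (simp add: w_def)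
    {
      assume "f \<in> M"
      then have wM: "w \<in> M" unfolding w_def using Mdiff piU(1)[OF f] \<open>U0 \<subseteq> M\<close> by blast
      then have "w \<in> W" using \<open>M \<subseteq> U1\<close> piU(2)[OF f] by (auto simp: W_def w_def)
      then have e: "om *\<^sub>v w = w" by (rule om_id)
      moreover have "w - w = 0\<^sub>v N" using wC by (intro eq_vecI) auto
      ultimately have "w \<in> flag_image l N A" unfolding image using wM wC by simp
      then show "om *\<^sub>v (f - pr *\<^sub>v f) = f - pr *\<^sub>v f \<and> f - pr *\<^sub>v f \<in> flag_image l N A"
        using e by (simp add: w_def)
    next
      assume *: "om *\<^sub>v (f - pr *\<^sub>v f) = f - pr *\<^sub>v f \<and> f - pr *\<^sub>v f \<in> flag_image l N A"
      then have "om *\<^sub>v w \<in> M" "om *\<^sub>v w = w" unfolding image by (auto simp: w_def)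
      then have "w \<in> M" by simp
      then have "w + pr *\<^sub>v f \<in> M" using Madd piU(1)[OF f] \<open>U0 \<subseteq> M\<close> by blast
      then show "f \<in> M" using fw by simp
    }
  qed
  have "l \<le> N" using nN by (simp add: n_def)
  then show ?thesis using sub0 pr subW om A(1) detA image recover unfolding W_def U1_def by blast
qed

end

section \<open>Definable closure\<close>

definition reps :: "'k eq_elem list \<Rightarrow> 'k list set" where
  "reps Cs = {concat xss | xss. list_all2 (\<in>) xss Cs}"

lemma reps_Nil [simp]: "reps [] = {[]}"
  by (auto simp: reps_def)

lemma reps_Cons: "z \<in> reps (C # Cs) \<longleftrightarrow> (\<exists>x\<in>C. \<exists>w\<in>reps Cs. z = x @ w)"
proof
  assume "z \<in> reps (C # Cs)"
  then obtain xss where xss: "z = concat xss" "list_all2 (\<in>) xss (C # Cs)" by (auto simp: reps_def)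
  then obtain x xss' where "xss = x # xss'" "x \<in> C" "list_all2 (\<in>) xss' Cs"
    unfolding list_all2_Cons2 by blast
  then show "\<exists>x\<in>C. \<exists>w\<in>reps Cs. z = x @ w" using xss(1) by (auto simp: reps_def)
next
  assume "\<exists>x\<in>C. \<exists>w\<in>reps Cs. z = x @ w"
  then obtain x xss where "x \<in> C" "list_all2 (\<in>) xss Cs" "z = x @ concat xss" by (auto simp: reps_def)
  then show "z \<in> reps (C # Cs)" unfolding reps_def by (intro CollectI exI[of _ "x # xss"]) simp
qed

lemma reps_snoc: "z \<in> reps (Cs @ [C]) \<longleftrightarrow> (\<exists>w\<in>reps Cs. \<exists>x\<in>C. z = w @ x)"
proof (induction Cs arbitrary: z)
  case (Cons B Cs)
  show ?case
  proof
    assume "z \<in> reps ((B # Cs) @ [C])"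
    then obtain b w x where "b \<in> B" "w \<in> reps Cs" "x \<in> C" "z = b @ w @ x" by (auto simp: reps_Cons Cons.IH)
    then show "\<exists>w\<in>reps (B # Cs). \<exists>x\<in>C. z = w @ x"
      by (intro bexI[of _ "b @ w"] bexI[of _ x]) (auto simp: reps_Cons)
  next
    assume "\<exists>w\<in>reps (B # Cs). \<exists>x\<in>C. z = w @ x"
    then obtain b w x where "b \<in> B" "w \<in> reps Cs" "x \<in> C" "z = b @ w @ x" by (auto simp: reps_Cons)
    moreover from this have "w @ x \<in> reps (Cs @ [C])" unfolding Cons.IH by blast
    ultimately show "z \<in> reps ((B # Cs) @ [C])" unfolding append_Cons reps_Cons by blast
  qed
qed (simp add: reps_Cons)

lemma listset_Cons: "Cs \<in> listset (S # Ss) \<longleftrightarrow> (\<exists>C\<in>S. \<exists>Bs\<in>listset Ss. Cs = C # Bs)"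
  by (auto simp: set_Cons_def)

lemma list_all_ConsD: "list_all P (x # xs) \<Longrightarrow> P x" "list_all P (x # xs) \<Longrightarrow> list_all P xs"
  by simp_all

lemma is_sort_cases:
  assumes "is_sort v S"
  obtains n P where "fdef v P" "\<And>C x. C \<in> S \<Longrightarrow> x \<in> C \<Longrightarrow> length x = n"
    "\<And>x y. length x = n \<Longrightarrow> length y = n \<Longrightarrow> P (env (x @ y)) \<longleftrightarrow> (\<exists>C\<in>S. x \<in> C \<and> y \<in> C)"
    "\<And>C C' x. C \<in> S \<Longrightarrow> C' \<in> S \<Longrightarrow> x \<in> C \<Longrightarrow> x \<in> C' \<Longrightarrow> C = C'" "\<And>C. C \<in> S \<Longrightarrow> \<exists>x. x \<in> C"
proof -
  obtain n D E where D: "D \<subseteq> {xs. length xs = n}" and E: "equiv D E"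
    and def: "definable v {} {xs @ ys | xs ys. (xs, ys) \<in> E}" and S: "S = D // E"
    using assms unfolding is_sort_def by blast
  obtain N P where P: "fdef v P" "\<And>zs. zs \<in> {xs @ ys | xs ys. (xs, ys) \<in> E} \<longleftrightarrow> length zs = N \<and> P (env zs)"
    by (rule definableE[OF def]) (rule that; assumption)
  have ED: "x \<in> D" "y \<in> D" if "(x, y) \<in> E" for x y
    using that E unfolding equiv_def refl_on_def by blast+
  have len: "length x = n" if "C \<in> S" "x \<in> C" for C x
    using in_quotient_imp_subset[OF E, of C] that D unfolding S by blast
  have rel: "(x, y) \<in> E \<longleftrightarrow> (\<exists>C\<in>S. x \<in> C \<and> y \<in> C)" for x y
  proof
    assume xy: "(x, y) \<in> E"
    have "E `` {x} \<in> S" unfolding S by (rule quotientI) (rule ED[OF xy])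
    moreover have "x \<in> E `` {x}" using E ED(1)[OF xy] by (rule equiv_class_self)
    ultimately show "\<exists>C\<in>S. x \<in> C \<and> y \<in> C" using xy by blast
  next
    assume "\<exists>C\<in>S. x \<in> C \<and> y \<in> C"
    then show "(x, y) \<in> E" unfolding S using in_quotient_imp_in_rel[OF E] by blast
  qed
  have uniq: "C = C'" if "C \<in> S" "C' \<in> S" "x \<in> C" "x \<in> C'" for C C' x
    using quotient_disj[OF E, of C C'] that unfolding S by blast
  have ne: "\<exists>x. x \<in> C" if "C \<in> S" for C
    using in_quotient_imp_non_empty[OF E, of C] that unfolding S by blast
  have app: "(x, y) \<in> E \<longleftrightarrow> length (x @ y) = N \<and> P (env (x @ y))" if "length x = n" "length y = n" for x y
  proof -
    have "x @ y \<in> {xs @ ys | xs ys. (xs, ys) \<in> E} \<longleftrightarrow> (x, y) \<in> E"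
    proof
      assume "x @ y \<in> {xs @ ys | xs ys. (xs, ys) \<in> E}"
      then obtain a b where ab: "x @ y = a @ b" "(a, b) \<in> E" by blast
      have "length a = n" using ED(1)[OF ab(2)] D by blast
      then show "(x, y) \<in> E" using ab that(1) by simp
    qed blast
    then show ?thesis using P(2) by simp
  qed
  show thesis
  proof (rule that[of "\<lambda>e. N = n + n \<and> P e" n])
    show "fdef v (\<lambda>e. N = n + n \<and> P e)" using P(1) by (intro fdef_intros)
    show "(N = n + n \<and> P (env (x @ y))) \<longleftrightarrow> (\<exists>C\<in>S. x \<in> C \<and> y \<in> C)" if "length x = n" "length y = n" for x y
      unfolding rel[symmetric] app[OF that] using that by auto
  qed (fact len uniq ne)+
qed

text \<open>A product of sorts, handled through concatenated representatives: \<open>P\<close>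
  decides for two such tuples whether they represent the same list of classes.\<close>

definition sort_rel ::
  "('k::field \<Rightarrow> 'g::linordered_ab_group_add) \<Rightarrow> 'k eq_sort list \<Rightarrow> nat \<Rightarrow> ((nat \<Rightarrow> 'k) \<Rightarrow> bool) \<Rightarrow> bool" where
  "sort_rel v Ss n P \<longleftrightarrow> fdef v P \<and> (\<forall>Cs\<in>listset Ss. \<forall>z\<in>reps Cs. length z = n) \<and>
    (\<forall>z z'. length z = n \<longrightarrow> length z' = n \<longrightarrow>
       (P (env (z @ z')) \<longleftrightarrow> (\<exists>Cs\<in>listset Ss. z \<in> reps Cs \<and> z' \<in> reps Cs))) \<and>
    (\<forall>Cs\<in>listset Ss. \<forall>Cs'\<in>listset Ss. \<forall>z. z \<in> reps Cs \<longrightarrow> z \<in> reps Cs' \<longrightarrow> Cs = Cs')"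

lemma ex_sort_rel:
  assumes "list_all (is_sort v) Ss"
  shows "\<exists>n P. sort_rel v Ss n P"
  using assms
proof (induction Ss)
  case Nil
  have "fdef v (\<lambda>e. True)" by (rule fdef_const)
  then show ?case unfolding sort_rel_def by (intro exI[of _ 0] exI[of _ "\<lambda>e. True"]) simp
next
  case (Cons S Ss)
  obtain n1 P1 where 1: "fdef v P1" "\<And>C x. C \<in> S \<Longrightarrow> x \<in> C \<Longrightarrow> length x = n1"
    "\<And>x y. length x = n1 \<Longrightarrow> length y = n1 \<Longrightarrow> P1 (env (x @ y)) \<longleftrightarrow> (\<exists>C\<in>S. x \<in> C \<and> y \<in> C)"
    "\<And>C C' x. C \<in> S \<Longrightarrow> C' \<in> S \<Longrightarrow> x \<in> C \<Longrightarrow> x \<in> C' \<Longrightarrow> C = C'"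
    "\<And>C. C \<in> S \<Longrightarrow> \<exists>x. x \<in> C"
    by (rule is_sort_cases[OF list_all_ConsD(1)[OF Cons.prems]]) (rule that; assumption)
  obtain n2 P2 where sr: "sort_rel v Ss n2 P2"
    using Cons.IH[OF list_all_ConsD(2)[OF Cons.prems]] by blast
  have P2: "fdef v P2" and l2: "\<And>Cs z. Cs \<in> listset Ss \<Longrightarrow> z \<in> reps Cs \<Longrightarrow> length z = n2"
    and r2: "\<And>z z'. length z = n2 \<Longrightarrow> length z' = n2 \<Longrightarrow>
       P2 (env (z @ z')) \<longleftrightarrow> (\<exists>Cs\<in>listset Ss. z \<in> reps Cs \<and> z' \<in> reps Cs)"
    and u2: "\<And>Cs Cs' z. Cs \<in> listset Ss \<Longrightarrow> Cs' \<in> listset Ss \<Longrightarrow> z \<in> reps Cs \<Longrightarrow> z \<in> reps Cs' \<Longrightarrow> Cs = Cs'"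
    using sr unfolding sort_rel_def by blast+
  \<comment> \<open>From a tuple composed of \<open>x\<close>, \<open>w\<close>, \<open>x'\<close>,
    \<open>w'\<close> these select \<open>x @ x'\<close> and \<open>w @ w'\<close>.\<close>
  define t1 where "t1 i e = (if i < n1 then e i else if i < 2 * n1 then e (i + n2) else 0)" for i and e :: "nat \<Rightarrow> 'a"
  define t2 where "t2 i e = (if i < n2 then e (n1 + i) else if i < 2 * n2 then e (i + 2 * n1) else 0)" for i and e :: "nat \<Rightarrow> 'a"
  have def: "fdef v (\<lambda>e. P1 (\<lambda>i. t1 i e) \<and> P2 (\<lambda>i. t2 i e))"
    by (intro fdef_conj fdef_subst[OF 1(1)] fdef_subst[OF P2]; unfold t1_def t2_def; intro fdef_intros)
  have t1: "(\<lambda>i. t1 i (env ((x @ w) @ (x' @ w')))) = env (x @ x')" and t2: "(\<lambda>i. t2 i (env ((x @ w) @ (x' @ w')))) = env (w @ w')"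
    if "length x = n1" "length x' = n1" "length w = n2" "length w' = n2" for x x' w w'
    using that by (auto simp: t1_def t2_def env_def fun_eq_iff nth_append intro!: arg_cong[of _ _ "(!) _"])
  have split: "\<exists>x w. z = x @ w \<and> length x = n1 \<and> length w = n2" if "length z = n1 + n2" for z :: "'a list"
    using that by (intro exI[of _ "take n1 z"] exI[of _ "drop n1 z"]) simp
  have reps: "x @ w \<in> reps (C # Cs) \<longleftrightarrow> x \<in> C \<and> w \<in> reps Cs" if "length x = n1" "C \<in> S" for x w C Cs
  proof
    assume "x @ w \<in> reps (C # Cs)"
    then obtain x' w' where x': "x' \<in> C" "w' \<in> reps Cs" "x @ w = x' @ w'" unfolding reps_Cons by blast
    then have "length x' = n1" using 1(2) that(2) by blast
    then show "x \<in> C \<and> w \<in> reps Cs" using x' that(1) by simp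
  qed (auto simp: reps_Cons)
  show ?case unfolding sort_rel_def
  proof (intro exI[of _ "n1 + n2"] exI[of _ "\<lambda>e. P1 (\<lambda>i. t1 i e) \<and> P2 (\<lambda>i. t2 i e)"] conjI def ballI allI impI)
    fix Cs z assume "Cs \<in> listset (S # Ss)" "z \<in> reps Cs"
    then show "length z = n1 + n2" unfolding listset_Cons using 1(2) l2 by (auto simp: reps_Cons)
  next
    fix z z' :: "'a list" assume "length z = n1 + n2" "length z' = n1 + n2"
    then obtain x w x' w' where z: "z = x @ w" "length x = n1" "length w = n2"
      "z' = x' @ w'" "length x' = n1" "length w' = n2" using split by metis
    have "(\<exists>Cs\<in>listset (S # Ss). z \<in> reps Cs \<and> z' \<in> reps Cs) \<longleftrightarrow>
        (\<exists>C\<in>S. x \<in> C \<and> x' \<in> C) \<and> (\<exists>Cs\<in>listset Ss. w \<in> reps Cs \<and> w' \<in> reps Cs)"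
    proof
      assume "\<exists>Cs\<in>listset (S # Ss). z \<in> reps Cs \<and> z' \<in> reps Cs"
      then obtain C Bs where "C \<in> S" "Bs \<in> listset Ss" "z \<in> reps (C # Bs)" "z' \<in> reps (C # Bs)"
        unfolding Bex_def listset_Cons by blast
      note C = this
      show "(\<exists>C\<in>S. x \<in> C \<and> x' \<in> C) \<and> (\<exists>Cs\<in>listset Ss. w \<in> reps Cs \<and> w' \<in> reps Cs)"
        using reps[OF z(2) C(1), of w Bs] reps[OF z(5) C(1), of w' Bs] C unfolding z(1,4) by blast
    next
      assume "(\<exists>C\<in>S. x \<in> C \<and> x' \<in> C) \<and> (\<exists>Cs\<in>listset Ss. w \<in> reps Cs \<and> w' \<in> reps Cs)"
      then obtain C Bs where C: "C \<in> S" "Bs \<in> listset Ss" "x \<in> C" "x' \<in> C" "w \<in> reps Bs" "w' \<in> reps Bs" by blast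
      show "\<exists>Cs\<in>listset (S # Ss). z \<in> reps Cs \<and> z' \<in> reps Cs"
      proof (intro bexI conjI)
        show "C # Bs \<in> listset (S # Ss)" unfolding listset_Cons using C by blast
        show "z \<in> reps (C # Bs)" "z' \<in> reps (C # Bs)"
          using reps[OF z(2) C(1)] reps[OF z(5) C(1)] C z(1,4) by blast+
      qed
    qed
    then show "(P1 (\<lambda>i. t1 i (env (z @ z'))) \<and> P2 (\<lambda>i. t2 i (env (z @ z')))) \<longleftrightarrow>
        (\<exists>Cs\<in>listset (S # Ss). z \<in> reps Cs \<and> z' \<in> reps Cs)"
      using t1[OF z(2,5,3,6)] t2[OF z(2,5,3,6)] 1(3)[OF z(2,5)] r2[OF z(3,6)] unfolding z(1,4) by simp
  next
    fix Cs Cs' z assume *: "Cs \<in> listset (S # Ss)" "Cs' \<in> listset (S # Ss)" "z \<in> reps Cs" "z \<in> reps Cs'"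
    obtain C Bs where C: "C \<in> S" "Bs \<in> listset Ss" "Cs = C # Bs" using *(1) unfolding listset_Cons by blast
    obtain C' Bs' where C': "C' \<in> S" "Bs' \<in> listset Ss" "Cs' = C' # Bs'" using *(2) unfolding listset_Cons by blast
    obtain x w where z: "x \<in> C" "w \<in> reps Bs" "z = x @ w" using *(3)[unfolded C(3)] unfolding reps_Cons by blast
    have "x \<in> C'" "w \<in> reps Bs'" using reps[OF 1(2)[OF C(1) z(1)] C'(1), of w Bs'] *(4) C'(3) z(3) by blast+
    then show "Cs = Cs'" using 1(4)[OF C(1) C'(1) z(1)] u2[OF C(2) C'(2) z(2)] C(3) C'(3) by blast
  qed
qed

lemma imaginary_nonempty:
  assumes "is_imaginary v e" "C \<in> fst e"
  shows "\<exists>x. x \<in> C"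
proof -
  have "is_sort v (fst e)" using assms(1) by (simp add: is_imaginary_def)
  then show ?thesis
  proof (rule is_sort_cases)
    assume "\<And>C. C \<in> fst e \<Longrightarrow> \<exists>x. x \<in> C"
    then show ?thesis using assms(2) .
  qed
qed

lemma reps_nonempty: "list_all (is_imaginary v) es \<Longrightarrow> \<exists>x. x \<in> reps (map snd es)"
proof (induction es)
  case (Cons e es)
  then obtain w where "w \<in> reps (map snd es)" using list_all_ConsD(2)[OF Cons.prems] by blast
  moreover obtain x where "x \<in> snd e"
    using imaginary_nonempty[OF list_all_ConsD(1)[OF Cons.prems]] Cons.prems by (auto simp: is_imaginary_def)
  ultimately show ?case by (auto simp: reps_Cons)
qed simp

lemma imaginary_listset: "list_all (is_imaginary v) es \<Longrightarrow> map snd es \<in> listset (map fst es)"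
  by (induction es) (auto simp: set_Cons_def is_imaginary_def)

lemma listset_snoc: "Cs \<in> listset Ss \<Longrightarrow> C \<in> S \<Longrightarrow> Cs @ [C] \<in> listset (Ss @ [S])"
  by (induction Ss arbitrary: Cs) (auto simp: set_Cons_def)

text \<open>The formula has to be correct only over the given \<open>es\<close>, for arbitrary
  representatives. Elsewhere its truth may depend on the representatives; requiring it for all of
  them yields a relation \<open>D\<close> between classes that agrees with it over
  \<open>es\<close>.\<close>

lemma in_dclI:
  fixes v :: "'k::field \<Rightarrow> 'g::linordered_ab_group_add"
  assumes e: "is_imaginary v e" and es: "list_all (is_imaginary v) es" and \<Psi>: "fdef v \<Psi>"
    and iff: "\<And>x y C. x \<in> reps (map snd es) \<Longrightarrow> C \<in> fst e \<Longrightarrow> y \<in> C \<Longrightarrow> \<Psi> (env (x @ y)) \<longleftrightarrow> C = snd e"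
  shows "in_dcl v e es"
proof -
  let ?Ss = "map fst es @ [fst e]"
  have "list_all (is_sort v) ?Ss"
    using e es by (auto simp: is_imaginary_def list_all_iff)
  then obtain n P where sr: "sort_rel v ?Ss n P" using ex_sort_rel by blast
  have P: "fdef v P" and len: "\<And>Cs z. Cs \<in> listset ?Ss \<Longrightarrow> z \<in> reps Cs \<Longrightarrow> length z = n"
    and rel: "\<And>z z'. length z = n \<Longrightarrow> length z' = n \<Longrightarrow>
       P (env (z @ z')) \<longleftrightarrow> (\<exists>Cs\<in>listset ?Ss. z \<in> reps Cs \<and> z' \<in> reps Cs)"
    and uniq: "\<And>Cs Cs' z. Cs \<in> listset ?Ss \<Longrightarrow> Cs' \<in> listset ?Ss \<Longrightarrow> z \<in> reps Cs \<Longrightarrow> z \<in> reps Cs' \<Longrightarrow> Cs = Cs'"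
    using sr unfolding sort_rel_def by blast+
  define D where "D = {Cs \<in> listset ?Ss. \<forall>z\<in>reps Cs. \<Psi> (env z)}"
  \<comment> \<open>The first clause says that the tuple represents some list of classes, the second
    that every equivalent tuple satisfies \<open>\<Psi>\<close>.\<close>
  define good where "good e \<longleftrightarrow> (\<exists>x\<in>carrier_vec n. P (\<lambda>i. if i < n then e i else if i < 2 * n then x $ (i - n) else 0)) \<and>
     (\<forall>x\<in>carrier_vec n. P (\<lambda>i. if i < n then e i else if i < 2 * n then x $ (i - n) else 0) \<longrightarrow>
       \<Psi> (\<lambda>i. if i < n then x $ i else 0))" for e :: "nat \<Rightarrow> 'k"
  have good: "fdef v good" unfolding good_def
    by (intro fdef_conj fdef_ex_vec fdef_all_vec fdef_imp fdef_subst[OF P] fdef_subst[OF \<Psi>]; intro fdef_intros; simp)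
  have good_iff: "good (env z) \<longleftrightarrow> (\<exists>Cs\<in>D. z \<in> reps Cs)" if z: "length z = n" for z
  proof -
    have 1: "P (\<lambda>i. if i < n then env z i else if i < 2 * n then x $ (i - n) else 0) \<longleftrightarrow>
        (\<exists>Cs\<in>listset ?Ss. z \<in> reps Cs \<and> list_of_vec x \<in> reps Cs)"
      and 2: "(\<lambda>i. if i < n then x $ i else 0) = env (list_of_vec x)" if x: "x \<in> carrier_vec n" for x
    proof -
      have "(\<lambda>i. if i < n then env z i else if i < 2 * n then x $ (i - n) else 0) = env (z @ list_of_vec x)"
        using x z by (auto simp: env_def fun_eq_iff nth_append list_of_vec_index)
      then show "P (\<lambda>i. if i < n then env z i else if i < 2 * n then x $ (i - n) else 0) \<longleftrightarrow>
        (\<exists>Cs\<in>listset ?Ss. z \<in> reps Cs \<and> list_of_vec x \<in> reps Cs)"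
        using rel[OF z, of "list_of_vec x"] x by simp
      show "(\<lambda>i. if i < n then x $ i else 0) = env (list_of_vec x)"
        using x by (auto simp: env_def fun_eq_iff list_of_vec_index)
    qed
    have vecs: "\<exists>x\<in>carrier_vec n. list_of_vec x = z'" if "length z' = n" for z' :: "'k list"
      using that by (intro bexI[of _ "vec_of_list z'"] carrier_vecI) (simp_all add: list_vec)
    have g: "good (env z) \<longleftrightarrow> (\<exists>x\<in>carrier_vec n. \<exists>Cs\<in>listset ?Ss. z \<in> reps Cs \<and> list_of_vec x \<in> reps Cs) \<and>
      (\<forall>x\<in>carrier_vec n. (\<exists>Cs\<in>listset ?Ss. z \<in> reps Cs \<and> list_of_vec x \<in> reps Cs) \<longrightarrow> \<Psi> (env (list_of_vec x)))"
      unfolding good_def by (intro arg_cong2[of _ _ _ _ "(\<and>)"] bex_cong ball_cong refl) (simp_all only: 1 2)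
    show ?thesis
    proof
      assume "good (env z)"
      note * = this[unfolded g]
      obtain Cs where Cs: "Cs \<in> listset ?Ss" "z \<in> reps Cs" using * by blast
      have "\<Psi> (env z')" if z': "z' \<in> reps Cs" for z'
      proof -
        obtain x where "x \<in> carrier_vec n" "list_of_vec x = z'" using vecs[OF len[OF Cs(1) z']] by blast
        then show ?thesis using * Cs z' by blast
      qed
      then show "\<exists>Cs\<in>D. z \<in> reps Cs" using Cs unfolding D_def by blast
    next
      assume "\<exists>Cs\<in>D. z \<in> reps Cs"
      then obtain Cs where Cs: "Cs \<in> listset ?Ss" "\<forall>z\<in>reps Cs. \<Psi> (env z)" "z \<in> reps Cs" unfolding D_def by blast
      obtain x where x: "x \<in> carrier_vec n" "list_of_vec x = z" using vecs[OF z] by blast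
      show "good (env z)" unfolding g
      proof (intro conjI ballI impI)
        show "\<exists>x\<in>carrier_vec n. \<exists>Cs\<in>listset ?Ss. z \<in> reps Cs \<and> list_of_vec x \<in> reps Cs"
          using x Cs by blast
        fix x assume "\<exists>Cs\<in>listset ?Ss. z \<in> reps Cs \<and> list_of_vec x \<in> reps Cs"
        then obtain Cs' where "Cs' \<in> listset ?Ss" "z \<in> reps Cs'" "list_of_vec x \<in> reps Cs'" by blast
        moreover from this have "Cs' = Cs" using uniq Cs by blast
        ultimately show "\<Psi> (env (list_of_vec x))" using Cs(2) by blast
      qed
    qed
  qed
  have "{concat xss | xss. \<exists>Cs\<in>D. list_all2 (\<in>) xss Cs} = {z. length z = n \<and> good (env z)}"
  proof -
    have "{concat xss | xss. \<exists>Cs\<in>D. list_all2 (\<in>) xss Cs} = {z. \<exists>Cs\<in>D. z \<in> reps Cs}"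
      unfolding reps_def by blast
    moreover have "length z = n" if "Cs \<in> D" "z \<in> reps Cs" for Cs z using that len unfolding D_def by blast
    ultimately show ?thesis using good_iff by blast
  qed
  then have "definable v {} {concat xss | xss. \<exists>Cs\<in>D. list_all2 (\<in>) xss Cs}"
    using definableI[OF good, of n] by simp
  moreover have "D \<subseteq> listset ?Ss" by (auto simp: D_def)
  ultimately have "eq_definable v ?Ss D" unfolding eq_definable_def by blast
  moreover have "{c \<in> fst e. map snd es @ [c] \<in> D} = {snd e}"
  proof -
    have "map snd es @ [c] \<in> D \<longleftrightarrow> c = snd e" if c: "c \<in> fst e" for c
    proof -
      obtain w where w: "w \<in> reps (map snd es)" using reps_nonempty[OF es] by blast
      obtain y where y: "y \<in> c" using imaginary_nonempty[OF e c] by blast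
      have "map snd es @ [c] \<in> D \<longleftrightarrow> (\<forall>w\<in>reps (map snd es). \<forall>y\<in>c. \<Psi> (env (w @ y)))"
        using listset_snoc[OF imaginary_listset[OF es] c] reps_snoc[of _ "map snd es" c] unfolding D_def by auto
      also have "\<dots> \<longleftrightarrow> c = snd e" using iff[OF _ c] w y by blast
      finally show ?thesis .
    qed
    moreover have "snd e \<in> fst e" using e by (simp add: is_imaginary_def)
    ultimately show ?thesis by blast
  qed
  ultimately show ?thesis using e es unfolding in_dcl_def by blast
qed

text \<open>The code becomes a formula in a tuple and a representative of a class. A member of
  \<open>X\<close> together with a representative of \<tau> fixes the arities.\<close>

lemma is_code_cases:
  assumes code: "is_code v \<tau> X" and X: "X \<noteq> {}" "\<And>xs. xs \<in> X \<Longrightarrow> length xs = r"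
  obtains n Q where "fdef v Q" "\<And>C y. C \<in> fst \<tau> \<Longrightarrow> y \<in> C \<Longrightarrow> length y = n"
    "\<And>C y. C \<in> fst \<tau> \<Longrightarrow> y \<in> C \<Longrightarrow> (\<forall>xs. length xs = r \<longrightarrow> (Q (env (xs @ y)) \<longleftrightarrow> xs \<in> X)) \<longleftrightarrow> C = snd \<tau>"
proof -
  have im: "is_imaginary v \<tau>" using code by (simp add: is_code_def)
  have "is_sort v (fst \<tau>)" using im by (simp add: is_imaginary_def)
  then obtain n P where "fdef v P" and len: "\<And>C y. C \<in> fst \<tau> \<Longrightarrow> y \<in> C \<Longrightarrow> length y = n"
    and "\<And>x y. length x = n \<Longrightarrow> length y = n \<Longrightarrow> P (env (x @ y)) \<longleftrightarrow> (\<exists>C\<in>fst \<tau>. x \<in> C \<and> y \<in> C)"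
    and uniq: "\<And>C C' x. C \<in> fst \<tau> \<Longrightarrow> C' \<in> fst \<tau> \<Longrightarrow> x \<in> C \<Longrightarrow> x \<in> C' \<Longrightarrow> C = C'"
    and ne: "\<And>C. C \<in> fst \<tau> \<Longrightarrow> \<exists>x. x \<in> C"
    by (rule is_sort_cases) (rule that; assumption)
  obtain r' D where D: "D \<subseteq> {xs. length xs = r'} \<times> fst \<tau>"
    and def: "definable v {} {xs @ ys | xs ys. \<exists>C. (xs, C) \<in> D \<and> ys \<in> C}"
    and fib': "\<forall>C\<in>fst \<tau>. {xs. (xs, C) \<in> D} = X \<longleftrightarrow> C = snd \<tau>"
    using code unfolding is_code_def by (elim conjE exE)
  note fib = bspec[OF fib']
  have t: "snd \<tau> \<in> fst \<tau>" using im by (simp add: is_imaginary_def)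
  obtain x0 where x0: "x0 \<in> X" using X(1) by blast
  have x0D: "(x0, snd \<tau>) \<in> D" using fib[OF t] x0 by blast
  then have r': "r' = r" using D X(2)[OF x0] by blast
  obtain N P where P: "fdef v P"
    "\<And>zs. zs \<in> {xs @ ys | xs ys. \<exists>C. (xs, C) \<in> D \<and> ys \<in> C} \<longleftrightarrow> length zs = N \<and> P (env zs)"
    by (rule definableE[OF def]) (rule that; assumption)
  obtain y0 where y0: "y0 \<in> snd \<tau>" using ne[OF t] by blast
  have "x0 @ y0 \<in> {xs @ ys | xs ys. \<exists>C. (xs, C) \<in> D \<and> ys \<in> C}" using x0D y0 by blast
  then have N: "N = r + n" using P(2) X(2)[OF x0] len[OF t y0] by auto
  have key: "P (env (xs @ y)) \<longleftrightarrow> (xs, C) \<in> D" if "C \<in> fst \<tau>" "y \<in> C" "length xs = r" for C y xs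
  proof -
    have "xs @ y \<in> {xs @ ys | xs ys. \<exists>C. (xs, C) \<in> D \<and> ys \<in> C} \<longleftrightarrow> (xs, C) \<in> D"
    proof
      assume "xs @ y \<in> {xs @ ys | xs ys. \<exists>C. (xs, C) \<in> D \<and> ys \<in> C}"
      then obtain xs' y' C' where *: "xs @ y = xs' @ y'" "(xs', C') \<in> D" "y' \<in> C'" by blast
      then have "length xs' = r" "C' \<in> fst \<tau>" using D r' by blast+
      then have "xs = xs'" "y = y'" using * that(3) by simp_all
      then have "C' = C" using uniq[OF \<open>C' \<in> fst \<tau>\<close> that(1) *(3)] that(2) by blast
      then show "(xs, C) \<in> D" using * \<open>xs = xs'\<close> by blast
    qed (use that(2) in blast)
    then show ?thesis using P(2)[of "xs @ y"] N len[OF that(1,2)] that(3) by simp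
  qed
  show thesis
  proof (rule that[OF P(1) len])
    fix C y assume C: "C \<in> fst \<tau>" "y \<in> C"
    have "(\<forall>xs. length xs = r \<longrightarrow> (P (env (xs @ y)) \<longleftrightarrow> xs \<in> X)) \<longleftrightarrow> {xs. (xs, C) \<in> D} = X"
      using key[OF C] D r' X(2) by blast
    then show "(\<forall>xs. length xs = r \<longrightarrow> (P (env (xs @ y)) \<longleftrightarrow> xs \<in> X)) \<longleftrightarrow> C = snd \<tau>"
      using fib[OF C(1)] by simp
  qed
qed

section \<open>Lattices and their reductions\<close>

lemma mult_unit_vec:
  fixes A :: "'a::semiring_1 mat"
  shows "A \<in> carrier_mat m n \<Longrightarrow> j < n \<Longrightarrow> A *\<^sub>v unit_vec n j = col A j"
  by (intro eq_vecI) (auto simp: scalar_prod_right_unit)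

context valued_field begin

lemma O_mult: "1 \<preceq> a \<Longrightarrow> 1 \<preceq> b \<Longrightarrow> 1 \<preceq> a * b"
  using vle_mult_mono[of 1 a 1 b] by simp

lemma MM_mult: "1 \<prec> a \<Longrightarrow> 1 \<preceq> b \<Longrightarrow> 1 \<prec> a * b"
  using vless_mult_mono1[of 1 a 1 b] by simp

lemma max_ideal_iff: "a \<in> max_ideal v \<longleftrightarrow> 1 \<prec> a"
  by (auto simp: max_ideal_def vless_def vdiv_def)

lemma val_ring_simps:
  "carrier (val_ring v) = {a. 1 \<preceq> a}" "\<one>\<^bsub>val_ring v\<^esub> = 1" "\<zero>\<^bsub>val_ring v\<^esub> = 0"
  "x \<otimes>\<^bsub>val_ring v\<^esub> y = x * y" "x \<oplus>\<^bsub>val_ring v\<^esub> y = x + y"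
  by (auto simp: val_ring_def class_ring_simps vdiv_def)

lemma cring_val_ring: "cring (val_ring v)"
proof (rule cringI)
  show "abelian_group (val_ring v)"
  proof (rule abelian_groupI)
    show "\<exists>y\<in>carrier (val_ring v). y \<oplus>\<^bsub>val_ring v\<^esub> x = \<zero>\<^bsub>val_ring v\<^esub>" if "x \<in> carrier (val_ring v)" for x
      using that by (intro bexI[of _ "- x"]) (auto simp: val_ring_simps)
  qed (auto simp: val_ring_simps algebra_simps intro: vle_add)
  show "comm_monoid (val_ring v)"
    by (rule comm_monoidI) (auto simp: val_ring_simps algebra_simps intro: O_mult)
qed (auto simp: val_ring_simps algebra_simps)

lemma Kn_simps:
  "carrier (Kn TYPE('k) n) = carrier_vec n" "\<zero>\<^bsub>Kn TYPE('k) n\<^esub> = 0\<^sub>v n"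
  "x \<oplus>\<^bsub>Kn TYPE('k) n\<^esub> y = x + y" "a \<odot>\<^bsub>Kn TYPE('k) n\<^esub> x = a \<cdot>\<^sub>v x"
  by (simp_all add: module_vec_def)

lemma module_Kn: "module (val_ring v) (Kn TYPE('k) n)"
proof (rule moduleI)
  show "abelian_group (Kn TYPE('k) n)"
  proof (rule abelian_groupI)
    show "\<exists>y\<in>carrier (Kn TYPE('k) n). y \<oplus>\<^bsub>Kn TYPE('k) n\<^esub> x = \<zero>\<^bsub>Kn TYPE('k) n\<^esub>" if "x \<in> carrier (Kn TYPE('k) n)" for x
      using that by (intro bexI[of _ "- x"]) (auto simp: Kn_simps)
  qed (auto simp: Kn_simps comm_add_vec)
qed (auto simp: Kn_simps val_ring_simps cring_val_ring add_smult_distrib_vec smult_add_distrib_vec smult_smult_assoc)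

lemma carrier_On: "carrier (On v n) = flag_module n n"
  by (auto simp: On_def flag_module_def val_ring_simps)

lemma flag_module_carrier: "z \<in> flag_module l n \<Longrightarrow> z \<in> carrier_vec n"
  by (simp add: flag_module_def)

lemma flag_module_0: "l \<le> n \<Longrightarrow> 0\<^sub>v n \<in> flag_module l n"
  by (simp add: flag_module_def)

lemma flag_module_add: "x \<in> flag_module l n \<Longrightarrow> y \<in> flag_module l n \<Longrightarrow> l \<le> n \<Longrightarrow> x + y \<in> flag_module l n"
  by (auto simp: flag_module_def intro!: vle_add vless_add)

lemma flag_module_smult: "x \<in> flag_module l n \<Longrightarrow> 1 \<preceq> a \<Longrightarrow> l \<le> n \<Longrightarrow> a \<cdot>\<^sub>v x \<in> flag_module l n"
  using O_mult MM_mult[of _ a] by (auto simp: flag_module_def mult.commute[of a])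

lemma flag_module_mono: "x \<in> flag_module l n \<Longrightarrow> l \<le> l' \<Longrightarrow> l' \<le> n \<Longrightarrow> x \<in> flag_module l' n"
  by (auto simp: flag_module_def) (metis leI order.strict_trans2 vless_imp_vle)

lemma flag_module_MM_smult: "x \<in> flag_module n n \<Longrightarrow> 1 \<prec> a \<Longrightarrow> a \<cdot>\<^sub>v x \<in> flag_module 0 n"
  using MM_mult by (auto simp: flag_module_def)

text \<open>Steinitz exchange over the valuation ring: \<open>z\<close> becomes column
  \<open>l\<close>, and the displaced unit vector moves to column \<open>i\<close>. Since
  \<open>z $ i\<close> is a unit, both the matrix and its inverse are integral.\<close>

lemma exchange_matrix:
  assumes z: "z \<in> flag_module n n" and l: "l \<le> i" "i < n" and u: "\<not> 1 \<prec> z $ i"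
  shows "\<exists>E\<in>carrier_mat n n. det E \<noteq> 0 \<and> flag_image n n E = flag_module n n \<and>
     col E l = z \<and> (\<forall>j<l. col E j = unit_vec n j)"
proof -
  define E where "E = mat n n (\<lambda>(k, j). if j = l then z $ k
     else if k = i then 0 else if k = l then (if j = i then 1 else 0) else if j = k then 1 else 0)"
  have E: "E \<in> carrier_mat n n" by (simp add: E_def)
  have zC: "z \<in> carrier_vec n" and zO: "\<And>k. k < n \<Longrightarrow> 1 \<preceq> z $ k" using z by (auto simp: flag_module_def)
  have zi: "z $ i \<noteq> 0" "z $ i \<preceq> 1" using u by (auto simp: vless_def)
  have ln: "l < n" using l by simp
  have Ey: "(E *\<^sub>v y) $ k = y $ l * z $ k + (if k = i then 0 else if k = l then y $ i else y $ k)"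
    if y: "y \<in> carrier_vec n" and k: "k < n" for y k
  proof -
    have "(E *\<^sub>v y) $ k = (\<Sum>j<n. (if j = l then y $ l * z $ k else 0) +
        (if k = i then 0 else if k = l then (if j = i then y $ i else 0) else if j = k then y $ k else 0))"
    proof -
      have "(E *\<^sub>v y) $ k = (\<Sum>j<n. E $$ (k, j) * y $ j)"
        using E y k by (simp add: scalar_prod_def lessThan_atLeast0)
      also have "\<dots> = (\<Sum>j<n. (if j = l then y $ l * z $ k else 0) +
        (if k = i then 0 else if k = l then (if j = i then y $ i else 0) else if j = k then y $ k else 0))"
        by (rule sum.cong) (use k l in \<open>auto simp: E_def\<close>)
      finally show ?thesis .
    qed
    also have "\<dots> = y $ l * z $ k + (if k = i then 0 else if k = l then y $ i else y $ k)"
      using k l ln by (simp add: sum.distrib)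
    finally show ?thesis .
  qed
  have EC: "E *\<^sub>v y \<in> carrier_vec n" if "y \<in> carrier_vec n" for y using E that by simp
  have "y = 0\<^sub>v n" if y: "y \<in> carrier_vec n" and 0: "E *\<^sub>v y = 0\<^sub>v n" for y
  proof -
    have e: "y $ l * z $ k + (if k = i then 0 else if k = l then y $ i else y $ k) = 0" if "k < n" for k
      using Ey[OF y that] 0 that by simp
    have yl: "y $ l = 0" using e[OF l(2)] zi(1) by simp
    have yi: "y $ i = 0" using e[OF ln] yl by (cases "l = i") auto
    have "y $ k = 0" if "k < n" for k using e[OF that] yl yi by (cases "k = i"; cases "k = l") auto
    then show ?thesis using y by (intro eq_vecI) auto
  qed
  then have detE: "det E \<noteq> 0" using det_0_iff_vec_prod_zero_field[OF E] by blast
  have "flag_image n n E = flag_module n n"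
  proof (intro equalityI subsetI)
    fix w assume "w \<in> flag_image n n E"
    then obtain y where y: "y \<in> flag_module n n" "w = E *\<^sub>v y" by blast
    have yO: "1 \<preceq> y $ k" if "k < n" for k using y(1) that by (simp add: flag_module_def)
    have "1 \<preceq> (E *\<^sub>v y) $ k" if k: "k < n" for k
      unfolding Ey[OF flag_module_carrier[OF y(1)] k]
      by (rule vle_add) (use yO zO k l ln O_mult in auto)
    then show "w \<in> flag_module n n" using EC[OF flag_module_carrier[OF y(1)]] unfolding y(2) flag_module_def by auto
  next
    fix w assume w: "w \<in> flag_module n n"
    have wO: "1 \<preceq> w $ k" if "k < n" for k using w that by (simp add: flag_module_def)
    \<comment> \<open>Row \<open>i\<close> of \<open>E\<close> involves \<open>y $ l\<close> alone,
      which forces this value; the other rows are then solved directly.\<close>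
    define c where "c = w $ i / z $ i"
    have c: "1 \<preceq> c"
    proof -
      have "z $ i * 1 \<preceq> z $ i * c" using vle_trans[OF zi(2) wO[OF l(2)]] zi(1) by (simp add: c_def)
      then show ?thesis using vle_mult[OF zi(1), of 1 c] by blast
    qed
    define y where "y = vec n (\<lambda>k. if k = l then c else if k = i then w $ l - c * z $ l else w $ k - c * z $ k)"
    have yC: "y \<in> carrier_vec n" by (simp add: y_def)
    have "1 \<preceq> y $ k" if k: "k < n" for k
      using that c wO[OF k] wO[OF ln] O_mult[OF c zO[OF k]] O_mult[OF c zO[OF ln]] by (auto simp: y_def intro!: vle_diff)
    then have "y \<in> flag_module n n" using yC by (simp add: flag_module_def)
    moreover have "E *\<^sub>v y = w"
    proof (rule eq_vecI)
      fix k assume "k < dim_vec w"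
      then have k: "k < n" using flag_module_carrier[OF w] by simp
      have "y $ l = c" using ln by (simp add: y_def)
      then show "(E *\<^sub>v y) $ k = w $ k"
        unfolding Ey[OF yC k] using k l ln zi(1) by (auto simp: y_def c_def)
    qed (use E flag_module_carrier[OF w] in auto)
    ultimately show "w \<in> flag_image n n E" by blast
  qed
  moreover have "col E l = z" using zC ln by (intro eq_vecI) (auto simp: E_def)
  moreover have "col E j = unit_vec n j" if "j < l" for j
    using that l by (intro eq_vecI) (auto simp: E_def unit_vec_def)
  ultimately show ?thesis using E detE by blast
qed

lemma image_mult_mat_vec:
  assumes "A \<in> carrier_mat n n" "B \<in> carrier_mat n n" "S \<subseteq> carrier_vec n"
  shows "(\<lambda>x. (A * B) *\<^sub>v x) ` S = (\<lambda>x. A *\<^sub>v x) ` (\<lambda>x. B *\<^sub>v x) ` S"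
  unfolding image_image by (rule image_cong[OF refl]) (use assms in auto)

text \<open>Take \<open>B\<close> with as many initial columns in \<open>Z\<close> as possible. An element of \<open>Z\<close> with a
  unit among its remaining coordinates could be exchanged for a further column.\<close>

lemma submodule_flag:
  assumes Z: "Z \<subseteq> flag_module n n" "flag_module 0 n \<subseteq> Z"
    and add: "\<And>x y. x \<in> Z \<Longrightarrow> y \<in> Z \<Longrightarrow> x + y \<in> Z" and sm: "\<And>x a. x \<in> Z \<Longrightarrow> 1 \<preceq> a \<Longrightarrow> a \<cdot>\<^sub>v x \<in> Z"
  shows "\<exists>B\<in>carrier_mat n n. \<exists>l\<le>n. det B \<noteq> 0 \<and> flag_image n n B = flag_module n n \<and>
     Z = flag_image l n B"
proof -
  define P where "P l \<longleftrightarrow> l \<le> n \<and> (\<exists>B\<in>carrier_mat n n. det B \<noteq> 0 \<and>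
     flag_image n n B = flag_module n n \<and> (\<forall>j<l. col B j \<in> Z))" for l
  have id: "(\<lambda>y. 1\<^sub>m n *\<^sub>v y) ` flag_module n n = flag_module n n"
    using flag_module_carrier[of _ n n] by (force simp: image_iff)
  have "P 0" unfolding P_def by (intro conjI bexI[of _ "1\<^sub>m n"] id) auto
  then have "\<exists>l. P l \<and> (\<forall>k. P k \<longrightarrow> k \<le> l)"
    by (rule ex_has_greatest_nat[of P 0 "\<lambda>l. l" "Suc n"]) (auto simp: P_def)
  then obtain l where l: "P l" "\<And>k. P k \<Longrightarrow> k \<le> l" by blast
  then obtain B where ln: "l \<le> n" and B: "B \<in> carrier_mat n n" "det B \<noteq> 0"
    "flag_image n n B = flag_module n n" "\<forall>j<l. col B j \<in> Z" unfolding P_def by blast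
  have "Z = flag_image l n B"
  proof (intro equalityI subsetI)
    fix x assume x: "x \<in> Z"
    then obtain z where z: "z \<in> flag_module n n" "x = B *\<^sub>v z" using Z(1) B(3) by blast
    have "1 \<prec> z $ i" if i: "i < n" "l \<le> i" for i
    proof (rule ccontr)
      assume u: "\<not> 1 \<prec> z $ i"
      obtain E where E: "E \<in> carrier_mat n n" "det E \<noteq> 0" "flag_image n n E = flag_module n n"
        "col E l = z" "\<forall>j<l. col E j = unit_vec n j" using exchange_matrix[OF z(1) i(2,1) u] by blast
      have cBE: "col (B * E) j = B *\<^sub>v col E j" if "j < n" for j using col_mult2[OF B(1) E(1) that] .
      have "P (Suc l)" unfolding P_def
      proof (intro conjI bexI[of _ "B * E"] allI impI)
        show "Suc l \<le> n" using i by simp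
        show "det (B * E) \<noteq> 0" using det_mult[OF B(1) E(1)] B(2) E(2) by simp
        have "flag_module n n \<subseteq> carrier_vec n" using flag_module_carrier by blast
        then show "(\<lambda>y. (B * E) *\<^sub>v y) ` flag_module n n = flag_module n n"
          using image_mult_mat_vec[OF B(1) E(1), of "flag_module n n"] E(3) B(3) by simp
        show "col (B * E) j \<in> Z" if j: "j < Suc l" for j
        proof (cases "j = l")
          case True
          then show ?thesis using cBE[of l] i E(4) z(2) x by simp
        next
          case False
          then have "j < l" "j < n" using j i by auto
          then have "col (B * E) j = col B j" using cBE[of j] E(5) B(1) by (simp add: mult_unit_vec)
          then show ?thesis using B(4) \<open>j < l\<close> by simp
        qed
        show "B * E \<in> carrier_mat n n" using B(1) E(1) by simp
      qed
      then show False using l(2)[of "Suc l"] by simp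
    qed
    then have "z \<in> flag_module l n" using z(1) ln by (auto simp: flag_module_def)
    then show "x \<in> flag_image l n B" using z(2) by blast
  next
    fix x assume "x \<in> flag_image l n B"
    then obtain z where z: "z \<in> flag_module l n" "x = B *\<^sub>v z" by blast
    show "x \<in> Z" unfolding z(2)
    proof (rule mat_vec_closed[OF _ add B(1) _ flag_module_carrier[OF z(1)]])
      show "0\<^sub>v n \<in> Z" using Z(2) flag_module_0[of 0 n] by auto
      fix j assume j: "j < n"
      show "z $ j \<cdot>\<^sub>v col B j \<in> Z"
      proof (cases "j < l")
        case True
        then show ?thesis using B(4) sm z(1) by (auto simp: flag_module_def)
      next
        case False
        \<comment> \<open>Beyond the first \<open>l\<close> columns the scalar lies in \<MM>, and
          \<MM>^n is contained in \<open>Z\<close>.\<close>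
        have "unit_vec n j \<in> flag_module n n" using j by (auto simp: flag_module_def unit_vec_def)
        then have "B *\<^sub>v unit_vec n j \<in> flag_module n n" using B(3) by blast
        then have "col B j \<in> flag_module n n" using B(1) j by (simp add: mult_unit_vec)
        then have "z $ j \<cdot>\<^sub>v col B j \<in> flag_module 0 n"
          using False j z(1) by (intro flag_module_MM_smult) (auto simp: flag_module_def)
        then show ?thesis using Z(2) by blast
      qed
    qed
  qed
  then show ?thesis using B ln by blast
qed

section \<open>The residue field and the reduction of a lattice\<close>

definition rc :: "'k \<Rightarrow> 'k set" where "rc a = {b. 1 \<prec> b - a}"

lemma rc_eq: "rc a = rc b \<longleftrightarrow> 1 \<prec> a - b"
proof
  assume "rc a = rc b"
  moreover have "a \<in> rc a" by (simp add: rc_def)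
  ultimately show "1 \<prec> a - b" by (auto simp: rc_def)
next
  assume ab: "1 \<prec> a - b"
  have "1 \<prec> c - a \<longleftrightarrow> 1 \<prec> c - b" for c
    using vless_add[of 1 "c - a" "a - b"] vless_diff[of 1 "c - b" "a - b"] ab by auto
  then show "rc a = rc b" by (simp add: rc_def)
qed

lemma rc_coset: "max_ideal v +>\<^bsub>val_ring v\<^esub> a = rc a"
proof -
  have "b \<in> (\<Union>h\<in>max_ideal v. {h + a}) \<longleftrightarrow> b \<in> rc a" for b
    by (auto simp: max_ideal_iff rc_def intro!: bexI[of _ "b - a"])
  then show ?thesis unfolding a_r_coset_def' val_ring_simps by blast
qed

text \<open>Multiplication in the quotient ring is a union over all representatives, so all their
  products must give the same class.\<close>

lemma rc_mult_cong:
  assumes "1 \<preceq> a" "1 \<preceq> b" "a' \<in> rc a" "b' \<in> rc b"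
  shows "rc (a' * b') = rc (a * b)"
proof -
  have "1 \<preceq> (b' - b) + b" using assms(2,4) by (intro vle_add) (auto simp: rc_def intro: vless_imp_vle)
  then have "1 \<prec> (a' - a) * b'" using assms by (intro MM_mult) (auto simp: rc_def)
  moreover have "1 \<prec> (b' - b) * a" using assms by (intro MM_mult) (auto simp: rc_def)
  ultimately have "1 \<prec> (a' - a) * b' + (b' - b) * a" by (rule vless_add)
  then show ?thesis unfolding rc_eq by (simp add: algebra_simps)
qed

lemma rc_self: "a \<in> rc a"
  by (simp add: rc_def)

lemma res_field_simps:
  "carrier (res_field v) = rc ` {a. 1 \<preceq> a}" "\<one>\<^bsub>res_field v\<^esub> = rc 1" "\<zero>\<^bsub>res_field v\<^esub> = rc 0"
  "rc a \<oplus>\<^bsub>res_field v\<^esub> rc b = rc (a + b)"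
  "1 \<preceq> a \<Longrightarrow> 1 \<preceq> b \<Longrightarrow> rc a \<otimes>\<^bsub>res_field v\<^esub> rc b = rc (a * b)"
proof -
  show "carrier (res_field v) = rc ` {a. 1 \<preceq> a}"
    by (simp add: res_field_def FactRing_def A_RCOSETS_def' rc_coset val_ring_simps UNION_singleton_eq_range)
  show "\<one>\<^bsub>res_field v\<^esub> = rc 1"
    by (simp add: res_field_def FactRing_def rc_coset val_ring_simps)
  show "\<zero>\<^bsub>res_field v\<^esub> = rc 0"
    by (auto simp: res_field_def FactRing_def rc_def max_ideal_iff)
  have "c \<in> rc (a + b) \<longleftrightarrow> (\<exists>x\<in>rc a. \<exists>y\<in>rc b. c = x + y)" for c
  proof
    assume "c \<in> rc (a + b)"
    then have "c - b \<in> rc a" by (simp add: rc_def algebra_simps)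
    then show "\<exists>x\<in>rc a. \<exists>y\<in>rc b. c = x + y" using rc_self[of b] by (intro bexI[of _ "c - b"] bexI[of _ b]) auto
  next
    assume "\<exists>x\<in>rc a. \<exists>y\<in>rc b. c = x + y"
    then obtain x y where xy: "x \<in> rc a" "y \<in> rc b" "c = x + y" by blast
    then have "1 \<prec> (x - a) + (y - b)" by (intro vless_add) (auto simp: rc_def)
    then show "c \<in> rc (a + b)" using xy(3) by (simp add: rc_def algebra_simps)
  qed
  then show "rc a \<oplus>\<^bsub>res_field v\<^esub> rc b = rc (a + b)"
    by (auto simp: res_field_def FactRing_def set_add_def' val_ring_simps)
  show "rc a \<otimes>\<^bsub>res_field v\<^esub> rc b = rc (a * b)" if "1 \<preceq> a" "1 \<preceq> b"
  proof -
    have "(\<Union>x\<in>rc a. \<Union>y\<in>rc b. rc (x * y)) = (\<Union>x\<in>rc a. \<Union>y\<in>rc b. rc (a * b))"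
      by (intro SUP_cong refl rc_mult_cong[OF that])
    also have "\<dots> = rc (a * b)" using rc_self[of a] rc_self[of b] by auto
    finally show ?thesis by (simp add: res_field_def FactRing_def rcoset_mult_def rc_coset val_ring_simps)
  qed
qed

lemma field_res_field: "field (res_field v)"
proof -
  have "cring (res_field v)"
  proof (rule cringI)
    show "abelian_group (res_field v)"
    proof (rule abelian_groupI)
      show "\<exists>y\<in>carrier (res_field v). y \<oplus>\<^bsub>res_field v\<^esub> x = \<zero>\<^bsub>res_field v\<^esub>" if x: "x \<in> carrier (res_field v)" for x
      proof -
        obtain a where "1 \<preceq> a" "x = rc a" using x by (auto simp: res_field_simps)
        then show ?thesis by (intro bexI[of _ "rc (- a)"]) (auto simp: res_field_simps)
      qed
    qed (auto simp: res_field_simps algebra_simps intro!: imageI vle_add)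
    show "comm_monoid (res_field v)"
      by (rule comm_monoidI) (auto simp: res_field_simps O_mult algebra_simps)
  qed (auto simp: res_field_simps O_mult vle_add algebra_simps)
  then interpret cring "res_field v" .
  show ?thesis
  proof (rule cring_fieldI)
    show "Units (res_field v) = carrier (res_field v) - {\<zero>\<^bsub>res_field v\<^esub>}"
    proof (intro equalityI subsetI)
      fix x assume "x \<in> Units (res_field v)"
      then obtain y where xy: "x \<in> carrier (res_field v)" "y \<in> carrier (res_field v)"
        "y \<otimes>\<^bsub>res_field v\<^esub> x = \<one>\<^bsub>res_field v\<^esub>" by (auto simp: Units_def)
      have "x \<noteq> \<zero>\<^bsub>res_field v\<^esub>"
      proof
        assume "x = \<zero>\<^bsub>res_field v\<^esub>"
        then have "rc 0 = rc 1" using xy r_null[OF xy(2)] by (simp add: res_field_simps)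
        then show False unfolding rc_eq by simp
      qed
      then show "x \<in> carrier (res_field v) - {\<zero>\<^bsub>res_field v\<^esub>}" using xy by blast
    next
      fix x assume x: "x \<in> carrier (res_field v) - {\<zero>\<^bsub>res_field v\<^esub>}"
      then obtain a where a1: "1 \<preceq> a" "x = rc a" by (auto simp: res_field_simps)
      then have a: "1 \<preceq> a" "x = rc a" "\<not> 1 \<prec> a" using x rc_eq[of a 0] by (auto simp: res_field_simps)
      have a0: "a \<noteq> 0" using a(3) by auto
      have "a * 1 \<preceq> a * inverse a" using a(3) a0 by (simp add: vless_def)
      then have i: "1 \<preceq> inverse a" using vle_mult[OF a0, of 1 "inverse a"] by blast
      have "rc (inverse a) \<otimes>\<^bsub>res_field v\<^esub> x = \<one>\<^bsub>res_field v\<^esub>" "x \<otimes>\<^bsub>res_field v\<^esub> rc (inverse a) = \<one>\<^bsub>res_field v\<^esub>"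
        using a i a0 by (simp_all add: res_field_simps)
      moreover have "rc (inverse a) \<in> carrier (res_field v)" using i by (auto simp: res_field_simps)
      ultimately show "x \<in> Units (res_field v)" using x unfolding Units_def by blast
    qed
  qed
qed

end

locale lattice_basis = valued_field v for v :: "'k::field \<Rightarrow> 'g::linordered_ab_group_add" +
  fixes n :: nat and A :: "'k mat"
  assumes A: "A \<in> carrier_mat n n" and det_A: "det A \<noteq> 0"
begin

definition L :: "'k vec set" where "L = flag_image n n A"

text \<open>This is \<MM> times the lattice, by \<open>max_ideal_mult_L\<close>. As the image of
  \<MM>^n it is accessible through coordinates, unlike the generated submodule.\<close>

definition mL :: "'k vec set" where "mL = flag_image 0 n A"

definition cs :: "'k vec \<Rightarrow> 'k vec set" where "cs x = (\<lambda>m. m + x) ` mL"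

lemma A_inj: "x \<in> carrier_vec n \<Longrightarrow> y \<in> carrier_vec n \<Longrightarrow> A *\<^sub>v x = A *\<^sub>v y \<Longrightarrow> x = y"
proof -
  assume x: "x \<in> carrier_vec n" and y: "y \<in> carrier_vec n" and e: "A *\<^sub>v x = A *\<^sub>v y"
  have "A *\<^sub>v (x - y) = 0\<^sub>v n" using A x y e by (simp add: mult_minus_distrib_mat_vec)
  moreover have "x - y \<in> carrier_vec n" using x y by simp
  ultimately have 0: "x - y = 0\<^sub>v n" using det_0_iff_vec_prod_zero_field[OF A] det_A by blast
  have "x = x - y + y" using minus_add_minus_vec_eq[OF x y] by simp
  then show "x = y" using 0 y by simp
qed

lemma A_carrier: "x \<in> carrier_vec n \<Longrightarrow> A *\<^sub>v x \<in> carrier_vec n"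
  using A by simp

lemma image_flag:
  assumes l: "l \<le> n"
  shows "0\<^sub>v n \<in> flag_image l n A"
    and "x \<in> flag_image l n A \<Longrightarrow> y \<in> flag_image l n A \<Longrightarrow>
       x + y \<in> flag_image l n A"
    and "x \<in> flag_image l n A \<Longrightarrow> 1 \<preceq> a \<Longrightarrow> a \<cdot>\<^sub>v x \<in> flag_image l n A"
    and "x \<in> flag_image l n A \<Longrightarrow> x \<in> carrier_vec n"
proof -
  have "A *\<^sub>v 0\<^sub>v n = 0\<^sub>v n" using A by (intro eq_vecI) (auto simp: scalar_prod_def)
  then show "0\<^sub>v n \<in> flag_image l n A" using flag_module_0[OF l] by (metis imageI)
  show "x + y \<in> flag_image l n A"
    if x: "x \<in> flag_image l n A" and y: "y \<in> flag_image l n A"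
  proof -
    obtain z w where zw: "z \<in> flag_module l n" "x = A *\<^sub>v z" "w \<in> flag_module l n" "y = A *\<^sub>v w" using x y by blast
    have "x + y = A *\<^sub>v (z + w)" using A flag_module_carrier[OF zw(1)] flag_module_carrier[OF zw(3)] zw(2,4)
      by (simp add: mult_add_distrib_mat_vec)
    then show ?thesis using flag_module_add[OF zw(1,3) l] by blast
  qed
  show "a \<cdot>\<^sub>v x \<in> flag_image l n A"
    if x: "x \<in> flag_image l n A" and a: "1 \<preceq> a"
  proof -
    obtain z where z: "z \<in> flag_module l n" "x = A *\<^sub>v z" using x by blast
    have "a \<cdot>\<^sub>v x = A *\<^sub>v (a \<cdot>\<^sub>v z)" using A flag_module_carrier[OF z(1)] z(2) by (simp add: mult_mat_vec)
    then show ?thesis using flag_module_smult[OF z(1) a l] by blast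
  qed
  show "x \<in> carrier_vec n" if "x \<in> flag_image l n A"
    using that A flag_module_carrier by auto
qed

lemmas L_closed = image_flag[OF order_refl, folded L_def]
lemmas mL_closed = image_flag[OF le0, folded mL_def]

lemma mL_smult: "x \<in> L \<Longrightarrow> 1 \<prec> a \<Longrightarrow> a \<cdot>\<^sub>v x \<in> mL"
proof -
  assume "x \<in> L" and a: "1 \<prec> a"
  then obtain z where z: "z \<in> flag_module n n" "x = A *\<^sub>v z" unfolding L_def by blast
  have "a \<cdot>\<^sub>v x = A *\<^sub>v (a \<cdot>\<^sub>v z)" using A flag_module_carrier[OF z(1)] z(2) by (simp add: mult_mat_vec)
  then show "a \<cdot>\<^sub>v x \<in> mL" unfolding mL_def using flag_module_MM_smult[OF z(1) a] by blast
qed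

lemma mL_diff: "x \<in> mL \<Longrightarrow> y \<in> mL \<Longrightarrow> x - y \<in> mL"
proof -
  assume x: "x \<in> mL" and y: "y \<in> mL"
  have "x + (- 1) \<cdot>\<^sub>v y \<in> mL" by (rule mL_closed(2)[OF x mL_closed(3)[OF y]]) simp
  moreover have "x + (- 1) \<cdot>\<^sub>v y = x - y" using mL_closed(4)[OF x] mL_closed(4)[OF y] by (intro eq_vecI) auto
  ultimately show ?thesis by simp
qed

lemma cs_iff: "x \<in> carrier_vec n \<Longrightarrow> y \<in> cs x \<longleftrightarrow> y \<in> carrier_vec n \<and> y - x \<in> mL"
proof
  assume x: "x \<in> carrier_vec n"
  {
    assume "y \<in> cs x"
    then obtain m where m: "m \<in> mL" "y = m + x" unfolding cs_def by blast
    have "m + x - x = m" using mL_closed(4)[OF m(1)] x by (intro eq_vecI) auto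
    then show "y \<in> carrier_vec n \<and> y - x \<in> mL" using m mL_closed(4)[OF m(1)] x by simp
  }
  assume y: "y \<in> carrier_vec n \<and> y - x \<in> mL"
  then have "y = (y - x) + x" using minus_add_minus_vec_eq x by metis
  then show "y \<in> cs x" unfolding cs_def using y by blast
qed

lemma cs_self: "x \<in> carrier_vec n \<Longrightarrow> x \<in> cs x"
proof -
  assume x: "x \<in> carrier_vec n"
  then have "x - x = 0\<^sub>v n" by (intro eq_vecI) auto
  then show ?thesis using cs_iff[OF x, of x] x mL_closed(1) by simp
qed

lemma cs_eq: "x \<in> carrier_vec n \<Longrightarrow> y \<in> carrier_vec n \<Longrightarrow> cs x = cs y \<longleftrightarrow> x - y \<in> mL"
proof
  assume x: "x \<in> carrier_vec n" and y: "y \<in> carrier_vec n"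
  show "x - y \<in> mL" if "cs x = cs y" using cs_self[OF x] cs_iff[OF y] that by blast
  assume xy: "x - y \<in> mL"
  have "z - x \<in> mL \<longleftrightarrow> z - y \<in> mL" if z: "z \<in> carrier_vec n" for z
  proof -
    have 1: "z - y = (z - x) + (x - y)" and 2: "z - x = (z - y) - (x - y)" using x y z by (auto intro!: eq_vecI)
    show ?thesis using mL_closed(2)[OF _ xy, of "z - x"] mL_diff[OF _ xy, of "z - y"] 1 2 by metis
  qed
  then show "cs x = cs y" using cs_iff[OF x] cs_iff[OF y] by blast
qed

lemma submodule_L: "LinearCombinations.submodule (val_ring v) L (Kn TYPE('k) n)"
  by (rule submodule.intro) (use L_closed module_Kn in \<open>auto simp: Kn_simps val_ring_simps\<close>)

lemma max_ideal_mult_L: "max_ideal_mult v n L = mL"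
proof
  have "LinearCombinations.submodule (val_ring v) mL (Kn TYPE('k) n)"
    by (rule submodule.intro) (use mL_closed module_Kn in \<open>auto simp: Kn_simps val_ring_simps\<close>)
  then show "max_ideal_mult v n L \<subseteq> mL"
    unfolding max_ideal_mult_def using mL_smult by (auto simp: max_ideal_iff)
  show "mL \<subseteq> max_ideal_mult v n L" unfolding max_ideal_mult_def
  proof (intro subsetI InterI)
    fix x N assume x: "x \<in> mL" and "N \<in> {N. LinearCombinations.submodule (val_ring v) N (Kn TYPE('k) n) \<and>
         (\<forall>a\<in>max_ideal v. \<forall>x\<in>L. a \<cdot>\<^sub>v x \<in> N)}"
    then have N: "LinearCombinations.submodule (val_ring v) N (Kn TYPE('k) n)"
      and aN: "\<And>a x. 1 \<prec> a \<Longrightarrow> x \<in> L \<Longrightarrow> a \<cdot>\<^sub>v x \<in> N" by (auto simp: max_ideal_iff)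
    obtain z where z: "z \<in> flag_module 0 n" "x = A *\<^sub>v z" using x unfolding mL_def by blast
    \<comment> \<open>Each term of the expansion is a column of \<open>A\<close>, hence an element
      of the lattice, scaled by an element of \<MM>.\<close>
    show "x \<in> N" unfolding z(2)
    proof (rule mat_vec_closed[OF _ _ A _ flag_module_carrier[OF z(1)]])
      show "0\<^sub>v n \<in> N" using submodule.zero_closed[OF N] by (simp add: Kn_simps)
      show "a + b \<in> N" if "a \<in> N" "b \<in> N" for a b using submodule.m_closed[OF N that] by (simp add: Kn_simps)
      fix j assume j: "j < n"
      have "unit_vec n j \<in> flag_module n n" using j by (auto simp: flag_module_def unit_vec_def)
      then have "col A j \<in> L" unfolding L_def using A j by (metis mult_unit_vec imageI)
      then show "z $ j \<cdot>\<^sub>v col A j \<in> N" using aN z(1) j by (simp add: flag_module_def)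
    qed
  qed
qed

lemma cs_coset: "max_ideal_mult v n L +>\<^bsub>Kn TYPE('k) n\<^esub> x = cs x"
  unfolding a_r_coset_def' Kn_simps max_ideal_mult_L cs_def by blast

lemma cs_smult_cong:
  assumes "1 \<preceq> a" "b \<in> rc a" "x \<in> L" "y \<in> cs x"
  shows "cs (b \<cdot>\<^sub>v y) = cs (a \<cdot>\<^sub>v x)"
proof -
  have xC: "x \<in> carrier_vec n" using assms(3) L_closed(4) by blast
  have yC: "y \<in> carrier_vec n" and yx: "y - x \<in> mL" using assms(4) cs_iff[OF xC] by auto
  have "1 \<preceq> (b - a) + a" using assms(1,2) by (intro vle_add) (auto simp: rc_def intro: vless_imp_vle)
  then have "b \<cdot>\<^sub>v (y - x) \<in> mL" using mL_closed(3)[OF yx] by simp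
  moreover have "(b - a) \<cdot>\<^sub>v x \<in> mL" using mL_smult[OF assms(3)] assms(2) by (simp add: rc_def)
  ultimately have "b \<cdot>\<^sub>v (y - x) + (b - a) \<cdot>\<^sub>v x \<in> mL" by (rule mL_closed(2))
  moreover have "b \<cdot>\<^sub>v (y - x) + (b - a) \<cdot>\<^sub>v x = b \<cdot>\<^sub>v y - a \<cdot>\<^sub>v x"
    using xC yC by (intro eq_vecI) (auto simp: algebra_simps)
  ultimately show ?thesis using cs_eq xC yC by simp
qed

lemma res_simps:
  "carrier (res v n L) = cs ` L" "\<zero>\<^bsub>res v n L\<^esub> = cs (0\<^sub>v n)"
  "x \<in> carrier_vec n \<Longrightarrow> y \<in> carrier_vec n \<Longrightarrow> cs x \<oplus>\<^bsub>res v n L\<^esub> cs y = cs (x + y)"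
  "1 \<preceq> a \<Longrightarrow> x \<in> L \<Longrightarrow> rc a \<odot>\<^bsub>res v n L\<^esub> cs x = cs (a \<cdot>\<^sub>v x)"
proof -
  have "max_ideal_mult v n L +>\<^bsub>(Kn TYPE('k) n)\<lparr>carrier := L\<rparr>\<^esub> x = cs x" for x
    unfolding cs_coset[symmetric] a_r_coset_def' by simp
  then show "carrier (res v n L) = cs ` L"
    by (simp add: res_def A_RCOSETS_def' UNION_singleton_eq_range)
  have "m + 0\<^sub>v n = m" if "m \<in> mL" for m using mL_closed(4)[OF that] by simp
  then have "cs (0\<^sub>v n) = mL" unfolding cs_def by simp
  then show "\<zero>\<^bsub>res v n L\<^esub> = cs (0\<^sub>v n)" by (simp add: res_def max_ideal_mult_L)
  show "cs x \<oplus>\<^bsub>res v n L\<^esub> cs y = cs (x + y)" if x: "x \<in> carrier_vec n" and y: "y \<in> carrier_vec n"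
  proof -
    have "c \<in> cs (x + y) \<longleftrightarrow> (\<exists>a\<in>cs x. \<exists>b\<in>cs y. c = a + b)" for c
    proof
      assume c: "c \<in> cs (x + y)"
      then have cC: "c \<in> carrier_vec n" "c - (x + y) \<in> mL" using cs_iff[of "x + y" c] x y by auto
      have "c - y - x = c - (x + y)" using cC(1) x y by (intro eq_vecI) auto
      then have "c - y \<in> cs x" using cs_iff[OF x] cC y by simp
      moreover have "c = c - y + y" using minus_add_minus_vec_eq[OF cC(1) y] by simp
      ultimately show "\<exists>a\<in>cs x. \<exists>b\<in>cs y. c = a + b" using cs_self[OF y] by blast
    next
      assume "\<exists>a\<in>cs x. \<exists>b\<in>cs y. c = a + b"
      then obtain a b where ab: "a \<in> cs x" "b \<in> cs y" "c = a + b" by blast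
      have a: "a \<in> carrier_vec n" "a - x \<in> mL" and b: "b \<in> carrier_vec n" "b - y \<in> mL"
        using ab cs_iff[OF x] cs_iff[OF y] by auto
      have "(a - x) + (b - y) = c - (x + y)" using a(1) b(1) x y ab(3) by (intro eq_vecI) auto
      then show "c \<in> cs (x + y)" using cs_iff[of "x + y" c] mL_closed(2)[OF a(2) b(2)] x y a(1) b(1) ab(3) by simp
    qed
    then show ?thesis by (auto simp: res_def set_add_def' Kn_simps)
  qed
  show "rc a \<odot>\<^bsub>res v n L\<^esub> cs x = cs (a \<cdot>\<^sub>v x)" if a: "1 \<preceq> a" and x: "x \<in> L"
  proof -
    have "(\<Union>b\<in>rc a. \<Union>y\<in>cs x. cs (b \<cdot>\<^sub>v y)) = (\<Union>b\<in>rc a. \<Union>y\<in>cs x. cs (a \<cdot>\<^sub>v x))"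
      by (intro SUP_cong refl cs_smult_cong[OF a _ x])
    also have "\<dots> = cs (a \<cdot>\<^sub>v x)" using rc_self[of a] cs_self[OF L_closed(4)[OF x]] by auto
    finally show ?thesis by (simp add: res_def cs_coset)
  qed
qed

lemma vectorspace_res: "vectorspace (res_field v) (res v n L)"
proof -
  interpret K: field "res_field v" by (rule field_res_field)
  note LC = L_closed(4)
  have "module (res_field v) (res v n L)"
  proof (rule moduleI)
    show "cring (res_field v)" by (rule K.is_cring)
    show "abelian_group (res v n L)"
    proof (rule abelian_groupI)
      show "x \<oplus>\<^bsub>res v n L\<^esub> y \<in> carrier (res v n L)"
        if "x \<in> carrier (res v n L)" "y \<in> carrier (res v n L)" for x y
        using that LC L_closed(2) by (auto simp: res_simps)
      show "\<zero>\<^bsub>res v n L\<^esub> \<in> carrier (res v n L)" using L_closed(1) by (simp add: res_simps)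
      show "x \<oplus>\<^bsub>res v n L\<^esub> y \<oplus>\<^bsub>res v n L\<^esub> z = x \<oplus>\<^bsub>res v n L\<^esub> (y \<oplus>\<^bsub>res v n L\<^esub> z)"
        if "x \<in> carrier (res v n L)" "y \<in> carrier (res v n L)" "z \<in> carrier (res v n L)" for x y z
        using that LC by (auto simp: res_simps assoc_add_vec[of _ n])
      show "x \<oplus>\<^bsub>res v n L\<^esub> y = y \<oplus>\<^bsub>res v n L\<^esub> x"
        if "x \<in> carrier (res v n L)" "y \<in> carrier (res v n L)" for x y
        using that LC by (auto simp: res_simps comm_add_vec[of _ n])
      show "\<zero>\<^bsub>res v n L\<^esub> \<oplus>\<^bsub>res v n L\<^esub> x = x" if "x \<in> carrier (res v n L)" for x
        using that LC by (auto simp: res_simps)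
      show "\<exists>y\<in>carrier (res v n L). y \<oplus>\<^bsub>res v n L\<^esub> x = \<zero>\<^bsub>res v n L\<^esub>" if x: "x \<in> carrier (res v n L)" for x
      proof -
        obtain w where w: "w \<in> L" "x = cs w" using x by (auto simp: res_simps)
        have "(- 1) \<cdot>\<^sub>v w \<in> L" by (rule L_closed(3)[OF w(1)]) simp
        moreover have "(- 1) \<cdot>\<^sub>v w + w = 0\<^sub>v n" using LC[OF w(1)] by (intro eq_vecI) auto
        ultimately show ?thesis using w LC[OF w(1)]
          by (intro bexI[of _ "cs ((- 1) \<cdot>\<^sub>v w)"]) (simp_all add: res_simps)
      qed
    qed
    fix a x assume "a \<in> carrier (res_field v)" "x \<in> carrier (res v n L)"
    then obtain \<alpha> w where aw: "1 \<preceq> \<alpha>" "a = rc \<alpha>" "w \<in> L" "x = cs w" by (auto simp: res_simps res_field_simps)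
    show "a \<odot>\<^bsub>res v n L\<^esub> x \<in> carrier (res v n L)" using aw L_closed(3) by (simp add: res_simps)
    {
      fix b assume "b \<in> carrier (res_field v)"
      then obtain \<beta> where b: "1 \<preceq> \<beta>" "b = rc \<beta>" by (auto simp: res_field_simps)
      show "(a \<oplus>\<^bsub>res_field v\<^esub> b) \<odot>\<^bsub>res v n L\<^esub> x = a \<odot>\<^bsub>res v n L\<^esub> x \<oplus>\<^bsub>res v n L\<^esub> b \<odot>\<^bsub>res v n L\<^esub> x"
        using aw b LC[OF aw(3)] by (simp add: res_simps res_field_simps vle_add add_smult_distrib_vec)
      show "(a \<otimes>\<^bsub>res_field v\<^esub> b) \<odot>\<^bsub>res v n L\<^esub> x = a \<odot>\<^bsub>res v n L\<^esub> (b \<odot>\<^bsub>res v n L\<^esub> x)"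
        using aw b L_closed(3) by (simp add: res_simps res_field_simps O_mult smult_smult_assoc)
    }
    fix y assume "y \<in> carrier (res v n L)"
    then obtain u where u: "u \<in> L" "y = cs u" by (auto simp: res_simps)
    show "a \<odot>\<^bsub>res v n L\<^esub> (x \<oplus>\<^bsub>res v n L\<^esub> y) = a \<odot>\<^bsub>res v n L\<^esub> x \<oplus>\<^bsub>res v n L\<^esub> a \<odot>\<^bsub>res v n L\<^esub> y"
      using aw u LC[OF aw(3)] LC[OF u(1)] L_closed(2) by (simp add: res_simps smult_add_distrib_vec[of _ n])
  next
    show "\<one>\<^bsub>res_field v\<^esub> \<odot>\<^bsub>res v n L\<^esub> x = x" if "x \<in> carrier (res v n L)" for x
      using that by (auto simp: res_simps res_field_simps)
  qed
  then show ?thesis using field_res_field by (rule vectorspace.intro)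
qed

end

context lattice_basis begin

lemma A_flag_carrier: "x \<in> flag_image l n A \<Longrightarrow> x \<in> carrier_vec n"
  using A flag_module_carrier by auto

lemma A_flag_L: "x \<in> flag_image l n A \<Longrightarrow> l \<le> n \<Longrightarrow> x \<in> L"
  unfolding L_def by (elim imageE, hypsubst, rule imageI, rule flag_module_mono) auto

lemma mL_A_flag: "x \<in> mL \<Longrightarrow> l \<le> n \<Longrightarrow> x \<in> flag_image l n A"
  unfolding mL_def by (elim imageE, hypsubst, rule imageI, rule flag_module_mono) auto

text \<open>The reduction of the module. It is spanned by the residues of the first \<open>l\<close>
  columns, since the remaining coordinates lie in \<MM>.\<close>

definition flag_space :: "nat \<Rightarrow> 'k vec set set" where
  "flag_space l = cs ` flag_image l n A"

lemma subspace_flag_space: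
  assumes l: "l \<le> n"
  shows "VectorSpace.subspace (res_field v) (flag_space l) (res v n L)"
proof (rule subspace.intro[OF vectorspace_res], rule submodule.intro)
  show "module (res_field v) (res v n L)" using vectorspace_res by (simp add: vectorspace_def)
  show "flag_space l \<subseteq> carrier (res v n L)"
    unfolding flag_space_def res_simps using A_flag_L[OF _ l] by blast
  show "x \<oplus>\<^bsub>res v n L\<^esub> y \<in> flag_space l" if "x \<in> flag_space l" "y \<in> flag_space l" for x y
  proof -
    obtain a b where ab: "a \<in> flag_image l n A" "x = cs a"
      "b \<in> flag_image l n A" "y = cs b" using \<open>x \<in> _\<close> \<open>y \<in> _\<close> unfolding flag_space_def by blast
    then show ?thesis using res_simps(3)[OF A_flag_carrier[OF ab(1)] A_flag_carrier[OF ab(3)]]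
        image_flag(2)[OF l ab(1,3)] unfolding flag_space_def by simp
  qed
  show "\<zero>\<^bsub>res v n L\<^esub> \<in> flag_space l" unfolding res_simps flag_space_def using image_flag(1)[OF l] by blast
  show "c \<odot>\<^bsub>res v n L\<^esub> x \<in> flag_space l" if "c \<in> carrier (res_field v)" "x \<in> flag_space l" for c x
  proof -
    obtain a where a: "a \<in> flag_image l n A" "x = cs a" using \<open>x \<in> _\<close> unfolding flag_space_def by blast
    obtain g where g: "1 \<preceq> g" "c = rc g" using \<open>c \<in> _\<close> by (auto simp: res_field_simps)
    show ?thesis using res_simps(4)[OF g(1) A_flag_L[OF a(1) l]] image_flag(3)[OF l a(1) g(1)] a(2) g(2)
      unfolding flag_space_def by simp
  qed
qed

text \<open>The residues of the first \<open>l\<close> columns form a basis. Combinations over the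
  residue field are computed by lifting the coefficients to \<O>, and such a combination vanishes
  only if all lifts lie in \<MM>.\<close>

lemma dim_flag_space:
  assumes l: "l \<le> n"
  shows "vectorspace.fin_dim (res_field v) ((res v n L)\<lparr>carrier := flag_space l\<rparr>)"
    and "vectorspace.dim (res_field v) ((res v n L)\<lparr>carrier := flag_space l\<rparr>) = l"
proof -
  interpret W: vectorspace "res_field v" "(res v n L)\<lparr>carrier := flag_space l\<rparr>"
    by (rule vectorspace.subspace_is_vs[OF vectorspace_res subspace_flag_space[OF l]])
  let ?W = "(res v n L)\<lparr>carrier := flag_space l\<rparr>"
  define b where "b i = cs (col A i)" for i
  define w where "w T \<alpha> = vec n (\<lambda>i. if i \<in> T then \<alpha> i else 0)" for T :: "nat set" and \<alpha> :: "nat \<Rightarrow> 'k"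
  have wC: "w T \<alpha> \<in> carrier_vec n" for T \<alpha> by (simp add: w_def)
  have colC: "col A i \<in> carrier_vec n" if "i < n" for i using A that by simp
  have colE: "col A i = A *\<^sub>v unit_vec n i" if "i < n" for i using mult_unit_vec[OF A that] by simp
  have scale: "\<alpha> \<cdot>\<^sub>v col A i \<in> flag_image l n A" if "1 \<preceq> \<alpha>" "i < l" for \<alpha> i
  proof -
    have "unit_vec n i \<in> flag_module l n" using that l by (auto simp: flag_module_def unit_vec_def)
    then have "col A i \<in> flag_image l n A" using colE[of i] that l by simp
    then show ?thesis using image_flag(3)[OF l _ that(1)] by blast
  qed
  have sm: "rc \<alpha> \<odot>\<^bsub>?W\<^esub> b i = cs (\<alpha> \<cdot>\<^sub>v col A i)" "cs (\<alpha> \<cdot>\<^sub>v col A i) \<in> flag_space l" if "1 \<preceq> \<alpha>" "i < l" for \<alpha> i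
  proof -
    have "1 \<cdot>\<^sub>v col A i \<in> flag_image l n A" by (rule scale) (use that in auto)
    then have "col A i \<in> L" using A_flag_L[OF _ l] by simp
    then show "rc \<alpha> \<odot>\<^bsub>?W\<^esub> b i = cs (\<alpha> \<cdot>\<^sub>v col A i)" using res_simps(4)[OF that(1)] by (simp add: b_def)
    show "cs (\<alpha> \<cdot>\<^sub>v col A i) \<in> flag_space l" unfolding flag_space_def using scale[OF that] by blast
  qed
  have binj: "i = j" if "b i = b j" "i < l" "j < l" for i j
  proof (rule ccontr)
    assume ij: "i \<noteq> j"
    have "col A i - col A j \<in> mL" using that cs_eq[OF colC colC] l by (simp add: b_def)
    then obtain z where z: "z \<in> flag_module 0 n" "col A i - col A j = A *\<^sub>v z" unfolding mL_def by blast
    have "A *\<^sub>v (unit_vec n i - unit_vec n j) = A *\<^sub>v z"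
      using z(2) colE[of i] colE[of j] that l A by (simp add: mult_minus_distrib_mat_vec)
    then have "unit_vec n i - unit_vec n j = z" by (rule A_inj[rotated 2]) (use flag_module_carrier[OF z(1)] in auto)
    then have "1 \<prec> (unit_vec n i - unit_vec n j :: 'k vec) $ i" using z(1) that l by (simp add: flag_module_def)
    then show False using that l ij by simp
  qed
  have lc: "finite T \<Longrightarrow> T \<subseteq> {..<l} \<Longrightarrow> (\<And>i. i \<in> T \<Longrightarrow> 1 \<preceq> \<alpha> i \<and> a (b i) = rc (\<alpha> i)) \<Longrightarrow>
      W.lincomb a (b ` T) = cs (A *\<^sub>v w T \<alpha>)" for T a \<alpha>
  proof (induction T rule: finite_induct)
    case empty
    have "A *\<^sub>v w {} \<alpha> = 0\<^sub>v n" using A by (intro eq_vecI) (auto simp: w_def scalar_prod_def)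
    then show ?case by (simp add: W.lincomb_def res_simps)
  next
    case (insert i T)
    have i: "i < l" "i < n" "1 \<preceq> \<alpha> i" "a (b i) = rc (\<alpha> i)" using insert.prems l by auto
    have T: "1 \<preceq> \<alpha> j" "a (b j) = rc (\<alpha> j)" "j < l" if "j \<in> T" for j using insert.prems that by auto
    have IH: "W.lincomb a (b ` T) = cs (A *\<^sub>v w T \<alpha>)" by (rule insert.IH) (use insert.prems in auto)
    have "b i \<notin> b ` T" using binj[of i] i(1) T(3) insert.hyps(2) by blast
    then have "W.lincomb a (b ` insert i T) = a (b i) \<odot>\<^bsub>?W\<^esub> b i \<oplus>\<^bsub>?W\<^esub> W.lincomb a (b ` T)"
      unfolding W.lincomb_def image_insert
      by (intro W.M.finsum_insert) (use insert.hyps(1) i T sm in auto)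
    also have "\<dots> = cs (\<alpha> i \<cdot>\<^sub>v col A i) \<oplus>\<^bsub>res v n L\<^esub> cs (A *\<^sub>v w T \<alpha>)" using IH i(4) sm(1)[OF i(3,1)] by simp
    also have "\<dots> = cs (\<alpha> i \<cdot>\<^sub>v col A i + A *\<^sub>v w T \<alpha>)"
      using colC[OF i(2)] A_carrier[OF wC] by (intro res_simps(3)) auto
    also have "\<alpha> i \<cdot>\<^sub>v col A i + A *\<^sub>v w T \<alpha> = A *\<^sub>v w (insert i T) \<alpha>"
    proof -
      have "w (insert i T) \<alpha> = \<alpha> i \<cdot>\<^sub>v unit_vec n i + w T \<alpha>"
        using insert.hyps(2) by (intro eq_vecI) (auto simp: w_def unit_vec_def)
      then show ?thesis using A wC[of T \<alpha>] colE[OF i(2)] by (simp add: mult_add_distrib_mat_vec mult_mat_vec)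
    qed
    finally show ?case .
  qed
  let ?S = "b ` {..<l}"
  have bS: "?S \<subseteq> carrier ?W"
  proof
    fix s assume "s \<in> ?S"
    then obtain i where "i < l" "s = b i" by blast
    then show "s \<in> carrier ?W" using sm(2)[of 1 i] by (simp add: b_def)
  qed
  have gen: "W.span ?S = carrier ?W"
  proof
    show "W.span ?S \<subseteq> carrier ?W" using bS by (rule W.span_is_subset2)
    show "carrier ?W \<subseteq> W.span ?S"
    proof
      fix x assume "x \<in> carrier ?W"
      then obtain z where z: "z \<in> flag_module l n" "x = cs (A *\<^sub>v z)" unfolding flag_space_def by auto
      define a where "a s = rc (z $ (inv_into {..<l} b s))" for s
      have ab: "a (b i) = rc (z $ i)" if "i < l" for i
        using that binj unfolding a_def by (subst inv_into_f_f) (auto simp: inj_on_def)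
      have zO: "1 \<preceq> z $ i" if "i < l" for i using z(1) that by (simp add: flag_module_def)
      have "W.lincomb a ?S = cs (A *\<^sub>v w {..<l} (\<lambda>i. z $ i))" by (rule lc) (use ab zO in auto)
      also have "\<dots> = x"
      proof -
        have zC: "z \<in> carrier_vec n" by (rule flag_module_carrier[OF z(1)])
        have "w {..<l} (\<lambda>i. z $ i) - z \<in> flag_module 0 n" using z(1) by (auto simp: flag_module_def w_def)
        then have "A *\<^sub>v (w {..<l} (\<lambda>i. z $ i) - z) \<in> mL" unfolding mL_def by blast
        then show ?thesis unfolding z(2) using cs_eq[OF A_carrier[OF wC] A_carrier[OF zC]]
            mult_minus_distrib_mat_vec[OF A wC zC] by simp
      qed
      finally have "x = W.lincomb a ?S" by simp
      moreover have "a \<in> ?S \<rightarrow> carrier (res_field v)" using ab zO by (auto simp: res_field_simps)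
      ultimately show "x \<in> W.span ?S" unfolding W.span_def by blast
    qed
  qed
  have "W.lin_indpt ?S"
  proof (rule W.finite_lin_indpt2)
    fix a assume a: "a \<in> ?S \<rightarrow> carrier (res_field v)" and 0: "W.lincomb a ?S = \<zero>\<^bsub>?W\<^esub>"
    have "\<exists>\<alpha>. 1 \<preceq> \<alpha> \<and> a (b i) = rc \<alpha>" if "i < l" for i using a that by (auto simp: res_field_simps)
    then obtain \<alpha> where \<alpha>: "\<And>i. i < l \<Longrightarrow> 1 \<preceq> \<alpha> i \<and> a (b i) = rc (\<alpha> i)" by metis
    have "cs (A *\<^sub>v w {..<l} \<alpha>) = cs (0\<^sub>v n)" using lc[of "{..<l}" \<alpha> a] \<alpha> 0 by (simp add: res_simps)
    then have "A *\<^sub>v w {..<l} \<alpha> - 0\<^sub>v n \<in> mL" using cs_eq[OF A_carrier[OF wC] zero_carrier_vec] by blast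
    moreover have "A *\<^sub>v w {..<l} \<alpha> - 0\<^sub>v n = A *\<^sub>v w {..<l} \<alpha>" using A_carrier[OF wC] by simp
    ultimately obtain z where z: "z \<in> flag_module 0 n" "A *\<^sub>v w {..<l} \<alpha> = A *\<^sub>v z" unfolding mL_def by auto
    have "w {..<l} \<alpha> = z" by (rule A_inj[OF wC flag_module_carrier[OF z(1)] z(2)])
    then have "1 \<prec> w {..<l} \<alpha> $ i" if "i < l" for i using z(1) that l by (simp add: flag_module_def)
    then have "rc (\<alpha> i) = rc 0" if "i < l" for i unfolding rc_eq using that l by (simp add: w_def)
    then show "\<forall>s\<in>?S. a s = \<zero>\<^bsub>res_field v\<^esub>" using \<alpha> by (auto simp: res_field_simps)
  qed (use bS in auto)
  then have "W.basis ?S" unfolding W.basis_def using gen bS by blast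
  then have "W.dim = card ?S" by (intro W.dim_basis) auto
  also have "card ?S = l" using binj by (subst card_image) (auto simp: inj_on_def)
  finally show "W.dim = l" .
  show "W.fin_dim" unfolding W.fin_dim_def using gen bS by (intro exI[of _ ?S]) auto
qed

lemma lattice_L: "lattice v n L"
  unfolding lattice_def
proof (intro conjI bexI[of _ "\<lambda>x. A *\<^sub>v x"])
  show "LinearCombinations.submodule (val_ring v) L (Kn TYPE('k) n)" by (rule submodule_L)
  show "bij_betw (\<lambda>x. A *\<^sub>v x) (carrier (On v n)) L"
    unfolding carrier_On bij_betw_def L_def inj_on_def using A_inj flag_module_carrier by blast
  show "(\<lambda>x. A *\<^sub>v x) \<in> LinearCombinations.module_hom (val_ring v) (On v n) ((Kn TYPE('k) n)\<lparr>carrier := L\<rparr>)"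
    unfolding LinearCombinations.module_hom_def carrier_On
    using A flag_module_carrier
    by (auto simp: On_def Kn_simps L_def mult_add_distrib_mat_vec[of _ n n] mult_mat_vec[of _ n n])
qed

lemma R_sort_L: "l \<le> n \<Longrightarrow> (L, flag_space l) \<in> R_sort v n l"
  unfolding R_sort_def using lattice_L subspace_flag_space dim_flag_space by blast

text \<open>In \<open>frames\<close> the coordinates from \<open>l\<close> on are zero, in the flag
  module they lie in \<MM>; the difference disappears in the reduction.\<close>

lemma frame_space:
  assumes l: "l \<le> n"
  shows "(\<lambda>x. max_ideal_mult v n L +>\<^bsub>Kn TYPE('k) n\<^esub> (A *\<^sub>v x)) `
      {x \<in> carrier (On v n). \<forall>i\<in>{l..<n}. x $ i = 0} = flag_space l"
  unfolding cs_coset carrier_On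
proof (intro equalityI subsetI)
  fix X assume "X \<in> (\<lambda>x. cs (A *\<^sub>v x)) ` {x \<in> flag_module n n. \<forall>i\<in>{l..<n}. x $ i = 0}"
  then obtain x where "x \<in> flag_module n n" "\<forall>i\<in>{l..<n}. x $ i = 0" "X = cs (A *\<^sub>v x)" by blast
  moreover from this have "x \<in> flag_module l n" using l by (auto simp: flag_module_def)
  ultimately show "X \<in> flag_space l" unfolding flag_space_def by blast
next
  fix X assume "X \<in> flag_space l"
  then obtain x where x: "x \<in> flag_module l n" "X = cs (A *\<^sub>v x)" unfolding flag_space_def by blast
  define y where "y = vec n (\<lambda>i. if i < l then x $ i else 0)"
  have y: "y \<in> flag_module n n" "y \<in> carrier_vec n" using x(1) by (auto simp: flag_module_def y_def)
  have xC: "x \<in> carrier_vec n" by (rule flag_module_carrier[OF x(1)])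
  have "x - y \<in> flag_module 0 n" using x(1) by (auto simp: flag_module_def y_def)
  then have "A *\<^sub>v (x - y) \<in> mL" unfolding mL_def by blast
  then have "X = cs (A *\<^sub>v y)" unfolding x(2)
    using cs_eq[OF A_carrier[OF xC] A_carrier[OF y(2)]] mult_minus_distrib_mat_vec[OF A xC y(2)] by simp
  moreover have "\<forall>i\<in>{l..<n}. y $ i = 0" by (simp add: y_def)
  ultimately show "X \<in> (\<lambda>x. cs (A *\<^sub>v x)) ` {x \<in> flag_module n n. \<forall>i\<in>{l..<n}. x $ i = 0}" using y(1) by blast
qed

text \<open>As \<open>mL\<close> is contained in the module, the module is a union of cosets and is
  recovered from its reduction.\<close>

lemma Union_flag_space:
  assumes l: "l \<le> n"
  shows "\<Union>(flag_space l) = flag_image l n A"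
proof (intro equalityI subsetI)
  fix y assume "y \<in> \<Union>(flag_space l)"
  then obtain x where x: "x \<in> flag_image l n A" "y \<in> cs x" unfolding flag_space_def by blast
  then obtain m where "m \<in> mL" "y = m + x" unfolding cs_def by blast
  then show "y \<in> flag_image l n A" using image_flag(2)[OF l mL_A_flag[OF _ l] x(1)] by blast
next
  fix y assume y: "y \<in> flag_image l n A"
  then show "y \<in> \<Union>(flag_space l)" unfolding flag_space_def using cs_self[OF A_flag_carrier[OF y]] by blast
qed

end

lemma invertible_mat_iff_det:
  fixes A :: "'k::field mat"
  assumes A: "A \<in> carrier_mat n n"
  shows "invertible_mat A \<longleftrightarrow> det A \<noteq> 0"
proof
  assume "invertible_mat A"
  then obtain B where B: "A * B = 1\<^sub>m n" "B * A = 1\<^sub>m (dim_row B)"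
    using A unfolding invertible_mat_def inverts_mat_def by auto
  have "dim_col (A * B) = n" "dim_col (B * A) = dim_row B" by (simp_all only: B index_one_mat)
  then have "B \<in> carrier_mat n n" using A by auto
  then show "det A \<noteq> 0" using det_mult[OF A, of B] B(1) by auto
next
  assume "det A \<noteq> 0"
  then obtain B where "B \<in> carrier_mat n n" "A * B = 1\<^sub>m n" "B * A = 1\<^sub>m n" using matrix_inverse[OF A] by blast
  then show "invertible_mat A" using A unfolding invertible_mat_def inverts_mat_def by auto
qed

section \<open>Bases adapted to a lattice and a subspace of its reduction\<close>

context valued_field begin

abbreviation GLn :: "nat \<Rightarrow> 'k mat set" where "GLn n \<equiv> {A \<in> carrier_mat n n. det A \<noteq> 0}"

lemma lattice_basis: "A \<in> GLn n \<Longrightarrow> lattice_basis v n A"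
  by unfold_locales auto

text \<open>The isomorphism from \<O>^n is multiplication by the matrix of images of the unit
  vectors. A nonzero kernel vector of this matrix could be scaled into \<O>^n, against
  injectivity.\<close>

lemma lattice_has_basis:
  assumes "lattice v n \<Lambda>"
  shows "\<exists>A\<in>GLn n. \<Lambda> = lattice_basis.L v n A"
proof -
  obtain f where f: "f \<in> LinearCombinations.module_hom (val_ring v) (On v n) ((Kn TYPE('k) n)\<lparr>carrier := \<Lambda>\<rparr>)"
    "bij_betw f (flag_module n n) \<Lambda>" and sub: "LinearCombinations.submodule (val_ring v) \<Lambda> (Kn TYPE('k) n)"
    using assms unfolding lattice_def carrier_On by blast
  have fadd: "f (x + y) = f x + f y" if "x \<in> flag_module n n" "y \<in> flag_module n n" for x y
    using f(1) that unfolding LinearCombinations.module_hom_def carrier_On by (auto simp: On_def Kn_simps)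
  have fsm: "f (a \<cdot>\<^sub>v x) = a \<cdot>\<^sub>v f x" if "x \<in> flag_module n n" "1 \<preceq> a" for x a
    using f(1) that unfolding LinearCombinations.module_hom_def carrier_On
    by (auto simp: On_def Kn_simps val_ring_simps)
  have \<Lambda>C: "\<Lambda> \<subseteq> carrier_vec n" using submodule.subset[OF sub] by (simp add: Kn_simps)
  have fC: "f x \<in> carrier_vec n" if "x \<in> flag_module n n" for x
    using f(2) that \<Lambda>C unfolding bij_betw_def by blast
  define A where "A = mat n n (\<lambda>(i, j). f (unit_vec n j) $ i)"
  have A: "A \<in> carrier_mat n n" by (simp add: A_def)
  have uO: "unit_vec n j \<in> flag_module n n" if "j < n" for j using that by (auto simp: flag_module_def unit_vec_def)
  have colA: "col A j = f (unit_vec n j)" if "j < n" for j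
    using fC[OF uO[OF that]] that by (intro eq_vecI) (auto simp: A_def)
  define U where "U = {y \<in> flag_module n n. f y = A *\<^sub>v y}"
  have z0: "0\<^sub>v n \<in> flag_module n n" by (simp add: flag_module_0)
  have f0: "f (0\<^sub>v n) = 0\<^sub>v n"
  proof -
    have "0 \<cdot>\<^sub>v f (0\<^sub>v n) = 0\<^sub>v n" using fC[OF z0] by (intro eq_vecI) auto
    moreover have "0 \<cdot>\<^sub>v 0\<^sub>v n = (0\<^sub>v n :: 'k vec)" by (intro eq_vecI) auto
    ultimately show ?thesis using fsm[OF z0, of 0] by simp
  qed
  have fA: "f x = A *\<^sub>v x" if x: "x \<in> flag_module n n" for x
  proof -
    have "1\<^sub>m n *\<^sub>v x \<in> U"
    proof (rule mat_vec_closed[OF _ _ one_carrier_mat _ flag_module_carrier[OF x]])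
      have "A *\<^sub>v 0\<^sub>v n = 0\<^sub>v n" using A by (intro eq_vecI) (auto simp: scalar_prod_def)
      then show "0\<^sub>v n \<in> U" using f0 z0 by (simp add: U_def)
      show "a + b \<in> U" if "a \<in> U" "b \<in> U" for a b
        using that fadd A flag_module_carrier[of a n n] flag_module_carrier[of b n n]
        by (auto simp: U_def flag_module_add mult_add_distrib_mat_vec[of A n n])
      show "x $ j \<cdot>\<^sub>v col (1\<^sub>m n) j \<in> U" if j: "j < n" for j
      proof -
        have xj: "1 \<preceq> x $ j" using x j by (simp add: flag_module_def)
        have "f (x $ j \<cdot>\<^sub>v unit_vec n j) = A *\<^sub>v (x $ j \<cdot>\<^sub>v unit_vec n j)"
          using fsm[OF uO[OF j] xj] colA[OF j] mult_unit_vec[OF A j] A by (simp add: mult_mat_vec[of A n n])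
        then show ?thesis using flag_module_smult[OF uO[OF j] xj] j by (simp add: U_def)
      qed
    qed
    then show ?thesis using flag_module_carrier[OF x] by (simp add: U_def)
  qed
  have "det A \<noteq> 0"
  proof
    assume "det A = 0"
    then obtain x where x: "x \<in> carrier_vec n" "x \<noteq> 0\<^sub>v n" "A *\<^sub>v x = 0\<^sub>v n"
      using det_0_iff_vec_prod_zero_field[OF A] by blast
    have fin: "finite (insert 1 ((\<lambda>i. x $ i) ` {..<n}))" by simp
    have "\<exists>c\<in>insert 1 ((\<lambda>i. x $ i) ` {..<n}). \<forall>y\<in>insert 1 ((\<lambda>i. x $ i) ` {..<n}). c \<preceq> y"
      using ex_vle_min[OF fin] by simp
    then obtain c where c: "\<forall>y\<in>insert 1 ((\<lambda>i. x $ i) ` {..<n}). c \<preceq> y" by (elim bexE)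
    have "c \<preceq> 1" using c by simp
    then have c0: "c \<noteq> 0" by auto
    have "1 \<preceq> inverse c * x $ i" if "i < n" for i
    proof -
      have "c * (inverse c * x $ i) = x $ i" using c0 by (simp add: field_simps)
      moreover have "c \<preceq> x $ i" using c that by simp
      ultimately have "c * 1 \<preceq> c * (inverse c * x $ i)" by (simp only: mult_1_right)
      then show ?thesis using vle_mult[OF c0] by blast
    qed
    then have xO: "inverse c \<cdot>\<^sub>v x \<in> flag_module n n" using x(1) by (simp add: flag_module_def)
    have "inverse c \<cdot>\<^sub>v 0\<^sub>v n = (0\<^sub>v n :: 'k vec)" by (intro eq_vecI) auto
    then have "f (inverse c \<cdot>\<^sub>v x) = f (0\<^sub>v n)"
      unfolding fA[OF xO] f0 using A x(1,3) by (simp add: mult_mat_vec[of A n n])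
    then have "inverse c \<cdot>\<^sub>v x = 0\<^sub>v n" using f(2) xO z0 unfolding bij_betw_def by (meson inj_onD)
    then have "x $ i = 0" if "i < n" for i
      using that x(1) c0 by (metis index_smult_vec(1) index_zero_vec(1) carrier_vecD mult_eq_0_iff nonzero_imp_inverse_nonzero)
    then show False using x(1,2) by (metis eq_vecI carrier_vecD index_zero_vec)
  qed
  then have A': "A \<in> GLn n" using A by simp
  have "\<Lambda> = flag_image n n A"
    using f(2) fA unfolding bij_betw_def by (metis image_cong)
  then show ?thesis using A' lattice_basis.L_def[OF lattice_basis[OF A']] by blast
qed

text \<open>The preimage of \<open>V\<close> in \<O>^n is a module between \<MM>^n and \<O>^n, so
  \<open>submodule_flag\<close> supplies a change of basis that turns it into a flag module. The
  dimension of \<open>V\<close> then identifies its length.\<close>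

lemma R_sort_has_basis:
  assumes "(\<Lambda>, V) \<in> R_sort v n l"
  shows "l \<le> n \<and> (\<exists>A\<in>GLn n. \<Lambda> = lattice_basis.L v n A \<and> V = lattice_basis.flag_space v n A l)"
proof -
  have lat: "lattice v n \<Lambda>" and V: "VectorSpace.subspace (res_field v) V (res v n \<Lambda>)"
    and dim: "vectorspace.dim (res_field v) ((res v n \<Lambda>)\<lparr>carrier := V\<rparr>) = l"
    using assms unfolding R_sort_def by auto
  obtain A where A: "A \<in> GLn n" "\<Lambda> = lattice_basis.L v n A" using lattice_has_basis[OF lat] by blast
  interpret A: lattice_basis v n A by (rule lattice_basis[OF A(1)])
  have sub: "LinearCombinations.submodule (res_field v) V (res v n A.L)"
    using subspace.submod[OF V] A(2) by simp
  define Z where "Z = {z \<in> flag_module n n. A.cs (A *\<^sub>v z) \<in> V}"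
  have AL: "A *\<^sub>v z \<in> A.L" "A *\<^sub>v z \<in> carrier_vec n" if "z \<in> flag_module n n" for z
    using that A.A_carrier[OF flag_module_carrier[OF that]] unfolding A.L_def by blast+
  have "\<exists>B\<in>carrier_mat n n. \<exists>r\<le>n. det B \<noteq> 0 \<and> flag_image n n B = flag_module n n \<and>
     Z = flag_image r n B"
  proof (rule submodule_flag)
    show "Z \<subseteq> flag_module n n" by (auto simp: Z_def)
    show "flag_module 0 n \<subseteq> Z"
    proof
      fix z assume z: "z \<in> flag_module 0 n"
      then have "A *\<^sub>v z \<in> A.mL" unfolding A.mL_def by blast
      then have "A.cs (A *\<^sub>v z) = A.cs (0\<^sub>v n)"
        using A.cs_eq[OF A.mL_closed(4) zero_carrier_vec, of "A *\<^sub>v z"] A.mL_closed(4)[of "A *\<^sub>v z"] by simp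
      then show "z \<in> Z" using submodule.zero_closed[OF sub] flag_module_mono[OF z, of n] A.res_simps(2) by (simp add: Z_def)
    qed
    show "x + y \<in> Z" if x: "x \<in> Z" and y: "y \<in> Z" for x y
    proof -
      have xy: "x \<in> flag_module n n" "y \<in> flag_module n n" using x y by (auto simp: Z_def)
      have "A.cs (A *\<^sub>v x) \<oplus>\<^bsub>res v n A.L\<^esub> A.cs (A *\<^sub>v y) \<in> V"
        using x y by (intro submodule.m_closed[OF sub]) (auto simp: Z_def)
      then have "A.cs (A *\<^sub>v x + A *\<^sub>v y) \<in> V" using A.res_simps(3)[OF AL(2)[OF xy(1)] AL(2)[OF xy(2)]] by simp
      then show ?thesis using mult_add_distrib_mat_vec[OF A.A flag_module_carrier[OF xy(1)] flag_module_carrier[OF xy(2)]]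
          flag_module_add[OF xy] by (simp add: Z_def)
    qed
    show "a \<cdot>\<^sub>v x \<in> Z" if x: "x \<in> Z" and a: "1 \<preceq> a" for x a
    proof -
      have xO: "x \<in> flag_module n n" using x by (auto simp: Z_def)
      have "rc a \<odot>\<^bsub>res v n A.L\<^esub> A.cs (A *\<^sub>v x) \<in> V"
        using x a by (intro submodule.smult_closed[OF sub]) (auto simp: Z_def res_field_simps)
      then have "A.cs (a \<cdot>\<^sub>v (A *\<^sub>v x)) \<in> V" using A.res_simps(4)[OF a AL(1)[OF xO]] by simp
      then show ?thesis using mult_mat_vec[OF A.A flag_module_carrier[OF xO]]
          flag_module_smult[OF xO a] by (simp add: Z_def)
    qed
  qed
  then obtain B r where B: "B \<in> carrier_mat n n" "r \<le> n" "det B \<noteq> 0" "flag_image n n B = flag_module n n"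
    "Z = flag_image r n B" by blast
  have AB: "A * B \<in> GLn n" using A.A B(1,3) A.det_A by (simp add: det_mult[OF A.A B(1)])
  interpret AB: lattice_basis v n "A * B" by (rule lattice_basis[OF AB])
  have FC: "flag_module k n \<subseteq> carrier_vec n" for k using flag_module_carrier by blast
  have L: "AB.L = A.L" unfolding AB.L_def A.L_def image_mult_mat_vec[OF A.A B(1) FC] B(4) by simp
  have cs: "AB.cs = A.cs" by (rule ext) (simp only: AB.cs_coset[symmetric] A.cs_coset[symmetric] L)
  have "V = A.cs ` (\<lambda>x. A *\<^sub>v x) ` Z"
  proof (intro equalityI subsetI)
    fix X assume X: "X \<in> V"
    then have "X \<in> A.cs ` A.L" using submodule.subset[OF sub] A.res_simps(1) by blast
    then obtain z where "z \<in> flag_module n n" "X = A.cs (A *\<^sub>v z)" unfolding A.L_def by blast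
    then show "X \<in> A.cs ` (\<lambda>x. A *\<^sub>v x) ` Z" using X by (auto simp: Z_def)
  qed (auto simp: Z_def)
  then have V': "V = AB.flag_space r"
    unfolding AB.flag_space_def cs image_mult_mat_vec[OF A.A B(1) FC] B(5) by simp
  have "r = l" using AB.dim_flag_space(2)[OF B(2)] dim unfolding A(2) V'[symmetric] L by simp
  then show ?thesis using AB B(2) V' L A(2) by blast
qed

lemma frames_eq_bases:
  assumes l: "l \<le> n"
  shows "frames v n l \<Lambda> V = {concat (mat_to_list B) | B. B \<in> GLn n \<and> \<Lambda> = lattice_basis.L v n B \<and>
     V = lattice_basis.flag_space v n B l}"
proof -
  have "B \<in> carrier_mat n n \<and> invertible_mat B \<and> \<Lambda> = (\<lambda>x. B *\<^sub>v x) ` carrier (On v n) \<and>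
        V = (\<lambda>x. max_ideal_mult v n \<Lambda> +>\<^bsub>Kn TYPE('k) n\<^esub> (B *\<^sub>v x)) `
              {x \<in> carrier (On v n). \<forall>i\<in>{l..<n}. x $ i = 0} \<longleftrightarrow>
      B \<in> GLn n \<and> \<Lambda> = lattice_basis.L v n B \<and> V = lattice_basis.flag_space v n B l" for B
  proof (cases "B \<in> GLn n")
    case True
    interpret B: lattice_basis v n B by (rule lattice_basis[OF True])
    have "invertible_mat B" using True invertible_mat_iff_det[of B n] by simp
    then show ?thesis using True B.frame_space[OF l] unfolding carrier_On B.L_def by auto
  next
    case False
    then show ?thesis using invertible_mat_iff_det[of B n] by auto
  qed
  then show ?thesis unfolding frames_def by simp
qed

end

section \<open>Elements of the geometric sorts as flag modules\<close>

context acvf begin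

text \<open>The module determines the lattice: a vector lies in the lattice iff all its multiples by
  elements of \<MM> lie in the module, as the value group is dense. The subspace is then the
  reduction of the module.\<close>

lemma same_flag:
  assumes A: "A \<in> GLn n" and B: "B \<in> GLn n" and l: "l \<le> n"
  shows "lattice_basis.L v n A = lattice_basis.L v n B \<and>
      lattice_basis.flag_space v n A l = lattice_basis.flag_space v n B l \<longleftrightarrow>
    flag_image l n A = flag_image l n B"
proof -
  interpret A: lattice_basis v n A by (rule lattice_basis[OF A])
  interpret B: lattice_basis v n B by (rule lattice_basis[OF B])
  have L_flag: "lattice_basis.L v n C = {x \<in> carrier_vec n. \<forall>c. 1 \<prec> c \<longrightarrow> c \<cdot>\<^sub>v x \<in> flag_image l n C}" if C: "C \<in> GLn n" for C
  proof -
    interpret C: lattice_basis v n C by (rule lattice_basis[OF C])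
    have "x \<in> C.L" if x: "x \<in> carrier_vec n" and c: "\<And>c. 1 \<prec> c \<Longrightarrow> c \<cdot>\<^sub>v x \<in> flag_image l n C" for x
    proof -
      obtain C' where C': "C' \<in> carrier_mat n n" "C * C' = 1\<^sub>m n" using matrix_inverse[OF C.A C.det_A] by blast
      define z where "z = C' *\<^sub>v x"
      have zC: "z \<in> carrier_vec n" using C' x by (simp add: z_def)
      have Cz: "C *\<^sub>v z = x" unfolding z_def using assoc_mult_mat_vec[OF C.A C'(1) x] C'(2) x by simp
      have cz: "c \<cdot>\<^sub>v z \<in> flag_module n n" if "1 \<prec> c" for c
      proof -
        obtain w where w: "w \<in> flag_module l n" "c \<cdot>\<^sub>v x = C *\<^sub>v w" using c[OF \<open>1 \<prec> c\<close>] by blast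
        have "C *\<^sub>v (c \<cdot>\<^sub>v z) = C *\<^sub>v w" using w(2) Cz mult_mat_vec[OF C.A zC] by simp
        then have "c \<cdot>\<^sub>v z = w" by (rule C.A_inj[rotated 2]) (use zC flag_module_carrier[OF w(1)] in auto)
        then show ?thesis using flag_module_mono[OF w(1) l] by simp
      qed
      have "1 \<preceq> z $ i" if i: "i < n" for i
      proof (rule ccontr)
        assume nz: "\<not> 1 \<preceq> z $ i"
        then have z0: "z $ i \<noteq> 0" by auto
        have "z $ i * 1 \<prec> z $ i * inverse (z $ i)" using nz z0 by (simp add: vless_def)
        then have "1 \<prec> inverse (z $ i)" using vless_mult[OF z0] by blast
        \<comment> \<open>A scalar of \<MM> with smaller value than the inverse of a non-integral
          coordinate leaves that coordinate non-integral.\<close>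
        then obtain c where c: "1 \<prec> c" "c \<prec> inverse (z $ i)" using vless_dense[OF _ one_neq_zero] by blast
        have "1 \<preceq> z $ i * c" using cz[OF c(1)] i zC by (simp add: flag_module_def mult.commute)
        moreover have "z $ i * c \<prec> z $ i * inverse (z $ i)" using c(2) vless_mult[OF z0] by blast
        ultimately show False using z0 by (simp add: vless_def)
      qed
      then have "z \<in> flag_module n n" using zC by (simp add: flag_module_def)
      then show ?thesis unfolding C.L_def using Cz by blast
    qed
    moreover have "c \<cdot>\<^sub>v x \<in> flag_image l n C" if "x \<in> C.L" "1 \<prec> c" for x c
      using C.mL_A_flag[OF C.mL_smult[OF that] l] .
    ultimately show ?thesis using C.L_closed(4) by blast
  qed
  show ?thesis
  proof
    assume "A.L = B.L \<and> A.flag_space l = B.flag_space l"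
    then show "flag_image l n A = flag_image l n B" using A.Union_flag_space[OF l] B.Union_flag_space[OF l] by simp
  next
    assume eq: "flag_image l n A = flag_image l n B"
    have L: "A.L = B.L" using L_flag[OF A] L_flag[OF B] eq by simp
    have "A.cs = B.cs" by (rule ext) (simp only: A.cs_coset[symmetric] B.cs_coset[symmetric] L)
    then show "A.L = B.L \<and> A.flag_space l = B.flag_space l"
      using L unfolding A.flag_space_def B.flag_space_def eq by simp
  qed
qed

text \<open>Elements of the sort described by the module alone, without lattice and subspace;
  equality of such modules is first-order in the entries of the matrices.\<close>

definition flag_class :: "nat \<Rightarrow> nat \<Rightarrow> 'k mat \<Rightarrow> 'k eq_elem" where
  "flag_class l n A = {concat (mat_to_list B) | B. B \<in> GLn n \<and> flag_image l n B = flag_image l n A}"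

lemma frames_flag_class:
  assumes "A \<in> GLn n" "l \<le> n"
  shows "frames v n l (lattice_basis.L v n A) (lattice_basis.flag_space v n A l) = flag_class l n A"
  unfolding frames_eq_bases[OF assms(2)] flag_class_def
proof -
  have "B \<in> GLn n \<and> lattice_basis.L v n A = lattice_basis.L v n B \<and>
      lattice_basis.flag_space v n A l = lattice_basis.flag_space v n B l \<longleftrightarrow>
    B \<in> GLn n \<and> flag_image l n B = flag_image l n A" for B
    unfolding eq_commute[of "flag_image l n B"] using same_flag[OF assms(1) _ assms(2)] by blast
  then show "{concat (mat_to_list B) | B. B \<in> GLn n \<and> lattice_basis.L v n A = lattice_basis.L v n B \<and>
      lattice_basis.flag_space v n A l = lattice_basis.flag_space v n B l} =
    {concat (mat_to_list B) | B. B \<in> GLn n \<and> flag_image l n B = flag_image l n A}" by (simp only:)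
qed

lemma R_sort_classes:
  assumes l: "l \<le> n"
  shows "(\<lambda>(\<Lambda>, V). frames v n l \<Lambda> V) ` R_sort v n l = flag_class l n ` GLn n"
proof (intro equalityI subsetI)
  fix C assume "C \<in> (\<lambda>(\<Lambda>, V). frames v n l \<Lambda> V) ` R_sort v n l"
  then obtain \<Lambda> V where "(\<Lambda>, V) \<in> R_sort v n l" "C = frames v n l \<Lambda> V" by auto
  then show "C \<in> flag_class l n ` GLn n" using R_sort_has_basis[of \<Lambda> V n l] frames_flag_class[OF _ l] by blast
next
  fix C assume "C \<in> flag_class l n ` GLn n"
  then obtain A where A: "A \<in> GLn n" "C = flag_class l n A" by blast
  then show "C \<in> (\<lambda>(\<Lambda>, V). frames v n l \<Lambda> V) ` R_sort v n l"
    using lattice_basis.R_sort_L[OF lattice_basis[OF A(1)] l] frames_flag_class[OF A(1) l] by force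
qed

end

section \<open>Geometric sorts\<close>

lemma nth_concat_blocks:
  "(\<And>xs. xs \<in> set xss \<Longrightarrow> length xs = n) \<Longrightarrow> i < length xss \<Longrightarrow> j < n \<Longrightarrow> concat xss ! (i * n + j) = xss ! i ! j"
proof (induction xss arbitrary: i)
  case (Cons xs xss)
  have "length xs = n" using Cons.prems by simp
  then show ?case using Cons.IH[of "i - 1"] Cons.prems by (cases i) (auto simp: nth_append)
qed simp

lemma length_concat_blocks: "(\<And>xs. xs \<in> set xss \<Longrightarrow> length xs = n) \<Longrightarrow> length (concat xss) = length xss * n"
  by (induction xss) auto

definition list_mat :: "nat \<Rightarrow> 'a list \<Rightarrow> 'a mat" where
  "list_mat n xs = mat n n (\<lambda>(i, j). xs ! (i * n + j))"

lemma list_mat_carrier [simp]: "list_mat n xs \<in> carrier_mat n n"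
  by (simp add: list_mat_def)

lemma div_mod_less: "i < n \<Longrightarrow> j < n \<Longrightarrow> i * n + j < n * (n :: nat)"
proof -
  assume "i < n" "j < n"
  then have "i * n + j < Suc i * n" by simp
  also have "\<dots> \<le> n * n" using \<open>i < n\<close> by (intro mult_le_mono1) simp
  finally show ?thesis .
qed

lemma concat_mat_to_list:
  assumes "A \<in> carrier_mat n n"
  shows "length (concat (mat_to_list A)) = n * n"
    and "i < n \<Longrightarrow> j < n \<Longrightarrow> concat (mat_to_list A) ! (i * n + j) = A $$ (i, j)"
    and "list_mat n (concat (mat_to_list A)) = A"
proof -
  have len: "length (mat_to_list A) = n" "\<And>xs. xs \<in> set (mat_to_list A) \<Longrightarrow> length xs = n"
    using assms by (auto simp: mat_to_list_def)
  show "length (concat (mat_to_list A)) = n * n" using length_concat_blocks[OF len(2)] len(1) by simp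
  show *: "concat (mat_to_list A) ! (i * n + j) = A $$ (i, j)" if "i < n" "j < n" for i j
    using nth_concat_blocks[OF len(2), of "mat_to_list A" i j] len(1) that assms by (simp add: mat_to_list_def)
  show "list_mat n (concat (mat_to_list A)) = A"
    by (rule eq_matI) (use assms * in \<open>auto simp: list_mat_def\<close>)
qed

lemma concat_list_mat:
  assumes "length xs = n * n"
  shows "concat (mat_to_list (list_mat n xs)) = xs"
proof (rule nth_equalityI)
  show "length (concat (mat_to_list (list_mat n xs))) = length xs"
    using concat_mat_to_list(1)[OF list_mat_carrier] assms by simp
  fix k assume "k < length (concat (mat_to_list (list_mat n xs)))"
  then have k: "k < n * n" using concat_mat_to_list(1)[OF list_mat_carrier] by metis
  then have n: "0 < n" by (cases n) auto
  have "k div n < n" "k mod n < n" using k n by (auto simp: less_mult_imp_div_less)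
  then show "concat (mat_to_list (list_mat n xs)) ! k = xs ! k"
    using concat_mat_to_list(2)[OF list_mat_carrier, of "k div n" n "k mod n" xs] by (simp add: list_mat_def)
qed

text \<open>First-order form of membership in \<open>flag_image\<close>. Matrices and vectors appear
  as functions of indices, so that terms can be inserted for their entries.\<close>

definition in_flag ::
  "('k::field \<Rightarrow> 'g::linordered_ab_group_add) \<Rightarrow> nat \<Rightarrow> nat \<Rightarrow> (nat \<Rightarrow> nat \<Rightarrow> 'k) \<Rightarrow> (nat \<Rightarrow> 'k) \<Rightarrow> bool" where
  "in_flag v l n a x \<longleftrightarrow> (\<exists>z\<in>carrier_vec n. (\<forall>i<n. if i < l then vdiv v 1 (z $ i) else \<not> vdiv v (z $ i) 1) \<and>
     (\<forall>i<n. x i = (\<Sum>j<n. a i j * z $ j)))"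

text \<open>Nonvanishing of the determinant, expressed through the kernel so that the determinant
  need not be written as a term.\<close>

definition nonsing :: "nat \<Rightarrow> (nat \<Rightarrow> nat \<Rightarrow> 'k::field) \<Rightarrow> bool" where
  "nonsing n a \<longleftrightarrow> (\<forall>x\<in>carrier_vec n. (\<forall>i<n. (\<Sum>j<n. a i j * x $ j) = 0) \<longrightarrow> (\<forall>i<n. x $ i = 0))"

lemma in_flag_cong:
  assumes a: "\<And>i j. i < n \<Longrightarrow> j < n \<Longrightarrow> a i j = a' i j" and x: "\<And>i. i < n \<Longrightarrow> x i = x' i"
  shows "in_flag v l n a x \<longleftrightarrow> in_flag v l n a' x'"
proof -
  have "(\<Sum>j<n. a i j * z $ j) = (\<Sum>j<n. a' i j * z $ j)" if "i < n" for i z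
    by (rule sum.cong) (use that a in auto)
  then have "(\<forall>i<n. x i = (\<Sum>j<n. a i j * z $ j)) \<longleftrightarrow> (\<forall>i<n. x' i = (\<Sum>j<n. a' i j * z $ j))" for z
    using x by auto
  then show ?thesis unfolding in_flag_def by simp
qed

lemma nonsing_cong:
  assumes a: "\<And>i j. i < n \<Longrightarrow> j < n \<Longrightarrow> a i j = a' i j"
  shows "nonsing n a \<longleftrightarrow> nonsing n a'"
proof -
  have "(\<Sum>j<n. a i j * z $ j) = (\<Sum>j<n. a' i j * z $ j)" if "i < n" for i z
    by (rule sum.cong) (use that a in auto)
  then have "(\<forall>i<n. (\<Sum>j<n. a i j * z $ j) = 0) \<longleftrightarrow> (\<forall>i<n. (\<Sum>j<n. a' i j * z $ j) = 0)" for z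
    by auto
  then show ?thesis unfolding nonsing_def by simp
qed

lemma fdef_in_flag [fdef_intros]:
  assumes a: "\<And>i j. i < n \<Longrightarrow> j < n \<Longrightarrow> tdef (a i j)" and x: "\<And>i. i < n \<Longrightarrow> tdef (x i)"
  shows "fdef v (\<lambda>e. in_flag v l n (\<lambda>i j. a i j e) (\<lambda>i. x i e))"
proof -
  \<comment> \<open>Variables at fixed positions come first, since arbitrary terms would have to be
    shifted past the quantified vector; the terms are substituted afterwards.\<close>
  have base: "fdef v (\<lambda>e. in_flag v l n (\<lambda>i j. e (i * n + j)) (\<lambda>i. e (n * n + i)))"
    unfolding in_flag_def by (intro fdef_intros; simp)
  define t where "t k e = (if k < n * n then if k div n < n \<and> k mod n < n then a (k div n) (k mod n) e else 0
     else if k - n * n < n then x (k - n * n) e else 0)" for k e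
  have "tdef (t k)" for k unfolding t_def by (intro fdef_intros a x) auto
  then have "fdef v (\<lambda>e. in_flag v l n (\<lambda>i j. t (i * n + j) e) (\<lambda>i. t (n * n + i) e))"
    by (rule fdef_subst[OF base])
  moreover have "in_flag v l n (\<lambda>i j. t (i * n + j) e) (\<lambda>i. t (n * n + i) e) \<longleftrightarrow>
      in_flag v l n (\<lambda>i j. a i j e) (\<lambda>i. x i e)" for e
    by (rule in_flag_cong) (auto simp: t_def div_mod_less)
  ultimately show ?thesis by simp
qed

lemma fdef_nonsing [fdef_intros]:
  assumes a: "\<And>i j. i < n \<Longrightarrow> j < n \<Longrightarrow> tdef (a i j)"
  shows "fdef v (\<lambda>e. nonsing n (\<lambda>i j. a i j e))"
proof -
  have base: "fdef v (\<lambda>e. nonsing n (\<lambda>i j. e (i * n + j)))"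
    unfolding nonsing_def by (intro fdef_intros; simp)
  define t where "t k e = (if k div n < n \<and> k mod n < n then a (k div n) (k mod n) e else 0)" for k e
  have "tdef (t k)" for k unfolding t_def by (intro fdef_intros a) auto
  then have "fdef v (\<lambda>e. nonsing n (\<lambda>i j. t (i * n + j) e))" by (rule fdef_subst[OF base])
  moreover have "nonsing n (\<lambda>i j. t (i * n + j) e) \<longleftrightarrow> nonsing n (\<lambda>i j. a i j e)" for e
    by (rule nonsing_cong) (auto simp: t_def)
  ultimately show ?thesis by simp
qed

lemma mat_mult_vec_nth:
  "z \<in> carrier_vec n \<Longrightarrow> i < n \<Longrightarrow> (mat n n (\<lambda>(i, j). a i j) *\<^sub>v z) $ i = (\<Sum>j<n. a i j * z $ j)"
  by (simp add: scalar_prod_def lessThan_atLeast0)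

lemma nonsing_iff: "nonsing n a \<longleftrightarrow> det (mat n n (\<lambda>(i, j). a i j)) \<noteq> 0"
proof -
  let ?A = "mat n n (\<lambda>(i, j). a i j)"
  have A: "?A \<in> carrier_mat n n" by simp
  have 1: "?A *\<^sub>v x = 0\<^sub>v n \<longleftrightarrow> (\<forall>i<n. (\<Sum>j<n. a i j * x $ j) = 0)" if x: "x \<in> carrier_vec n" for x
  proof
    assume "?A *\<^sub>v x = 0\<^sub>v n"
    then show "\<forall>i<n. (\<Sum>j<n. a i j * x $ j) = 0" using mat_mult_vec_nth[OF x] by (metis index_zero_vec(1))
  next
    assume "\<forall>i<n. (\<Sum>j<n. a i j * x $ j) = 0"
    then show "?A *\<^sub>v x = 0\<^sub>v n" using mat_mult_vec_nth[OF x] by (intro eq_vecI) (auto simp del: index_mult_mat_vec)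
  qed
  have 2: "x = 0\<^sub>v n \<longleftrightarrow> (\<forall>i<n. x $ i = 0)" if "x \<in> carrier_vec n" for x :: "'a vec"
    using that by (auto intro!: eq_vecI)
  have "nonsing n a \<longleftrightarrow> (\<forall>x\<in>carrier_vec n. ?A *\<^sub>v x = 0\<^sub>v n \<longrightarrow> x = 0\<^sub>v n)"
    unfolding nonsing_def by (rule ball_cong[OF refl]) (unfold 1 2, rule refl)
  then show ?thesis unfolding det_0_iff_vec_prod_zero_field[OF A] by blast
qed

lemma reps_singletons: "reps (map (\<lambda>a. {[a]}) xs) = {xs}"
  by (induction xs) (auto simp: reps_Cons set_eq_iff)

context acvf begin

lemma in_flag_iff:
  assumes l: "l \<le> n" and x: "x \<in> carrier_vec n"
  shows "in_flag v l n a (\<lambda>i. x $ i) \<longleftrightarrow> x \<in> flag_image l n (mat n n (\<lambda>(i, j). a i j))"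
proof -
  have flag: "z \<in> flag_module l n \<longleftrightarrow> z \<in> carrier_vec n \<and> (\<forall>i<n. if i < l then 1 \<preceq> z $ i else \<not> z $ i \<preceq> 1)" for z
  proof -
    have "(\<forall>i<n. if i < l then P i else Q i) \<longleftrightarrow> (\<forall>i<l. P i) \<and> (\<forall>i<n. l \<le> i \<longrightarrow> Q i)" for P Q
    proof (intro iffI conjI allI impI)
      fix i assume *: "\<forall>i<n. if i < l then P i else Q i"
      show "P i" if "i < l" using *[rule_format, of i] that l by simp
      show "Q i" if "i < n" "l \<le> i" using *[rule_format, of i] that by simp
    next
      fix i assume "(\<forall>i<l. P i) \<and> (\<forall>i<n. l \<le> i \<longrightarrow> Q i)" "i < n"
      then show "if i < l then P i else Q i" by (cases "i < l") simp_all
    qed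
    from this[of "\<lambda>i. 1 \<preceq> z $ i" "\<lambda>i. \<not> z $ i \<preceq> 1"] show ?thesis
      unfolding flag_module_def vless_def by (simp only: mem_Collect_eq)
  qed
  have eq: "x = mat n n (\<lambda>(i, j). a i j) *\<^sub>v z \<longleftrightarrow> (\<forall>i<n. x $ i = (\<Sum>j<n. a i j * z $ j))" if z: "z \<in> carrier_vec n" for z
  proof
    assume *: "\<forall>i<n. x $ i = (\<Sum>j<n. a i j * z $ j)"
    show "x = mat n n (\<lambda>(i, j). a i j) *\<^sub>v z"
    proof (rule eq_vecI)
      fix i assume "i < dim_vec (mat n n (\<lambda>(i, j). a i j) *\<^sub>v z)"
      then show "x $ i = (mat n n (\<lambda>(i, j). a i j) *\<^sub>v z) $ i" using * mat_mult_vec_nth[OF z, of i a] by simp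
    qed (use x in simp)
  qed (use mat_mult_vec_nth[OF z] in simp)
  show ?thesis unfolding in_flag_def image_iff
  proof
    assume "\<exists>z\<in>carrier_vec n. (\<forall>i<n. if i < l then 1 \<preceq> z $ i else \<not> z $ i \<preceq> 1) \<and> (\<forall>i<n. x $ i = (\<Sum>j<n. a i j * z $ j))"
    then obtain z where z: "z \<in> carrier_vec n" "\<forall>i<n. if i < l then 1 \<preceq> z $ i else \<not> z $ i \<preceq> 1"
      "\<forall>i<n. x $ i = (\<Sum>j<n. a i j * z $ j)" by blast
    then show "\<exists>z\<in>flag_module l n. x = mat n n (\<lambda>(i, j). a i j) *\<^sub>v z" using flag[of z] eq[of z] by blast
  next
    assume "\<exists>z\<in>flag_module l n. x = mat n n (\<lambda>(i, j). a i j) *\<^sub>v z"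
    then obtain z where "z \<in> flag_module l n" "x = mat n n (\<lambda>(i, j). a i j) *\<^sub>v z" by blast
    then show "\<exists>z\<in>carrier_vec n. (\<forall>i<n. if i < l then 1 \<preceq> z $ i else \<not> z $ i \<preceq> 1) \<and> (\<forall>i<n. x $ i = (\<Sum>j<n. a i j * z $ j))"
      using flag[of z] eq[of z] by blast
  qed
qed

lemma flag_class_iff:
  "y \<in> flag_class l n A \<longleftrightarrow> length y = n * n \<and> det (list_mat n y) \<noteq> 0 \<and> flag_image l n (list_mat n y) = flag_image l n A"
proof
  assume "y \<in> flag_class l n A"
  then obtain B where B: "y = concat (mat_to_list B)" "B \<in> GLn n" "flag_image l n B = flag_image l n A"
    unfolding flag_class_def by blast
  then show "length y = n * n \<and> det (list_mat n y) \<noteq> 0 \<and> flag_image l n (list_mat n y) = flag_image l n A"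
    using concat_mat_to_list[of B n] by simp
next
  assume *: "length y = n * n \<and> det (list_mat n y) \<noteq> 0 \<and> flag_image l n (list_mat n y) = flag_image l n A"
  then have "y = concat (mat_to_list (list_mat n y))" using concat_list_mat by metis
  then show "y \<in> flag_class l n A" unfolding flag_class_def using * list_mat_carrier by blast
qed

lemma flag_class_eq: "A \<in> GLn n \<Longrightarrow> flag_class l n A = flag_class l n B \<longleftrightarrow> flag_image l n A = flag_image l n B"
proof
  assume A: "A \<in> GLn n" and "flag_class l n A = flag_class l n B"
  moreover have "concat (mat_to_list A) \<in> flag_class l n A" unfolding flag_class_def using A by blast
  ultimately have "concat (mat_to_list A) \<in> flag_class l n B" by simp
  then show "flag_image l n A = flag_image l n B"
    unfolding flag_class_iff using concat_mat_to_list(3)[of A n] A by simp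
qed (simp add: flag_class_def)

lemma env_shift_list_mat:
  assumes "length zs = n * n"
  shows "mat n n (\<lambda>(i, j). env (xs @ zs) (length xs + (i * n + j))) = list_mat n zs"
  using assms by (intro eq_matI) (auto simp: list_mat_def env_def nth_append div_mod_less)

lemma is_sort_flag_classes:
  assumes l: "l \<le> n"
  shows "is_sort v (flag_class l n ` GLn n)"
proof -
  define D where "D = {x. length x = n * n \<and> det (list_mat n x :: 'k mat) \<noteq> 0}"
  define E where "E = {(x, y). x \<in> D \<and> y \<in> D \<and> flag_image l n (list_mat n x) = flag_image l n (list_mat n y)}"
  have equiv: "equiv D E"
    by (rule equivI) (auto simp: E_def refl_on_def sym_def trans_def)
  have cls: "E `` {x} = flag_class l n (list_mat n x)" if "x \<in> D" for x
  proof (rule Set.set_eqI)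
    show "y \<in> E `` {x} \<longleftrightarrow> y \<in> flag_class l n (list_mat n x)" for y
      using that unfolding Image_singleton_iff flag_class_iff
      by (simp only: E_def D_def mem_Collect_eq case_prod_conv) blast
  qed
  have quot: "flag_class l n ` GLn n = D // E"
  proof (intro equalityI subsetI)
    fix C assume "C \<in> flag_class l n ` GLn n"
    then obtain A where A: "A \<in> GLn n" "C = flag_class l n A" by blast
    have "concat (mat_to_list A) \<in> D" using A(1) concat_mat_to_list[of A n] by (simp add: D_def)
    then show "C \<in> D // E" using cls[of "concat (mat_to_list A)"] concat_mat_to_list(3)[of A n] A
      unfolding quotient_def by auto
  next
    fix C assume "C \<in> D // E"
    then obtain x where "x \<in> D" "C = E `` {x}" unfolding quotient_def by blast
    then show "C \<in> flag_class l n ` GLn n" using cls[of x] by (auto simp: D_def intro!: imageI)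
  qed
  define P where "P e \<longleftrightarrow> nonsing n (\<lambda>i j. e (i * n + j)) \<and> nonsing n (\<lambda>i j. e (n * n + (i * n + j))) \<and>
    (\<forall>x\<in>carrier_vec n. in_flag v l n (\<lambda>i j. e (i * n + j)) (\<lambda>i. x $ i) \<longleftrightarrow>
       in_flag v l n (\<lambda>i j. e (n * n + (i * n + j))) (\<lambda>i. x $ i))" for e
  have P: "fdef v P" unfolding P_def by (intro fdef_intros; simp)
  have P_iff: "P (env (x @ y)) \<longleftrightarrow> (x, y) \<in> E" if len: "length x = n * n" "length y = n * n" for x y
  proof -
    have 1: "mat n n (\<lambda>(i, j). env (x @ y) (i * n + j)) = list_mat n x"
      using len by (intro eq_matI) (auto simp: list_mat_def env_def nth_append div_mod_less trans_less_add1)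
    have 2: "mat n n (\<lambda>(i, j). env (x @ y) (n * n + (i * n + j))) = list_mat n y"
      using env_shift_list_mat[OF len(2), of x] len(1) by simp
    have "(\<forall>z\<in>carrier_vec n. z \<in> flag_image l n (list_mat n x) \<longleftrightarrow> z \<in> flag_image l n (list_mat n y)) \<longleftrightarrow>
        flag_image l n (list_mat n x) = flag_image l n (list_mat n y)"
    proof -
      have "flag_image l n (list_mat n w) \<subseteq> carrier_vec n" for w :: "'k list"
        using flag_module_carrier mult_mat_vec_carrier[OF list_mat_carrier] by blast
      then show ?thesis by blast
    qed
    then show ?thesis unfolding P_def nonsing_iff 1 2 E_def D_def using in_flag_iff[OF l] 1 2 len by simp
  qed
  have "{xs @ ys | xs ys. (xs, ys) \<in> E} = {zs. length zs = n * n + n * n \<and> P (env zs)}"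
  proof (intro equalityI subsetI)
    fix zs assume "zs \<in> {xs @ ys | xs ys. (xs, ys) \<in> E}"
    then obtain xs ys where "zs = xs @ ys" "(xs, ys) \<in> E" by blast
    moreover from this have "length xs = n * n" "length ys = n * n" by (auto simp: E_def D_def)
    ultimately show "zs \<in> {zs. length zs = n * n + n * n \<and> P (env zs)}" using P_iff by simp
  next
    fix zs assume "zs \<in> {zs. length zs = n * n + n * n \<and> P (env zs)}"
    then have zs: "length zs = n * n + n * n" "P (env (take (n * n) zs @ drop (n * n) zs))" by simp_all
    then have "(take (n * n) zs, drop (n * n) zs) \<in> E"
      using P_iff[of "take (n * n) zs" "drop (n * n) zs"] by simp
    then show "zs \<in> {xs @ ys | xs ys. (xs, ys) \<in> E}" by (metis (mono_tags, lifting) append_take_drop_id mem_Collect_eq)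
  qed
  then have "definable v {} {xs @ ys | xs ys. (xs, ys) \<in> E}" using definableI[OF P, of "n * n + n * n"] by simp
  moreover have "D \<subseteq> {xs. length xs = n * n}" by (auto simp: D_def)
  ultimately show ?thesis unfolding is_sort_def using equiv quot by blast
qed

lemma is_imaginary_field_element: "is_imaginary v (geom_imaginary v (FieldElem a))"
proof -
  define D where "D = range (\<lambda>x :: 'k. [x])"
  have "equiv D (Id_on D)" by (rule equivI) (auto simp: refl_on_def sym_def trans_def)
  moreover have "range (\<lambda>x. {[x]}) = D // Id_on D"
    unfolding quotient_def D_def by (auto simp: Id_on_def image_iff)
  moreover have "{xs @ ys | xs ys. (xs, ys) \<in> Id_on D} = {zs. length zs = 2 \<and> env zs 0 = env zs 1}"
  proof (intro equalityI subsetI)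
    fix zs :: "'k list" assume "zs \<in> {xs @ ys | xs ys. (xs, ys) \<in> Id_on D}"
    then show "zs \<in> {zs. length zs = 2 \<and> env zs 0 = env zs 1}" by (auto simp: D_def env_def)
  next
    fix zs :: "'k list" assume zs: "zs \<in> {zs. length zs = 2 \<and> env zs 0 = env zs 1}"
    then obtain b c where "zs = [b, c]" by (auto simp: length_Suc_conv numeral_2_eq_2)
    then have "zs = [b] @ [b]" using zs by (simp add: env_def)
    moreover have "([b], [b]) \<in> Id_on D" by (auto simp: D_def)
    ultimately show "zs \<in> {xs @ ys | xs ys. (xs, ys) \<in> Id_on D}" by blast
  qed
  moreover have "definable v {} {zs :: 'k list. length zs = 2 \<and> env zs 0 = env zs 1}"
    by (rule definableI[where P = "\<lambda>e. e 0 = e 1"]) (intro fdef_intros)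
  moreover have "D \<subseteq> {xs. length xs = 1}" by (auto simp: D_def)
  ultimately have "is_sort v (range (\<lambda>x. {[x]}))" unfolding is_sort_def by metis
  then show ?thesis by (simp add: is_imaginary_def)
qed

lemma geom_imaginary_lattice:
  assumes A: "A \<in> GLn n" and l: "l \<le> n"
  shows "geom_imaginary v (RElem n l (lattice_basis.L v n A) (lattice_basis.flag_space v n A l)) =
      (flag_class l n ` GLn n, flag_class l n A)"
    and "is_geometric v (RElem n l (lattice_basis.L v n A) (lattice_basis.flag_space v n A l))"
    and "is_imaginary v (flag_class l n ` GLn n, flag_class l n A)"
  using A is_sort_flag_classes[OF l] lattice_basis.R_sort_L[OF lattice_basis[OF A] l]
  by (simp_all add: R_sort_classes[OF l] frames_flag_class[OF A l] is_imaginary_def)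

end

section \<open>Coding valued vector space structures\<close>

text \<open>Membership of the flattened matrix \<open>f\<close> in the endomorphism module, with
  \<open>Q\<close> the formula given by the code. The environment holds a vector, its image under
  \<open>f\<close>, and a representative \<open>y\<close> of the code; further positions are 0, as
  in \<open>env\<close>.\<close>

definition in_module :: "((nat \<Rightarrow> 'k::field) \<Rightarrow> bool) \<Rightarrow> nat \<Rightarrow> nat \<Rightarrow> (nat \<Rightarrow> 'k) \<Rightarrow> (nat \<Rightarrow> 'k) \<Rightarrow> bool" where
  "in_module Q m k f y \<longleftrightarrow> (\<forall>a\<in>carrier_vec m. Q (\<lambda>i. if i < m then a $ i
     else if i < 2 * m then (\<Sum>j<m. f ((i - m) * m + j) * a $ j)
     else if i < 2 * m + k then y (i - 2 * m) else 0))"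

lemma in_module_cong:
  assumes f: "\<And>i. i < m * m \<Longrightarrow> f i = f' i" and y: "\<And>i. i < k \<Longrightarrow> y i = y' i"
  shows "in_module Q m k f y \<longleftrightarrow> in_module Q m k f' y'"
proof -
  have "(\<Sum>j<m. f ((i - m) * m + j) * a $ j) = (\<Sum>j<m. f' ((i - m) * m + j) * a $ j)" if "i < 2 * m" for i a
    by (rule sum.cong) (use that f[OF div_mod_less] in auto)
  then have "(\<lambda>i. if i < m then a $ i else if i < 2 * m then (\<Sum>j<m. f ((i - m) * m + j) * a $ j)
     else if i < 2 * m + k then y (i - 2 * m) else 0) =
    (\<lambda>i. if i < m then a $ i else if i < 2 * m then (\<Sum>j<m. f' ((i - m) * m + j) * a $ j)
     else if i < 2 * m + k then y' (i - 2 * m) else 0)" for a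
    using y by (auto simp: fun_eq_iff)
  then show ?thesis unfolding in_module_def by simp
qed

lemma fdef_in_module:
  assumes Q: "fdef v Q" and f: "\<And>i. i < m * m \<Longrightarrow> tdef (f i)" and y: "\<And>i. i < k \<Longrightarrow> tdef (y i)"
  shows "fdef v (\<lambda>e. in_module Q m k (\<lambda>i. f i e) (\<lambda>i. y i e))"
proof -
  have base: "fdef v (\<lambda>e. in_module Q m k (\<lambda>i. e i) (\<lambda>i. e (m * m + i)))"
    unfolding in_module_def by (intro fdef_all_vec fdef_subst[OF Q]; intro fdef_intros; simp)
  define t where "t i e = (if i < m * m then f i e else if i - m * m < k then y (i - m * m) e else 0)" for i e
  have "tdef (t i)" for i unfolding t_def by (intro fdef_intros f y) auto
  then have "fdef v (\<lambda>e. in_module Q m k (\<lambda>i. t i e) (\<lambda>i. t (m * m + i) e))" by (rule fdef_subst[OF base])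
  moreover have "in_module Q m k (\<lambda>i. t i e) (\<lambda>i. t (m * m + i) e) \<longleftrightarrow>
      in_module Q m k (\<lambda>i. f i e) (\<lambda>i. y i e)" for e
    by (rule in_module_cong) (auto simp: t_def)
  ultimately show ?thesis by simp
qed

lemma flat_mat_mult:
  "a \<in> carrier_vec m \<Longrightarrow> i < m \<Longrightarrow> (flat_mat m f *\<^sub>v a) $ i = (\<Sum>j<m. f $ (i * m + j) * a $ j)"
  by (simp add: flat_mat_def scalar_prod_def lessThan_atLeast0)

lemma flat_mat_carrier: "flat_mat m f \<in> carrier_mat m m"
  by (simp add: flat_mat_def)

lemma ex_unique_carrier:
  assumes "u \<in> carrier_vec N" "\<And>x. x \<in> carrier_vec N \<Longrightarrow> P x \<longleftrightarrow> x = u"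
  shows "(\<exists>x\<in>carrier_vec N. P x \<and> S x) \<longleftrightarrow> S u"
  using assms by blast

context vvs_rel begin

lemma code_interdefinable:
  assumes code: "is_code v \<tau> (rel_tuples R)"
  shows "\<exists>gs. (\<forall>g\<in>set gs. is_geometric v g) \<and> interdefinable v [\<tau>] (map (geom_imaginary v) gs)"
proof -
  define N where "N = m * m"
  define M where "M = endo_module m R"
  have im: "is_imaginary v \<tau>" using code by (simp add: is_code_def)
  have len_rel: "length xs = 2 * m" if "xs \<in> rel_tuples R" for xs
    using that R_carrier unfolding rel_tuples_def by fastforce
  have "rel_tuples R \<noteq> {}" using R_zero(1)[of "0\<^sub>v m"] unfolding rel_tuples_def by auto
  obtain k Q where Q: "fdef v Q" and klen: "\<And>C y. C \<in> fst \<tau> \<Longrightarrow> y \<in> C \<Longrightarrow> length y = k"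
    and fib: "\<And>C y. C \<in> fst \<tau> \<Longrightarrow> y \<in> C \<Longrightarrow>
      (\<forall>xs. length xs = 2 * m \<longrightarrow> (Q (env (xs @ y)) \<longleftrightarrow> xs \<in> rel_tuples R)) \<longleftrightarrow> C = snd \<tau>"
    by (rule is_code_cases[OF code \<open>rel_tuples R \<noteq> {}\<close> len_rel]) (assumption | (rule that; assumption))+
  have t: "snd \<tau> \<in> fst \<tau>" using im by (simp add: is_imaginary_def)
  \<comment> \<open>In terms of vectors: only the class of the code has \<open>R\<close> as its
    fibre, so comparing a fibre with \<open>R\<close> identifies the class.\<close>
  have fib': "(\<forall>a\<in>carrier_vec m. \<forall>b\<in>carrier_vec m. Q (env (list_of_vec a @ list_of_vec b @ y)) \<longleftrightarrow> (a, b) \<in> R)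
      \<longleftrightarrow> C = snd \<tau>" if C: "C \<in> fst \<tau>" "y \<in> C" for C y
  proof -
    have "(\<forall>xs. length xs = 2 * m \<longrightarrow> (Q (env (xs @ y)) \<longleftrightarrow> xs \<in> rel_tuples R)) \<longleftrightarrow>
      (\<forall>a\<in>carrier_vec m. \<forall>b\<in>carrier_vec m. Q (env (list_of_vec a @ list_of_vec b @ y)) \<longleftrightarrow> (a, b) \<in> R)"
    proof
      assume *: "\<forall>xs. length xs = 2 * m \<longrightarrow> (Q (env (xs @ y)) \<longleftrightarrow> xs \<in> rel_tuples R)"
      show "\<forall>a\<in>carrier_vec m. \<forall>b\<in>carrier_vec m. Q (env (list_of_vec a @ list_of_vec b @ y)) \<longleftrightarrow> (a, b) \<in> R"
      proof (intro ballI)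
        fix a b :: "'k vec" assume ab: "a \<in> carrier_vec m" "b \<in> carrier_vec m"
        have "length (list_of_vec a @ list_of_vec b) = 2 * m" using ab by simp
        then have "Q (env ((list_of_vec a @ list_of_vec b) @ y)) \<longleftrightarrow> list_of_vec a @ list_of_vec b \<in> rel_tuples R"
          using * by blast
        then show "Q (env (list_of_vec a @ list_of_vec b @ y)) \<longleftrightarrow> (a, b) \<in> R"
          using rel_tuples_iff[OF R_carrier ab] by simp
      qed
    next
      assume *: "\<forall>a\<in>carrier_vec m. \<forall>b\<in>carrier_vec m. Q (env (list_of_vec a @ list_of_vec b @ y)) \<longleftrightarrow> (a, b) \<in> R"
      show "\<forall>xs. length xs = 2 * m \<longrightarrow> (Q (env (xs @ y)) \<longleftrightarrow> xs \<in> rel_tuples R)"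
      proof (intro allI impI)
        fix xs :: "'k list" assume xs: "length xs = 2 * m"
        define a where "a = vec_of_list (take m xs)"
        define b where "b = vec_of_list (drop m xs)"
        have ab: "a \<in> carrier_vec m" "b \<in> carrier_vec m" using xs by (auto simp: a_def b_def intro!: carrier_vecI)
        have e: "list_of_vec a @ list_of_vec b = xs" by (simp add: a_def b_def list_vec)
        have "Q (env ((list_of_vec a @ list_of_vec b) @ y)) \<longleftrightarrow> (a, b) \<in> R" using * ab by simp
        then show "Q (env (xs @ y)) \<longleftrightarrow> xs \<in> rel_tuples R" using rel_tuples_iff[OF R_carrier ab] unfolding e by simp
      qed
    qed
    then show ?thesis using fib[OF C] by blast
  qed
  have fibR: "Q (env (list_of_vec a @ list_of_vec b @ y)) \<longleftrightarrow> (a, b) \<in> R"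
    if "y \<in> snd \<tau>" "a \<in> carrier_vec m" "b \<in> carrier_vec m" for a b y
    using fib'[OF t that(1)] that(2,3) by blast
  have env3: "(\<lambda>i. if i < m then a $ i else if i < 2 * m then g i else if i < 2 * m + k then y' (i - 2 * m) else 0) =
      env (list_of_vec a @ list_of_vec b @ y)"
    if "a \<in> carrier_vec m" "b \<in> carrier_vec m" "length y = k" "\<And>i. i < k \<Longrightarrow> y' i = y ! i"
      "\<And>i. m \<le> i \<Longrightarrow> i < 2 * m \<Longrightarrow> g i = b $ (i - m)" for a b y y' g
  proof
    fix i
    consider "i < m" | "m \<le> i" "i < 2 * m" | "2 * m \<le> i" "i < 2 * m + k" | "2 * m + k \<le> i" by linarith
    then show "(if i < m then a $ i else if i < 2 * m then g i else if i < 2 * m + k then y' (i - 2 * m) else 0) =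
        env (list_of_vec a @ list_of_vec b @ y) i"
    proof cases
      case 2
      then have "i - m < m" by simp
      then show ?thesis using 2 that by (simp add: env_def nth_append list_of_vec_index)
    next
      case 3
      then have "\<not> i < m" "\<not> i - m < m" "i - m - m = i - 2 * m" by simp_all
      then show ?thesis using 3 that by (simp add: env_def nth_append)
    qed (use that in \<open>simp_all add: env_def nth_append list_of_vec_index\<close>)
  qed
  have inM: "in_module Q m k f y' \<longleftrightarrow> vec N f \<in> M" if y: "y \<in> snd \<tau>" "\<And>i. i < k \<Longrightarrow> y' i = y ! i" for f y y'
  proof -
    have "Q (\<lambda>i. if i < m then a $ i else if i < 2 * m then (\<Sum>j<m. f ((i - m) * m + j) * a $ j)
        else if i < 2 * m + k then y' (i - 2 * m) else 0) \<longleftrightarrow> (a, flat_mat m (vec N f) *\<^sub>v a) \<in> R"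
      if a: "a \<in> carrier_vec m" for a
    proof -
      have b: "flat_mat m (vec N f) *\<^sub>v a \<in> carrier_vec m" using flat_mat_carrier a by (rule mult_mat_vec_carrier)
      have "(\<Sum>j<m. f ((i - m) * m + j) * a $ j) = (flat_mat m (vec N f) *\<^sub>v a) $ (i - m)" if i: "m \<le> i" "i < 2 * m" for i
      proof -
        have "i - m < m" using i by simp
        then show ?thesis unfolding flat_mat_mult[OF a \<open>i - m < m\<close>]
          by (intro sum.cong) (auto simp: N_def div_mod_less)
      qed
      note env3[of a "flat_mat m (vec N f) *\<^sub>v a" y y' "\<lambda>i. \<Sum>j<m. f ((i - m) * m + j) * a $ j", OF a b klen[OF t y(1)] y(2) this]
      then show ?thesis using fibR[OF y(1) a b] by (simp only:)
    qed
    then show ?thesis unfolding in_module_def M_def endo_module_def N_def by simp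
  qed
  obtain D J where D: "D \<in> carrier_mat N N" "det D \<noteq> 0" and J: "\<And>p. p < N \<Longrightarrow> basic_module (J p)"
    and M: "M = {f \<in> carrier_vec N. \<forall>p<N. (D *\<^sub>v f) $ p \<in> J p}"
    using endo_module_basic unfolding N_def M_def by blast
  define U0 where "U0 = {u \<in> carrier_vec N. \<forall>c. c \<cdot>\<^sub>v u \<in> M}"
  define W where "W P = {w \<in> carrier_vec N. \<exists>c. c \<noteq> 0 \<and> c \<cdot>\<^sub>v w \<in> M} \<inter> coord_space N P" for P
  obtain P0 pr T om A l where U0: "lin_subspace N U0" and pr: "projection N U0 P0 pr"
    and W: "lin_subspace N (W P0)" and om: "projection N (W P0) T om"
    and A: "A \<in> GLn N" and l: "l \<le> N"
    and flag: "flag_image l N A = {x \<in> carrier_vec N. om *\<^sub>v x \<in> M \<and> (\<forall>i<N. 1 \<prec> (x - om *\<^sub>v x) $ i)}"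
    and recover: "\<And>f. f \<in> carrier_vec N \<Longrightarrow> f \<in> M \<longleftrightarrow> om *\<^sub>v (f - pr *\<^sub>v f) = f - pr *\<^sub>v f \<and> f - pr *\<^sub>v f \<in> flag_image l N A"
    using module_code[OF D J M, folded U0_def, folded W_def] by (smt (verit) mem_Collect_eq)
  have prC: "pr \<in> carrier_mat N N" and omC: "om \<in> carrier_mat N N"
    using pr om by (auto simp: projection_def)
  define es where "es = concat (mat_to_list pr) @ concat (mat_to_list om)"
  define rl where "rl = RElem N l (lattice_basis.L v N A) (lattice_basis.flag_space v N A l)"
  \<comment> \<open>The formula recovering the code reads positions in this order: entries of
    \<open>pr\<close>, entries of \<open>om\<close>, a matrix representing
    \<open>rl\<close>.\<close>
  define gs where "gs = map FieldElem es @ [rl]"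
  have rl: "geom_imaginary v rl = (flag_class l N ` GLn N, flag_class l N A)" "is_geometric v rl"
    "is_imaginary v (geom_imaginary v rl)"
    using geom_imaginary_lattice[OF A l] unfolding rl_def by simp_all
  have les: "length es = N * N + N * N"
    using concat_mat_to_list(1)[OF prC] concat_mat_to_list(1)[OF omC] by (simp add: es_def)
  have es1: "es ! (i * N + j) = pr $$ (i, j)" and es2: "es ! (N * N + (i * N + j)) = om $$ (i, j)" if "i < N" "j < N" for i j
    using concat_mat_to_list[OF prC] concat_mat_to_list[OF omC] that by (simp_all add: es_def nth_append div_mod_less)
  have geo: "\<forall>g\<in>set gs. is_geometric v g" using rl(2) by (auto simp: gs_def)
  have ims: "list_all (is_imaginary v) (map (geom_imaginary v) gs)"
    unfolding list_all_iff gs_def using is_imaginary_field_element rl(3) by auto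

  have code_dcl: "in_dcl v \<tau> (map (geom_imaginary v) gs)"
  proof (rule in_dclI[OF im ims])
    \<comment> \<open>The membership criterion of \<open>module_code\<close>: \<open>g\<close>
      stands for \<open>f - pr f\<close>, and the entries of the representing matrix start at
      position \<open>N * N + N * N\<close>.\<close>
    define Mem where "Mem f e \<longleftrightarrow> (\<exists>g\<in>carrier_vec N. (\<forall>i<N. g $ i = f $ i - (\<Sum>j<N. e (i * N + j) * f $ j)) \<and>
      (\<forall>i<N. (\<Sum>j<N. e (N * N + (i * N + j)) * g $ j) = g $ i) \<and>
      in_flag v l N (\<lambda>i j. e (N * N + N * N + (i * N + j))) (\<lambda>i. g $ i))" for f :: "'k vec" and e
    \<comment> \<open>The fibre over the class of \<open>y\<close> is compared with the relation
      rebuilt from the module as in \<open>endo_module_determines\<close>.\<close>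
    define \<Psi> where "\<Psi> e \<longleftrightarrow> (\<forall>a\<in>carrier_vec m. \<forall>b\<in>carrier_vec m.
      Q (\<lambda>i. if i < m then a $ i else if i < 2 * m then b $ (i - m)
         else if i < 2 * m + k then e (N * N + N * N + N * N + (i - 2 * m)) else 0) \<longleftrightarrow>
      (\<exists>f\<in>carrier_vec N. Mem f e \<and> (\<forall>i<m. (\<Sum>j<m. f $ (i * m + j) * a $ j) = b $ i)))" for e
    show "fdef v \<Psi>" unfolding \<Psi>_def Mem_def
      by (intro fdef_all_vec fdef_iff fdef_subst[OF Q]; intro fdef_intros; simp add: N_def div_mod_less)
    fix x y C assume x: "x \<in> reps (map snd (map (geom_imaginary v) gs))" and C: "C \<in> fst \<tau>" "y \<in> C"
    have "map snd (map (geom_imaginary v) gs) = map (\<lambda>a. {[a]}) es @ [flag_class l N A]"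
      by (simp add: gs_def rl(1))
    then obtain w where w: "w \<in> flag_class l N A" "x = es @ w"
      using x reps_snoc[of x "map (\<lambda>a. {[a]}) es"] by (auto simp: reps_singletons)
    have lw: "length w = N * N" "det (list_mat N w) \<noteq> 0" "flag_image l N (list_mat N w) = flag_image l N A"
      using w(1) unfolding flag_class_iff by auto
    let ?e = "env (x @ y)"
    have ly: "length y = k" by (rule klen[OF C])
    have e1: "?e (i * N + j) = pr $$ (i, j)" and e2: "?e (N * N + (i * N + j)) = om $$ (i, j)" if "i < N" "j < N" for i j
      using es1[OF that] es2[OF that] div_mod_less[OF that] les by (auto simp: env_def w(2) nth_append)
    have e3: "mat N N (\<lambda>(i, j). ?e (N * N + N * N + (i * N + j))) = list_mat N w"
      using lw(1) les by (intro eq_matI) (auto simp: list_mat_def env_def nth_append w(2) div_mod_less trans_less_add1)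
    have e4: "?e (N * N + N * N + N * N + i) = y ! i" if "i < k" for i
      using that les lw(1) ly by (simp add: env_def nth_append w(2))
    have Mem: "Mem f ?e \<longleftrightarrow> f \<in> M" if f: "f \<in> carrier_vec N" for f
    proof -
      have prfC: "pr *\<^sub>v f \<in> carrier_vec N" using prC f by simp
      define g where "g = f - pr *\<^sub>v f"
      have gC: "g \<in> carrier_vec N" using f prfC by (simp add: g_def)
      have s1: "(\<Sum>j<N. ?e (i * N + j) * f $ j) = (pr *\<^sub>v f) $ i" if "i < N" for i
        using e1 that prC f by (simp add: scalar_prod_def lessThan_atLeast0)
      have s2: "(\<Sum>j<N. ?e (N * N + (i * N + j)) * g $ j) = (om *\<^sub>v g) $ i" if "i < N" for i
        using e2 that omC gC by (simp add: scalar_prod_def lessThan_atLeast0)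
      have g1: "(\<forall>i<N. h $ i = f $ i - (\<Sum>j<N. ?e (i * N + j) * f $ j)) \<longleftrightarrow> h = g" if h: "h \<in> carrier_vec N" for h
      proof
        assume *: "\<forall>i<N. h $ i = f $ i - (\<Sum>j<N. ?e (i * N + j) * f $ j)"
        show "h = g"
        proof (rule eq_vecI)
          fix i assume "i < dim_vec g"
          then have i: "i < N" using gC by simp
          have "h $ i = f $ i - (pr *\<^sub>v f) $ i" using * s1[OF i] i by simp
          then show "h $ i = g $ i" unfolding g_def using i carrier_vecD[OF prfC] carrier_vecD[OF f] by simp
        qed (use h gC in simp)
      next
        assume "h = g"
        then show "\<forall>i<N. h $ i = f $ i - (\<Sum>j<N. ?e (i * N + j) * f $ j)"
          unfolding g_def using s1 carrier_vecD[OF prfC] carrier_vecD[OF f] by simp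
      qed
      have "Mem f ?e \<longleftrightarrow> (\<forall>i<N. (\<Sum>j<N. ?e (N * N + (i * N + j)) * g $ j) = g $ i) \<and>
          in_flag v l N (\<lambda>i j. ?e (N * N + N * N + (i * N + j))) (\<lambda>i. g $ i)"
        unfolding Mem_def by (rule ex_unique_carrier[OF gC g1])
      also have "(\<forall>i<N. (\<Sum>j<N. ?e (N * N + (i * N + j)) * g $ j) = g $ i) \<longleftrightarrow> om *\<^sub>v g = g"
      proof
        assume *: "\<forall>i<N. (\<Sum>j<N. ?e (N * N + (i * N + j)) * g $ j) = g $ i"
        show "om *\<^sub>v g = g" by (rule eq_vecI) (use * s2 gC omC in \<open>auto simp del: index_mult_mat_vec\<close>)
      next
        assume "om *\<^sub>v g = g"
        then show "\<forall>i<N. (\<Sum>j<N. ?e (N * N + (i * N + j)) * g $ j) = g $ i" using s2 by simp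
      qed
      also have "in_flag v l N (\<lambda>i j. ?e (N * N + N * N + (i * N + j))) (\<lambda>i. g $ i) \<longleftrightarrow> g \<in> flag_image l N A"
        unfolding in_flag_iff[OF l gC] e3 lw(3) by (rule refl)
      finally show ?thesis using recover[OF f] unfolding g_def by simp
    qed
    have rec: "(\<exists>f\<in>carrier_vec N. Mem f ?e \<and> (\<forall>i<m. (\<Sum>j<m. f $ (i * m + j) * a $ j) = b $ i)) \<longleftrightarrow> (a, b) \<in> R"
      if ab: "a \<in> carrier_vec m" "b \<in> carrier_vec m" for a b
    proof -
      have "(\<forall>i<m. (\<Sum>j<m. f $ (i * m + j) * a $ j) = b $ i) \<longleftrightarrow> flat_mat m f *\<^sub>v a = b" for f
      proof
        assume *: "\<forall>i<m. (\<Sum>j<m. f $ (i * m + j) * a $ j) = b $ i"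
        show "flat_mat m f *\<^sub>v a = b"
          by (rule eq_vecI) (use * flat_mat_mult[OF ab(1)] ab flat_mat_carrier[of m f] in \<open>auto simp del: index_mult_mat_vec\<close>)
      next
        assume "flat_mat m f *\<^sub>v a = b"
        then show "\<forall>i<m. (\<Sum>j<m. f $ (i * m + j) * a $ j) = b $ i"
          using flat_mat_mult[OF ab(1), of _ f] by (intro allI impI) (simp only:)
      qed
      moreover have "M \<subseteq> carrier_vec N" unfolding M by blast
      ultimately show ?thesis using Mem endo_module_determines[OF ab] unfolding M_def[symmetric] by blast
    qed
    have env_y: "Q (\<lambda>i. if i < m then a $ i else if i < 2 * m then b $ (i - m)
         else if i < 2 * m + k then ?e (N * N + N * N + N * N + (i - 2 * m)) else 0) \<longleftrightarrow>
        Q (env (list_of_vec a @ list_of_vec b @ y))" if ab: "a \<in> carrier_vec m" "b \<in> carrier_vec m" for a b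
      using env3[of a b y "\<lambda>i. ?e (N * N + N * N + N * N + i)" "\<lambda>i. b $ (i - m)", OF ab ly e4 refl]
      by (simp only:)
    have "\<Psi> ?e \<longleftrightarrow> (\<forall>a\<in>carrier_vec m. \<forall>b\<in>carrier_vec m. Q (env (list_of_vec a @ list_of_vec b @ y)) \<longleftrightarrow> (a, b) \<in> R)"
      unfolding \<Psi>_def by (intro ball_cong refl) (simp only: env_y rec)
    then show "\<Psi> ?e \<longleftrightarrow> C = snd \<tau>" unfolding fib'[OF C] .
  qed

  have W_iff: "w \<in> W P0 \<longleftrightarrow> (\<exists>c. c \<noteq> 0 \<and> in_module Q m k (\<lambda>i. c * w $ i) y') \<and> (\<forall>i<N. i \<notin> P0 \<longrightarrow> w $ i = 0)"
    if "w \<in> carrier_vec N" "y \<in> snd \<tau>" "\<And>i. i < k \<Longrightarrow> y' i = y ! i" for w y y'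
  proof -
    have "vec N (\<lambda>i. c * w $ i) = c \<cdot>\<^sub>v w" for c using that(1) by (intro eq_vecI) auto
    then show ?thesis using inM[OF that(2,3)] that(1) by (simp add: W_def coord_space_def)
  qed
  have U0_iff: "u \<in> U0 \<longleftrightarrow> (\<forall>c. in_module Q m k (\<lambda>i. c * u $ i) y')"
    if "u \<in> carrier_vec N" "y \<in> snd \<tau>" "\<And>i. i < k \<Longrightarrow> y' i = y ! i" for u y y'
  proof -
    have "vec N (\<lambda>i. c * u $ i) = c \<cdot>\<^sub>v u" for c using that(1) by (intro eq_vecI) auto
    then show ?thesis using inM[OF that(2,3)] that(1) by (simp add: U0_def)
  qed
  have unit_coord: "(\<forall>i<N. i \<notin> P \<longrightarrow> (if i = q then 1 else 0) - u $ i = 0) \<longleftrightarrow> unit_vec N q - u \<in> coord_space N P"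
    if "u \<in> carrier_vec N" "q < N" for P q u
    using that by (auto simp: coord_space_def unit_vec_def)
  \<comment> \<open>With a definable subspace and a fixed index set, the projection of a vector is
    the unique solution of two first-order conditions.\<close>
  have proj_iff: "u \<in> U \<and> x - u \<in> coord_space N P \<longleftrightarrow> u = g *\<^sub>v x"
    if "lin_subspace N U" "projection N U P g" "x \<in> carrier_vec N" for U P g x u
    using that projection_unique[OF that] by (auto simp: projection_def)
  have col_entry: "(g *\<^sub>v unit_vec N q) $ p = g $$ (p, q)" if "g \<in> carrier_mat N N" "p < N" "q < N" for g :: "'k mat" and p q
    using that by (simp add: mult_unit_vec[OF that(1,3)])

  \<comment> \<open>A field element is defined by a formula in a representative of the code and, at
    position \<open>k\<close>, the element itself.\<close>
  have field_dcl: "in_dcl v (geom_imaginary v (FieldElem c)) [\<tau>]"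
    if \<Psi>: "fdef v \<Psi>" and iff: "\<And>y d. y \<in> snd \<tau> \<Longrightarrow> \<Psi> (env (y @ [d])) \<longleftrightarrow> d = c" for \<Psi> c
  proof (rule in_dclI[OF is_imaginary_field_element _ \<Psi>])
    show "list_all (is_imaginary v) [\<tau>]" using im by simp
    fix x y C assume "x \<in> reps (map snd [\<tau>])" "C \<in> fst (geom_imaginary v (FieldElem c))" "y \<in> C"
    then obtain d where d: "x \<in> snd \<tau>" "C = {[d]}" "y = [d]" by (auto simp: reps_Cons)
    then show "\<Psi> (env (x @ y)) \<longleftrightarrow> C = snd (geom_imaginary v (FieldElem c))" using iff[OF d(1)] by simp
  qed
  have yk: "env (y @ z) i = y ! i" if "y \<in> snd \<tau>" "i < k" for y z i
    using that klen[OF t that(1)] by (simp add: env_def nth_append)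
  have yd: "env (y @ [d]) k = d" if "y \<in> snd \<tau>" for y d
    using klen[OF t that] by (simp add: env_def nth_append)

  have pr_dcl: "in_dcl v (geom_imaginary v (FieldElem (pr $$ (p, q)))) [\<tau>]" if pq: "p < N" "q < N" for p q
  proof (rule field_dcl)
    \<comment> \<open>Column \<open>q\<close> of \<open>pr\<close> is the projection of a unit
      vector: the unique \<open>u\<close> in \<open>U0\<close> that differs from it by an element of
      the coordinate space of \<open>P0\<close>.\<close>
    let ?\<Psi> = "\<lambda>e. \<exists>u\<in>carrier_vec N. ((\<forall>c. in_module Q m k (\<lambda>i. c * u $ i) (\<lambda>i. e i)) \<and>
      (\<forall>i<N. i \<notin> P0 \<longrightarrow> (if i = q then 1 else 0) - u $ i = 0)) \<and> u $ p = e k"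
    show "fdef v ?\<Psi>" by (intro fdef_intros fdef_in_module[OF Q]; simp add: pq[unfolded N_def] N_def)
    fix y d assume y: "y \<in> snd \<tau>"
    have y': "env (y @ [d]) i = y ! i" if "i < k" for i using yk[OF y that] .
    have "(\<forall>c. in_module Q m k (\<lambda>i. c * u $ i) (env (y @ [d]))) \<and>
      (\<forall>i<N. i \<notin> P0 \<longrightarrow> (if i = q then 1 else 0) - u $ i = 0) \<longleftrightarrow> u = pr *\<^sub>v unit_vec N q" if u: "u \<in> carrier_vec N" for u
    proof -
      have "u \<in> U0 \<longleftrightarrow> (\<forall>c. in_module Q m k (\<lambda>i. c * u $ i) (env (y @ [d])))"
        by (rule U0_iff[OF u y]) (rule y')
      then show ?thesis
        using proj_iff[OF U0 pr unit_vec_carrier[of N q], of u] unit_coord[OF u pq(2), of P0] by (simp only:)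
    qed
    then have "?\<Psi> (env (y @ [d])) \<longleftrightarrow> (pr *\<^sub>v unit_vec N q) $ p = env (y @ [d]) k"
      using prC by (intro ex_unique_carrier) auto
    then show "?\<Psi> (env (y @ [d])) \<longleftrightarrow> d = pr $$ (p, q)" unfolding col_entry[OF prC pq] yd[OF y] eq_commute[of d "pr $$ (p, q)"] .
  qed
  have om_dcl: "in_dcl v (geom_imaginary v (FieldElem (om $$ (p, q)))) [\<tau>]" if pq: "p < N" "q < N" for p q
  proof (rule field_dcl)
    let ?\<Psi> = "\<lambda>e. \<exists>w\<in>carrier_vec N. (((\<exists>c. c \<noteq> 0 \<and> in_module Q m k (\<lambda>i. c * w $ i) (\<lambda>i. e i)) \<and>
      (\<forall>i<N. i \<notin> P0 \<longrightarrow> w $ i = 0)) \<and> (\<forall>i<N. i \<notin> T \<longrightarrow> (if i = q then 1 else 0) - w $ i = 0)) \<and> w $ p = e k"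
    show "fdef v ?\<Psi>" by (intro fdef_intros fdef_in_module[OF Q]; simp add: pq[unfolded N_def] N_def)
    fix y d assume y: "y \<in> snd \<tau>"
    have y': "env (y @ [d]) i = y ! i" if "i < k" for i using yk[OF y that] .
    have "((\<exists>c. c \<noteq> 0 \<and> in_module Q m k (\<lambda>i. c * w $ i) (env (y @ [d]))) \<and> (\<forall>i<N. i \<notin> P0 \<longrightarrow> w $ i = 0)) \<and>
      (\<forall>i<N. i \<notin> T \<longrightarrow> (if i = q then 1 else 0) - w $ i = 0) \<longleftrightarrow> w = om *\<^sub>v unit_vec N q" if w: "w \<in> carrier_vec N" for w
    proof -
      have "w \<in> W P0 \<longleftrightarrow> (\<exists>c. c \<noteq> 0 \<and> in_module Q m k (\<lambda>i. c * w $ i) (env (y @ [d]))) \<and> (\<forall>i<N. i \<notin> P0 \<longrightarrow> w $ i = 0)"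
        by (rule W_iff[OF w y]) (rule y')
      then show ?thesis
        using proj_iff[OF W om unit_vec_carrier[of N q], of w] unit_coord[OF w pq(2), of T] by (simp only:)
    qed
    then have "?\<Psi> (env (y @ [d])) \<longleftrightarrow> (om *\<^sub>v unit_vec N q) $ p = env (y @ [d]) k"
      using omC by (intro ex_unique_carrier) auto
    then show "?\<Psi> (env (y @ [d])) \<longleftrightarrow> d = om $$ (p, q)" unfolding col_entry[OF omC pq] yd[OF y] eq_commute[of d "om $$ (p, q)"] .
  qed
  have rl_dcl: "in_dcl v (geom_imaginary v rl) [\<tau>]"
  proof (rule in_dclI[OF rl(3)])
    show "list_all (is_imaginary v) [\<tau>]" using im by simp
    \<comment> \<open>The module of the candidate matrix is compared with the description of
      \<open>flag_image l N A\<close> in \<open>module_code\<close>. \<open>w\<close> stands for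
      \<open>om x\<close>; it is characterized rather than computed, so that only the code
      enters.\<close>
    let ?\<Psi> = "\<lambda>e. \<forall>x\<in>carrier_vec N. in_flag v l N (\<lambda>i j. e (k + (i * N + j))) (\<lambda>i. x $ i) \<longleftrightarrow>
      (\<exists>w\<in>carrier_vec N. (((\<exists>c. c \<noteq> 0 \<and> in_module Q m k (\<lambda>i. c * w $ i) (\<lambda>i. e i)) \<and>
        (\<forall>i<N. i \<notin> P0 \<longrightarrow> w $ i = 0)) \<and> (\<forall>i<N. i \<notin> T \<longrightarrow> x $ i - w $ i = 0)) \<and>
        in_module Q m k (\<lambda>i. w $ i) (\<lambda>i. e i) \<and> (\<forall>i<N. \<not> vdiv v (x $ i - w $ i) 1))"
    show "fdef v ?\<Psi>" by (intro fdef_intros fdef_in_module[OF Q]; simp add: N_def)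
    fix y z C assume "y \<in> reps (map snd [\<tau>])" and C: "C \<in> fst (geom_imaginary v rl)" "z \<in> C"
    then have y: "y \<in> snd \<tau>" by (auto simp: reps_Cons)
    have yz: "env (y @ z) i = y ! i" if "i < k" for i using yk[OF y that] .
    obtain B where B: "B \<in> GLn N" "C = flag_class l N B" using C(1) unfolding rl(1) by auto
    have z: "length z = N * N" "flag_image l N (list_mat N z) = flag_image l N B"
      using C(2) unfolding B(2) flag_class_iff by auto
    have "length y = k" by (rule klen[OF t y])
    then have mz: "mat N N (\<lambda>(i, j). env (y @ z) (k + (i * N + j))) = list_mat N z"
      using env_shift_list_mat[OF z(1), of y] by simp
    have rhs: "(\<exists>w\<in>carrier_vec N. (((\<exists>c. c \<noteq> 0 \<and> in_module Q m k (\<lambda>i. c * w $ i) (env (y @ z))) \<and>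
        (\<forall>i<N. i \<notin> P0 \<longrightarrow> w $ i = 0)) \<and> (\<forall>i<N. i \<notin> T \<longrightarrow> x $ i - w $ i = 0)) \<and>
        in_module Q m k (\<lambda>i. w $ i) (env (y @ z)) \<and> (\<forall>i<N. \<not> vdiv v (x $ i - w $ i) 1)) \<longleftrightarrow> x \<in> flag_image l N A"
      if x: "x \<in> carrier_vec N" for x
    proof -
      have omx: "om *\<^sub>v x \<in> carrier_vec N" using omC x by simp
      have "((\<exists>c. c \<noteq> 0 \<and> in_module Q m k (\<lambda>i. c * w $ i) (env (y @ z))) \<and>
          (\<forall>i<N. i \<notin> P0 \<longrightarrow> w $ i = 0)) \<and> (\<forall>i<N. i \<notin> T \<longrightarrow> x $ i - w $ i = 0) \<longleftrightarrow> w = om *\<^sub>v x"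
        if w: "w \<in> carrier_vec N" for w
      proof -
        have e: "(\<forall>i<N. i \<notin> T \<longrightarrow> x $ i - w $ i = 0) \<longleftrightarrow> x - w \<in> coord_space N T"
          using w x by (auto simp: coord_space_def)
        have "w \<in> W P0 \<longleftrightarrow> (\<exists>c. c \<noteq> 0 \<and> in_module Q m k (\<lambda>i. c * w $ i) (env (y @ z))) \<and> (\<forall>i<N. i \<notin> P0 \<longrightarrow> w $ i = 0)"
          by (rule W_iff[OF w y]) (rule yz)
        then show ?thesis using proj_iff[OF W om x, of w] e by (simp only:)
      qed
      then have "(\<exists>w\<in>carrier_vec N. (((\<exists>c. c \<noteq> 0 \<and> in_module Q m k (\<lambda>i. c * w $ i) (env (y @ z))) \<and>
        (\<forall>i<N. i \<notin> P0 \<longrightarrow> w $ i = 0)) \<and> (\<forall>i<N. i \<notin> T \<longrightarrow> x $ i - w $ i = 0)) \<and>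
        in_module Q m k (\<lambda>i. w $ i) (env (y @ z)) \<and> (\<forall>i<N. \<not> vdiv v (x $ i - w $ i) 1)) \<longleftrightarrow>
        in_module Q m k (\<lambda>i. (om *\<^sub>v x) $ i) (env (y @ z)) \<and> (\<forall>i<N. \<not> vdiv v (x $ i - (om *\<^sub>v x) $ i) 1)"
        by (rule ex_unique_carrier[OF omx])
      also have "in_module Q m k (\<lambda>i. (om *\<^sub>v x) $ i) (env (y @ z)) \<longleftrightarrow> om *\<^sub>v x \<in> M"
      proof -
        have "vec N (\<lambda>i. (om *\<^sub>v x) $ i) = om *\<^sub>v x" using carrier_vecD[OF omx] by (intro eq_vecI) simp_all
        then show ?thesis using inM[OF y yk[OF y]] by (simp only:)
      qed
      also have "(\<forall>i<N. \<not> vdiv v (x $ i - (om *\<^sub>v x) $ i) 1) \<longleftrightarrow> (\<forall>i<N. 1 \<prec> (x - om *\<^sub>v x) $ i)"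
        using carrier_vecD[OF omx] carrier_vecD[OF x] by (simp add: vless_def del: index_mult_mat_vec)
      finally show ?thesis unfolding flag using x by blast
    qed
    have "?\<Psi> (env (y @ z)) \<longleftrightarrow> (\<forall>x\<in>carrier_vec N. x \<in> flag_image l N (list_mat N z) \<longleftrightarrow> x \<in> flag_image l N A)"
      by (intro ball_cong refl) (simp only: in_flag_iff[OF l] mz rhs)
    also have "\<dots> \<longleftrightarrow> flag_image l N B = flag_image l N A"
    proof -
      have "flag_image l N G \<subseteq> carrier_vec N" if "G \<in> carrier_mat N N" for G
        using flag_module_carrier mult_mat_vec_carrier[OF that] by blast
      then have "flag_image l N B \<subseteq> carrier_vec N" "flag_image l N A \<subseteq> carrier_vec N" using A B by blast+
      then show ?thesis unfolding z(2) by blast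
    qed
    also have "\<dots> \<longleftrightarrow> C = snd (geom_imaginary v rl)"
      unfolding rl(1) B(2) using flag_class_eq[OF B(1), of l A] by simp
    finally show "?\<Psi> (env (y @ z)) \<longleftrightarrow> C = snd (geom_imaginary v rl)" .
  qed

  have "in_dcl v f [\<tau>]" if "f \<in> set (map (geom_imaginary v) gs)" for f
  proof -
    have mat: "\<exists>p<N. \<exists>q<N. a = g $$ (p, q)" if a: "a \<in> set (concat (mat_to_list g))" and g: "g \<in> carrier_mat N N"
      for a and g :: "'k mat"
    proof -
      obtain p q where "p < N" "q < N" "a = g $$ (p, q)" using a g by (auto simp: mat_to_list_def)
      then show ?thesis by blast
    qed
    have "f = geom_imaginary v rl \<or> (\<exists>a\<in>set es. f = geom_imaginary v (FieldElem a))"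
      using that by (auto simp: gs_def)
    then show ?thesis
    proof
      assume "\<exists>a\<in>set es. f = geom_imaginary v (FieldElem a)"
      then obtain a where a: "a \<in> set es" "f = geom_imaginary v (FieldElem a)" by blast
      then have "a \<in> set (concat (mat_to_list pr)) \<or> a \<in> set (concat (mat_to_list om))" by (simp add: es_def)
      then show ?thesis using mat[OF _ prC] mat[OF _ omC] pr_dcl om_dcl a(2) by blast
    qed (use rl_dcl in simp)
  qed
  then have "interdefinable v [\<tau>] (map (geom_imaginary v) gs)"
    unfolding interdefinable_def using code_dcl by simp
  then show ?thesis using geo by blast
qed

end

theorem theorem4p3:
  fixes \<kappa> :: "'c rel"
    and v :: "'k::alg_closed_field \<Rightarrow> 'g::linordered_ab_group_add"
    and m :: nat
    and R :: "'k vec rel"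
    and \<tau> :: "'k imaginary"
  assumes "monster_model \<kappa> v"
    and "vvs_structure v m R"
    and "definable v UNIV (rel_tuples R)"
    and "is_code v \<tau> (rel_tuples R)"
  shows "\<exists>gs. (\<forall>g\<in>set gs. is_geometric v g) \<and>
              interdefinable v [\<tau>] (map (geom_imaginary v) gs)"
proof -
  interpret vvs_rel v \<kappa> m R
    by (rule vvs_rel_of_structure[OF monster_of_monster_model[OF assms(1)] assms(2,3)])
  show ?thesis by (rule code_interdefinable[OF assms(4)])
qed

end
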